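(* Let $W$ be a Coxeter group, let $\Bbbk$ be any commutative unital ring, and let $\mathbf{q}=(q_i)\in\Bbbk^I$ be such that $q_i=q_j$ whenever $m_{ij}$ is odd. Then the assignments $T_i\mapsto s_i+(1-q_i)D_i$, $i\in I$, define an injective homomorphism of $\Bbbk$-algebras $\underline{\varphi}_W:H_{\mathbf{q}}(W)\to\underline{\mathbf{H}}(W)\otimes_{\mathbb{Z}}\Bbbk$ (whose image is a left coideal subalgebra in $\underline{\mathbf{H}}(W)\otimes\Bbbk$).
   Context: A Coxeter group $W$ is generated by $s_i$, $i\in I$, subject to relations $(s_is_j)^{m_{ij}}=1$, where $m_{ij}=m_{ji}\in\mathbb{Z}_{\ge 0}$ are such that $m_{ij}=1$ iff $i=j$ ($m_{ij}=0$ imposes no relation). The (generalized) Hecke algebra $H_{\mathbf{q}}(W)$ is the $\Bbbk$-algebra generated by $T_i$, $i\in I$, subject to the quadratic relations $T_i^2=(1-q_i)T_i+q_i$ for $i\in I$ and the braid relations $\underbrace{T_iT_j\cdots}_{m_{ij}}=\underbrace{T_jT_i\cdots}_{m_{ij}}$ for all distinct $i,j\in I$. $\hat{\mathbf{H}}(W)$ is the (unital associative) $\mathbb{Z}$-algebra generated by $s_i,D_i$, $i\in I$, subject to relations: (i) $s_i^2=1$, $D_i^2=D_i$, $s_iD_i+D_is_i=s_i-1$ for $i\in I$; (ii) $(s_is_j)^{m_{ij}}=1$; (iii) $\underbrace{D_is_js_i\cdots s_{j'}}_{m_{ij}}=\underbrace{s_j\cdots s_{i'}s_{j'}D_{i'}}_{m_{ij}}$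 for all distinct $i,j\in I$ with $m_{ij}\ne 0$, where $i'=i$ if $m_{ij}$ is even, $i'=j$ if $m_{ij}$ is odd, and $\{i',j'\}=\{i,j\}$ (each side has $m_{ij}$ factors with indices alternating between $i$ and $j$). It is a Hopf algebra over $\mathbb{Z}$ with $\Delta(s_i)=s_i\otimes s_i$, $\Delta(D_i)=D_i\otimes 1+s_i\otimes D_i$, $\varepsilon(s_i)=1$, $\varepsilon(D_i)=0$, $S(s_i)=s_i$, $S(D_i)=-s_iD_i$. $\mathcal{S}:=\{ws_iw^{-1}\mid w\in W,i\in I\}$. For each $s\in\mathcal{S}$ there is a unique element $D_s\in\hat{\mathbf{H}}(W)$ such that $D_{s_i}=D_i$ for $i\in I$ and $D_{s_iss_i}=s_iD_ss_i$ for any $i\in I$, $s\in\mathcal{S}\setminus\{s_i\}$. $\hat{\mathbf{D}}(W)$ is the subalgebra of $\hat{\mathbf{H}}(W)$ generated by all $D_s$, $s\in\mathcal{S}$, and $\mathbf{K}(W):=\bigcap_{w\in W}w\hat{\mathbf{D}}(W)w^{-1}$. The lower Hecke-Hopf algebra is $\underline{\mathbf{H}}(W)=\hat{\mathbf{H}}(W)/\mathbf{J}(W)$, where $\mathbf{J}(W)$ is the ideal generated by $\mathbf{K}(W)\cap\operatorname{Ker}\varepsilon$; it is a Hopf ideal, so $\underline{\mathbf{H}}(W)$ is a Hopf algebra. The images of $s_i,D_i$ in quotients are denoted by the same symbols. A subalgebra $A$ of a Hopf algebra $H$ is a left coideal subalgebra if $\Delta(A)\subset H\otimes A$. *)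

theory Defs
  imports "HOL-Algebra.Module" "HOL-Algebra.QuotRing" "HOL-Algebra.IntRing"
    "HOL-Algebra.Generated_Rings"
begin

section \<open>Associative algebras over a commutative ring\<close>

text \<open>
  An associative, not necessarily commutative, algebra over \<open>R\<close> is a record of type
  \<^typ>\<open>('r, 'a) module\<close>: the ring fields together with the scalar multiplication.
\<close>

definition alg_hom ::
    "('r, 'c) ring_scheme \<Rightarrow> ('r, 'a, 'd) module_scheme \<Rightarrow> ('r, 'b, 'e) module_scheme \<Rightarrow> ('a \<Rightarrow> 'b) set"
  where "alg_hom R A B =
    {h \<in> ring_hom A B. \<forall>r\<in>carrier R. \<forall>a\<in>carrier A. h (r \<odot>\<^bsub>A\<^esub> a) = r \<odot>\<^bsub>B\<^esub> h a}"

definition alg_quot :: "('r, 'a, 'c) module_scheme \<Rightarrow> 'a set \<Rightarrow> ('r, 'a set) module"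
  where "alg_quot A J =
    \<lparr>carrier = carrier (A Quot J), mult = mult (A Quot J), one = one (A Quot J),
     zero = zero (A Quot J), add = add (A Quot J),
     smult = (\<lambda>r X. \<Union>x\<in>X. J +>\<^bsub>A\<^esub> (r \<odot>\<^bsub>A\<^esub> x))\<rparr>"

text \<open>The monoid algebra \<open>R[M]\<close>: finitely supported functions on \<open>M\<close> with convolution.\<close>

definition monoid_algebra ::
    "('r, 'c) ring_scheme \<Rightarrow> ('m, 'd) monoid_scheme \<Rightarrow> ('r, 'm \<Rightarrow> 'r) module"
  where "monoid_algebra R M =
    \<lparr>carrier = {f. (\<forall>x. f x \<in> carrier R) \<and> (\<forall>x. x \<notin> carrier M \<longrightarrow> f x = \<zero>\<^bsub>R\<^esub>)
                  \<and> finite {x. f x \<noteq> \<zero>\<^bsub>R\<^esub>}},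
     mult = (\<lambda>f g z. finsum R (\<lambda>(x, y). f x \<otimes>\<^bsub>R\<^esub> g y)
                {(x, y). f x \<noteq> \<zero>\<^bsub>R\<^esub> \<and> g y \<noteq> \<zero>\<^bsub>R\<^esub> \<and> x \<otimes>\<^bsub>M\<^esub> y = z}),
     one = (\<lambda>z. if z = \<one>\<^bsub>M\<^esub> then \<one>\<^bsub>R\<^esub> else \<zero>\<^bsub>R\<^esub>),
     zero = (\<lambda>_. \<zero>\<^bsub>R\<^esub>),
     add = (\<lambda>f g z. f z \<oplus>\<^bsub>R\<^esub> g z),
     smult = (\<lambda>r f z. r \<otimes>\<^bsub>R\<^esub> f z)\<rparr>"

definition single :: "('r, 'c) ring_scheme \<Rightarrow> 'm \<Rightarrow> 'm \<Rightarrow> 'r"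
  where "single R x = (\<lambda>z. if z = x then \<one>\<^bsub>R\<^esub> else \<zero>\<^bsub>R\<^esub>)"

definition free_monoid :: "'g set \<Rightarrow> 'g list monoid"
  where "free_monoid X = \<lparr>carrier = lists X, mult = (@), one = []\<rparr>"

definition free_algebra :: "('r, 'c) ring_scheme \<Rightarrow> 'g set \<Rightarrow> ('r, 'g list \<Rightarrow> 'r) module"
  where "free_algebra R X = monoid_algebra R (free_monoid X)"

text \<open>
  Generators and relations. A relation \<open>(l, r)\<close> stands for \<open>l = r\<close>. A two-sided ideal of a unital
  algebra is closed under scalars, so the ideal generated in the underlying ring is the right one.
\<close>

definition rel_ideal ::
    "('r, 'c) ring_scheme \<Rightarrow> 'g set \<Rightarrow> (('g list \<Rightarrow> 'r) \<times> ('g list \<Rightarrow> 'r)) set \<Rightarrow> ('g list \<Rightarrow> 'r) set"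
  where "rel_ideal R X rels =
    genideal (free_algebra R X) {l \<ominus>\<^bsub>free_algebra R X\<^esub> r | l r. (l, r) \<in> rels}"

definition presented_algebra ::
    "('r, 'c) ring_scheme \<Rightarrow> 'g set \<Rightarrow> (('g list \<Rightarrow> 'r) \<times> ('g list \<Rightarrow> 'r)) set
      \<Rightarrow> ('r, ('g list \<Rightarrow> 'r) set) module"
  where "presented_algebra R X rels = alg_quot (free_algebra R X) (rel_ideal R X rels)"

definition presented_gen ::
    "('r, 'c) ring_scheme \<Rightarrow> 'g set \<Rightarrow> (('g list \<Rightarrow> 'r) \<times> ('g list \<Rightarrow> 'r)) set \<Rightarrow> 'g
      \<Rightarrow> ('g list \<Rightarrow> 'r) set"
  where "presented_gen R X rels g = rel_ideal R X rels +>\<^bsub>free_algebra R X\<^esub> single R [g]"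


section \<open>Tensor products of algebras\<close>

text \<open>
  The free \<open>R\<close>-module on \<open>A \<times> B\<close> is the monoid algebra of the product of the multiplicative monoids,
  with \<open>(a, b) (a', b') = (a a', b b')\<close>. Multiplying a bilinearity relation by a basis element gives a
  bilinearity relation again, so their \<open>R\<close>-span is already a two-sided ideal, and the quotient is the
  usual tensor product of modules with its usual multiplication.
\<close>

definition tensor_ideal ::
    "('r, 'c) ring_scheme \<Rightarrow> ('r, 'a, 'd) module_scheme \<Rightarrow> ('r, 'b, 'e) module_scheme
      \<Rightarrow> ('a \<times> 'b \<Rightarrow> 'r) set"
  where "tensor_ideal R A B =
    (let F = monoid_algebra R (A \<times>\<times> B); e = (\<lambda>a b. single R (a, b)) in
     genideal F
      ({e (a \<oplus>\<^bsub>A\<^esub> a') b \<ominus>\<^bsub>F\<^esub> (e a b \<oplus>\<^bsub>F\<^esub> e a' b)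
          | a a' b. a \<in> carrier A \<and> a' \<in> carrier A \<and> b \<in> carrier B}
     \<union> {e a (b \<oplus>\<^bsub>B\<^esub> b') \<ominus>\<^bsub>F\<^esub> (e a b \<oplus>\<^bsub>F\<^esub> e a b')
          | a b b'. a \<in> carrier A \<and> b \<in> carrier B \<and> b' \<in> carrier B}
     \<union> {e (r \<odot>\<^bsub>A\<^esub> a) b \<ominus>\<^bsub>F\<^esub> (r \<odot>\<^bsub>F\<^esub> e a b)
          | r a b. r \<in> carrier R \<and> a \<in> carrier A \<and> b \<in> carrier B}
     \<union> {e a (r \<odot>\<^bsub>B\<^esub> b) \<ominus>\<^bsub>F\<^esub> (r \<odot>\<^bsub>F\<^esub> e a b)
          | r a b. r \<in> carrier R \<and> a \<in> carrier A \<and> b \<in> carrier B}))"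

definition tensor_algebra ::
    "('r, 'c) ring_scheme \<Rightarrow> ('r, 'a, 'd) module_scheme \<Rightarrow> ('r, 'b, 'e) module_scheme
      \<Rightarrow> ('r, ('a \<times> 'b \<Rightarrow> 'r) set) module"
  where "tensor_algebra R A B = alg_quot (monoid_algebra R (A \<times>\<times> B)) (tensor_ideal R A B)"

definition pure_tensor ::
    "('r, 'c) ring_scheme \<Rightarrow> ('r, 'a, 'd) module_scheme \<Rightarrow> ('r, 'b, 'e) module_scheme
      \<Rightarrow> 'a \<Rightarrow> 'b \<Rightarrow> ('a \<times> 'b \<Rightarrow> 'r) set"
  where "pure_tensor R A B a b =
    tensor_ideal R A B +>\<^bsub>monoid_algebra R (A \<times>\<times> B)\<^esub> single R (a, b)"

definition int_algebra :: "('k, 'c) ring_scheme \<Rightarrow> (int, 'k) module"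
  where "int_algebra K =
    \<lparr>carrier = carrier K, mult = mult K, one = one K, zero = zero K, add = add K,
     smult = (\<lambda>n x. [n] \<cdot>\<^bsub>K\<^esub> x)\<rparr>"

text \<open>\<open>A \<otimes>\<^sub>\<int> K\<close> as a \<open>K\<close>-algebra, \<open>K\<close> acting through the second factor.\<close>

definition base_change ::
    "('k, 'c) ring_scheme \<Rightarrow> (int, 'a, 'd) module_scheme \<Rightarrow> ('k, ('a \<times> 'k \<Rightarrow> int) set) module"
  where "base_change K A =
    (let T = tensor_algebra \<Z> A (int_algebra K) in
     \<lparr>carrier = carrier T, mult = mult T, one = one T, zero = zero T, add = add T,
      smult = (\<lambda>c t. pure_tensor \<Z> A (int_algebra K) \<one>\<^bsub>A\<^esub> c \<otimes>\<^bsub>T\<^esub> t)\<rparr>)"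

definition base_change_map ::
    "('k, 'c) ring_scheme \<Rightarrow> (int, 'a, 'd) module_scheme \<Rightarrow> 'a \<Rightarrow> ('a \<times> 'k \<Rightarrow> int) set"
  where "base_change_map K A a = pure_tensor \<Z> A (int_algebra K) a \<one>\<^bsub>K\<^esub>"


section \<open>Coxeter groups\<close>

definition coxeter_matrix :: "'i set \<Rightarrow> ('i \<Rightarrow> 'i \<Rightarrow> nat) \<Rightarrow> bool"
  where "coxeter_matrix I m \<longleftrightarrow>
    (\<forall>i\<in>I. \<forall>j\<in>I. m i j = m j i \<and> (m i j = 1 \<longleftrightarrow> i = j))"

text \<open>
  The group presented by \<open>(s\<^sub>i s\<^sub>j)\<^bsup>m i j\<^esup> = 1\<close>, where \<open>m i j = 0\<close> imposes nothing. Formal inverses of the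
  generators are not needed, because \<open>m i i = 1\<close> makes every generator an involution.
\<close>

inductive coxeter_eq :: "'i set \<Rightarrow> ('i \<Rightarrow> 'i \<Rightarrow> nat) \<Rightarrow> 'i list \<Rightarrow> 'i list \<Rightarrow> bool"
  for I :: "'i set" and m :: "'i \<Rightarrow> 'i \<Rightarrow> nat"
  where
    refl: "u \<in> lists I \<Longrightarrow> coxeter_eq I m u u"
  | sym: "coxeter_eq I m u v \<Longrightarrow> coxeter_eq I m v u"
  | trans: "coxeter_eq I m u v \<Longrightarrow> coxeter_eq I m v w \<Longrightarrow> coxeter_eq I m u w"
  | rel: "u \<in> lists I \<Longrightarrow> v \<in> lists I \<Longrightarrow> i \<in> I \<Longrightarrow> j \<in> I \<Longrightarrow>
      coxeter_eq I m (u @ concat (replicate (m i j) [i, j]) @ v) (u @ v)"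

definition coxeter_group :: "'i set \<Rightarrow> ('i \<Rightarrow> 'i \<Rightarrow> nat) \<Rightarrow> 'i list set monoid"
  where "coxeter_group I m =
    \<lparr>carrier = lists I // {(u, v). coxeter_eq I m u v},
     mult = (\<lambda>X Y. {w. \<exists>x\<in>X. \<exists>y\<in>Y. coxeter_eq I m (x @ y) w}),
     one = {w. coxeter_eq I m [] w}\<rparr>"

definition cox_s :: "'i set \<Rightarrow> ('i \<Rightarrow> 'i \<Rightarrow> nat) \<Rightarrow> 'i \<Rightarrow> 'i list set"
  where "cox_s I m i = {w. coxeter_eq I m [i] w}"

definition reflections :: "'i set \<Rightarrow> ('i \<Rightarrow> 'i \<Rightarrow> nat) \<Rightarrow> 'i list set set"
  where "reflections I m =
    (let W = coxeter_group I m in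
     {w \<otimes>\<^bsub>W\<^esub> cox_s I m i \<otimes>\<^bsub>W\<^esub> inv\<^bsub>W\<^esub> w | w i. w \<in> carrier W \<and> i \<in> I})"

text \<open>The alternating word \<open>i j i \<dots>\<close> with the given number of letters.\<close>

fun alt_word :: "nat \<Rightarrow> 'i \<Rightarrow> 'i \<Rightarrow> 'i list"
  where
    "alt_word 0 i j = []"
  | "alt_word (Suc n) i j = i # alt_word n j i"


section \<open>Hecke algebras\<close>

definition hecke_rels ::
    "('k, 'c) ring_scheme \<Rightarrow> 'i set \<Rightarrow> ('i \<Rightarrow> 'i \<Rightarrow> nat) \<Rightarrow> ('i \<Rightarrow> 'k)
      \<Rightarrow> (('i list \<Rightarrow> 'k) \<times> ('i list \<Rightarrow> 'k)) set"
  where "hecke_rels K I m q =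
    (let F = free_algebra K I; T = single K in
      {(T [i, i], ((\<one>\<^bsub>K\<^esub> \<ominus>\<^bsub>K\<^esub> q i) \<odot>\<^bsub>F\<^esub> T [i]) \<oplus>\<^bsub>F\<^esub> (q i \<odot>\<^bsub>F\<^esub> T [])) | i. i \<in> I}
    \<union> {(T (alt_word (m i j) i j), T (alt_word (m i j) j i)) | i j. i \<in> I \<and> j \<in> I \<and> i \<noteq> j})"

definition hecke_algebra ::
    "('k, 'c) ring_scheme \<Rightarrow> 'i set \<Rightarrow> ('i \<Rightarrow> 'i \<Rightarrow> nat) \<Rightarrow> ('i \<Rightarrow> 'k) \<Rightarrow> ('k, ('i list \<Rightarrow> 'k) set) module"
  where "hecke_algebra K I m q = presented_algebra K I (hecke_rels K I m q)"

definition hecke_T ::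
    "('k, 'c) ring_scheme \<Rightarrow> 'i set \<Rightarrow> ('i \<Rightarrow> 'i \<Rightarrow> nat) \<Rightarrow> ('i \<Rightarrow> 'k) \<Rightarrow> 'i \<Rightarrow> ('i list \<Rightarrow> 'k) set"
  where "hecke_T K I m q i = presented_gen K I (hecke_rels K I m q) i"


section \<open>The Hopf algebra extending \<open>\<int>[W]\<close>\<close>

datatype 'i hh_gen = Gs 'i | Gd 'i

definition hh_gens :: "'i set \<Rightarrow> 'i hh_gen set"
  where "hh_gens I = Gs ` I \<union> Gd ` I"

text \<open>
  In the last family both sides have \<open>m i j\<close> factors: the letters \<open>s\<close> form the alternating word
  \<open>s\<^sub>j s\<^sub>i s\<^sub>j \<dots>\<close> of length \<open>m i j - 1\<close>, and the index of the final \<open>D\<close> continues the alternation.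
\<close>

definition hh_rels ::
    "'i set \<Rightarrow> ('i \<Rightarrow> 'i \<Rightarrow> nat) \<Rightarrow> (('i hh_gen list \<Rightarrow> int) \<times> ('i hh_gen list \<Rightarrow> int)) set"
  where "hh_rels I m =
    (let F = free_algebra \<Z> (hh_gens I); e = single \<Z> in
      {(e [Gs i, Gs i], e []) | i. i \<in> I}
    \<union> {(e [Gd i, Gd i], e [Gd i]) | i. i \<in> I}
    \<union> {(e [Gs i, Gd i] \<oplus>\<^bsub>F\<^esub> e [Gd i, Gs i], e [Gs i] \<ominus>\<^bsub>F\<^esub> e []) | i. i \<in> I}
    \<union> {(e (concat (replicate (m i j) [Gs i, Gs j])), e []) | i j. i \<in> I \<and> j \<in> I}
    \<union> {(e (Gd i # map Gs (alt_word (m i j - 1) j i)),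
        e (map Gs (alt_word (m i j - 1) j i) @ [Gd (if even (m i j) then i else j)]))
       | i j. i \<in> I \<and> j \<in> I \<and> i \<noteq> j \<and> m i j \<noteq> 0})"

definition hat_H :: "'i set \<Rightarrow> ('i \<Rightarrow> 'i \<Rightarrow> nat) \<Rightarrow> (int, ('i hh_gen list \<Rightarrow> int) set) module"
  where "hat_H I m = presented_algebra \<Z> (hh_gens I) (hh_rels I m)"

definition hat_s :: "'i set \<Rightarrow> ('i \<Rightarrow> 'i \<Rightarrow> nat) \<Rightarrow> 'i \<Rightarrow> ('i hh_gen list \<Rightarrow> int) set"
  where "hat_s I m i = presented_gen \<Z> (hh_gens I) (hh_rels I m) (Gs i)"

definition hat_D :: "'i set \<Rightarrow> ('i \<Rightarrow> 'i \<Rightarrow> nat) \<Rightarrow> 'i \<Rightarrow> ('i hh_gen list \<Rightarrow> int) set"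
  where "hat_D I m i = presented_gen \<Z> (hh_gens I) (hh_rels I m) (Gd i)"

definition hat_counit :: "'i set \<Rightarrow> ('i \<Rightarrow> 'i \<Rightarrow> nat) \<Rightarrow> ('i hh_gen list \<Rightarrow> int) set \<Rightarrow> int"
  where "hat_counit I m =
    (THE h. h \<in> extensional (carrier (hat_H I m)) \<and> h \<in> ring_hom (hat_H I m) \<Z>
        \<and> (\<forall>i\<in>I. h (hat_s I m i) = 1 \<and> h (hat_D I m i) = 0))"

text \<open>The canonical map \<open>W \<rightarrow> hat_H I m\<close>, constant on the words representing an element of \<open>W\<close>.\<close>

definition hat_W :: "'i set \<Rightarrow> ('i \<Rightarrow> 'i \<Rightarrow> nat) \<Rightarrow> 'i list set \<Rightarrow> ('i hh_gen list \<Rightarrow> int) set"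
  where "hat_W I m w =
    the_elem ((\<lambda>u. foldr (\<lambda>i x. hat_s I m i \<otimes>\<^bsub>hat_H I m\<^esub> x) u \<one>\<^bsub>hat_H I m\<^esub>) ` w)"

text \<open>
  \<open>(s, d) \<in> refl_D I m\<close> means \<open>d = D\<^sub>s\<close>. The two rules are the two clauses that define \<open>D\<^sub>s\<close>; that
  there is exactly one family satisfying them says that this relation is the graph of
  a function on the reflections.
\<close>

inductive_set refl_D ::
    "'i set \<Rightarrow> ('i \<Rightarrow> 'i \<Rightarrow> nat) \<Rightarrow> ('i list set \<times> ('i hh_gen list \<Rightarrow> int) set) set"
  for I :: "'i set" and m :: "'i \<Rightarrow> 'i \<Rightarrow> nat"
  where
    base: "i \<in> I \<Longrightarrow> (cox_s I m i, hat_D I m i) \<in> refl_D I m"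
  | conj: "(s, d) \<in> refl_D I m \<Longrightarrow> i \<in> I \<Longrightarrow> s \<in> reflections I m \<Longrightarrow> s \<noteq> cox_s I m i \<Longrightarrow>
      (cox_s I m i \<otimes>\<^bsub>coxeter_group I m\<^esub> s \<otimes>\<^bsub>coxeter_group I m\<^esub> cox_s I m i,
       hat_s I m i \<otimes>\<^bsub>hat_H I m\<^esub> d \<otimes>\<^bsub>hat_H I m\<^esub> hat_s I m i) \<in> refl_D I m"

definition hat_DW :: "'i set \<Rightarrow> ('i \<Rightarrow> 'i \<Rightarrow> nat) \<Rightarrow> ('i hh_gen list \<Rightarrow> int) set set"
  where "hat_DW I m = generate_ring (hat_H I m) {d. \<exists>s\<in>reflections I m. (s, d) \<in> refl_D I m}"

definition K_W :: "'i set \<Rightarrow> ('i \<Rightarrow> 'i \<Rightarrow> nat) \<Rightarrow> ('i hh_gen list \<Rightarrow> int) set set"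
  where "K_W I m =
    (\<Inter>w\<in>carrier (coxeter_group I m).
      {hat_W I m w \<otimes>\<^bsub>hat_H I m\<^esub> x \<otimes>\<^bsub>hat_H I m\<^esub> hat_W I m (inv\<^bsub>coxeter_group I m\<^esub> w)
        | x. x \<in> hat_DW I m})"


section \<open>The lower Hecke-Hopf algebra\<close>

definition J_W :: "'i set \<Rightarrow> ('i \<Rightarrow> 'i \<Rightarrow> nat) \<Rightarrow> ('i hh_gen list \<Rightarrow> int) set set"
  where "J_W I m =
    genideal (hat_H I m) (K_W I m \<inter> a_kernel (hat_H I m) \<Z> (hat_counit I m))"

definition lower_H :: "'i set \<Rightarrow> ('i \<Rightarrow> 'i \<Rightarrow> nat) \<Rightarrow> (int, ('i hh_gen list \<Rightarrow> int) set set) module"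
  where "lower_H I m = alg_quot (hat_H I m) (J_W I m)"

definition lower_HK ::
    "('k, 'c) ring_scheme \<Rightarrow> 'i set \<Rightarrow> ('i \<Rightarrow> 'i \<Rightarrow> nat)
      \<Rightarrow> ('k, (('i hh_gen list \<Rightarrow> int) set set \<times> 'k \<Rightarrow> int) set) module"
  where "lower_HK K I m = base_change K (lower_H I m)"

definition lowerK_s ::
    "('k, 'c) ring_scheme \<Rightarrow> 'i set \<Rightarrow> ('i \<Rightarrow> 'i \<Rightarrow> nat) \<Rightarrow> 'i
      \<Rightarrow> (('i hh_gen list \<Rightarrow> int) set set \<times> 'k \<Rightarrow> int) set"
  where "lowerK_s K I m i =
    base_change_map K (lower_H I m) (J_W I m +>\<^bsub>hat_H I m\<^esub> hat_s I m i)"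

definition lowerK_D ::
    "('k, 'c) ring_scheme \<Rightarrow> 'i set \<Rightarrow> ('i \<Rightarrow> 'i \<Rightarrow> nat) \<Rightarrow> 'i
      \<Rightarrow> (('i hh_gen list \<Rightarrow> int) set set \<times> 'k \<Rightarrow> int) set"
  where "lowerK_D K I m i =
    base_change_map K (lower_H I m) (J_W I m +>\<^bsub>hat_H I m\<^esub> hat_D I m i)"

text \<open>
  The coproduct of \<open>lower_HK K I m\<close>. The \<open>s\<^sub>i\<close> and \<open>D\<^sub>i\<close> generate, so these conditions determine it.
\<close>

definition is_lowerK_coproduct ::
    "('k, 'c) ring_scheme \<Rightarrow> 'i set \<Rightarrow> ('i \<Rightarrow> 'i \<Rightarrow> nat)
      \<Rightarrow> ((('i hh_gen list \<Rightarrow> int) set set \<times> 'k \<Rightarrow> int) set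
        \<Rightarrow> ((('i hh_gen list \<Rightarrow> int) set set \<times> 'k \<Rightarrow> int) set
          \<times> (('i hh_gen list \<Rightarrow> int) set set \<times> 'k \<Rightarrow> int) set \<Rightarrow> 'k) set) \<Rightarrow> bool"
  where "is_lowerK_coproduct K I m \<Delta> \<longleftrightarrow>
    (let H = lower_HK K I m; HH = tensor_algebra K H H; tens = pure_tensor K H H;
         s = lowerK_s K I m; D = lowerK_D K I m in
     \<Delta> \<in> alg_hom K H HH
     \<and> (\<forall>i\<in>I. \<Delta> (s i) = tens (s i) (s i)
            \<and> \<Delta> (D i) = tens (D i) \<one>\<^bsub>H\<^esub> \<oplus>\<^bsub>HH\<^esub> tens (s i) (D i)))"

text \<open>
  \<open>\<Delta>(A) \<subseteq> H \<otimes> A\<close>, where \<open>H \<otimes> A\<close> is the additive subgroup of \<open>H \<otimes>\<^sub>K H\<close> generated by the pure tensors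
  \<open>h \<otimes> a\<close>. It is the \<open>K\<close>-span of these, since scalars can be moved into \<open>h\<close>.
\<close>

definition left_coideal_subalgebra ::
    "('k, 'c) ring_scheme \<Rightarrow> ('k, 'a, 'd) module_scheme
      \<Rightarrow> ('a \<Rightarrow> ('a \<times> 'a \<Rightarrow> 'k) set) \<Rightarrow> 'a set \<Rightarrow> bool"
  where "left_coideal_subalgebra K H \<Delta> A \<longleftrightarrow>
    subring A H \<and> submodule A K H
    \<and> \<Delta> ` A \<subseteq> generate (add_monoid (tensor_algebra K H H))
        {pure_tensor K H H h a | h a. h \<in> carrier H \<and> a \<in> A}"

end

theory Submission
  imports Defs Complex_Main
begin

text \<open>
  Write \<open>c\<^sub>i = 1 - q\<^sub>i\<close>. The quadratic relation for \<open>T\<^sub>i = s\<^sub>i + c\<^sub>i D\<^sub>i\<close> is immediate. For the braid relation,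
  substitute \<open>s\<^sub>i = T\<^sub>i - c\<^sub>i D\<^sub>i\<close> in a product of simple reflections, with the \<open>c\<^sub>i\<close> kept formal, and carry the \<open>D\<^sub>i\<close> to
  the right: conjugation turns them into elements \<open>D\<^sub>s\<close>, so the product becomes a combination of products of the \<open>T\<^sub>i\<close> with
  coefficients polynomial in the \<open>D\<^sub>s\<close>. The two alternating words of length \<open>m i j\<close> represent the same element of \<open>W\<close>, so the
  difference of their expansions vanishes; its leading terms are the two sides of the braid relation. Conjugating this
  formal difference by a simple reflection only moves the starting point of the two walks in \<open>W\<close>. Hence all its
  coefficients lie in \<open>\<^bold>K(W)\<close>; below the leading terms they also have counit \<open>0\<close>, so they vanish in the lower algebra.

  For injectivity, \<open>W\<close> and the \<open>D\<^sub>i\<close> act on functions on \<open>W\<close> such that every element of the algebra generated by the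
  \<open>D\<^sub>s\<close> acts at the identity by its counit. So \<open>\<^bold>K(W) \<inter> Ker \<epsilon>\<close> acts by zero, the action descends to the lower algebra, and
  there the product of the \<open>T\<^sub>i\<close> along a reduced word of \<open>w\<close> evaluates a function at \<open>w\<^sup>-\<^sup>1\<close>, while these products
  span the Hecke algebra by Matsumoto's theorem. The coideal property follows from
  \<open>\<Delta>(T\<^sub>i) = c\<^sub>i D\<^sub>i \<otimes> 1 + s\<^sub>i \<otimes> T\<^sub>i\<close>.
\<close>

section \<open>Coxeter words\<close>

text \<open>The obstacle is that conjugation by a simple reflection s_k does not permute the D_s: at
  its own reflection it gives 1 - s_k - D_k. A conjugated walk therefore acquires a correction
  whenever it crosses the wall of k. An alternating word of length \<open>m i j\<close> crosses a
  given wall at most once, because \<open>m i j\<close> is the exact order of s_i s_j, and this is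
  what the real representation below is for. The two alternating words cross the same walls in
  opposite orders. Deleting the crossing letter leaves a word that folds back on itself, and every
  letter travelled forth and back contributes a factor 1 - c. Both corrections thus become the same
  shorter walk with the same scalar factors and the same sign, and drop out of the difference. For
  odd \<open>m i j\<close> the scalars match because the two parameters agree. Signs of roots are
  tracked without a root system, by the parity of the walls met by a word. The convention D = 1 - D'
  for opposite roots makes a step and its reverse cancel up to 1 - c from every starting
  point.\<close>

lemma rev_in_lists [simp]: "rev u \<in> lists A \<longleftrightarrow> u \<in> lists A"
  by (simp add: in_lists_conv_set)

locale coxeter =
  fixes I :: "'i set" and m :: "'i \<Rightarrow> 'i \<Rightarrow> nat"
  assumes matrix: "coxeter_matrix I m"
begin

abbreviation ceq :: "'i list \<Rightarrow> 'i list \<Rightarrow> bool" (infix "\<asymp>" 50)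
  where "u \<asymp> v \<equiv> coxeter_eq I m u v"

lemma m_sym: "i \<in> I \<Longrightarrow> j \<in> I \<Longrightarrow> m j i = m i j"
  and m_one: "i \<in> I \<Longrightarrow> m i i = 1"
  and m_ne_one: "i \<in> I \<Longrightarrow> j \<in> I \<Longrightarrow> i \<noteq> j \<Longrightarrow> m i j \<noteq> 1"
  using matrix by (auto simp: coxeter_matrix_def)

section \<open>Equality in the Coxeter group as a congruence on words\<close>

lemma ceq_lists: "u \<asymp> v \<Longrightarrow> u \<in> lists I \<and> v \<in> lists I"
proof (induction rule: coxeter_eq.induct)
  case (rel u v i j)
  then show ?case
    by (auto simp: in_lists_conv_set)
qed auto

lemma ceq_append_left: "u \<asymp> v \<Longrightarrow> w \<in> lists I \<Longrightarrow> w @ u \<asymp> w @ v"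
proof (induction rule: coxeter_eq.induct)
  case (rel u v i j)
  then show ?case using coxeter_eq.rel[of "w @ u" I v i j m] by simp
qed (simp add: coxeter_eq.refl, (blast intro: coxeter_eq.sym coxeter_eq.trans)+)

lemma ceq_append_right: "u \<asymp> v \<Longrightarrow> w \<in> lists I \<Longrightarrow> u @ w \<asymp> v @ w"
proof (induction rule: coxeter_eq.induct)
  case (rel u v i j)
  then show ?case using coxeter_eq.rel[of u I "v @ w" i j m] by simp
qed (simp add: coxeter_eq.refl, (blast intro: coxeter_eq.sym coxeter_eq.trans)+)

lemma ceq_append: "u \<asymp> u' \<Longrightarrow> v \<asymp> v' \<Longrightarrow> u @ v \<asymp> u' @ v'"
  by (meson ceq_append_left ceq_append_right ceq_lists coxeter_eq.trans)

lemma ceq_Cons: "u \<asymp> v \<Longrightarrow> i \<in> I \<Longrightarrow> i # u \<asymp> i # v"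
  using ceq_append_left[of u v "[i]"] by simp

lemma ceq_double: "i \<in> I \<Longrightarrow> u \<in> lists I \<Longrightarrow> v \<in> lists I \<Longrightarrow> u @ i # i # v \<asymp> u @ v"
  using coxeter_eq.rel[of u I v i i m] by (simp add: m_one)

lemma rev_pairs: "rev (concat (replicate n [i, j])) = concat (replicate n [j, i])"
proof (induction n)
  case (Suc n)
  have "concat (replicate n [j, i]) @ [j, i] = concat (replicate (Suc n) [j, i])"
    by (metis concat.simps(1,2) concat_append append_Nil2 replicate_Suc replicate_append_same)
  then show ?case using Suc by simp
qed simp

lemma ceq_rev: "u \<asymp> v \<Longrightarrow> rev u \<asymp> rev v"
proof (induction rule: coxeter_eq.induct)
  case (rel u v i j)
  then show ?case
    using coxeter_eq.rel[of "rev v" I "rev u" j i m] by (simp add: rev_pairs m_sym)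
qed (simp add: coxeter_eq.refl, (blast intro: coxeter_eq.sym coxeter_eq.trans)+)

lemma ceq_append_rev: "u \<in> lists I \<Longrightarrow> u @ rev u \<asymp> []"
proof (induction u rule: rev_induct)
  case (snoc i u)
  then have "u @ i # i # rev u \<asymp> u @ rev u" using ceq_double[of i u "rev u"] by simp
  then show ?case using snoc by (auto intro: coxeter_eq.trans)
qed (simp add: coxeter_eq.refl)

lemma ceq_rev_append: "u \<in> lists I \<Longrightarrow> rev u @ u \<asymp> []"
  using ceq_append_rev[of "rev u"] by simp

lemma ceq_move_right:
  assumes "u \<in> lists I" "v \<in> lists I"
  shows "u @ v \<asymp> w \<longleftrightarrow> u \<asymp> w @ rev v"
proof
  assume "u @ v \<asymp> w"
  then have "u @ v @ rev v \<asymp> w @ rev v"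
    using ceq_append_right[of "u @ v" w "rev v"] assms by simp
  moreover have "u @ v @ rev v \<asymp> u"
    using ceq_append_left[OF ceq_append_rev[OF assms(2)] assms(1)] by simp
  ultimately show "u \<asymp> w @ rev v" by (meson coxeter_eq.sym coxeter_eq.trans)
next
  assume a: "u \<asymp> w @ rev v"
  then have w: "w \<in> lists I" using ceq_lists[OF a] by simp
  have "u @ v \<asymp> w @ rev v @ v"
    using ceq_append_right[OF a assms(2)] by simp
  moreover have "w @ rev v @ v \<asymp> w"
    using ceq_append_left[OF ceq_rev_append[OF assms(2)] w] by simp
  ultimately show "u @ v \<asymp> w" by (meson coxeter_eq.trans)
qed

lemma ceq_move_left:
  assumes "u \<in> lists I" "v \<in> lists I"
  shows "u @ v \<asymp> w \<longleftrightarrow> v \<asymp> rev u @ w"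
proof -
  have "u @ v \<asymp> w \<longleftrightarrow> rev v @ rev u \<asymp> rev w" for w
    by (metis ceq_rev rev_append rev_rev_ident)
  then show ?thesis
    using ceq_move_right[of "rev v" "rev u" "rev w"] assms
    by (metis ceq_rev in_lists_conv_set rev_append rev_rev_ident set_rev)
qed

lemma ceq_snoc_iff: "u \<in> lists I \<Longrightarrow> x \<in> I \<Longrightarrow> u @ [x] \<asymp> w \<longleftrightarrow> u \<asymp> w @ [x]"
  using ceq_move_right[of u "[x]" w] by simp

lemma ceq_Cons_iff: "u \<in> lists I \<Longrightarrow> x \<in> I \<Longrightarrow> x # u \<asymp> w \<longleftrightarrow> u \<asymp> x # w"
  using ceq_move_left[of "[x]" u w] by simp

lemma ceq_sym_iff: "u \<asymp> v \<longleftrightarrow> v \<asymp> u"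
  by (meson coxeter_eq.sym)

lemma ceq_cancel_left: "u \<in> lists I \<Longrightarrow> u @ v \<asymp> u @ w \<longleftrightarrow> v \<asymp> w"
proof
  assume a: "u \<in> lists I" "u @ v \<asymp> u @ w"
  have vw: "v \<in> lists I" "w \<in> lists I" using ceq_lists[OF a(2)] by auto
  have "v \<asymp> rev u @ u @ w" using a ceq_move_left[OF a(1) vw(1)] by blast
  moreover have "rev u @ u @ w \<asymp> w"
    using ceq_append_right[OF ceq_rev_append[OF a(1)] vw(2)] by simp
  ultimately show "v \<asymp> w" by (rule coxeter_eq.trans)
qed (simp add: ceq_append_left)

lemma ceq_cancel_right: "u \<in> lists I \<Longrightarrow> v @ u \<asymp> w @ u \<longleftrightarrow> v \<asymp> w"
proof
  assume a: "u \<in> lists I" "v @ u \<asymp> w @ u"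
  have vw: "v \<in> lists I" "w \<in> lists I" using ceq_lists[OF a(2)] by auto
  have "v \<asymp> w @ u @ rev u" using a ceq_move_right[OF vw(1) a(1)] by simp
  moreover have "w @ u @ rev u \<asymp> w"
    using ceq_append_left[OF ceq_append_rev[OF a(1)] vw(2)] by simp
  ultimately show "v \<asymp> w" by (rule coxeter_eq.trans)
qed (simp add: ceq_append_right)

lemma ceq_cong: "u \<asymp> u' \<Longrightarrow> v \<asymp> v' \<Longrightarrow> u \<asymp> v \<longleftrightarrow> u' \<asymp> v'"
  by (meson coxeter_eq.sym coxeter_eq.trans)

end

subsection \<open>Alternating words\<close>

lemma length_alt_word [simp]: "length (alt_word n x y) = n"
  by (induction n arbitrary: x y) auto

lemma set_alt_word: "set (alt_word n x y) \<subseteq> {x, y}"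
  by (induction n x y rule: alt_word.induct) auto

lemma alt_word_in_lists [simp]: "x \<in> A \<Longrightarrow> y \<in> A \<Longrightarrow> alt_word n x y \<in> lists A"
  using set_alt_word[of n x y] by (auto simp: in_lists_conv_set)

lemma alt_word_add:
  "alt_word (a + b) x y =
    alt_word a x y @ (if even a then alt_word b x y else alt_word b y x)"
  by (induction a arbitrary: x y) auto

lemma alt_word_snoc: "alt_word (Suc n) x y = alt_word n x y @ [if even n then x else y]"
  using alt_word_add[of n 1 x y] by auto

lemma alt_word_last2: "alt_word n x y @ [if even n then x else y] = alt_word (Suc n) x y"
  by (simp only: alt_word_snoc)

lemma rev_alt_word: "rev (alt_word n x y) = (if odd n then alt_word n x y else alt_word n y x)"
proof (induction n arbitrary: x y)
  case (Suc n)
  have "rev (alt_word (Suc n) x y) = (if even n then x else y) # rev (alt_word n x y)"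
    by (simp only: alt_word_snoc rev_append) simp
  then show ?case by (simp add: Suc)
qed simp

lemma take_alt_word: "k \<le> n \<Longrightarrow> take k (alt_word n x y) = alt_word k x y"
  using alt_word_add[of k "n - k" x y] by simp

lemma drop_alt_word:
  "k \<le> n \<Longrightarrow> drop k (alt_word n x y) =
    (if even k then alt_word (n - k) x y else alt_word (n - k) y x)"
  using alt_word_add[of k "n - k" x y] by simp

lemma nth_alt_word: "k < n \<Longrightarrow> alt_word n x y ! k = (if even k then x else y)"
  by (induction n arbitrary: k x y) (auto simp: nth_Cons')

text \<open>Alternating words of odd length are palindromes and spell the reflections of the
  dihedral group. Whether a step meets a given wall is decided by comparison with one of
  them.\<close>

lemma alt_word_append_rev: "alt_word r x y @ rev (alt_word (Suc r) x y) = alt_word (Suc (2 * r)) x y"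
proof -
  have "alt_word (r + Suc r) x y = alt_word r x y @ rev (alt_word (Suc r) x y)"
    unfolding alt_word_add rev_alt_word by simp
  moreover have "r + Suc r = Suc (2 * r)" by simp
  ultimately show ?thesis by metis
qed

lemma concat_replicate_alt_word: "concat (replicate n [x, y]) = alt_word (2 * n) x y"
  by (induction n) auto

lemma distinct_adj_alt_word: "x \<noteq> y \<Longrightarrow> distinct_adj (alt_word n x y)"
proof (induction n arbitrary: x y)
  case (Suc n)
  then show ?case by (cases n) auto
qed simp

context coxeter
begin

lemma alt_word_relation: "x \<in> I \<Longrightarrow> y \<in> I \<Longrightarrow> alt_word (2 * m x y) x y \<asymp> []"
  using coxeter_eq.rel[of "[]" I "[]" x y m] by (simp add: concat_replicate_alt_word)

lemma alt_word_braid: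
  assumes "x \<in> I" "y \<in> I"
  shows "alt_word (m x y) x y \<asymp> alt_word (m x y) y x"
proof -
  have *: "2 * m x y = m x y + m x y" by simp
  have "alt_word (m x y) x y @ (if even (m x y) then alt_word (m x y) x y else alt_word (m x y) y x) \<asymp> []"
    using alt_word_relation[OF assms] unfolding * alt_word_add .
  then have "alt_word (m x y) x y \<asymp> [] @ rev (if even (m x y) then alt_word (m x y) x y else alt_word (m x y) y x)"
    using assms by (subst (asm) ceq_move_right) auto
  then show ?thesis by (cases "even (m x y)") (simp_all add: rev_alt_word)
qed

subsection \<open>A faithful representation of the rank two subgroups\<close>

text \<open>The number -2 B(\<alpha>_i, \<alpha>_k) for the Tits form B on simple roots. If
  \<open>m i k = 0\<close>, division by zero makes the angle 0 and the entry 2, which is the usual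
  choice B = -1 for infinite order.\<close>

definition refl_coeff :: "'i \<Rightarrow> 'i \<Rightarrow> real"
  where "refl_coeff i k = (if k = i then - 2 else 2 * cos (pi / real (m i k)))"

text \<open>\<open>f k\<close> is the value of a linear form on the simple root of \<open>k\<close>,
  and this is the contragredient of the geometric representation. In these coordinates a reflection
  reads the single value \<open>f i\<close>, which makes words easy to follow.\<close>

definition refl_act :: "'i \<Rightarrow> ('i \<Rightarrow> real) \<Rightarrow> 'i \<Rightarrow> real"
  where "refl_act i f = (\<lambda>k. f k + refl_coeff i k * f i)"

text \<open>The value at the letter that acts next obeys a three-term recursion with explicit
  solutions, so it can be prescribed as a sequence \<open>V\<close>. A coordinate outside the two
  letters only collects the values already met, those at even times through \<open>i\<close> and
  those at odd times through \<open>j\<close>.\<close>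

lemma refl_act_alt_word:
  fixes V :: "nat \<Rightarrow> real"
  assumes ij: "i \<in> I" "j \<in> I" "i \<noteq> j"
    and V: "\<And>t. V (Suc (Suc t)) = 2 * cos (pi / real (m i j)) * V (Suc t) - V t"
    and "f i = V 0" "f j = V 1 - 2 * cos (pi / real (m i j)) * V 0"
  shows "fold refl_act (alt_word t i j) f k =
    (if k = (if even t then i else j) then V t
     else if k = (if even t then j else i) then V (Suc t) - 2 * cos (pi / real (m i j)) * V t
     else f k + refl_coeff i k * (\<Sum>s\<in>{s. s < t \<and> even s}. V s)
       + refl_coeff j k * (\<Sum>s\<in>{s. s < t \<and> odd s}. V s))"
proof (induction t arbitrary: k)
  case 0
  then show ?case using assms by auto
next
  case (Suc t)
  have e: "{s. s < Suc t \<and> even s} = (if even t then insert t {s. s < t \<and> even s} else {s. s < t \<and> even s})"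
    and o: "{s. s < Suc t \<and> odd s} = (if odd t then insert t {s. s < t \<and> odd s} else {s. s < t \<and> odd s})"
    by (auto simp: less_Suc_eq)
  have f: "finite {s. s < t \<and> Q s}" for Q by simp
  have mji: "m j i = m i j" using ij m_sym by blast
  let ?g = "fold refl_act (alt_word t i j) f" and ?l = "if even t then i else j"
  have step: "fold refl_act (alt_word (Suc t) i j) f k = ?g k + refl_coeff ?l k * V t"
    unfolding alt_word_snoc fold_append comp_apply by (simp add: refl_act_def Suc.IH)
  show ?case
  proof (cases "k = i \<or> k = j")
    case True
    then show ?thesis
    proof (cases "k = ?l")
      case True
      then have "?g k = V t" using Suc.IH[of k] by simp
      then show ?thesis unfolding step using True ij V[of t] by (simp add: refl_coeff_def)
    next
      case False
      then have k: "k = (if even t then j else i)" using True by (simp split: if_splits)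
      then have "?g k = V (Suc t) - 2 * cos (pi / real (m i j)) * V t" using Suc.IH[of k] ij by simp
      moreover have "refl_coeff ?l k = 2 * cos (pi / real (m i j))"
        using k ij mji by (simp add: refl_coeff_def)
      ultimately show ?thesis unfolding step using k ij by simp
    qed
  next
    case False
    then have "?g k = f k + refl_coeff i k * (\<Sum>s\<in>{s. s < t \<and> even s}. V s)
       + refl_coeff j k * (\<Sum>s\<in>{s. s < t \<and> odd s}. V s)" using Suc.IH[of k] by simp
    then show ?thesis unfolding step e o using False f by (simp add: distrib_left)
  qed
qed

lemma sum_parity:
  fixes V :: "nat \<Rightarrow> real"
  shows "(\<Sum>s\<in>{s. s < 2 * n \<and> even s}. V s) = (\<Sum>s<n. V (2 * s))"
    and "(\<Sum>s\<in>{s. s < 2 * n \<and> odd s}. V s) = (\<Sum>s<n. V (Suc (2 * s)))"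
proof -
  have "{s. s < 2 * n \<and> even s} = (\<lambda>s. 2 * s) ` {..<n}"
    by (auto simp: image_iff)
  then show "(\<Sum>s\<in>{s. s < 2 * n \<and> even s}. V s) = (\<Sum>s<n. V (2 * s))"
    by (simp add: sum.reindex inj_on_def)
  have "{s. s < 2 * n \<and> odd s} = (\<lambda>s. Suc (2 * s)) ` {..<n}"
  proof (intro equalityI subsetI)
    fix s assume "s \<in> {s. s < 2 * n \<and> odd s}"
    then have "s = Suc (2 * (s div 2))" "s div 2 < n" by auto
    then show "s \<in> (\<lambda>s. Suc (2 * s)) ` {..<n}" by blast
  qed auto
  then show "(\<Sum>s\<in>{s. s < 2 * n \<and> odd s}. V s) = (\<Sum>s<n. V (Suc (2 * s)))"
    by (simp add: sum.reindex inj_on_def)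
qed

text \<open>Two steps of the recursion read V(t + 4) = (4 C^2 - 2) V(t + 2) - V(t). Over a full
  period all shifted sums agree, which leaves (4 C^2 - 4) S = 0.\<close>

lemma sum_periodic_zero:
  fixes V :: "nat \<Rightarrow> real" and C :: real
  assumes rec: "\<And>t. V (Suc (Suc t)) = 2 * C * V (Suc t) - V t" and "2 * C\<^sup>2 \<noteq> 2"
    and per: "\<And>t. V (t + 2 * n) = V t"
  shows "(\<Sum>s<n. V (2 * s + a)) = 0"
proof -
  define S where "S = (\<lambda>b. \<Sum>s<n. V (2 * s + b))"
  have S2: "S (b + 2) = S b" for b
  proof -
    have "S (b + 2) = (\<Sum>s<n. V (2 * Suc s + b))" unfolding S_def by (simp add: algebra_simps)
    also have "\<dots> = S b + (V (2 * n + b) - V b)"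
      unfolding S_def
      using sum.lessThan_Suc_shift[of "\<lambda>s. V (2 * s + b)" n] sum.lessThan_Suc[of "\<lambda>s. V (2 * s + b)" n]
      by simp
    also have "V (2 * n + b) = V b" using per[of b] by (simp add: add.commute)
    finally show ?thesis by simp
  qed
  have "V (t + 4) = (4 * C\<^sup>2 - 2) * V (t + 2) - V t" for t
  proof -
    have 1: "V (t + 4) = 2 * C * V (t + 3) - V (t + 2)" using rec[of "t + 2"] by (simp add: numeral_eq_Suc)
    have 2: "V (t + 3) = 2 * C * V (t + 2) - V (t + 1)" using rec[of "t + 1"] by (simp add: numeral_eq_Suc)
    have 3: "V (t + 2) = 2 * C * V (t + 1) - V t" using rec[of t] by (simp add: numeral_eq_Suc)
    have "2 * C * V (t + 1) = V (t + 2) + V t" using 3 by simp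
    then show ?thesis unfolding 1 2 by (simp add: power2_eq_square algebra_simps)
  qed
  then have "S (a + 4) = (4 * C\<^sup>2 - 2) * S (a + 2) - S a"
    unfolding S_def sum_distrib_left sum_subtractf[symmetric] add.assoc[symmetric] by (simp only:)
  moreover have "S (a + 4) = S a" using S2[of "a + 2"] S2[of a] by (simp add: numeral_eq_Suc)
  ultimately have "(2 * C\<^sup>2 - 2) * S a = 0" unfolding S2 by (simp add: algebra_simps)
  then show ?thesis using assms(2) unfolding S_def by simp
qed

text \<open>With \<theta> = pi / m every solution of the recursion has period 2 m, so the
  coordinates of the two letters return. The other coordinates return because the sums over a period
  vanish.\<close>

lemma refl_act_relation:
  assumes ij: "i \<in> I" "j \<in> I"
  shows "fold refl_act (alt_word (2 * m i j) i j) f = f"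
proof (cases "i = j")
  case True
  then show ?thesis using m_one[OF ij(1)] by (auto simp: refl_act_def refl_coeff_def numeral_eq_Suc)
next
  case ne: False
  show ?thesis
  proof (cases "m i j = 0")
    case False
    define n where "n = m i j"
    have n: "n \<ge> 2" using m_ne_one[OF ij ne] False unfolding n_def by simp
    define \<theta> where "\<theta> = pi / real n"
    have th: "0 < \<theta>" "\<theta> \<le> pi / 2" using n unfolding \<theta>_def by (auto simp: field_simps)
    have sin: "sin \<theta> > 0" using th pi_gt_zero by (intro sin_gt_zero) linarith+
    have nth: "real n * \<theta> = pi" using n by (simp add: \<theta>_def)
    \<comment> \<open>The coefficient of the sine that gives V(1) = f j + 2 cos \<theta> f i. It
      exists since the order is at least 2, hence sin \<theta> is positive.\<close>
    define Q where "Q = (f j + 2 * cos \<theta> * f i - f i * cos \<theta>) / sin \<theta>"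
    define V where "V = (\<lambda>t. f i * cos (real t * \<theta>) + Q * sin (real t * \<theta>))"
    have V: "V (Suc (Suc t)) = 2 * cos (pi / real (m i j)) * V (Suc t) - V t" for t
    proof -
      have "real (Suc (Suc t)) * \<theta> = real (Suc t) * \<theta> + \<theta>" "real t * \<theta> = real (Suc t) * \<theta> - \<theta>"
        by (simp_all add: algebra_simps)
      then show ?thesis
        unfolding V_def n_def[symmetric] \<theta>_def[symmetric]
        by (simp only: cos_add sin_add cos_diff sin_diff) (simp add: algebra_simps)
    qed
    have V0: "f i = V 0" by (simp add: V_def)
    have V1: "f j = V 1 - 2 * cos (pi / real (m i j)) * V 0"
      using sin unfolding V_def n_def[symmetric] \<theta>_def[symmetric] Q_def by simp
    have per: "V (t + 2 * n) = V t" for t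
    proof -
      have "real (t + 2 * n) * \<theta> = real t * \<theta> + 2 * pi" using nth by (simp add: algebra_simps)
      then show ?thesis unfolding V_def by (simp only: sin_periodic cos_periodic)
    qed
    have "(sin \<theta>)\<^sup>2 > 0" using sin by simp
    then have C: "2 * (cos \<theta>)\<^sup>2 \<noteq> 2" using sin_cos_squared_add[of \<theta>] by linarith
    have e: "(\<Sum>s\<in>{s. s < 2 * n \<and> even s}. V s) = 0" and o: "(\<Sum>s\<in>{s. s < 2 * n \<and> odd s}. V s) = 0"
      unfolding sum_parity
      using sum_periodic_zero[OF V[folded n_def \<theta>_def] C per, of 0]
        sum_periodic_zero[OF V[folded n_def \<theta>_def] C per, of 1] by simp_all
    show ?thesis
    proof
      fix k
      show "fold refl_act (alt_word (2 * m i j) i j) f k = f k"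
        using refl_act_alt_word[where V = V, OF ij ne V V0 V1, of "2 * n" k] per[of 0] per[of 1] e o V0 V1
        unfolding n_def[symmetric] by (simp split: if_splits)
    qed
  qed simp
qed

lemma refl_act_ceq: "u \<asymp> v \<Longrightarrow> fold refl_act u = fold refl_act v"
proof (induction rule: coxeter_eq.induct)
  case (rel u v i j)
  then have "fold refl_act (alt_word (2 * m i j) i j) f = f" for f using refl_act_relation by blast
  then show ?case by (simp add: concat_replicate_alt_word comp_def)
qed auto

text \<open>Hence \<open>m i j\<close> is the exact order of the product of two generators. A linear
  form is exhibited that the power in question moves.\<close>

lemma alt_word_ne_Nil:
  assumes ij: "i \<in> I" "j \<in> I" "i \<noteq> j" and n: "0 < n" "m i j = 0 \<or> n < m i j"
  shows "\<not> alt_word (2 * n) i j \<asymp> []"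
proof
  assume "alt_word (2 * n) i j \<asymp> []"
  then have id: "fold refl_act (alt_word (2 * n) i j) f = f" for f using refl_act_ceq by fastforce
  show False
  proof (cases "m i j = 0")
    case True
    \<comment> \<open>For infinite order the recursion has the unbounded solution V(t) = t, and
      these are its initial values.\<close>
    define f where "f = (\<lambda>k. if k = i then 0 else (1::real))"
    have "fold refl_act (alt_word (2 * n) i j) f i = 2 * real n"
      using refl_act_alt_word[OF ij, where V = real and f = f and t = "2 * n" and k = i] ij True
      by (simp add: f_def)
    then show False using n unfolding id by (simp add: f_def)
  next
    case False
    define \<theta> where "\<theta> = pi / real (m i j)"
    \<comment> \<open>These initial values select the solution V(t) = cos (t \<theta>), since cos
      \<theta> - 2 cos \<theta> = - cos \<theta>.\<close>
    define f where "f = (\<lambda>k. if k = i then 1 else - cos \<theta>)"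
    have V: "cos (real (Suc (Suc t)) * \<theta>) = 2 * cos \<theta> * cos (real (Suc t) * \<theta>) - cos (real t * \<theta>)" for t
    proof -
      have "real (Suc (Suc t)) * \<theta> = real (Suc t) * \<theta> + \<theta>" "real t * \<theta> = real (Suc t) * \<theta> - \<theta>"
        by (simp_all add: algebra_simps)
      then show ?thesis
        by (simp only: cos_add cos_diff) (simp add: algebra_simps)
    qed
    have "fold refl_act (alt_word (2 * n) i j) f i = cos (real (2 * n) * \<theta>)"
      using refl_act_alt_word[OF ij, where V = "\<lambda>t. cos (real t * \<theta>)" and f = f and t = "2 * n" and k = i] ij V
      by (simp add: f_def \<theta>_def)
    then have "cos (2 * (real n * \<theta>)) = 1" unfolding id by (simp add: f_def mult.assoc)
    then have "sin (real n * \<theta>) = 0" by (simp add: cos_double_sin)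
    moreover have "0 < real n * \<theta>" "real n * \<theta> < pi"
      using n False pi_gt_zero by (auto simp: \<theta>_def field_simps)
    ultimately show False using sin_gt_zero by fastforce
  qed
qed

end

lemma card_less_Suc_shift:
  "card {p. p < Suc n \<and> P p} = (if P 0 then 1 else 0) + card {p. p < n \<and> P (Suc p)}"
proof -
  have "{p. p < Suc n \<and> P p} = (if P 0 then {0} else {}) \<union> Suc ` {p. p < n \<and> P (Suc p)}"
    by (auto simp: image_iff less_Suc_eq_0_disj)
  then show ?thesis by (auto simp: card_image)
qed

section \<open>Products along words in a monoid\<close>

definition wprod :: "('b, 'c) monoid_scheme \<Rightarrow> ('a \<Rightarrow> 'b) \<Rightarrow> 'a list \<Rightarrow> 'b"
  where "wprod G g u = foldr (\<lambda>i x. g i \<otimes>\<^bsub>G\<^esub> x) u \<one>\<^bsub>G\<^esub>"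

lemma wprod_Nil [simp]: "wprod G g [] = \<one>\<^bsub>G\<^esub>"
  and wprod_Cons: "wprod G g (i # u) = g i \<otimes>\<^bsub>G\<^esub> wprod G g u"
  by (simp_all add: wprod_def)

context monoid
begin

lemma wprod_closed [simp]:
  "g \<in> A \<rightarrow> carrier G \<Longrightarrow> u \<in> lists A \<Longrightarrow> wprod G g u \<in> carrier G"
  by (induction u) (auto simp: wprod_Cons)

lemma wprod_append:
  "g \<in> A \<rightarrow> carrier G \<Longrightarrow> u \<in> lists A \<Longrightarrow> v \<in> lists A \<Longrightarrow>
    wprod G g (u @ v) = wprod G g u \<otimes> wprod G g v"
  by (induction u) (auto simp: wprod_Cons m_assoc Pi_iff)

lemma wprod_single: "g i \<in> carrier G \<Longrightarrow> wprod G g [i] = g i"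
  by (simp add: wprod_Cons)

end

context coxeter
begin

subsection \<open>Inversions\<close>

text \<open>
  In terms of the root system, \<^term>\<open>pos v x\<close> says that \<open>v\<close> maps the simple root of \<open>x\<close> to a positive
  root: the sign changes exactly when a letter is prepended whose own root has been reached.
\<close>

primrec pos :: "'i list \<Rightarrow> 'i \<Rightarrow> bool"
  where
    "pos [] x = True"
  | "pos (k # v) x = (pos v x \<noteq> (v @ [x] \<asymp> k # v))"

text \<open>Each letter of \<open>u\<close> flips the sign exactly when its own wall is met, so only
  the parity of the number of such letters enters.\<close>

lemma pos_append:
  "pos (u @ v) x =
    (pos v x \<noteq> odd (card {p. p < length u \<and> drop (Suc p) u @ v @ [x] \<asymp> drop p u @ v}))"
proof (induction u)
  case (Cons k u)
  show ?case
    using Cons card_less_Suc_shift[of "length u" "\<lambda>p. drop (Suc p) (k # u) @ v @ [x] \<asymp> drop p (k # u) @ v"]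
    by simp
qed simp

lemma alt_word_twice:
  assumes "x \<in> I" "y \<in> I" "v \<in> lists I"
  shows "alt_word (2 * m x y + n) x y @ v \<asymp> alt_word n x y @ v"
proof -
  have "alt_word (2 * m x y) x y @ alt_word n x y @ v \<asymp> [] @ alt_word n x y @ v"
    using assms by (intro ceq_append_right alt_word_relation) auto
  then show ?thesis by (simp add: alt_word_add)
qed

text \<open>Along the relator of length 2 m the reflections repeat with period m. Each wall is
  therefore met an even number of times, and the flips cancel.\<close>

lemma pos_relation:
  assumes "i \<in> I" "j \<in> I" "v \<in> lists I" "x \<in> I"
  shows "pos (alt_word (2 * m i j) i j @ v) x = pos v x"
proof -
  define n where "n = m i j"
  define w where "w = alt_word (2 * n) i j"
  define Q where "Q = (\<lambda>r. v @ [x] \<asymp> alt_word (Suc (2 * r)) j i @ v)"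
  have drop_w: "drop p w = rev (alt_word (2 * n - p) j i)" if "p \<le> 2 * n" for p
    unfolding w_def using that by (auto simp: drop_alt_word rev_alt_word)
  have PQ: "drop (Suc p) w @ v @ [x] \<asymp> drop p w @ v \<longleftrightarrow> Q (2 * n - 1 - p)" if "p < 2 * n" for p
  proof -
    define r where "r = 2 * n - 1 - p"
    have r: "2 * n - Suc p = r" "2 * n - p = Suc r" using that by (auto simp: r_def)
    have "drop (Suc p) w @ v @ [x] \<asymp> drop p w @ v \<longleftrightarrow>
        rev (alt_word r j i) @ (v @ [x]) \<asymp> rev (alt_word (Suc r) j i) @ v"
      using that by (simp add: drop_w r del: alt_word.simps)
    also have "\<dots> \<longleftrightarrow> v @ [x] \<asymp> (alt_word r j i @ rev (alt_word (Suc r) j i)) @ v"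
      using assms by (subst ceq_move_left) (auto simp del: alt_word.simps)
    also have "\<dots> \<longleftrightarrow> Q r" unfolding alt_word_append_rev Q_def by simp
    finally show ?thesis by (simp add: r_def)
  qed
  \<comment> \<open>Adding \<open>n\<close> to \<open>r\<close> lengthens the palindrome by the
    relator of length \<open>2 * m j i\<close>, which is trivial in the group.\<close>
  have per: "Q (n + r) = Q r" for r
  proof -
    have e: "Suc (2 * (n + r)) = 2 * m j i + Suc (2 * r)" using assms by (simp add: n_def m_sym)
    show ?thesis unfolding Q_def e
      using alt_word_twice[of j i v "Suc (2 * r)"] assms
      by (meson coxeter_eq.sym coxeter_eq.trans)
  qed
  have "{p. p < length w \<and> drop (Suc p) w @ v @ [x] \<asymp> drop p w @ v} = {p. p < 2 * n \<and> Q (2 * n - 1 - p)}"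
    using PQ by (auto simp: w_def)
  also have "card \<dots> = card {r. r < 2 * n \<and> Q r}"
    by (rule bij_betw_same_card[of "\<lambda>p. 2 * n - 1 - p"], rule bij_betw_byWitness[of _ "\<lambda>p. 2 * n - 1 - p"]) auto
  also have "{r. r < 2 * n \<and> Q r} = {r. r < n \<and> Q r} \<union> (+) n ` {r. r < n \<and> Q r}"
  proof (intro equalityI subsetI)
    fix r assume r: "r \<in> {r. r < 2 * n \<and> Q r}"
    show "r \<in> {r. r < n \<and> Q r} \<union> (+) n ` {r. r < n \<and> Q r}"
    proof (cases "r < n")
      case False
      then have "r = n + (r - n)" "r - n < n" using r by auto
      then show ?thesis using per[of "r - n"] r by auto
    qed (use r in auto)
  qed (auto simp: per)
  also have "card \<dots> = 2 * card {r. r < n \<and> Q r}"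
    by (subst card_Un_disjoint) (auto simp: card_image)
  finally show ?thesis unfolding n_def[symmetric] w_def[symmetric] pos_append by simp
qed

text \<open>The relator itself does not change the sign, and the letters of \<open>u\<close> see
  equivalent words on both sides. So \<open>pos\<close> is a function on the group and can stand for
  the sign of a root.\<close>

lemma pos_ceq: "u \<asymp> v \<Longrightarrow> x \<in> I \<Longrightarrow> pos u x = pos v x"
proof (induction rule: coxeter_eq.induct)
  case (rel u v i j)
  define w where "w = alt_word (2 * m i j) i j"
  have w: "concat (replicate (m i j) [i, j]) = w" by (simp add: w_def concat_replicate_alt_word)
  have wl: "w \<in> lists I" using rel by (simp add: w_def)
  have wv: "w @ v \<asymp> v"
    using ceq_append_right[OF alt_word_relation[OF rel(3,4)] rel(2)] by (simp add: w_def)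
  have "drop (Suc p) u @ (w @ v) @ [x] \<asymp> drop p u @ (w @ v) \<longleftrightarrow>
    drop (Suc p) u @ v @ [x] \<asymp> drop p u @ v" for p
  proof (rule ceq_cong)
    have "drop q u \<in> lists I" for q using rel(1) by (meson in_lists_conv_set in_set_dropD)
    then show "drop (Suc p) u @ (w @ v) @ [x] \<asymp> drop (Suc p) u @ v @ [x]"
      and "drop p u @ (w @ v) \<asymp> drop p u @ v"
      using ceq_append_left[OF ceq_append_right[OF wv, of "[x]"]] ceq_append_left[OF wv] rel by auto
  qed
  then show ?case
    using pos_append[of u "w @ v" x] pos_append[of u v x] pos_relation[OF rel(3,4,2,5)]
    unfolding w by (simp add: w_def)
qed auto

text \<open>If \<open>u\<close> maps the simple root of \<open>x'\<close> to \<open>\<plusminus>\<close> the simple root of \<open>x\<close>, then the signs multiply.\<close>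

lemma pos_append_simple:
  assumes "u @ [x'] \<asymp> x # u" "v \<in> lists I" "u \<in> lists I" "x \<in> I" "x' \<in> I"
  shows "pos (v @ u) x' = (pos v x = pos u x')"
proof -
  have "drop (Suc p) v @ u @ [x'] \<asymp> drop p v @ u \<longleftrightarrow> drop (Suc p) v @ [] @ [x] \<asymp> drop p v @ []" for p
  proof -
    have d: "drop q v \<in> lists I" for q using assms(2) by (meson in_lists_conv_set in_set_dropD)
    have "drop (Suc p) v @ u @ [x'] \<asymp> drop p v @ u \<longleftrightarrow> (drop (Suc p) v @ [x]) @ u \<asymp> drop p v @ u"
      using ceq_append_left[OF assms(1) d[of "Suc p"]] assms d[of p]
      by (intro ceq_cong) (auto intro!: coxeter_eq.refl simp del: in_lists_conv_set)
    also have "\<dots> \<longleftrightarrow> drop (Suc p) v @ [x] \<asymp> drop p v" by (rule ceq_cancel_right[OF assms(3)])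
    finally show ?thesis by simp
  qed
  then show ?thesis
    using pos_append[of v u x'] pos_append[of v "[]" x] by auto
qed

lemma pos_snoc_same:
  assumes "v \<in> lists I" "x \<in> I"
  shows "pos (v @ [x]) x = (\<not> pos v x)"
  using pos_append_simple[of "[x]" x x v] assms by (simp add: coxeter_eq.refl)

lemma alt_word_neq:
  assumes "x \<in> I" "y \<in> I" "x \<noteq> y" "0 < r" "m x y = 0 \<or> r < m x y"
  shows "\<not> alt_word r x y \<asymp> alt_word r y x"
proof
  assume a: "alt_word r x y \<asymp> alt_word r y x"
  have "alt_word r x y @ rev (alt_word r y x) \<asymp> []"
    using a assms by (subst ceq_move_right) auto
  moreover have "alt_word (r + r) x y = alt_word r x y @ rev (alt_word r y x)"
    unfolding alt_word_add rev_alt_word by simp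
  ultimately have "alt_word (2 * r) x y \<asymp> []" by (simp add: mult_2)
  then show False using alt_word_ne_Nil assms by blast
qed

text \<open>A flip would identify the two alternating words of some common length below the order,
  which \<open>alt_word_neq\<close> forbids.\<close>

lemma pos_alt_word:
  assumes "x \<in> I" "y \<in> I" "x \<noteq> y" "m x y = 0 \<or> k < m x y"
  shows "pos (alt_word k x y) (if even k then x else y)"
proof -
  let ?e = "alt_word k x y" and ?t = "if even k then x else y"
  have "\<not> drop (Suc p) ?e @ [?t] \<asymp> drop p ?e" if "p < k" for p
  proof -
    have "drop (Suc p) ?e @ [?t] = drop (Suc p) (alt_word (Suc k) x y)"
      using that by (simp only: alt_word_snoc) simp
    also have "\<dots> = (if even (Suc p) then alt_word (k - p) x y else alt_word (k - p) y x)"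
      using that by (subst drop_alt_word) auto
    finally have 1: "drop (Suc p) ?e @ [?t] = (if even p then alt_word (k - p) y x else alt_word (k - p) x y)"
      by simp
    have 2: "drop p ?e = (if even p then alt_word (k - p) x y else alt_word (k - p) y x)"
      using that by (subst drop_alt_word) auto
    have myx: "m y x = m x y" using assms m_sym by blast
    have "m x y = 0 \<or> k - p < m x y" "0 < k - p" using assms(4) that by linarith+
    then have "\<not> alt_word (k - p) x y \<asymp> alt_word (k - p) y x" "\<not> alt_word (k - p) y x \<asymp> alt_word (k - p) x y"
      using alt_word_neq[of x y "k - p"] alt_word_neq[of y x "k - p"] assms(1-3) myx by auto
    then show ?thesis unfolding 1 2 by simp
  qed
  then have "{p. p < length ?e \<and> drop (Suc p) ?e @ [] @ [?t] \<asymp> drop p ?e @ []} = {}" by auto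
  then show ?thesis using pos_append[of ?e "[]" ?t] by (simp only: append_Nil2 card.empty) simp
qed

text \<open>At the empty word the root is positive, so some letter of \<open>v\<close> turns it
  negative, and there it is the simple root of that letter. Deleting this letter amounts to
  multiplying by \<open>x\<close> on the right.\<close>

lemma exchange:
  assumes "\<not> pos v x" "v \<in> lists I" "x \<in> I"
  shows "\<exists>p<length v. v @ [x] \<asymp> take p v @ drop (Suc p) v"
  using assms
proof (induction v)
  case (Cons k v)
  have k: "k \<in> I" "v \<in> lists I" using Cons by auto
  show ?case
  proof (cases "pos v x")
    case True
    then have "v @ [x] \<asymp> k # v" using Cons by simp
    then have "k # v @ [x] \<asymp> v" using k Cons.prems by (subst ceq_Cons_iff) auto
    then show ?thesis by (intro exI[of _ 0]) simp
  next
    case False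
    then obtain p where p: "p < length v" "v @ [x] \<asymp> take p v @ drop (Suc p) v" using Cons k by blast
    then show ?thesis using ceq_Cons[OF p(2) k(1)] by (intro exI[of _ "Suc p"]) simp
  qed
qed simp

subsection \<open>Reduced words\<close>

definition reduced :: "'i list \<Rightarrow> bool"
  where "reduced u \<longleftrightarrow> u \<in> lists I \<and> (\<forall>v. u \<asymp> v \<longrightarrow> length u \<le> length v)"

lemma reduced_lists: "reduced u \<Longrightarrow> u \<in> lists I"
  by (simp add: reduced_def)

lemma reduced_Nil [simp]: "reduced []"
  by (simp add: reduced_def)

lemma reduced_exists: "u \<in> lists I \<Longrightarrow> \<exists>v. reduced v \<and> u \<asymp> v"
proof -
  assume u: "u \<in> lists I"
  obtain v where v: "u \<asymp> v" "\<And>w. u \<asymp> w \<Longrightarrow> length v \<le> length w"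
    using ex_has_least_nat[of "\<lambda>v. u \<asymp> v" u length] coxeter_eq.refl[OF u] by blast
  then have "reduced v" unfolding reduced_def by (meson ceq_lists coxeter_eq.trans)
  then show ?thesis using v by blast
qed

lemma reduced_ceq_length: "reduced u \<Longrightarrow> reduced v \<Longrightarrow> u \<asymp> v \<Longrightarrow> length u = length v"
  by (meson coxeter_eq.sym le_antisym reduced_def)

lemma reducedI: "reduced u \<Longrightarrow> u \<asymp> v \<Longrightarrow> length v \<le> length u \<Longrightarrow> reduced v"
  unfolding reduced_def by (meson ceq_lists coxeter_eq.trans le_trans)

lemma reduced_append:
  assumes "reduced (u @ v)"
  shows "reduced u" "reduced v"
proof -
  have l: "u \<in> lists I" "v \<in> lists I" using reduced_lists[OF assms] by auto
  have "length u \<le> length w" if "u \<asymp> w" for w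
    using ceq_append_right[OF that l(2)] assms unfolding reduced_def by fastforce
  then show "reduced u" using l by (simp add: reduced_def)
  have "length v \<le> length w" if "v \<asymp> w" for w
    using ceq_append_left[OF that l(1)] assms unfolding reduced_def by fastforce
  then show "reduced v" using l by (simp add: reduced_def)
qed

lemma reduced_rev: "reduced u \<Longrightarrow> reduced (rev u)"
  unfolding reduced_def using ceq_rev by (metis length_rev rev_in_lists rev_rev_ident)

lemma reduced_snoc_pos:
  assumes "reduced (a @ [x])"
  shows "pos a x"
proof (rule ccontr)
  assume "\<not> pos a x"
  moreover have "a \<in> lists I" "x \<in> I" using reduced_lists[OF assms] by auto
  ultimately obtain p where "p < length a" "a @ [x] \<asymp> take p a @ drop (Suc p) a" using exchange by blast
  then show False using assms unfolding reduced_def by fastforce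
qed

text \<open>Exchange deletes one letter of \<open>a\<close>. Putting \<open>x\<close> at the end
  restores the element and the length.\<close>

lemma reduced_neg:
  assumes "reduced a" "\<not> pos a x" "x \<in> I"
  shows "\<exists>b. reduced (b @ [x]) \<and> a \<asymp> b @ [x]"
proof -
  have a: "a \<in> lists I" using assms reduced_lists by blast
  obtain p where p: "p < length a" "a @ [x] \<asymp> take p a @ drop (Suc p) a" using exchange assms a by blast
  let ?b = "take p a @ drop (Suc p) a"
  have "a \<asymp> ?b @ [x]" using p a assms by (subst (asm) ceq_snoc_iff) auto
  moreover have "reduced (?b @ [x])" using reducedI[OF assms(1) calculation] p by simp
  ultimately show ?thesis by blast
qed

text \<open>Otherwise a reduced spelling \<open>b\<close> of \<open>a @ [x]\<close> is no longer
  than \<open>a\<close>, and the root of \<open>x\<close> is negative at \<open>b\<close>. Exchange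
  deletes a letter of \<open>b\<close> and yields a spelling of \<open>a\<close> that is too
  short.\<close>

lemma reduced_snocI:
  assumes "reduced a" "pos a x" "x \<in> I"
  shows "reduced (a @ [x])"
proof (rule ccontr)
  assume nr: "\<not> reduced (a @ [x])"
  have a: "a \<in> lists I" using assms reduced_lists by blast
  obtain b where b: "reduced b" "a @ [x] \<asymp> b" using reduced_exists[of "a @ [x]"] a assms by auto
  have lb: "length b < Suc (length a)"
  proof (rule ccontr)
    assume "\<not> ?thesis"
    then have "reduced (a @ [x])" using reducedI[OF b(1) coxeter_eq.sym[OF b(2)]] by simp
    then show False using nr by simp
  qed
  have ab: "a \<asymp> b @ [x]" using b a assms ceq_snoc_iff by blast
  have bl: "b \<in> lists I" using b reduced_lists by blast
  have "pos (b @ [x]) x" using pos_ceq[OF ab] assms by simp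
  then have "\<not> pos b x" using pos_snoc_same bl assms by blast
  then obtain p where p: "p < length b" "b @ [x] \<asymp> take p b @ drop (Suc p) b" using exchange bl assms by blast
  have "a \<asymp> take p b @ drop (Suc p) b" using ab p by (meson coxeter_eq.trans)
  then have "length a \<le> length (take p b @ drop (Suc p) b)" using assms unfolding reduced_def by blast
  then show False using p lb by simp
qed

text \<open>A new letter extends the alternating word or cancels its last letter. At full length
  \<open>m x y\<close> the braid relation provides the spelling in which it cancels.\<close>

lemma dihedral_normal_form:
  assumes "x \<in> I" "y \<in> I" "x \<noteq> y" "e \<in> lists {x, y}"
  shows "\<exists>k a b. {a, b} = {x, y} \<and> e \<asymp> alt_word k a b \<and> (m x y = 0 \<or> k \<le> m x y)"
  using assms(4)
proof (induction e rule: rev_induct)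
  case Nil
  show ?case by (intro exI[of _ 0] exI[of _ x] exI[of _ y]) (simp add: coxeter_eq.refl)
next
  case (snoc t e)
  then obtain k a b where k: "{a, b} = {x, y}" "e \<asymp> alt_word k a b" "m x y = 0 \<or> k \<le> m x y" by auto
  have t: "t = a \<or> t = b" using snoc k by auto
  have ab: "a \<in> I" "b \<in> I" "a \<noteq> b" using k assms by (auto simp: doubleton_eq_iff)
  have mab: "m a b = m x y" using k(1) assms m_sym by (auto simp: doubleton_eq_iff)
  have down: "\<exists>k' a' b'. {a', b'} = {x, y} \<and> e @ [t] \<asymp> alt_word k' a' b' \<and> (m x y = 0 \<or> k' \<le> m x y)"
    if "{a', b'} = {x, y}" "e \<asymp> alt_word (Suc k') a' b'" "m x y = 0 \<or> Suc k' \<le> m x y"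
      "t = (if even k' then a' else b')" for k' a' b'
  proof -
    have ab': "a' \<in> I" "b' \<in> I" using that assms by (auto simp: doubleton_eq_iff)
    have "e @ [t] \<asymp> alt_word k' a' b' @ [t, t]"
      using ceq_append_right[OF that(2), of "[t]"] that(4) ab' unfolding alt_word_snoc by auto
    moreover have "alt_word k' a' b' @ [t, t] \<asymp> alt_word k' a' b'"
      using ceq_double[of t "alt_word k' a' b'" "[]"] ab' that(4) by auto
    ultimately have "e @ [t] \<asymp> alt_word k' a' b'" by (rule coxeter_eq.trans)
    then show ?thesis using that by (metis Suc_leD)
  qed
  show ?case
  proof (cases "k = 0")
    case True
    obtain t' where "{t, t'} = {x, y}" using t k by auto
    moreover have "e @ [t] \<asymp> alt_word 1 t t'" using True k t ab ceq_append_right[OF k(2), of "[t]"] by auto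
    moreover have "m x y = 0 \<or> 1 \<le> m x y" by auto
    ultimately show ?thesis by blast
  next
    case False
    then obtain k' where k': "k = Suc k'" by (cases k) auto
    show ?thesis
    proof (cases "t = (if even k' then a else b)")
      case True
      then show ?thesis using down k k' by blast
    next
      case f: False
      show ?thesis
      proof (cases "m x y = 0 \<or> k < m x y")
        case True
        have "t = (if even k then a else b)" using f t k' by auto
        then have "e @ [t] \<asymp> alt_word (Suc k) a b"
          using ceq_append_right[OF k(2), of "[t]"] ab unfolding alt_word_snoc by auto
        then show ?thesis using k True by (metis Suc_leI)
      next
        case False
        then have "k = m a b" using k mab by auto
        then have "e \<asymp> alt_word (Suc k') b a"
          using k(2) alt_word_braid[OF ab(1,2)] k' by (metis coxeter_eq.trans)
        moreover have "t = (if even k' then b else a)" using f t by auto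
        ultimately show ?thesis using down[of b a k'] k k' by (auto simp: insert_commute)
      qed
    qed
  qed
qed

text \<open>\<open>z\<close> is a shortest element of the coset of \<open>u\<close> modulo the
  dihedral group. A flip caused by a letter of \<open>z\<close> would allow this letter to be
  deleted within the coset, so the sign of a dihedral root is decided by the dihedral part
  alone.\<close>

lemma coset_minimum:
  assumes "u \<in> lists I" "x \<in> I" "y \<in> I"
  shows "\<exists>z e. reduced z \<and> e \<in> lists {x, y} \<and> u \<asymp> z @ e \<and>
    (\<forall>e\<in>lists {x, y}. \<forall>t\<in>{x, y}. pos (z @ e) t = pos e t)"
proof -
  define P where "P = (\<lambda>z. \<exists>e\<in>lists {x, y}. u \<asymp> z @ e)"
  have "P u" unfolding P_def using assms by (intro bexI[of _ "[]"]) (auto intro: coxeter_eq.refl)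
  then obtain z where z: "P z" "\<And>w. P w \<Longrightarrow> length z \<le> length w"
    using ex_has_least_nat[of P u length] by blast
  obtain e where e: "e \<in> lists {x, y}" "u \<asymp> z @ e" using z(1) unfolding P_def by blast
  have zl: "z \<in> lists I" using ceq_lists[OF e(2)] by auto
  have sub: "e' \<in> lists I" if "e' \<in> lists {x, y}" for e' using that assms by auto
  have conj: "P w" if "z @ e' \<asymp> w @ e''" "e' \<in> lists {x, y}" "e'' \<in> lists {x, y}" for w e' e''
  proof -
    have "w \<in> lists I" using ceq_lists[OF that(1)] by auto
    have "z \<asymp> (w @ e'') @ rev e'" using that zl sub by (subst (asm) ceq_move_right) auto
    then have "z @ e \<asymp> w @ e'' @ rev e' @ e" using ceq_append_right[OF _ sub[OF e(1)]] by fastforce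
    then have "u \<asymp> w @ e'' @ rev e' @ e" using e coxeter_eq.trans by blast
    moreover have "e'' @ rev e' @ e \<in> lists {x, y}" using that e by simp
    ultimately show ?thesis unfolding P_def by blast
  qed
  have "reduced z"
    unfolding reduced_def
  proof (intro conjI allI impI zl)
    fix v assume "z \<asymp> v"
    then have "P v" using conj[of "[]" v "[]"] by simp
    then show "length z \<le> length v" by (rule z(2))
  qed
  moreover have "pos (z @ e') t = pos e' t" if e': "e' \<in> lists {x, y}" and t: "t \<in> {x, y}" for e' t
  proof -
    have "\<not> drop (Suc p) z @ e' @ [t] \<asymp> drop p z @ e'" if p: "p < length z" for p
    proof
      assume a: "drop (Suc p) z @ e' @ [t] \<asymp> drop p z @ e'"
      have "take p z \<in> lists I" using zl by (meson in_lists_conv_set in_set_takeD)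
      from ceq_append_left[OF coxeter_eq.sym[OF a] this]
      have "take p z @ drop p z @ e' \<asymp> take p z @ drop (Suc p) z @ e' @ [t]" .
      then have "z @ e' \<asymp> (take p z @ drop (Suc p) z) @ (e' @ [t])" by (simp flip: append_assoc)
      then have "P (take p z @ drop (Suc p) z)" using conj e' t by auto
      then show False using z(2) p by fastforce
    qed
    then have "{p. p < length z \<and> drop (Suc p) z @ e' @ [t] \<asymp> drop p z @ e'} = {}" by blast
    then show ?thesis unfolding pos_append[of z e' t] by (simp only: card.empty) simp
  qed
  ultimately show ?thesis using e by blast
qed

text \<open>Relative to the shortest coset element, the dihedral part of \<open>u\<close> makes both
  simple roots negative. An alternating word of length below the order leaves one of them positive,
  so the dihedral part is the longest element and the order is finite.\<close>

lemma two_descents: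
  assumes "reduced u" "x \<in> I" "y \<in> I" "x \<noteq> y" "\<not> pos u x" "\<not> pos u y"
  shows "\<exists>z. u \<asymp> z @ alt_word (m x y) x y \<and> 0 < m x y \<and> length u = length z + m x y \<and>
    (\<forall>k\<le>m x y. reduced (z @ alt_word k x y) \<and> reduced (z @ alt_word k y x))"
proof -
  have ul: "u \<in> lists I" using assms reduced_lists by blast
  obtain z e where z: "reduced z" "e \<in> lists {x, y}" "u \<asymp> z @ e"
    "\<And>e t. e \<in> lists {x, y} \<Longrightarrow> t \<in> {x, y} \<Longrightarrow> pos (z @ e) t = pos e t"
    using coset_minimum[OF ul assms(2,3)] by blast
  have zl: "z \<in> lists I" using z reduced_lists by blast
  obtain k a b where k: "{a, b} = {x, y}" "e \<asymp> alt_word k a b" "m x y = 0 \<or> k \<le> m x y"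
    using dihedral_normal_form[OF assms(2-4) z(2)] by blast
  have ab: "a \<in> I" "b \<in> I" "a \<noteq> b" using k assms by (auto simp: doubleton_eq_iff)
  have mab: "m a b = m x y" using k(1) assms m_sym by (auto simp: doubleton_eq_iff)
  have ua: "u \<asymp> z @ alt_word k a b" using z(3) ceq_append_left[OF k(2) zl] coxeter_eq.trans by blast
  have "k = m x y \<and> 0 < m x y"
  proof (rule ccontr)
    assume "\<not> ?thesis"
    then have "m a b = 0 \<or> k < m a b" using k mab by auto
    then have "pos (alt_word k a b) (if even k then a else b)" using pos_alt_word ab by blast
    moreover have abxy: "a \<in> {x, y}" "b \<in> {x, y}" using k(1) by blast+
    then have "(if even k then a else b) \<in> {x, y}" by presburger
    moreover have "alt_word k a b \<in> lists {x, y}" using abxy by (rule alt_word_in_lists)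
    ultimately have "pos (z @ alt_word k a b) (if even k then a else b)" using z(4) by blast
    then have "pos u (if even k then a else b)" using pos_ceq[OF ua] ab by simp
    then show False using assms(5,6) abxy by (auto split: if_splits)
  qed
  then have km: "k = m x y" "0 < m x y" by auto
  have red: "reduced (z @ alt_word n c d)" if "{c, d} = {x, y}" "n \<le> m x y" for n c d
    using that(2)
  proof (induction n)
    case 0
    then show ?case using z by simp
  next
    case (Suc n)
    have cd: "c \<in> I" "d \<in> I" "c \<noteq> d" using that assms by (auto simp: doubleton_eq_iff)
    have "m c d = m x y" using that(1) assms m_sym by (auto simp: doubleton_eq_iff)
    then have "pos (alt_word n c d) (if even n then c else d)" using pos_alt_word cd Suc by simp
    moreover have "c \<in> {x, y}" "d \<in> {x, y}" using that(1) by blast+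
    ultimately have "pos (z @ alt_word n c d) (if even n then c else d)"
      using z(4)[of "alt_word n c d" "if even n then c else d"] alt_word_in_lists[of c "{x, y}" d n] by simp
    then show ?case using reduced_snocI[of "z @ alt_word n c d" "if even n then c else d"] Suc cd
      unfolding alt_word_snoc by auto
  qed
  have "alt_word k a b \<asymp> alt_word (m x y) x y"
    using k(1) km alt_word_braid[OF assms(2,3)] coxeter_eq.refl[of "alt_word (m x y) x y"] assms
    by (auto simp: doubleton_eq_iff intro: coxeter_eq.sym)
  then have ux: "u \<asymp> z @ alt_word (m x y) x y"
    using ceq_append_left zl ua coxeter_eq.trans by blast
  moreover have "length u = length z + m x y"
    using reduced_ceq_length[OF assms(1) red ux] by simp
  moreover have "reduced (z @ alt_word n x y) \<and> reduced (z @ alt_word n y x)" if "n \<le> m x y" for n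
    using red that by (simp add: insert_commute)
  ultimately show ?thesis using km by blast
qed

text \<open>Matsumoto's theorem.\<close>

theorem matsumoto_wprod:
  assumes "monoid G" and g: "g \<in> I \<rightarrow> carrier G"
    and braid: "\<And>x y. x \<in> I \<Longrightarrow> y \<in> I \<Longrightarrow> x \<noteq> y \<Longrightarrow>
      wprod G g (alt_word (m x y) x y) = wprod G g (alt_word (m x y) y x)"
    and "reduced u" "reduced v" "u \<asymp> v"
  shows "wprod G g u = wprod G g v"
  using assms(4-6)
proof (induction "length u" arbitrary: u v rule: less_induct)
  case less
  interpret monoid G by fact
  have len: "length u = length v" using less reduced_ceq_length by blast
  show ?case
  proof (cases u rule: rev_cases)
    case Nil
    then show ?thesis using len by simp
  next
    case u: (snoc a x)
    then obtain b y where v: "v = b @ [y]" using len by (cases v rule: rev_cases) auto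
    have l: "a \<in> lists I" "b \<in> lists I" "x \<in> I" "y \<in> I"
      using less.prems(1,2)[THEN reduced_lists] u v by auto
    have ra: "reduced a" "reduced b" using less.prems u v reduced_append by blast+
    show ?thesis
    proof (cases "x = y")
      case True
      then have "a \<asymp> b" using less.prems(3) u v l ceq_cancel_right[of "[x]"] by auto
      then have "wprod G g a = wprod G g b" using less.hyps[of a b] ra u by simp
      then show ?thesis unfolding u v using True l g by (simp add: wprod_append[OF g])
    next
      case False
      have "\<not> pos u x" using reduced_snoc_pos[of a x] less.prems u pos_snoc_same l by simp
      moreover have "\<not> pos v y" using reduced_snoc_pos[of b y] less.prems v pos_snoc_same l by simp
      then have "\<not> pos u y" using pos_ceq[OF less.prems(3)] l by simp
      \<comment> \<open>Both last letters are descents of \<open>u\<close>, so \<open>u\<close> can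
        be respelled to end in the longest dihedral word, with last letter \<open>x\<close> or
        \<open>y\<close> at will.\<close>
      ultimately obtain z where z: "u \<asymp> z @ alt_word (m x y) x y" "0 < m x y" "length u = length z + m x y"
        "\<And>k. k \<le> m x y \<Longrightarrow> reduced (z @ alt_word k x y) \<and> reduced (z @ alt_word k y x)"
        using two_descents[OF less.prems(1) l(3,4) False] by blast
      have zl: "z \<in> lists I" using z(4)[of 0] reduced_lists by simp
      obtain n where n: "m x y = Suc n" using z(2) by (cases "m x y") auto
      have ux: "u \<asymp> z @ alt_word (m x y) y x"
        using z(1) ceq_append_left[OF alt_word_braid[OF l(3,4)] zl] coxeter_eq.trans by blast
      \<comment> \<open>Words with the same last letter are compared by induction after dropping it.
        The two respellings of \<open>u\<close> are then linked by the braid hypothesis.\<close>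
      have key: "wprod G g (w @ [t]) = wprod G g (z @ alt_word (Suc n) c d)"
        if "w @ [t] \<asymp> u" "reduced (w @ [t])" "{c, d} = {x, y}" "t = (if even n then c else d)" for w t c d
      proof -
        have cd: "c \<in> I" "d \<in> I" "t \<in> I" using that l by (auto simp: doubleton_eq_iff)
        have uc: "u \<asymp> z @ alt_word (Suc n) c d"
          using that(3) z(1) ux n by (auto simp: doubleton_eq_iff)
        have e: "alt_word (Suc n) c d = alt_word n c d @ [t]"
          using that(4) by (simp only: alt_word_snoc)
        have wl: "w \<in> lists I" using reduced_lists that by fastforce
        have "w @ [t] \<asymp> (z @ alt_word n c d) @ [t]"
          using that(1) uc unfolding e by (auto intro: coxeter_eq.trans)
        then have "w \<asymp> z @ alt_word n c d" using ceq_cancel_right[of "[t]"] cd by (metis Cons_in_lists_iff lists.Nil)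
        moreover have "reduced (z @ alt_word n c d)"
          using z(4)[of n] that(3) n by (auto simp: doubleton_eq_iff)
        moreover have "length w < length u"
          using reduced_ceq_length[OF that(2) less.prems(1) that(1)] by simp
        ultimately have "wprod G g w = wprod G g (z @ alt_word n c d)"
          using less.hyps reduced_append that(2) by blast
        then show ?thesis unfolding e using g wl zl cd by (simp add: wprod_append[OF g] m_assoc)
      qed
      have "wprod G g u = wprod G g (z @ alt_word (Suc n) (if even n then x else y) (if even n then y else x))"
        using key[of a x "if even n then x else y" "if even n then y else x"] u less.prems l
        by (auto simp: coxeter_eq.refl insert_commute)
      moreover have "wprod G g v = wprod G g (z @ alt_word (Suc n) (if even n then y else x) (if even n then x else y))"
        using key[of b y "if even n then y else x" "if even n then x else y"] v less.prems l
        by (auto simp: ceq_sym_iff insert_commute)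
      moreover have "wprod G g (alt_word (Suc n) x y) = wprod G g (alt_word (Suc n) y x)"
        using braid[OF l(3,4) False] n by simp
      then have "wprod G g (z @ alt_word (Suc n) x y) = wprod G g (z @ alt_word (Suc n) y x)"
        using g zl l by (subst (1 2) wprod_append[OF g]) (auto simp del: alt_word.simps)
      ultimately show ?thesis by (auto simp del: alt_word.simps)
    qed
  qed
qed

end

section \<open>Finitely supported functions\<close>

definition fsupp :: "('g, 'z) ring_scheme \<Rightarrow> 'x set \<Rightarrow> ('x \<Rightarrow> 'g) set"
  where "fsupp G X = {f. (\<forall>x. f x \<in> carrier G) \<and> (\<forall>x. x \<notin> X \<longrightarrow> f x = \<zero>\<^bsub>G\<^esub>) \<and> finite {x. f x \<noteq> \<zero>\<^bsub>G\<^esub>}}"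

definition delta :: "('g, 'z) ring_scheme \<Rightarrow> 'x \<Rightarrow> 'g \<Rightarrow> 'x \<Rightarrow> 'g"
  where "delta G x g = (\<lambda>z. if z = x then g else \<zero>\<^bsub>G\<^esub>)"

text \<open>Coefficients and values may lie in different groups, since each \<open>act x\<close> is
  just an additive map. The same construction gives maps out of monoid algebras, the evaluation of
  formal Hecke elements and the combinations of basis elements.\<close>

definition lin :: "('s, 'y) ring_scheme \<Rightarrow> ('g, 'z) ring_scheme \<Rightarrow> ('x \<Rightarrow> 'g \<Rightarrow> 's) \<Rightarrow> ('x \<Rightarrow> 'g) \<Rightarrow> 's"
  where "lin S G act f = finsum S (\<lambda>x. act x (f x)) {x. f x \<noteq> \<zero>\<^bsub>G\<^esub>}"

context abelian_group
begin

lemma fsupp_zero [simp]: "(\<lambda>_. \<zero>) \<in> fsupp G X"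
  by (simp add: fsupp_def)

lemma fsupp_add: "f \<in> fsupp G X \<Longrightarrow> g \<in> fsupp G X \<Longrightarrow> (\<lambda>z. f z \<oplus> g z) \<in> fsupp G X"
proof -
  assume a: "f \<in> fsupp G X" "g \<in> fsupp G X"
  have "{z. f z \<oplus> g z \<noteq> \<zero>} \<subseteq> {z. f z \<noteq> \<zero>} \<union> {z. g z \<noteq> \<zero>}"
    by auto
  then show ?thesis using a unfolding fsupp_def by (auto intro: finite_subset)
qed

lemma fsupp_delta: "x \<in> X \<Longrightarrow> g \<in> carrier G \<Longrightarrow> delta G x g \<in> fsupp G X"
proof -
  assume "x \<in> X" "g \<in> carrier G"
  moreover have "{z. delta G x g z \<noteq> \<zero>} \<subseteq> {x}" by (auto simp: delta_def)
  then have "finite {z. delta G x g z \<noteq> \<zero>}" using finite_subset by blast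
  ultimately show ?thesis unfolding fsupp_def by (auto simp: delta_def)
qed

lemma fsupp_induct [consumes 1, case_names zero delta add]:
  assumes "f \<in> fsupp G X"
    and zero: "P (\<lambda>_. \<zero>)"
    and delta: "\<And>x g. x \<in> X \<Longrightarrow> g \<in> carrier G \<Longrightarrow> P (delta G x g)"
    and add: "\<And>f g. f \<in> fsupp G X \<Longrightarrow> g \<in> fsupp G X \<Longrightarrow> P f \<Longrightarrow> P g \<Longrightarrow> P (\<lambda>z. f z \<oplus> g z)"
  shows "P f"
proof -
  have "finite {x. f x \<noteq> \<zero>}" using assms(1) by (simp add: fsupp_def)
  then show ?thesis using assms(1)
  proof (induction "{x. f x \<noteq> \<zero>}" arbitrary: f rule: finite_induct)
    case empty
    then have "f = (\<lambda>_. \<zero>)" by auto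
    then show ?case using zero by simp
  next
    case (insert x A)
    define g where "g = f(x := \<zero>)"
    have f: "\<And>z. f z \<in> carrier G" using insert.prems by (simp add: fsupp_def)
    have x: "x \<in> X" using insert.hyps(4) insert.prems by (force simp: fsupp_def)
    have A: "A = {z. g z \<noteq> \<zero>}" using insert.hyps by (auto simp: g_def)
    have g: "g \<in> fsupp G X" using insert.prems insert.hyps(1) unfolding A fsupp_def by (auto simp: g_def)
    have "f = (\<lambda>z. delta G x (f x) z \<oplus> g z)" using f by (auto simp: delta_def g_def)
    moreover have "P g" using insert.hyps(3) A g by blast
    ultimately show ?case using add[OF fsupp_delta[OF x f[of x]] g delta[OF x f[of x]]] by simp
  qed
qed

end

locale linear_extension = G: abelian_group G + S: abelian_group S
  for G :: "('g, 'z) ring_scheme" and S :: "('s, 'y) ring_scheme" +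
  fixes X :: "'x set" and act :: "'x \<Rightarrow> 'g \<Rightarrow> 's"
  assumes act_closed [simp]: "\<And>x g. x \<in> X \<Longrightarrow> g \<in> carrier G \<Longrightarrow> act x g \<in> carrier S"
    and act_add: "\<And>x g h. x \<in> X \<Longrightarrow> g \<in> carrier G \<Longrightarrow> h \<in> carrier G \<Longrightarrow>
      act x (g \<oplus>\<^bsub>G\<^esub> h) = act x g \<oplus>\<^bsub>S\<^esub> act x h"
begin

lemma act_zero [simp]: "x \<in> X \<Longrightarrow> act x \<zero>\<^bsub>G\<^esub> = \<zero>\<^bsub>S\<^esub>"
  using act_add[of x "\<zero>\<^bsub>G\<^esub>" "\<zero>\<^bsub>G\<^esub>"] by (simp add: S.add.r_cancel_one')

lemma fsupp_supp: "f \<in> fsupp G X \<Longrightarrow> finite {x. f x \<noteq> \<zero>\<^bsub>G\<^esub>} \<and> {x. f x \<noteq> \<zero>\<^bsub>G\<^esub>} \<subseteq> X"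
  by (auto simp: fsupp_def)

lemma fsupp_closed: "f \<in> fsupp G X \<Longrightarrow> f x \<in> carrier G"
  by (auto simp: fsupp_def)

lemma lin_superset:
  assumes "f \<in> fsupp G X" "finite B" "{x. f x \<noteq> \<zero>\<^bsub>G\<^esub>} \<subseteq> B" "B \<subseteq> X"
  shows "lin S G act f = finsum S (\<lambda>x. act x (f x)) B"
  unfolding lin_def
  using assms fsupp_closed by (intro S.add.finprod_mono_neutral_cong_left) auto

lemma lin_closed [simp]: "f \<in> fsupp G X \<Longrightarrow> lin S G act f \<in> carrier S"
  unfolding lin_def using fsupp_supp[of f] fsupp_closed[of f] by (intro S.finsum_closed) (auto simp: subset_iff)

lemma lin_zero [simp]: "lin S G act (\<lambda>_. \<zero>\<^bsub>G\<^esub>) = \<zero>\<^bsub>S\<^esub>"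
  by (simp add: lin_def)

lemma lin_delta [simp]: "x \<in> X \<Longrightarrow> g \<in> carrier G \<Longrightarrow> lin S G act (delta G x g) = act x g"
proof -
  assume a: "x \<in> X" "g \<in> carrier G"
  have "lin S G act (delta G x g) = finsum S (\<lambda>z. act z (delta G x g z)) {x}"
    using a G.fsupp_delta[OF a] by (intro lin_superset) (auto simp: delta_def)
  also have "\<dots> = act x (delta G x g x)"
    using a by (subst S.finsum_insert) (auto simp: delta_def)
  finally show ?thesis by (simp add: delta_def)
qed

lemma lin_add:
  assumes "f \<in> fsupp G X" "g \<in> fsupp G X"
  shows "lin S G act (\<lambda>z. f z \<oplus>\<^bsub>G\<^esub> g z) = lin S G act f \<oplus>\<^bsub>S\<^esub> lin S G act g"
proof -
  define B where "B = {x. f x \<noteq> \<zero>\<^bsub>G\<^esub>} \<union> {x. g x \<noteq> \<zero>\<^bsub>G\<^esub>}"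
  have B: "finite B" "B \<subseteq> X" using fsupp_supp assms unfolding B_def by blast+
  have 1: "lin S G act f = finsum S (\<lambda>x. act x (f x)) B"
    using assms B by (intro lin_superset) (auto simp: B_def)
  have 2: "lin S G act g = finsum S (\<lambda>x. act x (g x)) B"
    using assms B by (intro lin_superset) (auto simp: B_def)
  have 3: "lin S G act (\<lambda>z. f z \<oplus>\<^bsub>G\<^esub> g z) = finsum S (\<lambda>x. act x (f x \<oplus>\<^bsub>G\<^esub> g x)) B"
    using assms B G.fsupp_add by (intro lin_superset) (auto simp: B_def)
  also have "\<dots> = finsum S (\<lambda>x. act x (f x) \<oplus>\<^bsub>S\<^esub> act x (g x)) B"
    using assms B fsupp_closed by (intro S.finsum_cong') (auto simp: act_add subset_iff)
  also have "\<dots> = lin S G act f \<oplus>\<^bsub>S\<^esub> lin S G act g"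
    unfolding 1 2 using assms B fsupp_closed by (intro S.finsum_addf) (auto simp: subset_iff)
  finally show ?thesis .
qed

end

section \<open>Noncommutative algebras\<close>

locale nc_alg = A: ring A + module R A
  for R :: "('r, 'c) ring_scheme" (structure) and A :: "('r, 'a, 'd) module_scheme" (structure) +
  assumes smult_mult_left: "\<And>r x y. r \<in> carrier R \<Longrightarrow> x \<in> carrier A \<Longrightarrow> y \<in> carrier A \<Longrightarrow>
      (r \<odot>\<^bsub>A\<^esub> x) \<otimes>\<^bsub>A\<^esub> y = r \<odot>\<^bsub>A\<^esub> (x \<otimes>\<^bsub>A\<^esub> y)"
    and smult_mult_right: "\<And>r x y. r \<in> carrier R \<Longrightarrow> x \<in> carrier A \<Longrightarrow> y \<in> carrier A \<Longrightarrow>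
      x \<otimes>\<^bsub>A\<^esub> (r \<odot>\<^bsub>A\<^esub> y) = r \<odot>\<^bsub>A\<^esub> (x \<otimes>\<^bsub>A\<^esub> y)"

lemma nc_algI:
  assumes "cring R" "ring A"
    and "\<And>r x. r \<in> carrier R \<Longrightarrow> x \<in> carrier A \<Longrightarrow> r \<odot>\<^bsub>A\<^esub> x \<in> carrier A"
    and "\<And>r s x. r \<in> carrier R \<Longrightarrow> s \<in> carrier R \<Longrightarrow> x \<in> carrier A \<Longrightarrow>
      (r \<oplus>\<^bsub>R\<^esub> s) \<odot>\<^bsub>A\<^esub> x = r \<odot>\<^bsub>A\<^esub> x \<oplus>\<^bsub>A\<^esub> s \<odot>\<^bsub>A\<^esub> x"
    and "\<And>r x y. r \<in> carrier R \<Longrightarrow> x \<in> carrier A \<Longrightarrow> y \<in> carrier A \<Longrightarrow>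
      r \<odot>\<^bsub>A\<^esub> (x \<oplus>\<^bsub>A\<^esub> y) = r \<odot>\<^bsub>A\<^esub> x \<oplus>\<^bsub>A\<^esub> r \<odot>\<^bsub>A\<^esub> y"
    and "\<And>r s x. r \<in> carrier R \<Longrightarrow> s \<in> carrier R \<Longrightarrow> x \<in> carrier A \<Longrightarrow>
      (r \<otimes>\<^bsub>R\<^esub> s) \<odot>\<^bsub>A\<^esub> x = r \<odot>\<^bsub>A\<^esub> (s \<odot>\<^bsub>A\<^esub> x)"
    and "\<And>x. x \<in> carrier A \<Longrightarrow> \<one>\<^bsub>R\<^esub> \<odot>\<^bsub>A\<^esub> x = x"
    and "\<And>r x y. r \<in> carrier R \<Longrightarrow> x \<in> carrier A \<Longrightarrow> y \<in> carrier A \<Longrightarrow>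
      (r \<odot>\<^bsub>A\<^esub> x) \<otimes>\<^bsub>A\<^esub> y = r \<odot>\<^bsub>A\<^esub> (x \<otimes>\<^bsub>A\<^esub> y)"
    and "\<And>r x y. r \<in> carrier R \<Longrightarrow> x \<in> carrier A \<Longrightarrow> y \<in> carrier A \<Longrightarrow>
      x \<otimes>\<^bsub>A\<^esub> (r \<odot>\<^bsub>A\<^esub> y) = r \<odot>\<^bsub>A\<^esub> (x \<otimes>\<^bsub>A\<^esub> y)"
  shows "nc_alg R A"
proof -
  have "module R A" using assms ring.is_abelian_group by (intro moduleI) auto
  then show ?thesis using assms by (auto intro!: nc_alg.intro nc_alg_axioms.intro)
qed

context nc_alg
begin

lemma R_cring': "cring R" and A_ring: "ring A" and module_RA: "module R A"
  by (rule cring_axioms A.ring_axioms module_axioms)+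

end

lemma alg_homI:
  assumes "\<And>x. x \<in> carrier A \<Longrightarrow> h x \<in> carrier B"
    and "\<And>x y. x \<in> carrier A \<Longrightarrow> y \<in> carrier A \<Longrightarrow> h (x \<otimes>\<^bsub>A\<^esub> y) = h x \<otimes>\<^bsub>B\<^esub> h y"
    and "\<And>x y. x \<in> carrier A \<Longrightarrow> y \<in> carrier A \<Longrightarrow> h (x \<oplus>\<^bsub>A\<^esub> y) = h x \<oplus>\<^bsub>B\<^esub> h y"
    and "h \<one>\<^bsub>A\<^esub> = \<one>\<^bsub>B\<^esub>"
    and "\<And>r x. r \<in> carrier R \<Longrightarrow> x \<in> carrier A \<Longrightarrow> h (r \<odot>\<^bsub>A\<^esub> x) = r \<odot>\<^bsub>B\<^esub> h x"
  shows "h \<in> alg_hom R A B"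
  using assms by (auto simp: alg_hom_def intro: ring_hom_memI)

lemma alg_homD:
  assumes "h \<in> alg_hom R A B"
  shows "h \<in> ring_hom A B"
    and "\<And>x. x \<in> carrier A \<Longrightarrow> h x \<in> carrier B"
    and "\<And>x y. x \<in> carrier A \<Longrightarrow> y \<in> carrier A \<Longrightarrow> h (x \<otimes>\<^bsub>A\<^esub> y) = h x \<otimes>\<^bsub>B\<^esub> h y"
    and "\<And>x y. x \<in> carrier A \<Longrightarrow> y \<in> carrier A \<Longrightarrow> h (x \<oplus>\<^bsub>A\<^esub> y) = h x \<oplus>\<^bsub>B\<^esub> h y"
    and "h \<one>\<^bsub>A\<^esub> = \<one>\<^bsub>B\<^esub>"
    and "\<And>r x. r \<in> carrier R \<Longrightarrow> x \<in> carrier A \<Longrightarrow> h (r \<odot>\<^bsub>A\<^esub> x) = r \<odot>\<^bsub>B\<^esub> h x"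
  using assms by (auto simp: alg_hom_def ring_hom_def)

lemma ring_hom_diff:
  assumes "h \<in> ring_hom A B" "ring A" "ring B" "x \<in> carrier A" "y \<in> carrier A"
  shows "h (x \<ominus>\<^bsub>A\<^esub> y) = h x \<ominus>\<^bsub>B\<^esub> h y"
proof -
  interpret ring_hom_ring A B h using assms by (intro ring_hom_ringI2)
  show ?thesis using assms by (simp add: R.minus_eq S.minus_eq)
qed

lemma ring_hom_wprod:
  assumes "h \<in> ring_hom A B" "monoid A" "g \<in> X \<rightarrow> carrier A" "u \<in> lists X"
  shows "h (wprod A g u) = wprod B (h \<circ> g) u"
  using assms(4)
proof (induction u)
  case (Cons i u)
  then show ?case
    using assms monoid.wprod_closed[OF assms(2,3), of u] by (auto simp: wprod_Cons ring_hom_mult Pi_iff)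
qed (use assms in \<open>simp add: ring_hom_one\<close>)

lemma wprod_cong: "(\<And>i. i \<in> set u \<Longrightarrow> g i = g' i) \<Longrightarrow> wprod G g u = wprod G g' u"
  by (induction u) (auto simp: wprod_Cons)

lemma wprod_map: "wprod G g (map f u) = wprod G (g \<circ> f) u"
  by (induction u) (auto simp: wprod_Cons)

subsection \<open>Monoid algebras\<close>

locale mon_alg = R: cring R + M: monoid M
  for R :: "('r, 'c) ring_scheme" and M :: "('m, 'd) monoid_scheme"
begin

abbreviation "F \<equiv> monoid_algebra R M"

lemma carrier_F: "carrier F = fsupp R (carrier M)"
  by (simp add: monoid_algebra_def fsupp_def)

lemma add_F: "f \<oplus>\<^bsub>F\<^esub> g = (\<lambda>z. f z \<oplus>\<^bsub>R\<^esub> g z)"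
  and zero_F: "\<zero>\<^bsub>F\<^esub> = (\<lambda>_. \<zero>\<^bsub>R\<^esub>)"
  and smult_F: "r \<odot>\<^bsub>F\<^esub> f = (\<lambda>z. r \<otimes>\<^bsub>R\<^esub> f z)"
  and one_F: "\<one>\<^bsub>F\<^esub> = delta R \<one>\<^bsub>M\<^esub> \<one>\<^bsub>R\<^esub>"
  by (auto simp: monoid_algebra_def delta_def)

lemma single_delta: "single R x = delta R x \<one>\<^bsub>R\<^esub>"
  by (auto simp: single_def delta_def)

lemma fsuppD: "f \<in> fsupp R (carrier M) \<Longrightarrow> f x \<in> carrier R"
    "f \<in> fsupp R (carrier M) \<Longrightarrow> finite {x. f x \<noteq> \<zero>\<^bsub>R\<^esub>}"
  by (auto simp: fsupp_def)

text \<open>Supports can shrink under addition. Summing over any finite rectangle that contains them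
  makes the products of sums and summands comparable.\<close>

lemma mult_F:
  assumes "f \<in> fsupp R (carrier M)" "g \<in> fsupp R (carrier M)" "finite A" "finite B"
    "{x. f x \<noteq> \<zero>\<^bsub>R\<^esub>} \<subseteq> A" "{x. g x \<noteq> \<zero>\<^bsub>R\<^esub>} \<subseteq> B"
  shows "(f \<otimes>\<^bsub>F\<^esub> g) z =
    finsum R (\<lambda>(x, y). if x \<otimes>\<^bsub>M\<^esub> y = z then f x \<otimes>\<^bsub>R\<^esub> g y else \<zero>\<^bsub>R\<^esub>) (A \<times> B)"
proof -
  have "(f \<otimes>\<^bsub>F\<^esub> g) z = finsum R (\<lambda>(x, y). f x \<otimes>\<^bsub>R\<^esub> g y)
                {(x, y). f x \<noteq> \<zero>\<^bsub>R\<^esub> \<and> g y \<noteq> \<zero>\<^bsub>R\<^esub> \<and> x \<otimes>\<^bsub>M\<^esub> y = z}"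
    by (simp add: monoid_algebra_def)
  also have "\<dots> = finsum R (\<lambda>(x, y). if x \<otimes>\<^bsub>M\<^esub> y = z then f x \<otimes>\<^bsub>R\<^esub> g y else \<zero>\<^bsub>R\<^esub>) (A \<times> B)"
    using assms fsuppD(1)[OF assms(1)] fsuppD(1)[OF assms(2)]
    by (intro R.add.finprod_mono_neutral_cong_left) (auto split: if_splits)
  finally show ?thesis .
qed

lemma mult_F_add_left:
  assumes "f \<in> fsupp R (carrier M)" "g \<in> fsupp R (carrier M)" "h \<in> fsupp R (carrier M)"
  shows "(\<lambda>z. f z \<oplus>\<^bsub>R\<^esub> g z) \<otimes>\<^bsub>F\<^esub> h = (\<lambda>z. (f \<otimes>\<^bsub>F\<^esub> h) z \<oplus>\<^bsub>R\<^esub> (g \<otimes>\<^bsub>F\<^esub> h) z)"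
proof
  fix z
  let ?A = "{x. f x \<noteq> \<zero>\<^bsub>R\<^esub>} \<union> {x. g x \<noteq> \<zero>\<^bsub>R\<^esub>}" and ?B = "{x. h x \<noteq> \<zero>\<^bsub>R\<^esub>}"
  have fin: "finite ?A" "finite ?B" using assms fsuppD by auto
  have c: "f x \<in> carrier R" "g x \<in> carrier R" "h x \<in> carrier R" for x using assms by (auto intro: fsuppD)
  have s: "(\<lambda>z. f z \<oplus>\<^bsub>R\<^esub> g z) \<in> fsupp R (carrier M)" using R.fsupp_add assms by blast
  have "((\<lambda>z. f z \<oplus>\<^bsub>R\<^esub> g z) \<otimes>\<^bsub>F\<^esub> h) z = finsum R
      (\<lambda>(x, y). if x \<otimes>\<^bsub>M\<^esub> y = z then (f x \<oplus>\<^bsub>R\<^esub> g x) \<otimes>\<^bsub>R\<^esub> h y else \<zero>\<^bsub>R\<^esub>) (?A \<times> ?B)"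
    using s assms fin by (intro mult_F) auto
  also have "\<dots> = finsum R (\<lambda>p. (case p of (x, y) \<Rightarrow> if x \<otimes>\<^bsub>M\<^esub> y = z then f x \<otimes>\<^bsub>R\<^esub> h y else \<zero>\<^bsub>R\<^esub>) \<oplus>\<^bsub>R\<^esub>
        (case p of (x, y) \<Rightarrow> if x \<otimes>\<^bsub>M\<^esub> y = z then g x \<otimes>\<^bsub>R\<^esub> h y else \<zero>\<^bsub>R\<^esub>)) (?A \<times> ?B)"
    using c by (intro R.finsum_cong') (auto simp: R.l_distr)
  also have "\<dots> = (f \<otimes>\<^bsub>F\<^esub> h) z \<oplus>\<^bsub>R\<^esub> (g \<otimes>\<^bsub>F\<^esub> h) z"
    using c assms fin by (subst R.finsum_addf) (auto simp: mult_F[of _ _ ?A ?B])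
  finally show "((\<lambda>z. f z \<oplus>\<^bsub>R\<^esub> g z) \<otimes>\<^bsub>F\<^esub> h) z = (f \<otimes>\<^bsub>F\<^esub> h) z \<oplus>\<^bsub>R\<^esub> (g \<otimes>\<^bsub>F\<^esub> h) z" .
qed

lemma mult_F_add_right:
  assumes "f \<in> fsupp R (carrier M)" "g \<in> fsupp R (carrier M)" "h \<in> fsupp R (carrier M)"
  shows "h \<otimes>\<^bsub>F\<^esub> (\<lambda>z. f z \<oplus>\<^bsub>R\<^esub> g z) = (\<lambda>z. (h \<otimes>\<^bsub>F\<^esub> f) z \<oplus>\<^bsub>R\<^esub> (h \<otimes>\<^bsub>F\<^esub> g) z)"
proof
  fix z
  let ?A = "{x. f x \<noteq> \<zero>\<^bsub>R\<^esub>} \<union> {x. g x \<noteq> \<zero>\<^bsub>R\<^esub>}" and ?B = "{x. h x \<noteq> \<zero>\<^bsub>R\<^esub>}"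
  have fin: "finite ?A" "finite ?B" using assms fsuppD by auto
  have c: "f x \<in> carrier R" "g x \<in> carrier R" "h x \<in> carrier R" for x using assms by (auto intro: fsuppD)
  have s: "(\<lambda>z. f z \<oplus>\<^bsub>R\<^esub> g z) \<in> fsupp R (carrier M)" using R.fsupp_add assms by blast
  have "(h \<otimes>\<^bsub>F\<^esub> (\<lambda>z. f z \<oplus>\<^bsub>R\<^esub> g z)) z = finsum R
      (\<lambda>(x, y). if x \<otimes>\<^bsub>M\<^esub> y = z then h x \<otimes>\<^bsub>R\<^esub> (f y \<oplus>\<^bsub>R\<^esub> g y) else \<zero>\<^bsub>R\<^esub>) (?B \<times> ?A)"
    using s assms fin by (intro mult_F) auto
  also have "\<dots> = finsum R (\<lambda>p. (case p of (x, y) \<Rightarrow> if x \<otimes>\<^bsub>M\<^esub> y = z then h x \<otimes>\<^bsub>R\<^esub> f y else \<zero>\<^bsub>R\<^esub>) \<oplus>\<^bsub>R\<^esub>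
        (case p of (x, y) \<Rightarrow> if x \<otimes>\<^bsub>M\<^esub> y = z then h x \<otimes>\<^bsub>R\<^esub> g y else \<zero>\<^bsub>R\<^esub>)) (?B \<times> ?A)"
    using c by (intro R.finsum_cong') (auto simp: R.r_distr)
  also have "\<dots> = (h \<otimes>\<^bsub>F\<^esub> f) z \<oplus>\<^bsub>R\<^esub> (h \<otimes>\<^bsub>F\<^esub> g) z"
    using c assms fin by (subst R.finsum_addf) (auto simp: mult_F[of _ _ ?B ?A])
  finally show "(h \<otimes>\<^bsub>F\<^esub> (\<lambda>z. f z \<oplus>\<^bsub>R\<^esub> g z)) z = (h \<otimes>\<^bsub>F\<^esub> f) z \<oplus>\<^bsub>R\<^esub> (h \<otimes>\<^bsub>F\<^esub> g) z" .
qed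

lemma mult_F_delta:
  assumes "x \<in> carrier M" "y \<in> carrier M" "r \<in> carrier R" "s \<in> carrier R"
  shows "delta R x r \<otimes>\<^bsub>F\<^esub> delta R y s = delta R (x \<otimes>\<^bsub>M\<^esub> y) (r \<otimes>\<^bsub>R\<^esub> s)"
proof
  fix z
  have "(delta R x r \<otimes>\<^bsub>F\<^esub> delta R y s) z = finsum R (\<lambda>(x', y'). if x' \<otimes>\<^bsub>M\<^esub> y' = z
      then delta R x r x' \<otimes>\<^bsub>R\<^esub> delta R y s y' else \<zero>\<^bsub>R\<^esub>) ({x} \<times> {y})"
    using assms R.fsupp_delta by (intro mult_F) (auto simp: delta_def)
  also have "\<dots> = delta R (x \<otimes>\<^bsub>M\<^esub> y) (r \<otimes>\<^bsub>R\<^esub> s) z"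
    using assms by (auto simp: delta_def)
  finally show "(delta R x r \<otimes>\<^bsub>F\<^esub> delta R y s) z = delta R (x \<otimes>\<^bsub>M\<^esub> y) (r \<otimes>\<^bsub>R\<^esub> s) z" .
qed

lemma mult_F_zero:
  assumes "f \<in> fsupp R (carrier M)"
  shows "(\<lambda>_. \<zero>\<^bsub>R\<^esub>) \<otimes>\<^bsub>F\<^esub> f = (\<lambda>_. \<zero>\<^bsub>R\<^esub>)" "f \<otimes>\<^bsub>F\<^esub> (\<lambda>_. \<zero>\<^bsub>R\<^esub>) = (\<lambda>_. \<zero>\<^bsub>R\<^esub>)"
  by (auto simp: monoid_algebra_def)

lemma mult_F_closed:
  assumes "f \<in> fsupp R (carrier M)" "g \<in> fsupp R (carrier M)"
  shows "f \<otimes>\<^bsub>F\<^esub> g \<in> fsupp R (carrier M)"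
  using assms(1)
proof (induction rule: R.fsupp_induct)
  case (delta x r)
  show ?case using assms(2)
  proof (induction rule: R.fsupp_induct)
    case (delta y s)
    then show ?case using \<open>x \<in> carrier M\<close> \<open>r \<in> carrier R\<close> by (simp add: mult_F_delta R.fsupp_delta)
  next
    case (add f g)
    then show ?case using \<open>x \<in> carrier M\<close> \<open>r \<in> carrier R\<close>
      by (simp add: mult_F_add_right R.fsupp_delta R.fsupp_add)
  qed (use delta in \<open>simp add: mult_F_zero R.fsupp_delta\<close>)
qed (use assms in \<open>simp_all add: mult_F_zero mult_F_add_left R.fsupp_add\<close>)

lemma mult_F_assoc:
  assumes "f \<in> fsupp R (carrier M)" "g \<in> fsupp R (carrier M)" "h \<in> fsupp R (carrier M)"
  shows "(f \<otimes>\<^bsub>F\<^esub> g) \<otimes>\<^bsub>F\<^esub> h = f \<otimes>\<^bsub>F\<^esub> (g \<otimes>\<^bsub>F\<^esub> h)"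
  using assms(1)
proof (induction rule: R.fsupp_induct)
  case (delta x r)
  note x = delta and xd = R.fsupp_delta[OF delta]
  show ?case using assms(2)
  proof (induction rule: R.fsupp_induct)
    case (delta y s)
    note y = delta and yd = R.fsupp_delta[OF delta]
    show ?case using assms(3)
    proof (induction rule: R.fsupp_induct)
      case (delta z t)
      then show ?case using x y by (simp add: mult_F_delta M.m_assoc R.m_assoc)
    next
      case (add f g)
      then show ?case using xd yd by (simp add: mult_F_add_right mult_F_closed)
    qed (use xd yd in \<open>simp add: mult_F_zero mult_F_closed\<close>)
  next
    case (add f g)
    then show ?case using assms xd by (simp add: mult_F_add_right mult_F_add_left mult_F_closed)
  qed (use assms xd in \<open>simp add: mult_F_zero mult_F_closed\<close>)
qed (use assms in \<open>simp_all add: mult_F_zero mult_F_add_left mult_F_closed\<close>)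

lemma mult_F_one:
  assumes "f \<in> fsupp R (carrier M)"
  shows "\<one>\<^bsub>F\<^esub> \<otimes>\<^bsub>F\<^esub> f = f" "f \<otimes>\<^bsub>F\<^esub> \<one>\<^bsub>F\<^esub> = f"
proof -
  note o = R.fsupp_delta[of "\<one>\<^bsub>M\<^esub>" "carrier M" "\<one>\<^bsub>R\<^esub>"]
  show "\<one>\<^bsub>F\<^esub> \<otimes>\<^bsub>F\<^esub> f = f" using assms
    by (induction rule: R.fsupp_induct) (use o in \<open>simp_all add: one_F mult_F_delta mult_F_zero mult_F_add_right\<close>)
  show "f \<otimes>\<^bsub>F\<^esub> \<one>\<^bsub>F\<^esub> = f" using assms
    by (induction rule: R.fsupp_induct) (use o in \<open>simp_all add: one_F mult_F_delta mult_F_zero mult_F_add_left\<close>)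
qed

lemma ring_F: "ring F"
proof (rule ringI)
  show "abelian_group F"
  proof (rule abelian_groupI)
    fix f assume f: "f \<in> carrier F"
    have "(\<lambda>z. \<ominus>\<^bsub>R\<^esub> f z) \<in> fsupp R (carrier M)"
    proof -
      have "{z. \<ominus>\<^bsub>R\<^esub> f z \<noteq> \<zero>\<^bsub>R\<^esub>} \<subseteq> {z. f z \<noteq> \<zero>\<^bsub>R\<^esub>}" by auto
      then show ?thesis using f unfolding carrier_F fsupp_def by (auto intro: finite_subset)
    qed
    then show "\<exists>g\<in>carrier F. g \<oplus>\<^bsub>F\<^esub> f = \<zero>\<^bsub>F\<^esub>"
      using f fsuppD(1)[of f] unfolding carrier_F add_F zero_F
      by (intro bexI[of _ "\<lambda>z. \<ominus>\<^bsub>R\<^esub> f z"]) (auto simp: R.l_neg)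
  qed (auto simp: carrier_F add_F zero_F R.fsupp_add fsuppD R.a_ac)
  show "monoid F"
    by (rule monoidI) (auto simp: carrier_F mult_F_closed mult_F_assoc mult_F_one, simp add: one_F R.fsupp_delta)
qed (auto simp: carrier_F add_F mult_F_add_left mult_F_add_right)

lemma smult_closed_F: "r \<in> carrier R \<Longrightarrow> f \<in> fsupp R X \<Longrightarrow> (\<lambda>z. r \<otimes>\<^bsub>R\<^esub> f z) \<in> fsupp R X"
proof -
  assume a: "r \<in> carrier R" "f \<in> fsupp R X"
  have "{z. r \<otimes>\<^bsub>R\<^esub> f z \<noteq> \<zero>\<^bsub>R\<^esub>} \<subseteq> {z. f z \<noteq> \<zero>\<^bsub>R\<^esub>}" using a by auto
  then show ?thesis using a unfolding fsupp_def by (auto intro: finite_subset)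
qed

text \<open>Scalars become multiplications by central elements, so the algebra axioms follow from
  the ring axioms.\<close>

lemma smult_as_mult: "r \<in> carrier R \<Longrightarrow> f \<in> fsupp R (carrier M) \<Longrightarrow>
    delta R \<one>\<^bsub>M\<^esub> r \<otimes>\<^bsub>F\<^esub> f = (\<lambda>z. r \<otimes>\<^bsub>R\<^esub> f z) \<and> f \<otimes>\<^bsub>F\<^esub> delta R \<one>\<^bsub>M\<^esub> r = (\<lambda>z. r \<otimes>\<^bsub>R\<^esub> f z)"
proof -
  assume r: "r \<in> carrier R" and f: "f \<in> fsupp R (carrier M)"
  note o = R.fsupp_delta[of "\<one>\<^bsub>M\<^esub>" "carrier M" r]
  show ?thesis using f
  proof (induction rule: R.fsupp_induct)
    case (delta x g)
    then show ?case using r by (auto simp: mult_F_delta R.m_comm) (auto simp: delta_def R.m_comm fun_eq_iff)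
  next
    case (add f g)
    then show ?case using r o fsuppD(1)[of f] fsuppD(1)[of g]
      by (auto simp: mult_F_add_left mult_F_add_right R.r_distr)
  qed (use r o in \<open>simp add: mult_F_zero\<close>)
qed

lemma nc_alg_F: "nc_alg R F"
proof -
  interpret F: ring F by (rule ring_F)
  have d: "delta R \<one>\<^bsub>M\<^esub> r \<in> carrier F" if "r \<in> carrier R" for r
    using that by (simp add: carrier_F R.fsupp_delta)
  have s: "r \<odot>\<^bsub>F\<^esub> f = delta R \<one>\<^bsub>M\<^esub> r \<otimes>\<^bsub>F\<^esub> f" "f \<otimes>\<^bsub>F\<^esub> delta R \<one>\<^bsub>M\<^esub> r = delta R \<one>\<^bsub>M\<^esub> r \<otimes>\<^bsub>F\<^esub> f"
    if "r \<in> carrier R" "f \<in> carrier F" for r f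
    using that smult_as_mult by (simp_all add: smult_F carrier_F)
  show ?thesis
  proof (rule nc_algI)
    fix r x y assume a: "r \<in> carrier R" "x \<in> carrier F" "y \<in> carrier F"
    show "(r \<odot>\<^bsub>F\<^esub> x) \<otimes>\<^bsub>F\<^esub> y = r \<odot>\<^bsub>F\<^esub> (x \<otimes>\<^bsub>F\<^esub> y)"
      using a d by (simp add: s F.m_assoc)
    show "x \<otimes>\<^bsub>F\<^esub> (r \<odot>\<^bsub>F\<^esub> y) = r \<odot>\<^bsub>F\<^esub> (x \<otimes>\<^bsub>F\<^esub> y)"
      using a d by (simp add: s) (metis F.m_assoc s(2))
  qed (auto simp: R.is_cring ring_F smult_F carrier_F add_F smult_closed_F fsuppD R.l_distr R.r_distr R.m_assoc)
qed

lemma single_closed: "x \<in> carrier M \<Longrightarrow> single R x \<in> carrier F"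
  by (simp add: single_delta carrier_F R.fsupp_delta)

lemma F_induct [consumes 1, case_names single add]:
  assumes "f \<in> carrier F"
    and "\<And>x r. x \<in> carrier M \<Longrightarrow> r \<in> carrier R \<Longrightarrow> P (r \<odot>\<^bsub>F\<^esub> single R x)"
    and "\<And>f g. f \<in> carrier F \<Longrightarrow> g \<in> carrier F \<Longrightarrow> P f \<Longrightarrow> P g \<Longrightarrow> P (f \<oplus>\<^bsub>F\<^esub> g)"
  shows "P f"
proof -
  have s: "r \<odot>\<^bsub>F\<^esub> single R x = delta R x r" if "r \<in> carrier R" for r x
    using that by (auto simp: single_delta smult_F delta_def)
  show ?thesis using assms(1) unfolding carrier_F
  proof (induction rule: R.fsupp_induct)
    case zero
    have "delta R \<one>\<^bsub>M\<^esub> \<zero>\<^bsub>R\<^esub> = (\<lambda>_. \<zero>\<^bsub>R\<^esub>)" by (auto simp: delta_def)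
    then show ?case using assms(2)[of "\<one>\<^bsub>M\<^esub>" "\<zero>\<^bsub>R\<^esub>"] s[of "\<zero>\<^bsub>R\<^esub>"] by simp
  next
    case (delta x g)
    then show ?case using assms(2) s by metis
  next
    case (add f g)
    then show ?case using assms(3)[of f g] by (simp add: carrier_F add_F)
  qed
qed

lemma single_mult: "x \<in> carrier M \<Longrightarrow> y \<in> carrier M \<Longrightarrow>
    single R x \<otimes>\<^bsub>F\<^esub> single R y = single R (x \<otimes>\<^bsub>M\<^esub> y)"
  by (simp add: single_delta mult_F_delta)

lemma monoid_algebra_universal:
  assumes "nc_alg R S" and cl: "\<And>x. x \<in> carrier M \<Longrightarrow> \<theta> x \<in> carrier S"
    and mult: "\<And>x y. x \<in> carrier M \<Longrightarrow> y \<in> carrier M \<Longrightarrow> \<theta> (x \<otimes>\<^bsub>M\<^esub> y) = \<theta> x \<otimes>\<^bsub>S\<^esub> \<theta> y"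
    and one: "\<theta> \<one>\<^bsub>M\<^esub> = \<one>\<^bsub>S\<^esub>"
  shows "\<exists>h\<in>alg_hom R F S. \<forall>x\<in>carrier M. h (single R x) = \<theta> x"
proof -
  interpret S: nc_alg R S by fact
  interpret L: linear_extension R S "carrier M" "\<lambda>x r. r \<odot>\<^bsub>S\<^esub> \<theta> x"
    by unfold_locales (auto simp: cl S.smult_l_distr)
  define h where "h = lin S R (\<lambda>x r. r \<odot>\<^bsub>S\<^esub> \<theta> x)"
  have hd: "h (delta R x r) = r \<odot>\<^bsub>S\<^esub> \<theta> x" if "x \<in> carrier M" "r \<in> carrier R" for x r
    using that unfolding h_def by simp
  have hcl: "h f \<in> carrier S" if "f \<in> fsupp R (carrier M)" for f
    using that unfolding h_def by simp
  have hadd: "h (\<lambda>z. f z \<oplus>\<^bsub>R\<^esub> g z) = h f \<oplus>\<^bsub>S\<^esub> h g"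
    if "f \<in> fsupp R (carrier M)" "g \<in> fsupp R (carrier M)" for f g
    using L.lin_add that unfolding h_def .
  have h0: "h (\<lambda>_. \<zero>\<^bsub>R\<^esub>) = \<zero>\<^bsub>S\<^esub>" unfolding h_def by simp
  have hmult: "h (f \<otimes>\<^bsub>F\<^esub> g) = h f \<otimes>\<^bsub>S\<^esub> h g" if f: "f \<in> fsupp R (carrier M)" and g: "g \<in> fsupp R (carrier M)" for f g
    using f
  proof (induction rule: R.fsupp_induct)
    case (delta x r)
    note x = delta and xd = R.fsupp_delta[OF delta]
    show ?case using g
    proof (induction rule: R.fsupp_induct)
      case (delta y s)
      then have "s \<odot>\<^bsub>S\<^esub> (r \<odot>\<^bsub>S\<^esub> (\<theta> x \<otimes>\<^bsub>S\<^esub> \<theta> y)) = (r \<otimes>\<^bsub>R\<^esub> s) \<odot>\<^bsub>S\<^esub> (\<theta> x \<otimes>\<^bsub>S\<^esub> \<theta> y)"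
        using x by (simp add: cl R.m_comm S.smult_assoc1[symmetric])
      then show ?case using x delta by (simp add: mult_F_delta hd mult S.smult_mult_left S.smult_mult_right cl)
    next
      case (add f g)
      then show ?case using xd by (simp add: mult_F_add_right hadd mult_F_closed S.A.r_distr hcl)
    qed (use xd in \<open>simp add: mult_F_zero h0 hcl\<close>)
  next
    case (add f f')
    then show ?case using g by (simp add: mult_F_add_left hadd mult_F_closed S.A.l_distr hcl)
  qed (use g in \<open>simp add: mult_F_zero h0 hcl\<close>)
  have hs: "h (\<lambda>z. r \<otimes>\<^bsub>R\<^esub> f z) = r \<odot>\<^bsub>S\<^esub> h f" if "r \<in> carrier R" "f \<in> fsupp R (carrier M)" for r f
  proof -
    have "(\<lambda>z. r \<otimes>\<^bsub>R\<^esub> f z) = delta R \<one>\<^bsub>M\<^esub> r \<otimes>\<^bsub>F\<^esub> f" using smult_as_mult that by simp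
    then have "h (\<lambda>z. r \<otimes>\<^bsub>R\<^esub> f z) = h (delta R \<one>\<^bsub>M\<^esub> r) \<otimes>\<^bsub>S\<^esub> h f" 
      using hmult[OF R.fsupp_delta[OF M.one_closed that(1)] that(2)] by simp
    then show ?thesis using that hcl[OF that(2)] by (simp add: hd one S.smult_mult_left)
  qed
  have "h \<in> alg_hom R F S"
    using hcl hmult hadd hs hd[of "\<one>\<^bsub>M\<^esub>" "\<one>\<^bsub>R\<^esub>"]
    by (intro alg_homI) (auto simp: carrier_F add_F smult_F one_F one)
  moreover have "\<forall>x\<in>carrier M. h (single R x) = \<theta> x" by (simp add: single_delta hd cl)
  ultimately show ?thesis by blast
qed

end

subsection \<open>Quotients\<close>

lemma ring_cong:
  assumes "ring R" "carrier S = carrier R" "mult S = mult R" "one S = one R" "zero S = zero R" "add S = add R"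
  shows "ring S"
proof -
  interpret R: ring R by fact
  show ?thesis
  proof (rule ringI)
    show "abelian_group S"
      by (rule abelian_groupI) (simp_all add: assms(2-6) R.a_ac R.add.l_inv_ex)
    show "Group.monoid S"
      by (rule monoidI) (simp_all add: assms(2-6) R.m_assoc)
  qed (simp_all add: assms(2-6) R.l_distr R.r_distr)
qed

locale alg_ideal = nc_alg R A + ideal J A
  for R :: "('r, 'c) ring_scheme" and A :: "('r, 'a, 'd) module_scheme" and J
begin

abbreviation "Q \<equiv> alg_quot A J"
abbreviation "cls \<equiv> (\<lambda>a. J +>\<^bsub>A\<^esub> a)"

lemma Q_ring: "ring Q"
  by (rule ring_cong[OF quotient_is_ring]) (simp_all add: alg_quot_def)

lemma carrier_Q: "carrier Q = cls ` carrier A"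
  by (auto simp: alg_quot_def FactRing_def A_RCOSETS_def')

lemma cls_eq: "a \<in> carrier A \<Longrightarrow> b \<in> carrier A \<Longrightarrow> cls a = cls b \<longleftrightarrow> a \<ominus>\<^bsub>A\<^esub> b \<in> J"
  using A.quotient_eq_iff_same_a_r_cos[OF ideal_axioms] by simp

lemma cls_hom: "cls \<in> ring_hom A Q"
  using rcos_ring_hom by (simp add: ring_hom_def alg_quot_def)

lemma smult_J: "r \<in> carrier R \<Longrightarrow> j \<in> J \<Longrightarrow> r \<odot>\<^bsub>A\<^esub> j \<in> J"
proof -
  assume a: "r \<in> carrier R" "j \<in> J"
  then have "r \<odot>\<^bsub>A\<^esub> j = (r \<odot>\<^bsub>A\<^esub> \<one>\<^bsub>A\<^esub>) \<otimes>\<^bsub>A\<^esub> j" by (simp add: smult_mult_left)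
  then show ?thesis using a I_l_closed by simp
qed

text \<open>Scalar multiplication on the quotient is defined as a union over all representatives.
  They contribute the same coset because the ideal is closed under scalars.\<close>

lemma smult_Q: "r \<in> carrier R \<Longrightarrow> a \<in> carrier A \<Longrightarrow> r \<odot>\<^bsub>Q\<^esub> cls a = cls (r \<odot>\<^bsub>A\<^esub> a)"
proof -
  assume r: "r \<in> carrier R" and a: "a \<in> carrier A"
  have "cls (r \<odot>\<^bsub>A\<^esub> x) = cls (r \<odot>\<^bsub>A\<^esub> a)" if xc: "x \<in> cls a" for x
  proof -
    have x: "x \<in> carrier A" using xc a a_elemrcos_carrier by blast
    obtain j where j: "j \<in> J" "x = j \<oplus>\<^bsub>A\<^esub> a" using xc unfolding a_r_coset_def r_coset_def by auto
    have "r \<odot>\<^bsub>A\<^esub> x \<ominus>\<^bsub>A\<^esub> r \<odot>\<^bsub>A\<^esub> a = r \<odot>\<^bsub>A\<^esub> j"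
      using j a r x by (simp add: smult_r_distr A.minus_eq A.a_assoc A.r_neg)
    then show ?thesis using cls_eq r x a smult_J j by simp
  qed
  moreover have "a \<in> cls a" using a by (rule a_rcos_self)
  ultimately have "(\<Union>x\<in>cls a. cls (r \<odot>\<^bsub>A\<^esub> x)) = cls (r \<odot>\<^bsub>A\<^esub> a)" by blast
  then show ?thesis unfolding alg_quot_def by simp
qed

lemma cls_alg_hom: "cls \<in> alg_hom R A Q"
  using cls_hom smult_Q by (auto simp: alg_hom_def)

lemma nc_alg_Q: "nc_alg R Q"
proof -
  note h = alg_homD[OF cls_alg_hom]
  note hs = h(6)[symmetric] h(3)[symmetric] h(4)[symmetric]
  show ?thesis
  proof (rule nc_algI)
    show "cring R" "ring Q" by (rule R_cring' Q_ring)+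
  qed (auto simp: carrier_Q hs smult_l_distr smult_r_distr smult_assoc1 smult_mult_left smult_mult_right)
qed

lemma quot_universal:
  assumes "nc_alg R S" "h \<in> alg_hom R A S" "\<And>x. x \<in> J \<Longrightarrow> h x = \<zero>\<^bsub>S\<^esub>"
  shows "\<exists>h'\<in>alg_hom R Q S. \<forall>a\<in>carrier A. h' (cls a) = h a"
proof -
  interpret S: nc_alg R S by fact
  note hh = alg_homD[OF assms(2)]
  define h' where "h' = (\<lambda>X. h (SOME a. a \<in> carrier A \<and> cls a = X))"
  have h': "h' (cls a) = h a" if a: "a \<in> carrier A" for a
  proof -
    define b where "b = (SOME b. b \<in> carrier A \<and> cls b = cls a)"
    have b: "b \<in> carrier A \<and> cls b = cls a" unfolding b_def by (rule someI[of _ a]) (use a in simp)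
    have "h (b \<ominus>\<^bsub>A\<^esub> a) = \<zero>\<^bsub>S\<^esub>" using b a cls_eq assms(3) by blast
    then have "h b = h a" using ring_hom_diff[OF hh(1)] A.ring_axioms S.A.ring_axioms a b hh(2)
      by (metis S.A.r_right_minus_eq)
    then show ?thesis by (simp add: h'_def b_def)
  qed
  note c = alg_homD[OF cls_alg_hom]
  have "h' \<in> alg_hom R Q S"
    by (rule alg_homI) (auto simp: carrier_Q h' hh c(3-6)[symmetric])
  then show ?thesis using h' by blast
qed

end

lemma ring_hom_genideal_zero:
  assumes "ring A" "ring S" "h \<in> ring_hom A S" "G \<subseteq> carrier A" "\<And>x. x \<in> G \<Longrightarrow> h x = \<zero>\<^bsub>S\<^esub>"
    "x \<in> genideal A G"
  shows "h x = \<zero>\<^bsub>S\<^esub>"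
proof -
  interpret ring_hom_ring A S h by (intro ring_hom_ringI2 assms(1-3))
  have "G \<subseteq> a_kernel A S h" using assms(4,5) unfolding a_kernel_def' by blast
  then have "genideal A G \<subseteq> a_kernel A S h" by (rule R.genideal_minimal[OF kernel_is_ideal])
  then show ?thesis using assms(6) unfolding a_kernel_def' by blast
qed

subsection \<open>Presented algebras\<close>

lemma free_monoid_simps [simp]:
  "carrier (free_monoid X) = lists X" "u \<otimes>\<^bsub>free_monoid X\<^esub> v = u @ v" "\<one>\<^bsub>free_monoid X\<^esub> = []"
  by (auto simp: free_monoid_def)

lemma monoid_free_monoid: "monoid (free_monoid X)"
  by (rule monoidI) auto

locale presentation =
  fixes R :: "('r, 'c) ring_scheme" and X :: "'g set" and rels
  assumes R: "cring R"
    and rels: "\<And>l r. (l, r) \<in> rels \<Longrightarrow> l \<in> carrier (free_algebra R X) \<and> r \<in> carrier (free_algebra R X)"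
begin

abbreviation "F \<equiv> free_algebra R X"
abbreviation "PA \<equiv> presented_algebra R X rels"
abbreviation "gen \<equiv> presented_gen R X rels"
abbreviation "proj f \<equiv> rel_ideal R X rels +>\<^bsub>F\<^esub> f"

sublocale F: mon_alg R "free_monoid X"
  rewrites "monoid_algebra R (free_monoid X) = F" and "carrier (free_monoid X) = lists X"
    and "u \<otimes>\<^bsub>free_monoid X\<^esub> v = u @ v" and "\<one>\<^bsub>free_monoid X\<^esub> = []"
  by (auto intro!: mon_alg.intro R monoid_free_monoid simp: free_algebra_def)

lemma rel_set: "{l \<ominus>\<^bsub>F\<^esub> r | l r. (l, r) \<in> rels} \<subseteq> carrier F"
proof -
  interpret ring F by (rule F.ring_F)
  show ?thesis using rels by auto
qed

sublocale Q: alg_ideal R F "rel_ideal R X rels"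
  using F.nc_alg_F ring.genideal_ideal[OF F.ring_F rel_set] unfolding rel_ideal_def alg_ideal_def by blast

lemma nc_alg_presented: "nc_alg R PA"
  using Q.nc_alg_Q unfolding presented_algebra_def .

lemma proj_hom: "proj \<in> alg_hom R F PA"
  using Q.cls_alg_hom unfolding presented_algebra_def .

lemma carrier_presented: "carrier PA = proj ` carrier F"
  using Q.carrier_Q unfolding presented_algebra_def .

lemma gen_closed [simp]: "g \<in> X \<Longrightarrow> gen g \<in> carrier PA"
  unfolding presented_gen_def carrier_presented using F.single_closed[of "[g]"] by auto

lemma proj_single: "u \<in> lists X \<Longrightarrow> proj (single R u) = wprod PA gen u"
proof (induction u)
  case Nil
  have "single R [] = \<one>\<^bsub>F\<^esub>" by (simp add: F.one_F F.single_delta)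
  then show ?case using alg_homD(5)[OF proj_hom] by simp
next
  case (Cons i u)
  have "single R (i # u) = single R [i] \<otimes>\<^bsub>F\<^esub> single R u" using Cons F.single_mult[of "[i]" u] by simp
  then show ?case using Cons alg_homD(3)[OF proj_hom, of "single R [i]" "single R u"] F.single_closed
    by (auto simp: wprod_Cons presented_gen_def)
qed

lemma presented_relation: "(l, r) \<in> rels \<Longrightarrow> proj l = proj r"
proof -
  assume a: "(l, r) \<in> rels"
  then have "l \<ominus>\<^bsub>F\<^esub> r \<in> rel_ideal R X rels"
    unfolding rel_ideal_def using ring.genideal_self[OF F.ring_F rel_set] by blast
  then show ?thesis using rels[OF a] Q.cls_eq by blast
qed

lemma presented_induct [consumes 1, case_names word add]:
  assumes "x \<in> carrier PA"
    and "\<And>u r. u \<in> lists X \<Longrightarrow> r \<in> carrier R \<Longrightarrow> P (r \<odot>\<^bsub>PA\<^esub> wprod PA gen u)"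
    and "\<And>x y. x \<in> carrier PA \<Longrightarrow> y \<in> carrier PA \<Longrightarrow> P x \<Longrightarrow> P y \<Longrightarrow> P (x \<oplus>\<^bsub>PA\<^esub> y)"
  shows "P x"
proof -
  note p = alg_homD[OF proj_hom]
  obtain f where f: "f \<in> carrier F" "x = proj f" using assms(1) carrier_presented by auto
  have "P (proj f)" using f(1)
  proof (induction rule: F.F_induct)
    case (single u r)
    then show ?case using assms(2) p(6) F.single_closed by (simp add: proj_single)
  next
    case (add f g)
    then show ?case using assms(3) p(2,4) by simp
  qed
  then show ?thesis using f by simp
qed

text \<open>The relations are elements of the free algebra rather than words, so the hypothesis
  tests them on an arbitrary algebra map \<open>h\<close> that extends \<open>g\<close>.\<close>

lemma presented_universal:
  assumes "nc_alg R S" and g: "g \<in> X \<rightarrow> carrier S"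
    and rel: "\<And>h l r. h \<in> alg_hom R F S \<Longrightarrow> (\<And>u. u \<in> lists X \<Longrightarrow> h (single R u) = wprod S g u) \<Longrightarrow>
      (l, r) \<in> rels \<Longrightarrow> h l = h r"
  shows "\<exists>h\<in>alg_hom R PA S. \<forall>x\<in>X. h (gen x) = g x"
proof -
  interpret S: nc_alg R S by fact
  obtain h where h: "h \<in> alg_hom R F S" "\<And>u. u \<in> lists X \<Longrightarrow> h (single R u) = wprod S g u"
    using F.monoid_algebra_universal[OF assms(1), of "wprod S g"] g
    by (auto simp: S.A.wprod_append[OF g] intro: S.A.wprod_closed[OF g])
  have "h x = \<zero>\<^bsub>S\<^esub>" if "x \<in> rel_ideal R X rels" for x
  proof (rule ring_hom_genideal_zero[OF F.ring_F S.A.ring_axioms alg_homD(1)[OF h(1)] rel_set])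
    fix y assume "y \<in> {l \<ominus>\<^bsub>F\<^esub> r | l r. (l, r) \<in> rels}"
    then obtain l r where lr: "(l, r) \<in> rels" "y = l \<ominus>\<^bsub>F\<^esub> r" by blast
    have "h y = h l \<ominus>\<^bsub>S\<^esub> h r"
      unfolding lr(2) using rels[OF lr(1)] by (intro ring_hom_diff[OF alg_homD(1)[OF h(1)] F.ring_F S.A.ring_axioms]) auto
    moreover have "h l = h r" using rel[OF h lr(1)] .
    moreover have "h r \<in> carrier S" using rels[OF lr(1)] alg_homD(2)[OF h(1)] by blast
    ultimately show "h y = \<zero>\<^bsub>S\<^esub>" by (simp add: S.A.minus_eq S.A.r_neg)
  qed (use that in \<open>simp add: rel_ideal_def\<close>)
  then obtain h' where h': "h' \<in> alg_hom R PA S" "\<And>f. f \<in> carrier F \<Longrightarrow> h' (proj f) = h f"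
    using Q.quot_universal[OF assms(1) h(1)] unfolding presented_algebra_def by blast
  have "h' (gen x) = g x" if "x \<in> X" for x
    using that g h'(2)[OF F.single_closed[of "[x]"]] h(2)[of "[x]"] S.A.wprod_single[of g x]
    by (auto simp: presented_gen_def)
  then show ?thesis using h' by blast
qed

end

subsection \<open>Tensor products\<close>

locale tensor = A: nc_alg R A + B: nc_alg R B
  for R :: "('r, 'c) ring_scheme" and A :: "('r, 'a, 'd) module_scheme" and B :: "('r, 'b, 'e) module_scheme"
begin

abbreviation "FT \<equiv> monoid_algebra R (A \<times>\<times> B)"
abbreviation "T \<equiv> tensor_algebra R A B"
abbreviation "pt \<equiv> pure_tensor R A B"
abbreviation "e a b \<equiv> single R (a, b)"

sublocale F: mon_alg R "A \<times>\<times> B"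
  rewrites "carrier (A \<times>\<times> B) = carrier A \<times> carrier B"
    and "\<one>\<^bsub>A \<times>\<times> B\<^esub> = (\<one>\<^bsub>A\<^esub>, \<one>\<^bsub>B\<^esub>)"
  by (auto intro!: mon_alg.intro A.R_cring' DirProd_monoid A.A.monoid_axioms B.A.monoid_axioms)

definition "bilinearity_relations =
      {e (a \<oplus>\<^bsub>A\<^esub> a') b \<ominus>\<^bsub>FT\<^esub> (e a b \<oplus>\<^bsub>FT\<^esub> e a' b)
          | a a' b. a \<in> carrier A \<and> a' \<in> carrier A \<and> b \<in> carrier B}
     \<union> {e a (b \<oplus>\<^bsub>B\<^esub> b') \<ominus>\<^bsub>FT\<^esub> (e a b \<oplus>\<^bsub>FT\<^esub> e a b')
          | a b b'. a \<in> carrier A \<and> b \<in> carrier B \<and> b' \<in> carrier B}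
     \<union> {e (r \<odot>\<^bsub>A\<^esub> a) b \<ominus>\<^bsub>FT\<^esub> (r \<odot>\<^bsub>FT\<^esub> e a b)
          | r a b. r \<in> carrier R \<and> a \<in> carrier A \<and> b \<in> carrier B}
     \<union> {e a (r \<odot>\<^bsub>B\<^esub> b) \<ominus>\<^bsub>FT\<^esub> (r \<odot>\<^bsub>FT\<^esub> e a b)
          | r a b. r \<in> carrier R \<and> a \<in> carrier A \<and> b \<in> carrier B}"

lemma tensor_ideal_eq: "tensor_ideal R A B = genideal FT bilinearity_relations"
  unfolding tensor_ideal_def Let_def bilinearity_relations_def ..

lemma e_closed [simp]: "a \<in> carrier A \<Longrightarrow> b \<in> carrier B \<Longrightarrow> e a b \<in> carrier FT"
  using F.single_closed by simp

sublocale FT: nc_alg R FT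
  by (rule F.nc_alg_F)

lemma bilinearity_relations_closed: "bilinearity_relations \<subseteq> carrier FT"
  unfolding bilinearity_relations_def by auto

sublocale Q: alg_ideal R FT "tensor_ideal R A B"
  unfolding tensor_ideal_eq
  using F.nc_alg_F FT.A.genideal_ideal[OF bilinearity_relations_closed] by (rule alg_ideal.intro)

lemma nc_alg_tensor: "nc_alg R T"
  using Q.nc_alg_Q unfolding tensor_algebra_def .

sublocale T: nc_alg R T by (rule nc_alg_tensor)

lemma proj_hom: "(\<lambda>f. tensor_ideal R A B +>\<^bsub>FT\<^esub> f) \<in> alg_hom R FT T"
  using Q.cls_alg_hom unfolding tensor_algebra_def .

lemma pt_eq: "pt a b = tensor_ideal R A B +>\<^bsub>FT\<^esub> e a b"
  by (simp add: pure_tensor_def)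

lemma pt_closed [simp]: "a \<in> carrier A \<Longrightarrow> b \<in> carrier B \<Longrightarrow> pt a b \<in> carrier T"
  unfolding pt_eq using alg_homD(2)[OF proj_hom] by simp

lemma bilinearity:
  assumes "x \<ominus>\<^bsub>FT\<^esub> y \<in> bilinearity_relations" "x \<in> carrier FT" "y \<in> carrier FT"
  shows "tensor_ideal R A B +>\<^bsub>FT\<^esub> x = tensor_ideal R A B +>\<^bsub>FT\<^esub> y"
  using assms FT.A.genideal_self[OF bilinearity_relations_closed] Q.cls_eq unfolding tensor_ideal_eq by blast

lemma pt_add_left: "a \<in> carrier A \<Longrightarrow> a' \<in> carrier A \<Longrightarrow> b \<in> carrier B \<Longrightarrow>
    pt (a \<oplus>\<^bsub>A\<^esub> a') b = pt a b \<oplus>\<^bsub>T\<^esub> pt a' b"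
  unfolding pt_eq alg_homD(4)[OF proj_hom e_closed e_closed, symmetric]
  by (rule bilinearity) (unfold bilinearity_relations_def, blast, auto)

lemma pt_add_right: "a \<in> carrier A \<Longrightarrow> b \<in> carrier B \<Longrightarrow> b' \<in> carrier B \<Longrightarrow>
    pt a (b \<oplus>\<^bsub>B\<^esub> b') = pt a b \<oplus>\<^bsub>T\<^esub> pt a b'"
  unfolding pt_eq alg_homD(4)[OF proj_hom e_closed e_closed, symmetric]
  by (rule bilinearity) (unfold bilinearity_relations_def, blast, auto)

lemma pt_smult_left: "r \<in> carrier R \<Longrightarrow> a \<in> carrier A \<Longrightarrow> b \<in> carrier B \<Longrightarrow>
    pt (r \<odot>\<^bsub>A\<^esub> a) b = r \<odot>\<^bsub>T\<^esub> pt a b"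
  unfolding pt_eq alg_homD(6)[OF proj_hom _ e_closed, symmetric]
  by (rule bilinearity) (unfold bilinearity_relations_def, blast, auto)

lemma pt_smult_right: "r \<in> carrier R \<Longrightarrow> a \<in> carrier A \<Longrightarrow> b \<in> carrier B \<Longrightarrow>
    pt a (r \<odot>\<^bsub>B\<^esub> b) = r \<odot>\<^bsub>T\<^esub> pt a b"
  unfolding pt_eq alg_homD(6)[OF proj_hom _ e_closed, symmetric]
  by (rule bilinearity) (unfold bilinearity_relations_def, blast, auto)

lemma pt_mult: "a \<in> carrier A \<Longrightarrow> a' \<in> carrier A \<Longrightarrow> b \<in> carrier B \<Longrightarrow> b' \<in> carrier B \<Longrightarrow>
    pt a b \<otimes>\<^bsub>T\<^esub> pt a' b' = pt (a \<otimes>\<^bsub>A\<^esub> a') (b \<otimes>\<^bsub>B\<^esub> b')"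
  unfolding pt_eq using alg_homD(3)[OF proj_hom e_closed e_closed, of a b a' b']
    F.single_mult[of "(a, b)" "(a', b')"] by simp

lemma pt_one: "pt \<one>\<^bsub>A\<^esub> \<one>\<^bsub>B\<^esub> = \<one>\<^bsub>T\<^esub>"
  unfolding pt_eq using alg_homD(5)[OF proj_hom] by (simp add: F.one_F F.single_delta)

text \<open>A scalar is absorbed by the left factor, so sums of pure tensors exhaust the tensor
  product.\<close>

lemma tensor_induct [consumes 1, case_names pure add]:
  assumes "x \<in> carrier T"
    and "\<And>a b. a \<in> carrier A \<Longrightarrow> b \<in> carrier B \<Longrightarrow> P (pt a b)"
    and "\<And>x y. x \<in> carrier T \<Longrightarrow> y \<in> carrier T \<Longrightarrow> P x \<Longrightarrow> P y \<Longrightarrow> P (x \<oplus>\<^bsub>T\<^esub> y)"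
  shows "P x"
proof -
  note p = alg_homD[OF proj_hom]
  obtain f where f: "f \<in> carrier FT" "x = tensor_ideal R A B +>\<^bsub>FT\<^esub> f"
    using assms(1) Q.carrier_Q unfolding tensor_algebra_def by blast
  have "P (tensor_ideal R A B +>\<^bsub>FT\<^esub> f)" using f(1)
  proof (induction rule: F.F_induct)
    case (single ab r)
    obtain a b where ab: "ab = (a, b)" "a \<in> carrier A" "b \<in> carrier B" using single by auto
    then have "tensor_ideal R A B +>\<^bsub>FT\<^esub> (r \<odot>\<^bsub>FT\<^esub> single R ab) = pt (r \<odot>\<^bsub>A\<^esub> a) b"
      using single by (simp add: pt_smult_left p(6) pt_eq[symmetric])
    then show ?case using assms(2) ab single by simp
  next
    case (add f g)
    then show ?case using assms(3) p(2,4) by simp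
  qed
  then show ?thesis using f by simp
qed

lemma tensor_universal:
  assumes "nc_alg R S" and \<alpha>: "\<alpha> \<in> alg_hom R A S" and \<beta>: "\<beta> \<in> alg_hom R B S"
    and comm: "\<And>a b. a \<in> carrier A \<Longrightarrow> b \<in> carrier B \<Longrightarrow> \<alpha> a \<otimes>\<^bsub>S\<^esub> \<beta> b = \<beta> b \<otimes>\<^bsub>S\<^esub> \<alpha> a"
  shows "\<exists>h\<in>alg_hom R T S. \<forall>a\<in>carrier A. \<forall>b\<in>carrier B. h (pt a b) = \<alpha> a \<otimes>\<^bsub>S\<^esub> \<beta> b"
proof -
  interpret S: nc_alg R S by fact
  note a = alg_homD[OF \<alpha>] and b = alg_homD[OF \<beta>]
  have mult: "\<alpha> (x \<otimes>\<^bsub>A\<^esub> x') \<otimes>\<^bsub>S\<^esub> \<beta> (y \<otimes>\<^bsub>B\<^esub> y') = (\<alpha> x \<otimes>\<^bsub>S\<^esub> \<beta> y) \<otimes>\<^bsub>S\<^esub> (\<alpha> x' \<otimes>\<^bsub>S\<^esub> \<beta> y')"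
    if "x \<in> carrier A" "x' \<in> carrier A" "y \<in> carrier B" "y' \<in> carrier B" for x x' y y'
  proof -
    have "(\<alpha> x \<otimes>\<^bsub>S\<^esub> \<beta> y) \<otimes>\<^bsub>S\<^esub> (\<alpha> x' \<otimes>\<^bsub>S\<^esub> \<beta> y') = \<alpha> x \<otimes>\<^bsub>S\<^esub> (\<beta> y \<otimes>\<^bsub>S\<^esub> \<alpha> x') \<otimes>\<^bsub>S\<^esub> \<beta> y'"
      using that a(2) b(2) by (simp add: S.A.m_assoc)
    also have "\<dots> = \<alpha> x \<otimes>\<^bsub>S\<^esub> (\<alpha> x' \<otimes>\<^bsub>S\<^esub> \<beta> y) \<otimes>\<^bsub>S\<^esub> \<beta> y'" using comm that by simp
    finally show ?thesis using that a(2,3) b(2,3) by (simp add: S.A.m_assoc)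
  qed
  obtain h where h: "h \<in> alg_hom R FT S" "\<And>x. x \<in> carrier A \<times> carrier B \<Longrightarrow> h (single R x) = (case x of (a, b) \<Rightarrow> \<alpha> a \<otimes>\<^bsub>S\<^esub> \<beta> b)"
    using F.monoid_algebra_universal[OF assms(1), of "\<lambda>(a, b). \<alpha> a \<otimes>\<^bsub>S\<^esub> \<beta> b"] a b mult by auto
  have he: "h (e x y) = \<alpha> x \<otimes>\<^bsub>S\<^esub> \<beta> y" if "x \<in> carrier A" "y \<in> carrier B" for x y using h(2) that by simp
  note hh = alg_homD[OF h(1)]
  have hd: "h (x \<ominus>\<^bsub>FT\<^esub> y) = h x \<ominus>\<^bsub>S\<^esub> h y" if "x \<in> carrier FT" "y \<in> carrier FT" for x y
    using ring_hom_diff[OF hh(1) FT.A.ring_axioms S.A.ring_axioms that] .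
  have z: "x \<ominus>\<^bsub>S\<^esub> x = \<zero>\<^bsub>S\<^esub>" if "x \<in> carrier S" for x using that by (simp add: S.A.minus_eq S.A.r_neg)
  have "h x = \<zero>\<^bsub>S\<^esub>" if "x \<in> tensor_ideal R A B" for x
  proof (rule ring_hom_genideal_zero[OF FT.A.ring_axioms S.A.ring_axioms hh(1) bilinearity_relations_closed])
    fix y assume y: "y \<in> bilinearity_relations"
    show "h y = \<zero>\<^bsub>S\<^esub>"
      using y unfolding bilinearity_relations_def
      using a b by (auto simp: hd hh he z S.A.l_distr S.A.r_distr S.smult_mult_left S.smult_mult_right)
  qed (use that in \<open>simp add: tensor_ideal_eq\<close>)
  then obtain h' where h': "h' \<in> alg_hom R T S" "\<And>f. f \<in> carrier FT \<Longrightarrow> h' (tensor_ideal R A B +>\<^bsub>FT\<^esub> f) = h f"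
    using Q.quot_universal[OF assms(1) h(1)] unfolding tensor_algebra_def by blast
  have "h' (pt x y) = \<alpha> x \<otimes>\<^bsub>S\<^esub> \<beta> y" if "x \<in> carrier A" "y \<in> carrier B" for x y
    using that h'(2) he by (simp add: pt_eq)
  then show ?thesis using h' by blast
qed

end

subsection \<open>Rings as integral algebras, and base change\<close>

lemma ring_int_algebra:
  assumes "ring S"
  shows "ring (int_algebra S)"
  by (rule ring_cong[OF assms]) (simp_all add: int_algebra_def)

lemma nc_alg_int_algebra:
  assumes "ring S"
  shows "nc_alg \<Z> (int_algebra S)"
proof -
  interpret S: ring S by fact
  show ?thesis
  proof (rule nc_algI)
    show "ring (int_algebra S)" "cring \<Z>" by (rule ring_int_algebra[OF assms] int_is_cring)+
  qed (auto simp: int_algebra_def S.add.int_pow_mult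
        S.add.int_pow_distrib S.add.int_pow_pow mult.commute S.add_pow_ldistr_int S.add_pow_rdistr_int
        S.add.int_pow_1)
qed

lemma int_algebra_simps [simp]:
  "carrier (int_algebra S) = carrier S" "mult (int_algebra S) = mult S" "one (int_algebra S) = one S"
  "zero (int_algebra S) = zero S" "add (int_algebra S) = add S"
  by (simp_all add: int_algebra_def)

lemma wprod_int_algebra [simp]: "wprod (int_algebra S) g u = wprod S g u"
  by (induction u) (simp_all add: wprod_Cons)

lemma ring_hom_int_algebra: "ring_hom A (int_algebra S) = ring_hom A S"
  by (simp add: ring_hom_def)

text \<open>By distributivity the integer scalars of any integral algebra are iterated addition,
  which an additive map respects.\<close>

lemma ring_hom_alg_hom_int:
  assumes "nc_alg \<Z> A" "ring S" "h \<in> ring_hom A S"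
  shows "h \<in> alg_hom \<Z> A (int_algebra S)"
proof -
  interpret A: nc_alg \<Z> A by fact
  interpret S: nc_alg \<Z> "int_algebra S" by (rule nc_alg_int_algebra[OF assms(2)])
  interpret h: ring_hom_ring A "int_algebra S" h
    using assms A.A.ring_axioms S.A.ring_axioms by (intro ring_hom_ringI2) (auto simp: ring_hom_int_algebra)
  have nat: "h (int n \<odot>\<^bsub>A\<^esub> x) = int n \<odot>\<^bsub>int_algebra S\<^esub> h x" if "x \<in> carrier A" for n x
  proof (induction n)
    case 0
    then show ?case using that A.smult_l_null[of x] S.smult_l_null[of "h x"] h.hom_closed[OF that] by simp
  next
    case (Suc n)
    have 1: "int (Suc n) \<odot>\<^bsub>A\<^esub> x = int n \<odot>\<^bsub>A\<^esub> x \<oplus>\<^bsub>A\<^esub> x"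
      using A.smult_l_distr[of "int n" 1 x] A.smult_one[of x] that by (simp add: add.commute)
    have 2: "int (Suc n) \<odot>\<^bsub>int_algebra S\<^esub> h x = int n \<odot>\<^bsub>int_algebra S\<^esub> h x \<oplus>\<^bsub>int_algebra S\<^esub> h x"
      using S.smult_l_distr[of "int n" 1 "h x"] S.smult_one[of "h x"] h.hom_closed[OF that] by (simp add: add.commute)
    show ?case unfolding 1 2 using Suc that A.smult_closed[of "int n" x] h.hom_add[of "int n \<odot>\<^bsub>A\<^esub> x" x] by simp
  qed
  have "h (r \<odot>\<^bsub>A\<^esub> x) = r \<odot>\<^bsub>int_algebra S\<^esub> h x" if x: "x \<in> carrier A" for r x
  proof (cases r)
    case (nonneg n)
    then show ?thesis using nat x by simp
  next
    case (neg n)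

    show ?thesis
      using A.smult_l_minus[of "int (Suc n)" x] S.smult_l_minus[of "int (Suc n)" "h x"] nat[OF x, of "Suc n"]
        h.hom_closed[OF x] x A.smult_closed[of "int (Suc n)" x] h.hom_a_inv[of "int (Suc n) \<odot>\<^bsub>A\<^esub> x"]
      neg by (simp add: int_a_inv_eq)
  qed
  then show ?thesis using assms(3) by (simp add: alg_hom_def ring_hom_int_algebra)
qed

locale base_extension = cring K + A: nc_alg \<Z> A
  for K :: "('k, 'c) ring_scheme" and A :: "(int, 'a, 'd) module_scheme"
begin

abbreviation "AK \<equiv> base_change K A"
abbreviation "bc \<equiv> base_change_map K A"

sublocale T: tensor \<Z> A "int_algebra K"
  by (intro tensor.intro A.nc_alg_axioms nc_alg_int_algebra ring_axioms)

lemma AK_simps: "carrier AK = carrier T.T" "mult AK = mult T.T" "one AK = one T.T"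
  "zero AK = zero T.T" "add AK = add T.T"
  "c \<odot>\<^bsub>AK\<^esub> t = T.pt \<one>\<^bsub>A\<^esub> c \<otimes>\<^bsub>T.T\<^esub> t"
  by (simp_all add: base_change_def Let_def)

text \<open>The second factor is commutative, and the first component is the unit. This is what
  makes \<open>K\<close> act by scalars on the base change.\<close>

lemma pt_central:
  assumes "c \<in> carrier K" "t \<in> carrier T.T"
  shows "T.pt \<one>\<^bsub>A\<^esub> c \<otimes>\<^bsub>T.T\<^esub> t = t \<otimes>\<^bsub>T.T\<^esub> T.pt \<one>\<^bsub>A\<^esub> c"
  using assms(2)
proof (induction rule: T.tensor_induct)
  case (pure a b)
  then show ?case using assms by (simp add: T.pt_mult m_comm)
next
  case (add x y)
  then show ?case using assms by (simp add: T.T.A.l_distr T.T.A.r_distr)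
qed

lemma nc_alg_base_change: "nc_alg K AK"
proof (rule nc_algI)
  show "ring AK" by (rule ring_cong[OF T.T.A.ring_axioms]) (simp_all add: AK_simps)
  fix r x y assume a: "r \<in> carrier K" "x \<in> carrier AK" "y \<in> carrier AK"
  show "x \<otimes>\<^bsub>AK\<^esub> (r \<odot>\<^bsub>AK\<^esub> y) = r \<odot>\<^bsub>AK\<^esub> (x \<otimes>\<^bsub>AK\<^esub> y)"
    using a pt_central[of r x] by (simp add: AK_simps T.T.A.m_assoc[symmetric])
next
  fix r s x assume "r \<in> carrier K" "s \<in> carrier K" "x \<in> carrier AK"
  then show "(r \<oplus>\<^bsub>K\<^esub> s) \<odot>\<^bsub>AK\<^esub> x = r \<odot>\<^bsub>AK\<^esub> x \<oplus>\<^bsub>AK\<^esub> s \<odot>\<^bsub>AK\<^esub> x"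
    using T.pt_add_right[of "\<one>\<^bsub>A\<^esub>" r s] by (simp add: AK_simps T.T.A.l_distr)
next
  fix r s x assume "r \<in> carrier K" "s \<in> carrier K" "x \<in> carrier AK"
  then show "(r \<otimes>\<^bsub>K\<^esub> s) \<odot>\<^bsub>AK\<^esub> x = r \<odot>\<^bsub>AK\<^esub> (s \<odot>\<^bsub>AK\<^esub> x)"
    using T.pt_mult[of "\<one>\<^bsub>A\<^esub>" "\<one>\<^bsub>A\<^esub>" r s] by (simp add: AK_simps T.T.A.m_assoc[symmetric])
next
  fix x assume "x \<in> carrier AK"
  then show "\<one>\<^bsub>K\<^esub> \<odot>\<^bsub>AK\<^esub> x = x"
    using T.pt_one by (simp add: AK_simps)
qed (auto simp: is_cring AK_simps T.T.A.r_distr T.T.A.m_assoc)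

sublocale AK: nc_alg K AK by (rule nc_alg_base_change)

lemma bc_hom: "bc \<in> ring_hom A AK"
  unfolding base_change_map_def
  using T.pt_add_left[of _ _ "\<one>\<^bsub>K\<^esub>"] T.pt_mult[of _ _ "\<one>\<^bsub>K\<^esub>" "\<one>\<^bsub>K\<^esub>"] T.pt_one
  by (intro ring_hom_memI) (auto simp: AK_simps)

text \<open>A scalar \<open>c\<close> is sent to \<open>c\<close> times the unit. This is central in
  \<open>S\<close>, so it commutes with the image of \<open>\<alpha>\<close> as the universal
  property of the tensor product asks.\<close>

lemma base_change_universal:
  assumes S: "nc_alg K S" and \<alpha>: "\<alpha> \<in> ring_hom A S"
  shows "\<exists>h\<in>alg_hom K AK S. \<forall>a\<in>carrier A. h (bc a) = \<alpha> a"
proof -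
  interpret S: nc_alg K S by fact
  define \<beta> where "\<beta> = (\<lambda>c. c \<odot>\<^bsub>S\<^esub> \<one>\<^bsub>S\<^esub>)"
  have \<alpha>c: "\<alpha> a \<in> carrier S" if "a \<in> carrier A" for a using ring_hom_closed[OF \<alpha> that] .
  have "\<beta> \<in> ring_hom K S"
    unfolding \<beta>_def by (rule ring_hom_memI) (auto simp: S.smult_l_distr S.smult_mult_left S.smult_assoc1)
  then have "\<beta> \<in> ring_hom (int_algebra K) S" by (simp add: ring_hom_def)
  then have \<beta>': "\<beta> \<in> alg_hom \<Z> (int_algebra K) (int_algebra S)"
    using ring_hom_alg_hom_int[OF nc_alg_int_algebra[OF ring_axioms] S.A.ring_axioms] by simp
  have \<alpha>': "\<alpha> \<in> alg_hom \<Z> A (int_algebra S)"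
    using ring_hom_alg_hom_int[OF A.nc_alg_axioms S.A.ring_axioms \<alpha>] .
  have comm: "\<alpha> a \<otimes>\<^bsub>S\<^esub> \<beta> c = \<beta> c \<otimes>\<^bsub>S\<^esub> \<alpha> a" "\<alpha> a \<otimes>\<^bsub>S\<^esub> \<beta> c = c \<odot>\<^bsub>S\<^esub> \<alpha> a" if "a \<in> carrier A" "c \<in> carrier K" for a c
    using that \<alpha>c by (simp_all add: \<beta>_def S.smult_mult_left S.smult_mult_right)
  obtain h where h: "h \<in> alg_hom \<Z> T.T (int_algebra S)"
    "\<And>a c. a \<in> carrier A \<Longrightarrow> c \<in> carrier K \<Longrightarrow> h (T.pt a c) = \<alpha> a \<otimes>\<^bsub>S\<^esub> \<beta> c"
    using T.tensor_universal[OF nc_alg_int_algebra[OF S.A.ring_axioms] \<alpha>' \<beta>'] comm(1) by auto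
  note hh = alg_homD[OF h(1), simplified]
  have "h \<in> alg_hom K AK S"
  proof (rule alg_homI)
    fix c x assume c: "c \<in> carrier K" and x: "x \<in> carrier AK"
    have "h (T.pt \<one>\<^bsub>A\<^esub> c) = c \<odot>\<^bsub>S\<^esub> \<one>\<^bsub>S\<^esub>" using h(2)[of "\<one>\<^bsub>A\<^esub>" c] c comm(2)[of "\<one>\<^bsub>A\<^esub>" c] ring_hom_one[OF \<alpha>] by simp
    then show "h (c \<odot>\<^bsub>AK\<^esub> x) = c \<odot>\<^bsub>S\<^esub> h x" using c x hh(2,3) by (simp add: AK_simps S.smult_mult_left)
  qed (use hh in \<open>auto simp: AK_simps\<close>)
  moreover have "h (bc a) = \<alpha> a" if "a \<in> carrier A" for a
    using that h(2)[of a "\<one>\<^bsub>K\<^esub>"] comm(2)[of a "\<one>\<^bsub>K\<^esub>"] \<alpha>c by (simp add: base_change_map_def)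
  ultimately show ?thesis by blast
qed

end

section \<open>The braid relation\<close>

lemma (in abelian_group) diff_rearrange:
  assumes "a \<in> carrier G" "b \<in> carrier G" "c \<in> carrier G"
  shows "d \<in> carrier G \<Longrightarrow> (a \<ominus> b) \<ominus> (c \<ominus> d) = (a \<ominus> c) \<ominus> (b \<ominus> d)"
    and "d \<in> carrier G \<Longrightarrow> (a \<oplus> b) \<ominus> (c \<oplus> d) = (a \<ominus> c) \<oplus> (b \<ominus> d)"
    and "d \<in> carrier G \<Longrightarrow> (a \<oplus> b) \<ominus> (c \<oplus> d) = (b \<ominus> d) \<oplus> (a \<ominus> c)"
    and "d \<in> carrier G \<Longrightarrow> (a \<oplus> b) \<oplus> (c \<oplus> d) = (a \<oplus> c) \<oplus> (b \<oplus> d)"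
  using assms by (simp_all add: a_minus_def minus_add a_ac)

lemma (in abelian_group) diff_diff_cancel:
  assumes "a \<in> carrier G" "b \<in> carrier G" "c \<in> carrier G"
  shows "(a \<oplus> b \<ominus> c) \<ominus> (a \<ominus> c) = b"
proof -
  have "(a \<oplus> b \<ominus> c) \<ominus> (a \<ominus> c) = (b \<oplus> a \<ominus> a) \<ominus> (c \<ominus> c)"
    using assms diff_rearrange(1)[of "b \<oplus> a" c a c] by (simp add: a_comm)
  then show ?thesis using assms by (simp add: a_minus_def a_assoc r_neg)
qed

locale cox_hopf = coxeter I m + H: ring H
  for I :: "'i set" and m and H :: "('h, 'z) ring_scheme" (structure) +
  fixes s D :: "'i \<Rightarrow> 'h"
  assumes s_closed [simp]: "i \<in> I \<Longrightarrow> s i \<in> carrier H"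
    and D_closed [simp]: "i \<in> I \<Longrightarrow> D i \<in> carrier H"
    and s_sq: "i \<in> I \<Longrightarrow> s i \<otimes> s i = \<one>"
    and D_sq: "i \<in> I \<Longrightarrow> D i \<otimes> D i = D i"
    and s_D: "i \<in> I \<Longrightarrow> s i \<otimes> D i \<oplus> D i \<otimes> s i = s i \<ominus> \<one>"
    and s_rel: "i \<in> I \<Longrightarrow> j \<in> I \<Longrightarrow> wprod H s (concat (replicate (m i j) [i, j])) = \<one>"
begin

section \<open>Group elements and root elements in a ring with the given relations\<close>

abbreviation "h \<equiv> wprod H s"

lemma h_closed [simp]: "u \<in> lists I \<Longrightarrow> h u \<in> carrier H"
  by (rule H.wprod_closed[of s I]) auto

lemma h_append: "u \<in> lists I \<Longrightarrow> v \<in> lists I \<Longrightarrow> h (u @ v) = h u \<otimes> h v"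
  by (rule H.wprod_append[of s I]) auto

lemma h_Cons: "h (i # u) = s i \<otimes> h u"
  by (rule wprod_Cons)

lemma h_ceq: "u \<asymp> v \<Longrightarrow> h u = h v"
proof (induction rule: coxeter_eq.induct)
  case (rel u v i j)
  have "concat (replicate (m i j) [i, j]) \<in> lists I" using rel by (simp add: concat_replicate_alt_word)
  then show ?case using rel by (simp add: h_append s_rel)
qed auto

lemma h_rev: "u \<in> lists I \<Longrightarrow> h u \<otimes> h (rev u) = \<one>" "u \<in> lists I \<Longrightarrow> h (rev u) \<otimes> h u = \<one>"
  using h_ceq[OF ceq_append_rev] h_ceq[OF ceq_rev_append] by (simp_all add: h_append)

text \<open>The mixed relation multiplied by \<open>s i\<close> on the left. Here conjugation leaves
  the family of the D_s, and every correction term below goes back to this formula.\<close>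

lemma s_D_s: "i \<in> I \<Longrightarrow> s i \<otimes> D i \<otimes> s i = \<one> \<ominus> s i \<ominus> D i"
proof -
  assume i: "i \<in> I"
  have "s i \<otimes> (s i \<otimes> D i \<oplus> D i \<otimes> s i) = s i \<otimes> (s i \<ominus> \<one>)" using s_D i by simp
  moreover have "s i \<otimes> (s i \<otimes> D i \<oplus> D i \<otimes> s i) = D i \<oplus> s i \<otimes> D i \<otimes> s i"
    using i by (simp add: H.r_distr H.m_assoc[symmetric] s_sq)
  moreover have "s i \<otimes> (s i \<ominus> \<one>) = \<one> \<ominus> s i"
    using i by (simp add: a_minus_def H.r_distr s_sq H.r_minus)
  ultimately have e: "D i \<oplus> s i \<otimes> D i \<otimes> s i = \<one> \<ominus> s i" by simp
  have c: "s i \<otimes> D i \<otimes> s i \<in> carrier H" using i by simp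
  have "z = (D i \<oplus> z) \<ominus> D i" if "z \<in> carrier H" for z
    using i that H.a_comm[of "D i" z] by (simp add: a_minus_def H.a_assoc H.r_neg)
  from this[OF c] show ?thesis unfolding e .
qed

text \<open>The element attached to the root that is the image under \<open>v\<close> of the simple root of \<open>x\<close>.\<close>

definition Dr :: "'i list \<Rightarrow> 'i \<Rightarrow> 'h"
  where "Dr v x = (if pos v x then h v \<otimes> D x \<otimes> h (rev v)
    else \<one> \<ominus> h (v @ [x]) \<otimes> D x \<otimes> h (rev (v @ [x])))"

lemma Dr_closed [simp]: "v \<in> lists I \<Longrightarrow> x \<in> I \<Longrightarrow> Dr v x \<in> carrier H"
  unfolding Dr_def by simp

lemma Dr_ceq: "v \<asymp> w \<Longrightarrow> x \<in> I \<Longrightarrow> Dr v x = Dr w x"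
  using h_ceq[of v w] h_ceq[OF ceq_rev, of v w] h_ceq[OF ceq_append_right[of v w "[x]"]]
    h_ceq[OF ceq_rev[OF ceq_append_right[of v w "[x]"]]] pos_ceq[of v w x]
  by (simp add: Dr_def)

lemma conj_D_idem: "v \<in> lists I \<Longrightarrow> x \<in> I \<Longrightarrow>
    (h v \<otimes> D x \<otimes> h (rev v)) \<otimes> (h v \<otimes> D x \<otimes> h (rev v)) = h v \<otimes> D x \<otimes> h (rev v)"
proof -
  assume a: "v \<in> lists I" "x \<in> I"
  have "(h v \<otimes> D x \<otimes> h (rev v)) \<otimes> (h v \<otimes> D x \<otimes> h (rev v)) =
      h v \<otimes> D x \<otimes> (h (rev v) \<otimes> h v) \<otimes> (D x \<otimes> h (rev v))"
    using a by (simp add: H.m_assoc)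
  also have "\<dots> = h v \<otimes> (D x \<otimes> D x) \<otimes> h (rev v)" using a by (simp add: h_rev H.m_assoc)
  finally show ?thesis using a by (simp add: D_sq)
qed

text \<open>Appending \<open>x\<close> turns the root into its negative. A root and its negative
  thus carry complementary idempotents, whichever of the two is positive.\<close>

lemma Dr_snoc: "v \<in> lists I \<Longrightarrow> x \<in> I \<Longrightarrow> Dr (v @ [x]) x = \<one> \<ominus> Dr v x"
proof -
  assume a: "v \<in> lists I" "x \<in> I"
  have "v @ [x, x] \<asymp> v" using ceq_double[of x v "[]"] a by simp
  then have e: "h (v @ [x, x]) = h v" "h (x # x # rev v) = h (rev v)"
    using h_ceq ceq_rev[of "v @ [x, x]" v] by auto
  have c: "h (v @ [x]) \<otimes> D x \<otimes> h (x # rev v) \<in> carrier H" using a by simp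
  have "\<one> \<ominus> (\<one> \<ominus> h (v @ [x]) \<otimes> D x \<otimes> h (x # rev v)) = h (v @ [x]) \<otimes> D x \<otimes> h (x # rev v)"
    using c by algebra
  then show ?thesis using a pos_snoc_same[OF a] by (auto simp: Dr_def e)
qed

lemma Dr_idem: "v \<in> lists I \<Longrightarrow> x \<in> I \<Longrightarrow> Dr v x \<otimes> Dr v x = Dr v x"
proof -
  assume a: "v \<in> lists I" "x \<in> I"
  define y where "y = h (v @ [x]) \<otimes> D x \<otimes> h (rev (v @ [x]))"
  have y: "y \<in> carrier H" using a unfolding y_def by simp
  have "y \<otimes> y = y" unfolding y_def using conj_D_idem[of "v @ [x]" x] a by simp
  then have "y \<otimes> (\<one> \<ominus> y) = \<zero>" using y by (simp add: a_minus_def H.r_distr H.r_minus H.r_neg)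
  moreover have "(\<one> \<ominus> y) \<otimes> (\<one> \<ominus> y) = (\<one> \<ominus> y) \<ominus> y \<otimes> (\<one> \<ominus> y)"
    using y H.l_distr[of \<one> "\<ominus> y" "\<one> \<ominus> y"] by (simp add: a_minus_def H.l_minus)
  ultimately have "(\<one> \<ominus> y) \<otimes> (\<one> \<ominus> y) = \<one> \<ominus> y" using y by (simp add: a_minus_def)
  then show ?thesis unfolding Dr_def y_def[symmetric] using conj_D_idem a by simp
qed

lemma Dr_orth: "v \<in> lists I \<Longrightarrow> x \<in> I \<Longrightarrow> Dr v x \<otimes> Dr (v @ [x]) x = \<zero>"
proof -
  assume a: "v \<in> lists I" "x \<in> I"
  have "Dr v x \<otimes> (\<one> \<ominus> Dr v x) = Dr v x \<ominus> Dr v x \<otimes> Dr v x" using a by (simp add: a_minus_def H.r_distr H.r_minus)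
  then show ?thesis using a by (simp add: Dr_snoc Dr_idem a_minus_def H.r_neg)
qed

lemma Dr_conj:
  assumes "v \<in> lists I" "x \<in> I" "k \<in> I" "\<not> v @ [x] \<asymp> k # v"
  shows "s k \<otimes> Dr v x \<otimes> s k = Dr (k # v) x"
proof -
  have 1: "s k \<otimes> (h v \<otimes> D x \<otimes> h (rev v)) \<otimes> s k = h (k # v) \<otimes> D x \<otimes> h (rev (k # v))"
    using assms by (simp add: h_Cons h_append H.m_assoc)
  have 2: "s k \<otimes> (h (v @ [x]) \<otimes> D x \<otimes> h (rev (v @ [x]))) \<otimes> s k =
      h (k # v @ [x]) \<otimes> D x \<otimes> h (rev (k # v @ [x]))"
    using assms by (simp add: h_Cons h_append H.m_assoc)
  have 3: "s k \<otimes> (\<one> \<ominus> y) \<otimes> s k = \<one> \<ominus> s k \<otimes> y \<otimes> s k" if "y \<in> carrier H" for y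
    using that assms by (simp add: a_minus_def H.r_distr H.l_distr H.r_minus H.l_minus s_sq)
  show ?thesis
    unfolding Dr_def using assms 1 2 3[of "h (v @ [x]) \<otimes> D x \<otimes> h (rev (v @ [x]))"] by simp
qed

text \<open>Conjugates \<open>s_D_s\<close> by \<open>h v\<close>; in the crossing case the
  conjugate of \<open>s x\<close> is \<open>s k\<close>.\<close>

lemma conj_D_cross:
  assumes "v \<in> lists I" "x \<in> I" "k \<in> I" "v @ [x] \<asymp> k # v"
  shows "h (v @ [x]) \<otimes> D x \<otimes> h (rev (v @ [x])) = \<one> \<ominus> s k \<ominus> h v \<otimes> D x \<otimes> h (rev v)"
proof -
  have "v @ [x] @ rev v \<asymp> [k]"
    using ceq_append_right[OF assms(4), of "rev v"] ceq_append_left[OF ceq_append_rev[OF assms(1)], of "[k]"] assms(1,3)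
    by (auto intro: coxeter_eq.trans)
  then have sk: "h v \<otimes> s x \<otimes> h (rev v) = s k"
    using h_ceq[of "v @ [x] @ rev v" "[k]"] assms by (simp add: h_append h_Cons H.m_assoc)
  have "h (v @ [x]) \<otimes> D x \<otimes> h (rev (v @ [x])) = h v \<otimes> (s x \<otimes> D x \<otimes> s x) \<otimes> h (rev v)"
    using assms by (simp add: h_append h_Cons H.m_assoc)
  also have "\<dots> = h v \<otimes> h (rev v) \<ominus> h v \<otimes> s x \<otimes> h (rev v) \<ominus> h v \<otimes> D x \<otimes> h (rev v)"
    using assms by (simp add: s_D_s a_minus_def H.r_distr H.l_distr H.r_minus H.l_minus)
  finally show ?thesis using assms by (simp add: h_rev sk)
qed

text \<open>Here prepending \<open>k\<close> is the same as appending \<open>x\<close>, so the root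
  changes sign. The conjugate misses the idempotent of the new root by \<open>s k\<close>, with a
  sign that depends on the side from which the wall is crossed.\<close>

lemma Dr_conj_cross:
  assumes "v \<in> lists I" "x \<in> I" "k \<in> I" "v @ [x] \<asymp> k # v"
  shows "s k \<otimes> Dr v x \<otimes> s k = (if pos v x then Dr (k # v) x \<ominus> s k else Dr (k # v) x \<oplus> s k)"
proof -
  define y where "y = h v \<otimes> D x \<otimes> h (rev v)"
  define z where "z = h (v @ [x]) \<otimes> D x \<otimes> h (rev (v @ [x]))"
  have c: "y \<in> carrier H" "z \<in> carrier H" "s k \<in> carrier H" using assms by (simp_all add: y_def z_def)
  have z: "z = \<one> \<ominus> s k \<ominus> y" unfolding y_def z_def by (rule conj_D_cross[OF assms])
  have kv: "h (k # v) = h (v @ [x])" "h (rev (k # v)) = h (rev (v @ [x]))"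
    using h_ceq[OF assms(4)] h_ceq[OF ceq_rev[OF assms(4)]] by simp_all
  have "k # v @ [x] \<asymp> v" using assms by (subst ceq_Cons_iff) auto
  then have kvx: "h (k # v @ [x]) = h v" "h (rev (k # v @ [x])) = h (rev v)"
    using h_ceq h_ceq[OF ceq_rev] by blast+
  have sy: "s k \<otimes> y \<otimes> s k = z"
    unfolding y_def z_def kv[symmetric] using assms by (simp add: h_Cons h_append H.m_assoc)
  have "s k \<otimes> z \<otimes> s k = h (k # v @ [x]) \<otimes> D x \<otimes> h (rev (k # v @ [x]))"
    unfolding z_def using assms by (simp add: h_Cons h_append H.m_assoc)
  then have sz: "s k \<otimes> z \<otimes> s k = y" unfolding y_def kvx .
  show ?thesis
  proof (cases "pos v x")
    case True
    have "Dr v x = y" "Dr (k # v) x = \<one> \<ominus> y"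
      using True assms(4) kvx by (simp_all add: Dr_def y_def)
    moreover have "\<one> \<ominus> s k \<ominus> y = (\<one> \<ominus> y) \<ominus> s k" using c by algebra
    ultimately show ?thesis using True sy z by simp
  next
    case False
    have "Dr v x = \<one> \<ominus> z" "Dr (k # v) x = z"
      using False assms(4) kv by (simp_all add: Dr_def z_def)
    moreover have "s k \<otimes> (\<one> \<ominus> z) \<otimes> s k = \<one> \<ominus> s k \<otimes> z \<otimes> s k"
      using c assms by (simp add: a_minus_def H.r_distr H.l_distr H.r_minus H.l_minus s_sq)
    moreover have "\<one> \<ominus> y = (\<one> \<ominus> s k \<ominus> y) \<oplus> s k" using c by algebra
    ultimately show ?thesis using False sz z by simp
  qed
qed

end

subsection \<open>Generic Hecke operators\<close>

text \<open>
  A function \<open>f\<close> stands for the sum of all \<open>c\<^sup>e T\<^sub>u \<otimes> f (u, e)\<close>, where \<open>u\<close> runs over the words without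
  equal neighbours, which index a basis of the algebra given by the quadratic relations alone, and the
  \<open>c\<close> are two formal parameters. The operators \<open>TT x\<close> and \<open>CC x\<close> multiply by \<open>T\<^sub>x\<close> from the left and by
  the parameter of \<open>x\<close>. Keeping the parameters formal is what makes the coefficients of
  \<open>braid_defect\<close> elements of the integral algebra.
\<close>

type_synonym 'i hidx = "'i list \<times> (bool \<Rightarrow> nat)"

locale hecke_walk = cox_hopf I m H s D
  for I :: "'i set" and m and H :: "('h, 'z) ring_scheme" (structure) and s D +
  fixes cl :: "'i \<Rightarrow> bool"
begin

definition IX :: "'i hidx set"
  where "IX = {(u, e). u \<in> lists I \<and> distinct_adj u}"

definition CC :: "'i \<Rightarrow> ('i hidx \<Rightarrow> 'h) \<Rightarrow> 'i hidx \<Rightarrow> 'h"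
  where "CC x f = (\<lambda>(u, e). if e (cl x) = 0 then \<zero> else f (u, e(cl x := e (cl x) - 1)))"

text \<open>On basis elements this is T_x T_u = T_(xu) if \<open>u\<close> does not start with
  \<open>x\<close>, and T_x T_(xu) = (1 - c) T_u + c T_(xu). The definition collects the
  contributions to each single coefficient.\<close>

definition TT :: "'i \<Rightarrow> ('i hidx \<Rightarrow> 'h) \<Rightarrow> 'i hidx \<Rightarrow> 'h"
  where "TT x f = (\<lambda>(u, e). if (u, e) \<notin> IX then \<zero>
    else if u \<noteq> [] \<and> hd u = x then f (tl u, e) \<oplus> CC x f (u, e)
    else f (x # u, e) \<ominus> CC x f (x # u, e))"

text \<open>Left multiplication of \<open>h (rev v)\<close> by s_x = T_x - c D_x. Carrying D_x to
  the right past \<open>h (rev v)\<close> conjugates it by \<open>h v\<close>, which gives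
  \<open>Dr v x\<close> for a positive root. For a negative root \<open>Dr\<close> is chosen so that
  a step followed by its reverse is a scalar.\<close>

definition step :: "'i list \<Rightarrow> 'i \<Rightarrow> ('i hidx \<Rightarrow> 'h) \<Rightarrow> 'i hidx \<Rightarrow> 'h"
  where "step v x f = (\<lambda>p. TT x f p \<ominus> CC x (\<lambda>p. f p \<otimes> Dr v x) p)"

text \<open>The formal counterpart of multiplication by q = 1 - c.\<close>

definition QQ :: "'i \<Rightarrow> ('i hidx \<Rightarrow> 'h) \<Rightarrow> 'i hidx \<Rightarrow> 'h"
  where "QQ x f = (\<lambda>p. f p \<ominus> CC x f p)"

primrec walk :: "'i list \<Rightarrow> 'i list \<Rightarrow> ('i hidx \<Rightarrow> 'h) \<Rightarrow> 'i hidx \<Rightarrow> 'h"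
  where
    "walk v [] f = f"
  | "walk v (x # u) f = walk (v @ [x]) u (step v x f)"

definition supp_ok :: "('i hidx \<Rightarrow> 'h) \<Rightarrow> bool"
  where "supp_ok f \<longleftrightarrow> (\<forall>p. f p \<in> carrier H) \<and> (\<forall>p. p \<notin> IX \<longrightarrow> f p = \<zero>)"

lemma supp_okD [simp]: "supp_ok f \<Longrightarrow> f p \<in> carrier H"
  unfolding supp_ok_def by blast

lemma CC_closed: "(\<And>p. f p \<in> carrier H) \<Longrightarrow> CC x f p \<in> carrier H"
  by (auto simp: CC_def split: prod.splits)

lemma TT_closed: "(\<And>p. f p \<in> carrier H) \<Longrightarrow> TT x f p \<in> carrier H"
  using CC_closed[of f x] by (cases p) (simp add: TT_def)

lemma supp_okI: "(\<And>p. f p \<in> carrier H) \<Longrightarrow> (\<And>u e. (u, e) \<notin> IX \<Longrightarrow> f (u, e) = \<zero>) \<Longrightarrow> supp_ok f"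
  unfolding supp_ok_def by auto

lemma supp_ok_zero: "supp_ok f \<Longrightarrow> (u, e) \<notin> IX \<Longrightarrow> f (u, e) = \<zero>"
  unfolding supp_ok_def by blast

lemma CC_ok [simp]: "supp_ok f \<Longrightarrow> supp_ok (CC x f)"
  by (rule supp_okI) (auto simp: CC_closed, auto simp: CC_def IX_def supp_ok_zero)

lemma TT_ok [simp]: "supp_ok f \<Longrightarrow> supp_ok (TT x f)"
  by (rule supp_okI) (auto simp: TT_closed, auto simp: TT_def)

lemma mult_ok [simp]: "supp_ok f \<Longrightarrow> d \<in> carrier H \<Longrightarrow> supp_ok (\<lambda>p. f p \<otimes> d)"
  unfolding supp_ok_def by auto

lemma diff_ok [simp]: "supp_ok f \<Longrightarrow> supp_ok g \<Longrightarrow> supp_ok (\<lambda>p. f p \<ominus> g p)"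
  unfolding supp_ok_def by auto

lemma add_ok [simp]: "supp_ok f \<Longrightarrow> supp_ok g \<Longrightarrow> supp_ok (\<lambda>p. f p \<oplus> g p)"
  unfolding supp_ok_def by auto

lemma conj_ok [simp]: "supp_ok f \<Longrightarrow> k \<in> I \<Longrightarrow> supp_ok (\<lambda>p. s k \<otimes> f p \<otimes> s k)"
  unfolding supp_ok_def by auto

lemma step_ok [simp]: "supp_ok f \<Longrightarrow> v \<in> lists I \<Longrightarrow> x \<in> I \<Longrightarrow> supp_ok (step v x f)"
  unfolding step_def by simp

lemma QQ_ok [simp]: "supp_ok f \<Longrightarrow> supp_ok (QQ x f)"
  unfolding QQ_def by simp

lemma walk_ok [simp]: "supp_ok f \<Longrightarrow> v \<in> lists I \<Longrightarrow> u \<in> lists I \<Longrightarrow> supp_ok (walk v u f)"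
  by (induction u arbitrary: v f) auto

lemma CC_hom:
  assumes "\<phi> \<zero> = \<zero>"
  shows "CC x (\<lambda>p. \<phi> (f p)) = (\<lambda>p. \<phi> (CC x f p))"
  using assms by (auto simp: CC_def)

lemma CC_add: "CC x (\<lambda>p. f p \<oplus> g p) = (\<lambda>p. CC x f p \<oplus> CC x g p)"
  by (auto simp: CC_def)

lemma CC_diff: "CC x (\<lambda>p. f p \<ominus> g p) = (\<lambda>p. CC x f p \<ominus> CC x g p)"
  by (auto simp: CC_def a_minus_def)

lemma CC_CC: "CC x (CC y f) = CC y (CC x f)"
  by (cases "cl x = cl y") (auto simp: CC_def fun_upd_twist)

text \<open>\<open>TT\<close> and \<open>CC\<close> only add, subtract and move coefficients, so
  they commute with every additive map of the coefficients. Right multiplication, conjugation and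
  negation are the cases in use.\<close>

lemma TT_hom:
  assumes "supp_ok f" "\<And>a b. a \<in> carrier H \<Longrightarrow> b \<in> carrier H \<Longrightarrow> \<phi> (a \<oplus> b) = \<phi> a \<oplus> \<phi> b"
    "\<And>a. a \<in> carrier H \<Longrightarrow> \<phi> a \<in> carrier H"
  shows "TT x (\<lambda>p. \<phi> (f p)) = (\<lambda>p. \<phi> (TT x f p))" "CC x (\<lambda>p. \<phi> (f p)) = (\<lambda>p. \<phi> (CC x f p))"
proof -
  have z: "\<phi> \<zero> = \<zero>" using assms(2)[of \<zero> \<zero>] assms(3)[of \<zero>] by (simp add: H.add.r_cancel_one')
  have n: "\<phi> (\<ominus> a) = \<ominus> \<phi> a" if "a \<in> carrier H" for a
    using assms(2)[of a "\<ominus> a"] assms(3)[of a] assms(3)[of "\<ominus> a"] that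
    by (metis H.add.inv_closed H.minus_equality H.r_neg H.a_comm z)
  have d: "\<phi> (a \<ominus> b) = \<phi> a \<ominus> \<phi> b" if "a \<in> carrier H" "b \<in> carrier H" for a b
    using that assms(2)[of a "\<ominus> b"] n by (simp add: a_minus_def)
  show C: "CC x (\<lambda>p. \<phi> (f p)) = (\<lambda>p. \<phi> (CC x f p))" using CC_hom z .
  show "TT x (\<lambda>p. \<phi> (f p)) = (\<lambda>p. \<phi> (TT x f p))"
    unfolding TT_def C using assms CC_closed[of f x] by (auto simp: z d)
qed

lemma TT_mult: "supp_ok f \<Longrightarrow> d \<in> carrier H \<Longrightarrow> TT x (\<lambda>p. f p \<otimes> d) = (\<lambda>p. TT x f p \<otimes> d)"
  and CC_mult: "supp_ok f \<Longrightarrow> d \<in> carrier H \<Longrightarrow> CC x (\<lambda>p. f p \<otimes> d) = (\<lambda>p. CC x f p \<otimes> d)"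
  using TT_hom[where \<phi> = "\<lambda>a. a \<otimes> d"] by (auto simp: H.l_distr)

lemma TT_conj: "supp_ok f \<Longrightarrow> k \<in> I \<Longrightarrow> TT x (\<lambda>p. s k \<otimes> f p \<otimes> s k) = (\<lambda>p. s k \<otimes> TT x f p \<otimes> s k)"
  and CC_conj: "supp_ok f \<Longrightarrow> k \<in> I \<Longrightarrow> CC x (\<lambda>p. s k \<otimes> f p \<otimes> s k) = (\<lambda>p. s k \<otimes> CC x f p \<otimes> s k)"
  using TT_hom[where \<phi> = "\<lambda>a. s k \<otimes> a \<otimes> s k"] by (auto simp: H.l_distr H.r_distr)

lemma TT_add: "supp_ok f \<Longrightarrow> supp_ok g \<Longrightarrow> TT x (\<lambda>p. f p \<oplus> g p) = (\<lambda>p. TT x f p \<oplus> TT x g p)"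
proof (intro ext, clarify)
  fix u e assume f: "supp_ok f" "supp_ok g"
  have c: "CC x f p \<in> carrier H" "CC x g p \<in> carrier H" for p using CC_ok f supp_okD by blast+
  have "f (x # u, e) \<oplus> g (x # u, e) \<ominus> (CC x f (x # u, e) \<oplus> CC x g (x # u, e)) =
     (f (x # u, e) \<ominus> CC x f (x # u, e)) \<oplus> (g (x # u, e) \<ominus> CC x g (x # u, e))"
    using f c by (intro H.diff_rearrange) auto
  moreover have "f (tl u, e) \<oplus> g (tl u, e) \<oplus> (CC x f (u, e) \<oplus> CC x g (u, e)) =
     (f (tl u, e) \<oplus> CC x f (u, e)) \<oplus> (g (tl u, e) \<oplus> CC x g (u, e))"
    using f c by (intro H.diff_rearrange) auto
  ultimately show "TT x (\<lambda>p. f p \<oplus> g p) (u, e) = TT x f (u, e) \<oplus> TT x g (u, e)"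
    by (simp add: TT_def CC_add)
qed

lemma TT_neg: "supp_ok f \<Longrightarrow> TT x (\<lambda>p. \<ominus> f p) = (\<lambda>p. \<ominus> TT x f p)"
  using TT_hom(1)[where \<phi> = "\<lambda>a. \<ominus> a"] by (auto simp: H.minus_add)

lemma neg_ok [simp]: "supp_ok f \<Longrightarrow> supp_ok (\<lambda>p. \<ominus> f p)"
  unfolding supp_ok_def by auto

lemma TT_diff: "supp_ok f \<Longrightarrow> supp_ok g \<Longrightarrow> TT x (\<lambda>p. f p \<ominus> g p) = (\<lambda>p. TT x f p \<ominus> TT x g p)"
  using TT_add[of f "\<lambda>p. \<ominus> g p" x] TT_neg[of g x] by (simp add: a_minus_def)

lemma TT_CC: "TT x (CC y f) = CC y (TT x f)"
proof (intro ext, clarify)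
  fix u e
  have "CC x (CC y f) = CC y (CC x f)" by (rule CC_CC)
  then show "TT x (CC y f) (u, e) = CC y (TT x f) (u, e)"
    by (simp add: TT_def IX_def) (simp add: CC_def a_minus_def)
qed

lemma TT_Cons: "(x # u, e) \<in> IX \<Longrightarrow> TT x f (x # u, e) = f (u, e) \<oplus> CC x f (x # u, e)"
  and TT_other: "(u, e) \<in> IX \<Longrightarrow> \<not> (u \<noteq> [] \<and> hd u = x) \<Longrightarrow>
      TT x f (u, e) = f (x # u, e) \<ominus> CC x f (x # u, e)"
  by (auto simp: TT_def)

lemma IX_Cons_iff: "(x # u, e) \<in> IX \<longleftrightarrow> x \<in> I \<and> (u, e) \<in> IX \<and> \<not> (u \<noteq> [] \<and> hd u = x)"
  by (cases u) (auto simp: IX_def)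

text \<open>The quadratic relation T^2 = c T + (1 - c) for the formal operators, checked according
  to whether \<open>u\<close> starts with \<open>x\<close>.\<close>

lemma TT_TT:
  assumes f: "supp_ok f" and x: "x \<in> I"
  shows "TT x (TT x f) = (\<lambda>p. CC x (TT x f) p \<oplus> (f p \<ominus> CC x f p))"
proof (intro ext, clarify)
  fix u e
  have c: "f p \<in> carrier H" "CC x f p \<in> carrier H" "CC x (TT x f) p \<in> carrier H" "CC x (CC x f) p \<in> carrier H" for p
    using f by simp_all
  show "TT x (TT x f) (u, e) = CC x (TT x f) (u, e) \<oplus> (f (u, e) \<ominus> CC x f (u, e))"
  proof (cases "(u, e) \<in> IX")
    case False
    have "f (u, e) = \<zero>" "CC x f (u, e) = \<zero>" "CC x (TT x f) (u, e) = \<zero>" "TT x (TT x f) (u, e) = \<zero>"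
      using False f by (auto intro!: supp_ok_zero)
    then show ?thesis by (simp add: a_minus_def)
  next
    case True
    show ?thesis
    proof (cases "u \<noteq> [] \<and> hd u = x")
      case True2: True
      then obtain u' where u: "u = x # u'" by (cases u) auto
      have u': "(u', e) \<in> IX" "\<not> (u' \<noteq> [] \<and> hd u' = x)"
        using True unfolding u IX_Cons_iff by auto
      have "TT x (TT x f) (u, e) = (f (u, e) \<ominus> CC x f (u, e)) \<oplus> CC x (TT x f) (u, e)"
        using TT_Cons[of x u' e "TT x f"] True unfolding u by (simp only: TT_other[OF u'])
      then show ?thesis using c by (simp add: H.a_comm)
    next
      case False
      then have xu: "(x # u, e) \<in> IX" using True x unfolding IX_Cons_iff by blast
      have 1: "TT x f (x # u, e) = f (u, e) \<oplus> CC x f (x # u, e)"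
        by (rule TT_Cons[OF xu])
      have 2: "CC x (TT x f) (x # u, e) = CC x f (u, e) \<oplus> CC x (CC x f) (x # u, e)"
        using TT_Cons[OF xu, of "CC x f"] by (simp only: TT_CC)
      have 3: "CC x (TT x f) (u, e) = CC x f (x # u, e) \<ominus> CC x (CC x f) (x # u, e)"
        using TT_other[OF True False, of "CC x f"] by (simp only: TT_CC)
      show ?thesis
        unfolding TT_other[OF True False, of "TT x f"] 1 2 3
        using c by (intro H.diff_rearrange) auto
    qed
  qed
qed

text \<open>Write d and d' for the two root elements, acting on the right. As d' = 1 - d and d d' =
  0, the two steps compose to T^2 - c T (d + d') = T^2 - c T, and this is 1 - c.\<close>

lemma step_cancel:
  assumes f: "supp_ok f" and v: "v \<in> lists I" "x \<in> I"
  shows "step (v @ [x]) x (step v x f) = QQ x f"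
proof
  fix p
  define d d' where "d = Dr v x" and "d' = Dr (v @ [x]) x"
  have dc: "d \<in> carrier H" "d' \<in> carrier H" using v by (auto simp: d_def d'_def)
  have d': "d' = \<one> \<ominus> d" unfolding d_def d'_def using Dr_snoc v by simp
  have orth: "d \<otimes> d' = \<zero>" unfolding d_def d'_def using Dr_orth v by simp
  note oks = CC_ok TT_ok mult_ok[OF _ dc(1)] mult_ok[OF _ dc(2)] diff_ok f
  have 1: "TT x (step v x f) p = CC x (TT x f) p \<oplus> (f p \<ominus> CC x f p) \<ominus> CC x (TT x f) p \<otimes> d"
    unfolding step_def d_def[symmetric] using f dc
    by (simp add: TT_diff TT_CC TT_mult CC_mult TT_TT[OF f v(2)])
  have "CC x (\<lambda>p. step v x f p \<otimes> d') p = CC x (\<lambda>p. TT x f p \<ominus> TT x f p \<otimes> d) p"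
  proof -
    have "step v x f p \<otimes> d' = TT x f p \<ominus> TT x f p \<otimes> d" for p
    proof -
      have t: "TT x f p \<in> carrier H" "CC x f p \<in> carrier H" using f by simp_all
      have "step v x f p \<otimes> d' = TT x f p \<otimes> d' \<ominus> CC x f p \<otimes> (d \<otimes> d')"
        unfolding step_def d_def[symmetric] using f dc t
        by (simp add: CC_mult a_minus_def H.l_distr H.l_minus H.m_assoc)
      also have "\<dots> = TT x f p \<ominus> TT x f p \<otimes> d"
        unfolding orth unfolding d' using t dc by (simp add: a_minus_def H.r_distr H.r_minus)
      finally show ?thesis .
    qed
    then show ?thesis by simp
  qed
  also have "\<dots> = CC x (TT x f) p \<ominus> CC x (TT x f) p \<otimes> d"
    using f dc by (simp add: CC_diff CC_mult)
  finally have 2: "CC x (\<lambda>p. step v x f p \<otimes> d') p = CC x (TT x f) p \<ominus> CC x (TT x f) p \<otimes> d" .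
  have c: "CC x (TT x f) p \<in> carrier H" "f p \<in> carrier H" "CC x f p \<in> carrier H" "CC x (TT x f) p \<otimes> d \<in> carrier H"
    using f dc by simp_all
  have "step (v @ [x]) x (step v x f) p =
     (CC x (TT x f) p \<oplus> (f p \<ominus> CC x f p) \<ominus> CC x (TT x f) p \<otimes> d) \<ominus> (CC x (TT x f) p \<ominus> CC x (TT x f) p \<otimes> d)"
    using 1 2 unfolding step_def[of "v @ [x]"] d'_def by simp
  also have "\<dots> = f p \<ominus> CC x f p" using c by (intro H.diff_diff_cancel) auto
  finally show "step (v @ [x]) x (step v x f) p = QQ x f p" by (simp add: QQ_def)
qed

lemma step_diff:
  assumes "supp_ok f" "supp_ok g" "v \<in> lists I" "x \<in> I"
  shows "step v x (\<lambda>p. f p \<ominus> g p) = (\<lambda>p. step v x f p \<ominus> step v x g p)"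
proof
  fix p
  have "(\<lambda>p. (f p \<ominus> g p) \<otimes> Dr v x) = (\<lambda>p. f p \<otimes> Dr v x \<ominus> g p \<otimes> Dr v x)"
    using assms by (simp add: a_minus_def H.l_distr H.l_minus)
  then have "CC x (\<lambda>p. (f p \<ominus> g p) \<otimes> Dr v x) p = CC x f p \<otimes> Dr v x \<ominus> CC x g p \<otimes> Dr v x"
    using assms by (simp add: CC_mult CC_diff)
  moreover have "TT x f p \<in> carrier H" "TT x g p \<in> carrier H" "CC x f p \<otimes> Dr v x \<in> carrier H" "CC x g p \<otimes> Dr v x \<in> carrier H"
    using assms by simp_all
  then have "(TT x f p \<ominus> TT x g p) \<ominus> (CC x f p \<otimes> Dr v x \<ominus> CC x g p \<otimes> Dr v x) =
     (TT x f p \<ominus> CC x f p \<otimes> Dr v x) \<ominus> (TT x g p \<ominus> CC x g p \<otimes> Dr v x)" by (rule H.diff_rearrange)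
  ultimately show "step v x (\<lambda>p. f p \<ominus> g p) p = step v x f p \<ominus> step v x g p"
    using assms by (simp add: step_def TT_diff CC_mult)
qed

lemma step_add:
  assumes "supp_ok f" "supp_ok g" "v \<in> lists I" "x \<in> I"
  shows "step v x (\<lambda>p. f p \<oplus> g p) = (\<lambda>p. step v x f p \<oplus> step v x g p)"
proof
  fix p
  have "CC x (\<lambda>p. (f p \<oplus> g p) \<otimes> Dr v x) p = CC x f p \<otimes> Dr v x \<oplus> CC x g p \<otimes> Dr v x"
    using assms by (simp add: CC_mult CC_add H.l_distr)
  moreover have "TT x f p \<in> carrier H" "TT x g p \<in> carrier H" "CC x f p \<otimes> Dr v x \<in> carrier H" "CC x g p \<otimes> Dr v x \<in> carrier H"
    using assms by simp_all
  then have "(TT x f p \<oplus> TT x g p) \<ominus> (CC x f p \<otimes> Dr v x \<oplus> CC x g p \<otimes> Dr v x) =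
     (TT x f p \<ominus> CC x f p \<otimes> Dr v x) \<oplus> (TT x g p \<ominus> CC x g p \<otimes> Dr v x)" by (rule H.diff_rearrange)
  ultimately show "step v x (\<lambda>p. f p \<oplus> g p) p = step v x f p \<oplus> step v x g p"
    using assms by (simp add: step_def TT_add CC_mult)
qed

lemma step_CC: "supp_ok f \<Longrightarrow> v \<in> lists I \<Longrightarrow> x \<in> I \<Longrightarrow> step v x (CC y f) = CC y (step v x f)"
  by (simp add: step_def TT_CC CC_diff CC_mult CC_CC)

lemma step_QQ: "supp_ok f \<Longrightarrow> v \<in> lists I \<Longrightarrow> x \<in> I \<Longrightarrow> step v x (QQ y f) = QQ y (step v x f)"
  unfolding QQ_def by (simp add: step_diff step_CC)

section \<open>Linearity and round trips of walks\<close>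

lemma walk_append: "walk v (u @ w) f = walk (v @ u) w (walk v u f)"
  by (induction u arbitrary: v f) auto

lemma walk_ceq: "v \<asymp> w \<Longrightarrow> u \<in> lists I \<Longrightarrow> walk v u f = walk w u f"
proof (induction u arbitrary: v w f)
  case (Cons x u)
  have "step v x f = step w x f" using Dr_ceq[OF Cons.prems(1)] Cons.prems by (simp add: step_def)
  then show ?case using Cons.IH[OF ceq_append_right[OF Cons.prems(1), of "[x]"]] Cons.prems by simp
qed simp

lemma walk_diff: "supp_ok f \<Longrightarrow> supp_ok g \<Longrightarrow> v \<in> lists I \<Longrightarrow> u \<in> lists I \<Longrightarrow>
    walk v u (\<lambda>p. f p \<ominus> g p) = (\<lambda>p. walk v u f p \<ominus> walk v u g p)"
  by (induction u arbitrary: v f g) (auto simp: step_diff)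

lemma walk_add: "supp_ok f \<Longrightarrow> supp_ok g \<Longrightarrow> v \<in> lists I \<Longrightarrow> u \<in> lists I \<Longrightarrow>
    walk v u (\<lambda>p. f p \<oplus> g p) = (\<lambda>p. walk v u f p \<oplus> walk v u g p)"
  by (induction u arbitrary: v f g) (auto simp: step_add)

lemma walk_CC: "supp_ok f \<Longrightarrow> v \<in> lists I \<Longrightarrow> u \<in> lists I \<Longrightarrow> walk v u (CC y f) = CC y (walk v u f)"
  by (induction u arbitrary: v f) (auto simp: step_CC)

lemma walk_QQ: "supp_ok f \<Longrightarrow> v \<in> lists I \<Longrightarrow> u \<in> lists I \<Longrightarrow> walk v u (QQ y f) = QQ y (walk v u f)"
  by (induction u arbitrary: v f) (auto simp: step_QQ)

lemma walk_fold_QQ: "supp_ok f \<Longrightarrow> v \<in> lists I \<Longrightarrow> u \<in> lists I \<Longrightarrow>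
    walk v u (fold QQ w f) = fold QQ w (walk v u f)"
  by (induction w arbitrary: f) (auto simp: walk_QQ)

text \<open>The inner round trip returns to its starting point and is a scalar by induction. The
  outer letter then meets its own reverse.\<close>

lemma walk_cancel:
  "supp_ok f \<Longrightarrow> v \<in> lists I \<Longrightarrow> u \<in> lists I \<Longrightarrow> walk v (u @ rev u) f = fold QQ u f"
proof (induction u arbitrary: v f)
  case (Cons x u)
  have x: "x \<in> I" "u \<in> lists I" using Cons.prems by auto
  have "walk v ((x # u) @ rev (x # u)) f = walk (v @ [x]) ((u @ rev u) @ [x]) (step v x f)" by simp
  also have "\<dots> = walk (v @ [x] @ u @ rev u) [x] (fold QQ u (step v x f))"
    using Cons x by (subst walk_append) simp
  also have "\<dots> = walk (v @ [x]) [x] (fold QQ u (step v x f))"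
  proof (rule walk_ceq)
    show "v @ [x] @ u @ rev u \<asymp> v @ [x]"
      using ceq_append_left[OF ceq_append_rev[OF x(2)], of "v @ [x]"] x Cons.prems by simp
  qed (use x in simp)
  also have "\<dots> = fold QQ u (walk (v @ [x]) [x] (step v x f))"
    using Cons.prems x by (intro walk_fold_QQ) auto
  also have "\<dots> = fold QQ (x # u) f"
    using Cons.prems x by (simp add: step_cancel)
  finally show ?case .
qed simp

end

context hecke_walk
begin

subsection \<open>Conjugating a walk by a simple reflection\<close>

text \<open>Inserting the square of \<open>s k\<close> lets the conjugation act separately on the
  coefficient and on the root element. Away from the wall of \<open>k\<close> the latter just moves
  from \<open>v\<close> to \<open>k # v\<close>.\<close>

lemma conj_step:
  assumes f: "supp_ok f" and v: "v \<in> lists I" "x \<in> I" "k \<in> I" and nc: "\<not> v @ [x] \<asymp> k # v"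
  shows "(\<lambda>p. s k \<otimes> step v x f p \<otimes> s k) = step (k # v) x (\<lambda>p. s k \<otimes> f p \<otimes> s k)"
proof
  fix p
  let ?F = "\<lambda>p. s k \<otimes> f p \<otimes> s k"
  have t: "TT x f p \<in> carrier H" "CC x f p \<in> carrier H" using f by simp_all
  have "s k \<otimes> step v x f p \<otimes> s k = s k \<otimes> TT x f p \<otimes> s k \<ominus> s k \<otimes> (CC x f p \<otimes> Dr v x) \<otimes> s k"
    using f v t by (simp add: step_def CC_mult a_minus_def H.r_distr H.l_distr H.r_minus H.l_minus)
  also have "s k \<otimes> (CC x f p \<otimes> Dr v x) \<otimes> s k = s k \<otimes> CC x f p \<otimes> (s k \<otimes> s k) \<otimes> Dr v x \<otimes> s k"
    using t v by (simp add: s_sq H.m_assoc)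
  also have "\<dots> = (s k \<otimes> CC x f p \<otimes> s k) \<otimes> (s k \<otimes> Dr v x \<otimes> s k)"
    using t v by (simp only: H.m_assoc s_closed Dr_closed H.m_closed)
  also have "s k \<otimes> Dr v x \<otimes> s k = Dr (k # v) x" using Dr_conj v nc by blast
  finally show "s k \<otimes> step v x f p \<otimes> s k = step (k # v) x ?F p"
    using f v by (simp add: step_def TT_conj CC_conj CC_mult)
qed

text \<open>The same computation at the wall of \<open>k\<close>: the extra \<open>s k\<close> in
  \<open>Dr_conj_cross\<close> leaves a second term with \<open>s k\<close> at its right
  end.\<close>

lemma conj_step_cross:
  assumes f: "supp_ok f" and v: "v \<in> lists I" "x \<in> I" "k \<in> I" and cr: "v @ [x] \<asymp> k # v"
  defines "F \<equiv> \<lambda>p. s k \<otimes> f p \<otimes> s k"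
  shows "(\<lambda>p. s k \<otimes> step v x f p \<otimes> s k) = (\<lambda>p. if pos v x then step (k # v) x F p \<oplus> CC x F p \<otimes> s k
    else step (k # v) x F p \<ominus> CC x F p \<otimes> s k)"
proof
  fix p
  have F: "supp_ok F" unfolding F_def using f v by simp
  have t: "TT x f p \<in> carrier H" "CC x f p \<in> carrier H" "TT x F p \<in> carrier H" "CC x F p \<in> carrier H"
    using f F by simp_all
  have "s k \<otimes> step v x f p \<otimes> s k = s k \<otimes> TT x f p \<otimes> s k \<ominus> s k \<otimes> (CC x f p \<otimes> Dr v x) \<otimes> s k"
    using f v t by (simp add: step_def CC_mult a_minus_def H.r_distr H.l_distr H.r_minus H.l_minus)
  also have "s k \<otimes> (CC x f p \<otimes> Dr v x) \<otimes> s k = s k \<otimes> CC x f p \<otimes> (s k \<otimes> s k) \<otimes> Dr v x \<otimes> s k"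
    using t v by (simp add: s_sq H.m_assoc)
  also have "\<dots> = (s k \<otimes> CC x f p \<otimes> s k) \<otimes> (s k \<otimes> Dr v x \<otimes> s k)"
    using t v by (simp only: H.m_assoc s_closed Dr_closed H.m_closed)
  also have "s k \<otimes> CC x f p \<otimes> s k = CC x F p" unfolding F_def using f v by (simp add: CC_conj)
  also have "s k \<otimes> TT x f p \<otimes> s k = TT x F p" unfolding F_def using f v by (simp add: TT_conj)
  finally have e: "s k \<otimes> step v x f p \<otimes> s k = TT x F p \<ominus> CC x F p \<otimes> (s k \<otimes> Dr v x \<otimes> s k)" .
  have d: "Dr (k # v) x \<in> carrier H" using v by simp
  have st: "step (k # v) x F p = TT x F p \<ominus> CC x F p \<otimes> Dr (k # v) x"
    using F d by (simp add: step_def CC_mult)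
  show "s k \<otimes> step v x f p \<otimes> s k = (if pos v x then step (k # v) x F p \<oplus> CC x F p \<otimes> s k
    else step (k # v) x F p \<ominus> CC x F p \<otimes> s k)"
    unfolding e Dr_conj_cross[OF v cr] st using t d v
    by (simp add: a_minus_def H.r_distr H.r_minus H.minus_add H.a_assoc)
qed

text \<open>\<open>v @ [x] \<asymp> k # v\<close> means that the edge from \<open>v\<close> to
  \<open>v @ [x]\<close> crosses the wall of the reflection \<open>k\<close>. No edge of the walk
  may do so.\<close>

primrec nocross :: "'i \<Rightarrow> 'i list \<Rightarrow> 'i list \<Rightarrow> bool"
  where
    "nocross k v [] = True"
  | "nocross k v (x # u) = (\<not> v @ [x] \<asymp> k # v \<and> nocross k (v @ [x]) u)"

lemma nocrossI:
  "(\<And>q. q < length u \<Longrightarrow> \<not> v @ take (Suc q) u \<asymp> k # v @ take q u) \<Longrightarrow> nocross k v u"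
proof (induction u arbitrary: v)
  case (Cons x u)
  have "\<not> (v @ [x]) @ take (Suc q) u \<asymp> k # (v @ [x]) @ take q u" if "q < length u" for q
    using Cons.prems[of "Suc q"] that by simp
  then show ?case using Cons.IH[of "v @ [x]"] Cons.prems[of 0] by simp
qed simp

lemma conj_walk:
  "supp_ok f \<Longrightarrow> v \<in> lists I \<Longrightarrow> u \<in> lists I \<Longrightarrow> k \<in> I \<Longrightarrow> nocross k v u \<Longrightarrow>
    (\<lambda>p. s k \<otimes> walk v u f p \<otimes> s k) = walk (k # v) u (\<lambda>p. s k \<otimes> f p \<otimes> s k)"
proof (induction u arbitrary: v f)
  case (Cons x u)
  then show ?case using Cons.IH[of "step v x f" "v @ [x]"] conj_step[of f v x k] by simp
qed simp

text \<open>A factor \<open>s k\<close> at the right end of the coefficients can be carried past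
  later steps. It conjugates the root elements on its way, so the starting point changes from
  \<open>k # v\<close> to \<open>v\<close>.\<close>

lemma mult_step:
  assumes f: "supp_ok f" and v: "v \<in> lists I" "x \<in> I" "k \<in> I" and nc: "\<not> v @ [x] \<asymp> k # v"
  shows "step (k # v) x (\<lambda>p. f p \<otimes> s k) = (\<lambda>p. step v x f p \<otimes> s k)"
proof
  fix p
  have t: "TT x f p \<in> carrier H" "CC x f p \<in> carrier H" using f by simp_all
  have "s k \<otimes> Dr (k # v) x = s k \<otimes> (s k \<otimes> Dr v x \<otimes> s k)" using Dr_conj[OF v nc] by simp
  also have "\<dots> = (s k \<otimes> s k) \<otimes> Dr v x \<otimes> s k" using v by (simp add: H.m_assoc del: s_sq)
  finally have sd: "s k \<otimes> Dr (k # v) x = Dr v x \<otimes> s k" using v by (simp add: s_sq)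
  have "step (k # v) x (\<lambda>p. f p \<otimes> s k) p = TT x f p \<otimes> s k \<ominus> CC x f p \<otimes> (s k \<otimes> Dr (k # v) x)"
    using f v t by (simp add: step_def TT_mult CC_mult H.m_assoc)
  then show "step (k # v) x (\<lambda>p. f p \<otimes> s k) p = step v x f p \<otimes> s k"
    unfolding sd using f v t by (simp add: step_def CC_mult a_minus_def H.l_distr H.l_minus H.m_assoc)
qed

lemma mult_walk:
  "supp_ok f \<Longrightarrow> v \<in> lists I \<Longrightarrow> u \<in> lists I \<Longrightarrow> k \<in> I \<Longrightarrow> nocross k v u \<Longrightarrow>
    walk (k # v) u (\<lambda>p. f p \<otimes> s k) = (\<lambda>p. walk v u f p \<otimes> s k)"
proof (induction u arbitrary: v f)
  case (Cons x u)
  then show ?case using Cons.IH[of "step v x f" "v @ [x]"] mult_step[of f v x k] by simp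
qed simp

text \<open>The correction at the crossing ends in \<open>s k\<close>, which
  \<open>mult_walk\<close> moves past the remaining letters. Since \<open>v @ A @ [x]\<close> and
  \<open>k # v @ A\<close> are the same element, the remaining walk starts where the walk along
  \<open>A\<close> from \<open>k # v\<close> ended, so the correction is the walk with the letter
  \<open>x\<close> deleted.\<close>

lemma conj_walk_cross:
  assumes f: "supp_ok f" and l: "v \<in> lists I" "A \<in> lists I" "B \<in> lists I" "x \<in> I" "k \<in> I"
    and nc: "nocross k v A" "nocross k (v @ A @ [x]) B" and cr: "v @ A @ [x] \<asymp> k # v @ A"
  defines "F \<equiv> \<lambda>p. s k \<otimes> f p \<otimes> s k"
  shows "(\<lambda>p. s k \<otimes> walk v (A @ x # B) f p \<otimes> s k) =
    (\<lambda>p. if pos (v @ A) x then walk (k # v) (A @ x # B) F p \<oplus> CC x (walk (k # v) (A @ B) F) p \<otimes> s k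
      else walk (k # v) (A @ x # B) F p \<ominus> CC x (walk (k # v) (A @ B) F) p \<otimes> s k)"
proof -
  have F: "supp_ok F" unfolding F_def using f l by simp
  define g where "g = walk v A f"
  define G where "G = walk (k # v) A F"
  have g: "supp_ok g" unfolding g_def using f l by simp
  have G: "supp_ok G" unfolding G_def using F l by simp
  have gG: "(\<lambda>p. s k \<otimes> g p \<otimes> s k) = G"
    unfolding g_def G_def F_def using conj_walk[OF f l(1,2,5) nc(1)] .
  let ?w = "v @ A @ [x]"
  have w: "?w \<in> lists I" using l by simp
  have R: "walk (k # ?w) B (\<lambda>p. CC x G p \<otimes> s k) = (\<lambda>p. CC x (walk (k # v) (A @ B) F) p \<otimes> s k)"
  proof -
    have "walk (k # ?w) B (\<lambda>p. CC x G p \<otimes> s k) = (\<lambda>p. walk ?w B (CC x G) p \<otimes> s k)"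
      using mult_walk[of "CC x G" ?w B k] G w l nc(2) by simp
    also have "walk ?w B (CC x G) = CC x (walk ?w B G)" using G w l by (simp add: walk_CC)
    also have "walk ?w B G = walk (k # v @ A) B G" using walk_ceq[OF cr l(3)] .
    also have "\<dots> = walk (k # v) (A @ B) F" unfolding G_def by (simp add: walk_append)
    finally show ?thesis .
  qed
  have M: "walk (k # ?w) B (step (k # v @ A) x G) = walk (k # v) (A @ x # B) F"
    unfolding G_def by (simp add: walk_append)
  have "walk v (A @ x # B) f = walk ?w B (step (v @ A) x g)"
    unfolding g_def by (simp add: walk_append)
  then have "(\<lambda>p. s k \<otimes> walk v (A @ x # B) f p \<otimes> s k) =
      walk (k # ?w) B (\<lambda>p. s k \<otimes> step (v @ A) x g p \<otimes> s k)"
    using conj_walk[of "step (v @ A) x g" ?w B k] g l w nc(2) by simp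
  also have "(\<lambda>p. s k \<otimes> step (v @ A) x g p \<otimes> s k) =
      (\<lambda>p. if pos (v @ A) x then step (k # v @ A) x G p \<oplus> CC x G p \<otimes> s k
        else step (k # v @ A) x G p \<ominus> CC x G p \<otimes> s k)"
    using conj_step_cross[of g "v @ A" x k] g l cr unfolding gG by simp
  also have "walk (k # ?w) B \<dots> = (\<lambda>p. if pos (v @ A) x
      then walk (k # v) (A @ x # B) F p \<oplus> CC x (walk (k # v) (A @ B) F) p \<otimes> s k
      else walk (k # v) (A @ x # B) F p \<ominus> CC x (walk (k # v) (A @ B) F) p \<otimes> s k)"
  proof (cases "pos (v @ A) x")
    case True
    have "walk (k # ?w) B (\<lambda>p. step (k # v @ A) x G p \<oplus> CC x G p \<otimes> s k) =
      (\<lambda>p. walk (k # ?w) B (step (k # v @ A) x G) p \<oplus> walk (k # ?w) B (\<lambda>p. CC x G p \<otimes> s k) p)"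
      using G l by (intro walk_add) auto
    then show ?thesis unfolding R M using True by simp
  next
    case False
    have "walk (k # ?w) B (\<lambda>p. step (k # v @ A) x G p \<ominus> CC x G p \<otimes> s k) =
      (\<lambda>p. walk (k # ?w) B (step (k # v @ A) x G) p \<ominus> walk (k # ?w) B (\<lambda>p. CC x G p \<otimes> s k) p)"
      using G l by (intro walk_diff) auto
    then show ?thesis unfolding R M using False by simp
  qed
  finally show ?thesis .
qed

subsection \<open>The braid defect\<close>

definition one_f :: "'i hidx \<Rightarrow> 'h"
  where "one_f = delta H ([], \<lambda>_. 0) \<one>"

definition braid_defect :: "'i list \<Rightarrow> 'i \<Rightarrow> 'i \<Rightarrow> 'i hidx \<Rightarrow> 'h"
  where "braid_defect v x y = (\<lambda>p. walk v (alt_word (m x y) x y) one_f p \<ominus> walk v (alt_word (m x y) y x) one_f p)"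

lemma one_f_ok [simp]: "supp_ok one_f"
  by (rule supp_okI) (auto simp: one_f_def delta_def IX_def)

lemma conj_one_f: "k \<in> I \<Longrightarrow> (\<lambda>p. s k \<otimes> one_f p \<otimes> s k) = one_f"
  by (auto simp: one_f_def delta_def s_sq)

lemma CC_cong: "cl x = cl y \<Longrightarrow> CC x = CC y"
  by (auto simp: CC_def fun_eq_iff)

lemma QQ_cong: "cl x = cl y \<Longrightarrow> QQ x = QQ y"
proof -
  assume "cl x = cl y"
  then have "CC x = CC y" by (rule CC_cong)
  then show ?thesis by (simp add: QQ_def fun_eq_iff)
qed

lemma fold_QQ_alt_word: "cl x = cl y \<Longrightarrow> fold QQ (alt_word n x y) = fold QQ (alt_word n y x)"
proof (induction n)
  case (Suc n)
  have "QQ x = QQ y" using Suc.prems by (rule QQ_cong)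
  then show ?case using Suc.IH[OF Suc.prems] by simp
qed simp

lemma alt_word_palindrome: "alt_word (Suc p) x y @ rev (alt_word p x y) = alt_word (Suc (2 * p)) x y"
proof -
  have "alt_word (Suc p) x y @ rev (alt_word p x y) = rev (alt_word p x y @ rev (alt_word (Suc p) x y))"
    by (simp del: alt_word.simps)
  also have "\<dots> = alt_word (Suc (2 * p)) x y"
    unfolding alt_word_append_rev by (simp only: rev_alt_word) simp
  finally show ?thesis .
qed

text \<open>Moving the prefix to the other side shows that the wall crossed at step \<open>p\<close>
  is that of the palindrome of length 2 p + 1, conjugated by \<open>v\<close>. Crossings become
  statements about reflections.\<close>

lemma cross_root:
  assumes "v \<in> lists I" "x \<in> I" "y \<in> I"
  shows "v @ alt_word (Suc p) x y \<asymp> k # v @ alt_word p x y \<longleftrightarrow> v @ alt_word (Suc (2 * p)) x y \<asymp> k # v"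
proof -
  have "v @ alt_word (Suc (2 * p)) x y \<asymp> k # v \<longleftrightarrow> (v @ alt_word (Suc p) x y) @ rev (alt_word p x y) \<asymp> k # v"
    unfolding alt_word_palindrome[symmetric] by (simp only: append_assoc)
  also have "\<dots> \<longleftrightarrow> v @ alt_word (Suc p) x y \<asymp> (k # v) @ rev (rev (alt_word p x y))"
    using assms by (intro ceq_move_right) (simp_all del: alt_word.simps)
  finally show ?thesis by (simp del: alt_word.simps)
qed

text \<open>Both palindromes together form the relator of length 2 m, and a palindrome is its own
  inverse. So the two alternating words list the same reflections in opposite orders.\<close>

lemma alt_word_flip:
  assumes "x \<in> I" "y \<in> I" "p < m x y"
  shows "alt_word (Suc (2 * p)) x y \<asymp> alt_word (Suc (2 * (m x y - 1 - p))) y x"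
proof -
  have e: "2 * m x y = Suc (2 * p) + Suc (2 * (m x y - 1 - p))" using assms by simp
  have "alt_word (2 * m x y) x y =
      alt_word (Suc (2 * p)) x y @ alt_word (Suc (2 * (m x y - 1 - p))) y x"
    unfolding e alt_word_add[of "Suc (2 * p)"] by (simp del: alt_word.simps)
  then have "alt_word (Suc (2 * p)) x y @ alt_word (Suc (2 * (m x y - 1 - p))) y x \<asymp> []"
    using alt_word_relation[OF assms(1,2)] by metis
  then have "alt_word (Suc (2 * p)) x y \<asymp> [] @ rev (alt_word (Suc (2 * (m x y - 1 - p))) y x)"
    using assms by (subst (asm) ceq_move_right) (simp_all del: alt_word.simps)
  then show ?thesis unfolding rev_alt_word by simp
qed

text \<open>Two equal palindromes would make a shorter even alternating word trivial, against the
  exact order. Each reflection thus occurs only once in the list.\<close>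

lemma alt_word_odd_inj:
  assumes "x \<in> I" "y \<in> I" "x \<noteq> y" "alt_word (Suc (2 * p)) x y \<asymp> alt_word (Suc (2 * q)) x y"
    "p < m x y" "q < m x y"
  shows "p = q"
proof -
  have *: False if "p < q" "q < m x y" "alt_word (Suc (2 * p)) x y \<asymp> alt_word (Suc (2 * q)) x y" for p q
  proof -
    have e: "Suc (2 * q) = Suc (2 * p) + 2 * (q - p)" using that by simp
    have "alt_word (Suc (2 * q)) x y = alt_word (Suc (2 * p)) x y @ alt_word (2 * (q - p)) y x"
      unfolding e alt_word_add[of "Suc (2 * p)"] by (simp del: alt_word.simps)
    then have "alt_word (Suc (2 * p)) x y @ [] \<asymp> alt_word (Suc (2 * p)) x y @ alt_word (2 * (q - p)) y x"
      using that(3) by simp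
    then have "[] \<asymp> alt_word (2 * (q - p)) y x"
      using assms by (subst (asm) ceq_cancel_left) (simp_all del: alt_word.simps)
    then have "alt_word (2 * (q - p)) y x \<asymp> []" by (rule coxeter_eq.sym)
    moreover have "m y x = m x y" using assms m_sym by blast
    ultimately show False using alt_word_ne_Nil[of y x "q - p"] assms that by auto
  qed
  show ?thesis
  proof (rule ccontr)
    assume "p \<noteq> q"
    then consider "p < q" | "q < p" by linarith
    then show False using *[of p q] *[of q p] assms coxeter_eq.sym by cases blast+
  qed
qed

text \<open>The two crossing points differ by an alternating word \<open>u\<close> of length m - 1.
  It carries one simple root to another and keeps it positive, so both crossings happen from the
  same side.\<close>

lemma pos_opposite:
  assumes "v \<in> lists I" "x \<in> I" "y \<in> I" "x \<noteq> y" "p + p' + 1 = m x y"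
  shows "pos (v @ alt_word p' y x) (if even p' then y else x) = pos (v @ alt_word p x y) (if even p then x else y)"
proof -
  define a b where "a = (if even p then y else x)" and "b = (if even p then x else y)"
  define u where "u = alt_word (p + p') a b"
  define t where "t = (if even p' then y else x)"
  have ab: "a \<in> I" "b \<in> I" "a \<noteq> b" using assms by (auto simp: a_def b_def)
  have mab: "m a b = p + p' + 1" using assms m_sym by (auto simp: a_def b_def)
  have ul: "u \<in> lists I" using ab by (simp add: u_def)
  have ue: "u = rev (alt_word p x y) @ alt_word p' y x"
    unfolding u_def alt_word_add rev_alt_word by (auto simp: a_def b_def)
  have tn: "t = (if even (p + p') then a else b)" by (auto simp: t_def a_def b_def)
  have "u @ [t] = alt_word (m a b) a b"
    unfolding u_def tn alt_word_last2 mab by simp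
  moreover have "b # u = alt_word (m a b) b a" unfolding u_def mab by simp
  ultimately have c: "u @ [t] \<asymp> b # u" using alt_word_braid ab by simp
  have "pos u t" unfolding u_def tn using pos_alt_word[OF ab, of "p + p'"] mab by simp
  then have "pos ((v @ alt_word p x y) @ u) t = pos (v @ alt_word p x y) b"
    using pos_append_simple[OF c _ ul ab(2), of "v @ alt_word p x y"] assms by (simp add: t_def)
  moreover have "(v @ alt_word p x y) @ u \<asymp> v @ alt_word p' y x"
    unfolding ue
    using ceq_append_left[OF ceq_append_right[OF ceq_append_rev[of "alt_word p x y"], of "alt_word p' y x"] assms(1)] assms
    by simp
  ultimately show ?thesis using pos_ceq[of "(v @ alt_word p x y) @ u" "v @ alt_word p' y x" t] assms
    by (auto simp: t_def b_def)
qed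

text \<open>Without the crossing letter, one word runs along the prefix of length \<open>p\<close>,
  back again and then along \<open>g\<close>; the other runs along \<open>g\<close>, then along
  \<open>e\<close> and back. Round trips are scalars, so both are the walk along \<open>g\<close>
  with one factor 1 - c for each letter of the prefix or of \<open>e\<close>. For even
  \<open>n\<close> these two words coincide, and for odd \<open>n\<close> the two parameters
  do.\<close>

lemma walk_remainder_aux:
  assumes f: "supp_ok f" and w: "w \<in> lists I" "x \<in> I" "y \<in> I" and cl: "odd n \<Longrightarrow> cl x = cl y"
    and p: "p + p' + 1 = n" "p \<le> p'"
  shows "walk w (alt_word p x y @ drop (Suc p) (alt_word n x y)) f =
    walk w (alt_word p' y x @ drop (Suc p') (alt_word n y x)) f"
proof -
  define g where "g = alt_word (p' - p) y x"
  define e where "e = (if even (p' - p) then alt_word p y x else alt_word p x y)"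
  have l: "alt_word p x y \<in> lists I" "g \<in> lists I" "e \<in> lists I" using w by (auto simp: g_def e_def)
  have B: "drop (Suc p) (alt_word n x y) = rev (alt_word p x y) @ g"
  proof -
    have n: "n = Suc p + (p + (p' - p))" using p by simp
    show ?thesis unfolding n alt_word_add rev_alt_word g_def by (simp del: alt_word.simps)
  qed
  have p': "p' = (p' - p) + p" using p by simp
  have A': "alt_word p' y x = g @ e"
    by (subst p', subst alt_word_add) (auto simp: g_def e_def)
  have B': "drop (Suc p') (alt_word n y x) = rev e"
  proof -
    have n: "n = Suc p' + p" using p by simp
    have "even (p' - p) \<longleftrightarrow> even (p' + p)" using p by simp
    moreover have "drop (Suc p') (alt_word n y x) = (if even (Suc p') then alt_word p y x else alt_word p x y)"
      unfolding n alt_word_add by (simp del: alt_word.simps)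
    ultimately show ?thesis by (cases "even p"; cases "even p'") (simp_all add: e_def rev_alt_word)
  qed
  have "walk w (alt_word p x y @ rev (alt_word p x y) @ g) f =
      walk (w @ alt_word p x y @ rev (alt_word p x y)) g (fold QQ (alt_word p x y) f)"
    using walk_append[of w "alt_word p x y @ rev (alt_word p x y)" g f] walk_cancel[OF f w(1) l(1)] by simp
  also have "\<dots> = walk w g (fold QQ (alt_word p x y) f)"
    using ceq_append_left[OF ceq_append_rev[OF l(1)] w(1)] l by (intro walk_ceq) simp_all
  also have "\<dots> = fold QQ (alt_word p x y) (walk w g f)" using f w l by (intro walk_fold_QQ)
  also have "fold QQ (alt_word p x y) = fold QQ e"
  proof (cases "odd n")
    case True
    then show ?thesis using cl fold_QQ_alt_word by (auto simp: e_def)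
  next
    case False
    then have "odd (p' - p)" using p by auto
    then show ?thesis by (simp add: e_def)
  qed
  also have "fold QQ e (walk w g f) = walk (w @ g) (e @ rev e) (walk w g f)"
    using f w l by (intro walk_cancel[symmetric]) auto
  also have "\<dots> = walk w ((g @ e) @ rev e) f" using walk_append[of w g "e @ rev e" f] by simp
  finally show ?thesis unfolding B A' B' by simp
qed

lemma walk_remainder:
  assumes "supp_ok f" "w \<in> lists I" "x \<in> I" "y \<in> I" "odd n \<Longrightarrow> cl x = cl y" "p + p' + 1 = n"
  shows "CC (if even p then x else y) (walk w (alt_word p x y @ drop (Suc p) (alt_word n x y)) f) =
    CC (if even p' then y else x) (walk w (alt_word p' y x @ drop (Suc p') (alt_word n y x)) f)"
proof -
  have "CC (if even p then x else y) = CC (if even p' then y else x)"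
  proof (cases "odd n")
    case True
    then show ?thesis using CC_cong assms(5) by metis
  next
    case False
    then have "even p \<longleftrightarrow> odd p'" using assms(6) by auto
    then show ?thesis by simp
  qed
  moreover have "walk w (alt_word p x y @ drop (Suc p) (alt_word n x y)) f =
    walk w (alt_word p' y x @ drop (Suc p') (alt_word n y x)) f"
  proof (cases "p \<le> p'")
    case True
    then show ?thesis using walk_remainder_aux[of f w x y n p p'] assms by blast
  next
    case False
    then show ?thesis using walk_remainder_aux[of f w y x n p' p] assms by auto
  qed
  ultimately show ?thesis by simp
qed

lemma conj_braid_defect:
  assumes v: "v \<in> lists I" "x \<in> I" "y \<in> I" "x \<noteq> y" "k \<in> I"
    and cl: "odd (m x y) \<Longrightarrow> cl x = cl y"
  shows "s k \<otimes> braid_defect v x y p0 \<otimes> s k = braid_defect (k # v) x y p0"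
proof -
  define n where "n = m x y"
  define cr where "cr = (\<lambda>q a b. v @ alt_word (Suc q) a b \<asymp> k # v @ alt_word q a b)"
  have myx: "m y x = n" using v m_sym by (simp add: n_def)
  have flip: "cr q x y \<longleftrightarrow> cr (n - 1 - q) y x" if "q < n" for q
  proof -
    have "v @ alt_word (Suc (2 * q)) x y \<asymp> v @ alt_word (Suc (2 * (n - 1 - q))) y x"
      using ceq_append_left[OF alt_word_flip[of x y q] v(1)] v that unfolding n_def by blast
    then show ?thesis unfolding cr_def cross_root[OF v(1,2,3)] cross_root[OF v(1,3,2)]
      by (meson coxeter_eq.sym coxeter_eq.trans)
  qed
  have uniq: "q = q'" if "cr q a b" "cr q' a b" "q < n" "q' < n" "{a, b} = {x, y}" for q q' a b
  proof -
    have ab: "a \<in> I" "b \<in> I" "a \<noteq> b" "m a b = n" using that(5) v myx by (auto simp: doubleton_eq_iff n_def)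
    have "v @ alt_word (Suc (2 * q)) a b \<asymp> v @ alt_word (Suc (2 * q')) a b"
      using that(1,2) unfolding cr_def cross_root[OF v(1) ab(1,2)] by (meson coxeter_eq.sym coxeter_eq.trans)
    then have "alt_word (Suc (2 * q)) a b \<asymp> alt_word (Suc (2 * q')) a b"
      using ceq_cancel_left[OF v(1)] by blast
    then show ?thesis using alt_word_odd_inj[OF ab(1-3)] that ab by simp
  qed
  have nc: "nocross k (v @ alt_word a c d) (drop a (alt_word b c d))"
    if "\<And>q. a \<le> q \<Longrightarrow> q < b \<Longrightarrow> \<not> cr q c d" "a \<le> b" for a b c d
  proof (rule nocrossI)
    fix q assume q: "q < length (drop a (alt_word b c d))"
    have t: "(v @ alt_word a c d) @ take r (drop a (alt_word b c d)) = v @ alt_word (a + r) c d" if "a + r \<le> b" for r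
      using that take_add[of a r "alt_word b c d"] by (simp add: take_alt_word)
    show "\<not> (v @ alt_word a c d) @ take (Suc q) (drop a (alt_word b c d)) \<asymp>
        k # (v @ alt_word a c d) @ take q (drop a (alt_word b c d))"
      using that(1)[of "a + q"] q unfolding cr_def by (subst (1 2) t) auto
  qed
  have al: "alt_word n x y \<in> lists I" "alt_word n y x \<in> lists I" using v by auto
  have diff: "s k \<otimes> braid_defect v x y p0 \<otimes> s k =
      s k \<otimes> walk v (alt_word n x y) one_f p0 \<otimes> s k \<ominus> s k \<otimes> walk v (alt_word n y x) one_f p0 \<otimes> s k"
  proof -
    have "walk v (alt_word n x y) one_f p0 \<in> carrier H" "walk v (alt_word n y x) one_f p0 \<in> carrier H"
      using v al by simp_all
    then show ?thesis using v unfolding braid_defect_def n_def[symmetric]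
      by (simp add: a_minus_def H.r_distr H.l_distr H.r_minus H.l_minus)
  qed
  show ?thesis
  \<comment> \<open>Either no edge of the two walks crosses the wall of \<open>k\<close>, or exactly
    one edge of each walk does.\<close>
  proof (cases "\<exists>p<n. cr p x y")
    case False
    have "\<not> cr q y x" if "q < n" for q
      using flip[of "n - 1 - q"] False that by auto
    then have "nocross k v (alt_word n x y)" "nocross k v (alt_word n y x)"
      using nc[of 0 n x y] nc[of 0 n y x] False by auto
    then have "s k \<otimes> walk v (alt_word n x y) one_f p0 \<otimes> s k = walk (k # v) (alt_word n x y) one_f p0"
      "s k \<otimes> walk v (alt_word n y x) one_f p0 \<otimes> s k = walk (k # v) (alt_word n y x) one_f p0"
      using conj_walk[OF one_f_ok v(1) _ v(5)] conj_one_f[OF v(5)] al by (metis (no_types, lifting))+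
    then show ?thesis unfolding diff by (simp add: braid_defect_def n_def)
  next
    case True
    then obtain p where p: "p < n" "cr p x y" by blast
    define p' where "p' = n - 1 - p"
    have pp: "p + p' + 1 = n" using p by (simp add: p'_def)
    have p': "p' < n" "cr p' y x" using p flip pp by (auto simp: p'_def)
    have key: "(\<lambda>z. s k \<otimes> walk v (alt_word n c d) one_f z \<otimes> s k) =
      (\<lambda>z. if pos (v @ alt_word q c d) (if even q then c else d)
        then walk (k # v) (alt_word n c d) one_f z \<oplus>
          CC (if even q then c else d) (walk (k # v) (alt_word q c d @ drop (Suc q) (alt_word n c d)) one_f) z \<otimes> s k
        else walk (k # v) (alt_word n c d) one_f z \<ominus>
          CC (if even q then c else d) (walk (k # v) (alt_word q c d @ drop (Suc q) (alt_word n c d)) one_f) z \<otimes> s k)"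
      if q: "q < n" "cr q c d" "{c, d} = {x, y}" for q c d
    proof -
      have cd: "c \<in> I" "d \<in> I" using q(3) v by (auto simp: doubleton_eq_iff)
      let ?A = "alt_word q c d" and ?t = "if even q then c else d" and ?B = "drop (Suc q) (alt_word n c d)"
      have no: "\<not> cr r c d" if "r < n" "r \<noteq> q" for r using uniq[OF q(2) _ q(1) _ q(3)] that by blast
      have w: "alt_word n c d = ?A @ ?t # ?B"
      proof -
        have "alt_word n c d = take q (alt_word n c d) @ (alt_word n c d ! q) # ?B"
          using q(1) id_take_nth_drop[of q "alt_word n c d"] by simp
        then show ?thesis using q(1) by (simp add: take_alt_word nth_alt_word)
      qed
      have s: "?A @ [?t] = alt_word (Suc q) c d" by (simp only: alt_word_last2)
      have Bl: "?B \<in> lists I" using cd by (meson alt_word_in_lists in_lists_conv_set in_set_dropD)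
      have n1: "nocross k v ?A" using nc[of 0 q c d] no q(1) by simp
      have n2: "nocross k (v @ ?A @ [?t]) ?B"
        unfolding s using nc[of "Suc q" n c d] no q(1) by simp
      have cr': "v @ ?A @ [?t] \<asymp> k # v @ ?A" unfolding s using q(2) unfolding cr_def .
      show ?thesis
        using conj_walk_cross[OF one_f_ok v(1) _ Bl _ v(5) n1 n2 cr'] cd
        unfolding conj_one_f[OF v(5)] w[symmetric] by simp
    qed
    \<comment> \<open>The correction common to both words; \<open>R'\<close> identifies the two
      expressions for it, and \<open>\<eta>'\<close> their signs.\<close>
    define R where "R = CC (if even p then x else y) (walk (k # v) (alt_word p x y @ drop (Suc p) (alt_word n x y)) one_f) p0"
    have R': "CC (if even p' then y else x) (walk (k # v) (alt_word p' y x @ drop (Suc p') (alt_word n y x)) one_f) p0 = R"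
      unfolding R_def using walk_remainder[of one_f "k # v" x y n p p'] v cl pp by (simp add: n_def)
    define \<eta> where "\<eta> = pos (v @ alt_word p x y) (if even p then x else y)"
    have \<eta>': "pos (v @ alt_word p' y x) (if even p' then y else x) = \<eta>"
      unfolding \<eta>_def using pos_opposite[of v x y p p'] v pp by (simp add: n_def)
    define W1 W2 where "W1 = walk (k # v) (alt_word n x y) one_f p0" and "W2 = walk (k # v) (alt_word n y x) one_f p0"
    have c: "W1 \<in> carrier H" "W2 \<in> carrier H" "R \<otimes> s k \<in> carrier H"
    proof -
      have "drop (Suc p) (alt_word n x y) \<in> lists I" using al by (meson in_lists_conv_set in_set_dropD)
      then show "R \<otimes> s k \<in> carrier H" unfolding R_def using v by simp
    qed (use v al in \<open>simp_all add: W1_def W2_def\<close>)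
    have 1: "s k \<otimes> walk v (alt_word n x y) one_f p0 \<otimes> s k = (if \<eta> then W1 \<oplus> R \<otimes> s k else W1 \<ominus> R \<otimes> s k)"
      using fun_cong[OF key[OF p], of p0] unfolding \<eta>_def R_def W1_def by simp
    have 2: "s k \<otimes> walk v (alt_word n y x) one_f p0 \<otimes> s k = (if \<eta> then W2 \<oplus> R \<otimes> s k else W2 \<ominus> R \<otimes> s k)"
      using fun_cong[OF key[OF p'], of p0] unfolding \<eta>' R' W2_def by (simp add: insert_commute)
    have z: "R \<otimes> s k \<ominus> R \<otimes> s k = \<zero>" using c(3) by (simp add: a_minus_def H.r_neg)
    have "(W1 \<oplus> R \<otimes> s k) \<ominus> (W2 \<oplus> R \<otimes> s k) = W1 \<ominus> W2"
      using H.diff_rearrange(2)[OF c(1,3,2,3)] z c by simp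
    moreover have "(W1 \<ominus> R \<otimes> s k) \<ominus> (W2 \<ominus> R \<otimes> s k) = W1 \<ominus> W2"
      using H.diff_rearrange(1)[OF c(1,3,2,3)] z c by (simp add: a_minus_def)
    ultimately show ?thesis unfolding diff 1 2 by (simp add: braid_defect_def n_def W1_def W2_def)
  qed
qed

lemma braid_defect_ceq: "v \<asymp> w \<Longrightarrow> x \<in> I \<Longrightarrow> y \<in> I \<Longrightarrow> braid_defect v x y = braid_defect w x y"
  unfolding braid_defect_def using walk_ceq[of v w] by simp

lemma braid_defect_ok: "v \<in> lists I \<Longrightarrow> x \<in> I \<Longrightarrow> y \<in> I \<Longrightarrow> supp_ok (braid_defect v x y)"
  unfolding braid_defect_def by simp

lemma conj_braid_defect_word:
  assumes "u \<in> lists I" "v \<in> lists I" "x \<in> I" "y \<in> I" "x \<noteq> y" "odd (m x y) \<Longrightarrow> cl x = cl y"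
  shows "h u \<otimes> braid_defect v x y p \<otimes> h (rev u) = braid_defect (u @ v) x y p"
  using assms(1)
proof (induction u)
  case Nil
  have "braid_defect v x y p \<in> carrier H" using braid_defect_ok assms by simp
  then show ?case by simp
next
  case (Cons k u)
  have c: "braid_defect v x y p \<in> carrier H" using braid_defect_ok assms by simp
  have k: "k \<in> I" "u \<in> lists I" using Cons by auto
  have "h (k # u) \<otimes> braid_defect v x y p \<otimes> h (rev (k # u)) =
      s k \<otimes> (h u \<otimes> braid_defect v x y p \<otimes> h (rev u)) \<otimes> s k"
    using c k by (simp add: h_Cons h_append H.m_assoc)
  also have "\<dots> = braid_defect (k # u @ v) x y p"
    using Cons k assms conj_braid_defect[of "u @ v" x y k p] by simp
  finally show ?case by simp
qed

text \<open>The coefficients of a walk are built from root elements alone, without the group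
  elements. This is what puts the braid defect into the subalgebra generated by the D_s.\<close>

lemma walk_subring:
  assumes "subring B H" "\<And>v x. v \<in> lists I \<Longrightarrow> x \<in> I \<Longrightarrow> Dr v x \<in> B"
  shows "(\<And>p. f p \<in> B) \<Longrightarrow> v \<in> lists I \<Longrightarrow> u \<in> lists I \<Longrightarrow> walk v u f p \<in> B"
proof (induction u arbitrary: v f)
  case (Cons x u)
  note B = subringE[OF assms(1)]
  have dm: "a \<ominus> b \<in> B" if "a \<in> B" "b \<in> B" for a b using that B by (simp add: a_minus_def)
  have C: "CC x g q \<in> B" if "\<And>q. g q \<in> B" for g q using that B(2) by (cases q) (auto simp: CC_def)
  have "TT x f q \<in> B" for q using Cons.prems(1) C[of f] B dm by (cases q) (auto simp: TT_def)
  moreover have "CC x (\<lambda>p. f p \<otimes> Dr v x) q \<in> B" for q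
    using C[of "\<lambda>p. f p \<otimes> Dr v x"] Cons.prems B assms(2) by simp
  ultimately have "step v x f q \<in> B" for q unfolding step_def using dm by simp
  then show ?case using Cons.IH[of "step v x f" "v @ [x]"] Cons.prems by simp
next
  case Nil
  then show ?case using Nil(1)[of p] by simp
qed

lemma braid_defect_subring:
  assumes "subring B H" "\<And>v x. v \<in> lists I \<Longrightarrow> x \<in> I \<Longrightarrow> Dr v x \<in> B" "v \<in> lists I" "x \<in> I" "y \<in> I"
  shows "braid_defect v x y p \<in> B"
proof -
  note B = subringE[OF assms(1)]
  have o: "one_f q \<in> B" for q using B by (simp add: one_f_def delta_def)
  have "walk v (alt_word n a b) one_f p \<in> B" if "a \<in> I" "b \<in> I" for n a b
    by (rule walk_subring[OF assms(1)]) (use assms o that in auto)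
  from this[OF assms(4,5)] this[OF assms(5,4)]
  show ?thesis using B by (simp add: braid_defect_def a_minus_def)
qed

text \<open>
  Modulo an ideal containing the \<open>D i\<close>, a walk along positive roots from the identity only keeps the
  term in which every letter contributes its \<open>T\<close>; this is also its only term of full length.
\<close>

lemma walk_leading:
  assumes "ideal N H" "\<And>i. i \<in> I \<Longrightarrow> D i \<in> N"
  shows "w \<in> lists I \<Longrightarrow> distinct_adj w \<Longrightarrow> (\<And>q. q < length w \<Longrightarrow> pos (take q w) (w ! q)) \<Longrightarrow>
    (\<forall>u e. u \<noteq> rev w \<longrightarrow> walk [] w one_f (u, e) \<in> N) \<and>
    (\<forall>u e. length w \<le> length u \<longrightarrow> walk [] w one_f (u, e) = (if u = rev w \<and> e = (\<lambda>_. 0) then \<one> else \<zero>))"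
proof (induction w rule: rev_induct)
  case Nil
  interpret ideal N H by fact
  show ?case by (auto simp: one_f_def delta_def)
next
  case (snoc x w)
  interpret N: ideal N H by fact
  have x: "x \<in> I" "w \<in> lists I" using snoc.prems by auto
  have dw: "distinct_adj w" using snoc.prems by (auto simp: distinct_adj_append_iff)
  have posw: "pos (take q w) (w ! q)" if "q < length w" for q
    using snoc.prems(3)[of q] that by (simp add: nth_append)
  define f where "f = walk [] w one_f"
  have fok: "supp_ok f" unfolding f_def using x by simp
  have fN: "f (u, e) \<in> N" if "u \<noteq> rev w" for u e using snoc.IH x dw posw that unfolding f_def by blast
  have fl: "f (u, e) = (if u = rev w \<and> e = (\<lambda>_. 0) then \<one> else \<zero>)" if "length w \<le> length u" for u e
    using snoc.IH x dw posw that unfolding f_def by blast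
  have "pos w x" using snoc.prems(3)[of "length w"] by simp
  then have "Dr w x = h w \<otimes> D x \<otimes> h (rev w)" by (simp add: Dr_def)
  then have DN: "Dr w x \<in> N" using assms(2) x by (simp add: N.I_l_closed N.I_r_closed)
  have w: "walk [] (w @ [x]) one_f = step w x f" unfolding f_def by (simp add: walk_append)
  \<comment> \<open>\<open>rev w\<close> does not start with \<open>x\<close>, so the next letter
    lengthens the leading word and the quadratic relation does not interfere.\<close>
  have hdw: "rev w = [] \<or> hd (rev w) \<noteq> x"
    using snoc.prems(2) by (cases w rule: rev_cases) (auto simp: distinct_adj_append_iff)
  have dN: "a \<ominus> b \<in> N" if "a \<in> N" "b \<in> N" for a b using that by (simp add: a_minus_def)
  have CN: "CC x (\<lambda>p. f p \<otimes> Dr w x) (u, e) \<in> N" for u e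
    unfolding CC_def using DN fok by (auto intro: N.I_l_closed)
  have CfN: "CC x f (u, e) \<in> N" if "u \<noteq> rev w" for u e
    using fN[OF that] by (auto simp: CC_def)
  have TN: "TT x f (u, e) \<in> N" if u: "u \<noteq> rev (w @ [x])" for u e
  proof (cases "(u, e) \<in> IX")
    case True
    show ?thesis
    proof (cases "u \<noteq> [] \<and> hd u = x")
      case t: True
      then obtain u' where u': "u = x # u'" by (cases u) auto
      have "u' \<noteq> rev w" using u u' by auto
      moreover have "u \<noteq> rev w" using u' hdw by (metis list.sel(1) list.distinct(1))
      ultimately
      show ?thesis using TT_Cons[of x u' e f] True fN CfN unfolding u' by simp
    next
      case False
      have "x # u \<noteq> rev w" using hdw by (metis list.sel(1) list.distinct(1))
      then show ?thesis unfolding TT_other[OF True False] using fN CfN dN by simp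
    qed
  qed (simp add: TT_def)
  have 1: "step w x f (u, e) \<in> N" if "u \<noteq> rev (w @ [x])" for u e
    unfolding step_def using TN[OF that] CN dN by simp
  have 2: "step w x f (u, e) = (if u = rev (w @ [x]) \<and> e = (\<lambda>_. 0) then \<one> else \<zero>)"
    if u: "length (w @ [x]) \<le> length u" for u e
  proof -
    have z: "f (u', e') = \<zero>" if "length w < length u'" for u' e'
      using fl[of u' e'] that by auto
    have Cz: "CC x f (u', e) = \<zero>" "CC x (\<lambda>p. f p \<otimes> Dr w x) (u', e) = \<zero>" if "length w < length u'" for u'
      using z[OF that] x by (auto simp: CC_def)
    have lu: "length w < length u" using u by simp
    have "TT x f (u, e) = (if u = rev (w @ [x]) \<and> e = (\<lambda>_. 0) then \<one> else \<zero>)"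
    proof (cases "(u, e) \<in> IX")
      case True
      show ?thesis
      proof (cases "u \<noteq> [] \<and> hd u = x")
        case t: True
        then obtain u' where u': "u = x # u'" by (cases u) auto
        have "TT x f (u, e) = f (u', e)"
          using TT_Cons[of x u' e f] True Cz(1)[OF lu] fok unfolding u' by simp
        then show ?thesis using fl[of u' e] lu u' by auto
      next
        case False
        have "TT x f (u, e) = \<zero>"
          unfolding TT_other[OF True False] using z[of "x # u"] Cz(1)[of "x # u"] lu by (simp add: a_minus_def)
        then show ?thesis using False by auto
      qed
    next
      case False
      have "(rev (w @ [x]), e) \<in> IX"
        using snoc.prems x unfolding IX_def by (auto simp del: rev_append)
      then show ?thesis using False by (auto simp: TT_def)
    qed
    then show ?thesis unfolding step_def using Cz(2)[OF lu] by (auto simp: a_minus_def)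
  qed
  show ?case unfolding w using 1 2 by blast
qed

end

subsection \<open>Evaluating the formal parameters\<close>

text \<open>\<open>\<iota>\<close> carries the coefficients into a \<open>K\<close>-algebra,
  \<open>\<gamma>\<close> assigns values to the two formal parameters, and \<open>cl\<close> tells
  which parameter belongs to a letter. A braid relation involves only two letters, so two parameters
  are enough.\<close>

locale hecke_eval = hecke_walk I m H s D cl + A: nc_alg K A
  for I :: "'i set" and m and H :: "('h, 'z) ring_scheme" and s D cl
    and K :: "('k, 'c) ring_scheme" and A :: "('k, 'a, 'd) module_scheme" +
  fixes \<iota> :: "'h \<Rightarrow> 'a" and \<gamma> :: "bool \<Rightarrow> 'k"
  assumes \<iota>: "\<iota> \<in> ring_hom H A" and \<gamma> [simp]: "\<gamma> b \<in> carrier K"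
begin

definition T :: "'i \<Rightarrow> 'a"
  where "T x = \<iota> (s x) \<oplus>\<^bsub>A\<^esub> \<gamma> (cl x) \<odot>\<^bsub>A\<^esub> \<iota> (D x)"

definition cm :: "(bool \<Rightarrow> nat) \<Rightarrow> 'k"
  where "cm e = \<gamma> True [^]\<^bsub>K\<^esub> e True \<otimes>\<^bsub>K\<^esub> \<gamma> False [^]\<^bsub>K\<^esub> e False"

definition act :: "'i hidx \<Rightarrow> 'h \<Rightarrow> 'a"
  where "act = (\<lambda>(u, e) g. cm e \<odot>\<^bsub>A\<^esub> (wprod A T u \<otimes>\<^bsub>A\<^esub> \<iota> g))"

definition ev :: "('i hidx \<Rightarrow> 'h) \<Rightarrow> 'a"
  where "ev f = lin A H act f"

abbreviation "FS \<equiv> fsupp H IX"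

lemma \<iota>_closed [simp]: "g \<in> carrier H \<Longrightarrow> \<iota> g \<in> carrier A"
  using ring_hom_closed[OF \<iota>] .

lemma \<iota>_hom: "\<iota> \<one>\<^bsub>H\<^esub> = \<one>\<^bsub>A\<^esub>"
    "g \<in> carrier H \<Longrightarrow> g' \<in> carrier H \<Longrightarrow> \<iota> (g \<otimes>\<^bsub>H\<^esub> g') = \<iota> g \<otimes>\<^bsub>A\<^esub> \<iota> g'"
    "g \<in> carrier H \<Longrightarrow> g' \<in> carrier H \<Longrightarrow> \<iota> (g \<oplus>\<^bsub>H\<^esub> g') = \<iota> g \<oplus>\<^bsub>A\<^esub> \<iota> g'"
  using \<iota> by (auto simp: ring_hom_def)

lemma \<iota>_zero: "\<iota> \<zero>\<^bsub>H\<^esub> = \<zero>\<^bsub>A\<^esub>"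
  using ring_hom_zero[OF \<iota> H.ring_axioms A.A.ring_axioms] .

lemma \<iota>_diff: "g \<in> carrier H \<Longrightarrow> g' \<in> carrier H \<Longrightarrow> \<iota> (g \<ominus>\<^bsub>H\<^esub> g') = \<iota> g \<ominus>\<^bsub>A\<^esub> \<iota> g'"
  using ring_hom_diff[OF \<iota> H.ring_axioms A.A.ring_axioms] .

lemma T_closed [simp]: "x \<in> I \<Longrightarrow> T x \<in> carrier A"
  by (simp add: T_def)

lemma wT_closed [simp]: "u \<in> lists I \<Longrightarrow> wprod A T u \<in> carrier A"
  by (rule A.A.wprod_closed[of T I]) auto

lemma cm_closed [simp]: "cm e \<in> carrier K"
  by (simp add: cm_def)

lemma cm_Suc: "cm (e(b := Suc (e b))) = \<gamma> b \<otimes>\<^bsub>K\<^esub> cm e"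
  by (cases b) (auto simp: cm_def A.R.m_ac)

lemma cm_zero: "cm (\<lambda>_. 0) = \<one>\<^bsub>K\<^esub>"
  by (simp add: cm_def)

lemma IX_lists: "(u, e) \<in> IX \<Longrightarrow> u \<in> lists I"
  by (simp add: IX_def)

sublocale L: linear_extension H A IX act
proof unfold_locales
  fix p :: "'i hidx" and g assume p: "p \<in> IX" and g: "g \<in> carrier H"
  obtain u e where ue: "p = (u, e)" by (cases p)
  have u: "u \<in> lists I" using p ue IX_lists by blast
  show "act p g \<in> carrier A" using u g unfolding ue act_def by simp
  fix g' assume g': "g' \<in> carrier H"
  show "act p (g \<oplus>\<^bsub>H\<^esub> g') = act p g \<oplus>\<^bsub>A\<^esub> act p g'"
    using u g g' unfolding ue act_def by (simp add: \<iota>_hom A.A.r_distr A.smult_r_distr)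
qed

lemma FS_ok: "f \<in> FS \<Longrightarrow> supp_ok f"
  by (rule supp_okI) (auto simp: fsupp_def)

lemma CC_delta: "CC x (delta H (u, e) g) = delta H (u, e(cl x := Suc (e (cl x)))) g"
proof (intro ext, clarify)
  fix w and e' :: "bool \<Rightarrow> nat"
  let ?e = "e(cl x := Suc (e (cl x)))"
  show "CC x (delta H (u, e) g) (w, e') = delta H (u, ?e) g (w, e')"
  proof (cases "e' (cl x)")
    case 0
    then have "e' \<noteq> ?e" by (metis fun_upd_same nat.distinct(1))
    then show ?thesis using 0 by (simp add: CC_def delta_def)
  next
    case (Suc k)
    have "e'(cl x := k) = e \<longleftrightarrow> e' = ?e"
      using Suc by (metis fun_upd_same fun_upd_triv fun_upd_upd nat.inject)
    then show ?thesis using Suc by (simp add: CC_def delta_def)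
  qed
qed

lemma IX_upd: "(u, e) \<in> IX \<Longrightarrow> (u, e') \<in> IX"
  by (simp add: IX_def)

lemma TT_delta_up:
  assumes "(u, e) \<in> IX" "x \<in> I" "\<not> (u \<noteq> [] \<and> hd u = x)" "g \<in> carrier H"
  shows "TT x (delta H (u, e) g) = delta H (x # u, e) g"
proof (intro ext, clarify)
  fix w e'
  show "TT x (delta H (u, e) g) (w, e') = delta H (x # u, e) g (w, e')"
  proof (cases "(w, e') \<in> IX")
    case True
    show ?thesis
    proof (cases "w \<noteq> [] \<and> hd w = x")
      case t: True
      then obtain w' where w': "w = x # w'" by (cases w) auto
      have "w \<noteq> u" using t assms(3) by auto
      then have "CC x (delta H (u, e) g) (w, e') = \<zero>\<^bsub>H\<^esub>" unfolding CC_delta by (simp add: delta_def)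
      then show ?thesis using TT_Cons[of x w' e' "delta H (u, e) g"] True assms(4)
        unfolding w' by (auto simp: delta_def)
    next
      case False
      have "x # w \<noteq> u" "w \<noteq> x # u" using assms(3) False by auto
      then show ?thesis unfolding TT_other[OF True False] CC_delta by (simp add: delta_def a_minus_def)
    qed
  next
    case False
    have "(x # u, e) \<in> IX" using assms IX_Cons_iff by blast
    then have "(w, e') \<noteq> (x # u, e)" using False by auto
    then show ?thesis using False by (auto simp: TT_def delta_def)
  qed
qed

lemma TT_delta_down:
  assumes "(x # u, e) \<in> IX" "g \<in> carrier H"
  shows "TT x (delta H (x # u, e) g) =
    (\<lambda>p. delta H (u, e) g p \<ominus>\<^bsub>H\<^esub> CC x (delta H (u, e) g) p \<oplus>\<^bsub>H\<^esub> CC x (delta H (x # u, e) g) p)"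
proof (intro ext, clarify)
  fix w e'
  have u: "(u, e) \<in> IX" "\<not> (u \<noteq> [] \<and> hd u = x)" using assms IX_Cons_iff by blast+
  have out: "delta H (w, e) g (w', e') = \<zero>\<^bsub>H\<^esub>" if "w \<noteq> w'" for w w' e e' using that by (simp add: delta_def)
  show "TT x (delta H (x # u, e) g) (w, e') = delta H (u, e) g (w, e') \<ominus>\<^bsub>H\<^esub>
      CC x (delta H (u, e) g) (w, e') \<oplus>\<^bsub>H\<^esub> CC x (delta H (x # u, e) g) (w, e')"
  proof (cases "(w, e') \<in> IX")
    case True
    show ?thesis
    proof (cases "w \<noteq> [] \<and> hd w = x")
      case t: True
      then obtain w' where w': "w = x # w'" by (cases w) auto
      have "w' \<noteq> x # u" using True unfolding w' IX_Cons_iff by auto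
      moreover have "w \<noteq> u" using t u by auto
      moreover have "CC x (delta H (x # u, e) g) (w, e') \<in> carrier H"
        unfolding CC_delta using assms by (simp add: delta_def)
      ultimately show ?thesis using TT_Cons[of x w' e' "delta H (x # u, e) g"] True
        unfolding w' CC_delta[of x u] by (simp add: out a_minus_def)
    next
      case False
      have "w \<noteq> x # u" using False by auto
      moreover have "delta H (x # u, e) g (x # w, e') = delta H (u, e) g (w, e')" for e by (simp add: delta_def)
      moreover have "delta H (u, e) g (w, e') \<in> carrier H" for e using assms by (simp add: delta_def)
      ultimately show ?thesis unfolding TT_other[OF True False] CC_delta by (simp add: out)
    qed
  next
    case False
    have "w \<noteq> u" "w \<noteq> x # u" using False u assms IX_upd by blast+
    then show ?thesis unfolding CC_delta using False by (simp add: TT_def out a_minus_def)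
  qed
qed

lemma ev_delta: "(u, e) \<in> IX \<Longrightarrow> g \<in> carrier H \<Longrightarrow> ev (delta H (u, e) g) = cm e \<odot>\<^bsub>A\<^esub> (wprod A T u \<otimes>\<^bsub>A\<^esub> \<iota> g)"
  using L.lin_delta[of "(u, e)" g] by (simp add: ev_def act_def)

lemma ev_zero: "ev (\<lambda>_. \<zero>\<^bsub>H\<^esub>) = \<zero>\<^bsub>A\<^esub>"
  by (simp add: ev_def)

lemma ev_closed [simp]: "f \<in> FS \<Longrightarrow> ev f \<in> carrier A"
  by (simp add: ev_def)

lemma ev_add: "f \<in> FS \<Longrightarrow> g \<in> FS \<Longrightarrow> ev (\<lambda>p. f p \<oplus>\<^bsub>H\<^esub> g p) = ev f \<oplus>\<^bsub>A\<^esub> ev g"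
  unfolding ev_def by (rule L.lin_add)

lemma FS_neg: "f \<in> FS \<Longrightarrow> (\<lambda>p. \<ominus>\<^bsub>H\<^esub> f p) \<in> FS"
proof -
  assume f: "f \<in> FS"
  have "{p. \<ominus>\<^bsub>H\<^esub> f p \<noteq> \<zero>\<^bsub>H\<^esub>} \<subseteq> {p. f p \<noteq> \<zero>\<^bsub>H\<^esub>}" by auto
  then show ?thesis using f unfolding fsupp_def by (auto intro: finite_subset)
qed

lemma FS_diff: "f \<in> FS \<Longrightarrow> g \<in> FS \<Longrightarrow> (\<lambda>p. f p \<ominus>\<^bsub>H\<^esub> g p) \<in> FS"
  unfolding a_minus_def by (intro H.fsupp_add FS_neg)

lemma ev_diff: "f \<in> FS \<Longrightarrow> g \<in> FS \<Longrightarrow> ev (\<lambda>p. f p \<ominus>\<^bsub>H\<^esub> g p) = ev f \<ominus>\<^bsub>A\<^esub> ev g"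
proof -
  assume f: "f \<in> FS" and g: "g \<in> FS"
  have "(\<lambda>p. (f p \<ominus>\<^bsub>H\<^esub> g p) \<oplus>\<^bsub>H\<^esub> g p) = f"
    using FS_ok[OF f] FS_ok[OF g] by (simp add: a_minus_def H.a_assoc H.l_neg)
  then have e: "ev f = ev (\<lambda>p. f p \<ominus>\<^bsub>H\<^esub> g p) \<oplus>\<^bsub>A\<^esub> ev g"
    using ev_add[OF FS_diff[OF f g] g] by simp
  have "z = (z \<oplus>\<^bsub>A\<^esub> w) \<ominus>\<^bsub>A\<^esub> w" if "z \<in> carrier A" "w \<in> carrier A" for z w
    using that by (simp add: a_minus_def A.A.a_assoc A.A.r_neg)
  then show ?thesis unfolding e using FS_diff[OF f g] g by simp
qed

lemma FS_mult: "f \<in> FS \<Longrightarrow> d \<in> carrier H \<Longrightarrow> (\<lambda>p. f p \<otimes>\<^bsub>H\<^esub> d) \<in> FS"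
proof -
  assume f: "f \<in> FS" and d: "d \<in> carrier H"
  have "{p. f p \<otimes>\<^bsub>H\<^esub> d \<noteq> \<zero>\<^bsub>H\<^esub>} \<subseteq> {p. f p \<noteq> \<zero>\<^bsub>H\<^esub>}" using d by auto
  then show ?thesis using f d unfolding fsupp_def by (auto intro: finite_subset)
qed

lemma FS_CC: "f \<in> FS \<Longrightarrow> CC x f \<in> FS"
proof (induction rule: H.fsupp_induct)
  case zero
  have "CC x (\<lambda>_. \<zero>\<^bsub>H\<^esub>) = (\<lambda>_. \<zero>\<^bsub>H\<^esub>)" by (auto simp: CC_def)
  then show ?case by simp
next
  case (delta p g)
  then show ?case by (cases p) (auto simp: CC_delta IX_upd intro!: H.fsupp_delta)
next
  case (add f g)
  then show ?case by (simp add: CC_add H.fsupp_add)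
qed

lemma FS_TT: "f \<in> FS \<Longrightarrow> x \<in> I \<Longrightarrow> TT x f \<in> FS"
proof (induction rule: H.fsupp_induct)
  case zero
  have "TT x (\<lambda>_. \<zero>\<^bsub>H\<^esub>) = (\<lambda>_. \<zero>\<^bsub>H\<^esub>)" by (auto simp: TT_def CC_def a_minus_def)
  then show ?case by simp
next
  case (delta p g)
  obtain u e where p: "p = (u, e)" by (cases p)
  show ?case
  proof (cases "u \<noteq> [] \<and> hd u = x")
    case True
    then obtain u' where u': "u = x # u'" by (cases u) auto
    have i: "(u', e) \<in> IX" using delta IX_Cons_iff unfolding p u' by blast
    show ?thesis using delta i unfolding p u'
      by (simp add: TT_delta_down H.fsupp_add FS_diff FS_CC H.fsupp_delta)
  next
    case False
    then have "(x # u, e) \<in> IX" using delta IX_Cons_iff unfolding p by blast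
    then show ?thesis using delta False unfolding p by (simp add: TT_delta_up H.fsupp_delta)
  qed
next
  case (add f g)
  then show ?case using FS_ok by (simp add: TT_add H.fsupp_add)
qed

lemma ev_CC: "f \<in> FS \<Longrightarrow> ev (CC x f) = \<gamma> (cl x) \<odot>\<^bsub>A\<^esub> ev f"
proof (induction rule: H.fsupp_induct)
  case zero
  have "CC x (\<lambda>_. \<zero>\<^bsub>H\<^esub>) = (\<lambda>_. \<zero>\<^bsub>H\<^esub>)" by (auto simp: CC_def)
  then show ?case by (simp add: ev_zero)
next
  case (delta p g)
  obtain u e where p: "p = (u, e)" by (cases p)
  have u: "u \<in> lists I" using delta p IX_lists by blast
  show ?case using delta u unfolding p
    by (simp add: CC_delta ev_delta IX_upd[of u e] cm_Suc A.smult_assoc1)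
next
  case (add f g)
  then show ?case by (simp add: CC_add ev_add FS_CC A.smult_r_distr)
qed

lemma ev_mult: "f \<in> FS \<Longrightarrow> d \<in> carrier H \<Longrightarrow> ev (\<lambda>p. f p \<otimes>\<^bsub>H\<^esub> d) = ev f \<otimes>\<^bsub>A\<^esub> \<iota> d"
proof (induction rule: H.fsupp_induct)
  case zero
  then show ?case by (simp add: ev_zero)
next
  case (delta p g)
  obtain u e where p: "p = (u, e)" by (cases p)
  have u: "u \<in> lists I" using delta p IX_lists by blast
  have "(\<lambda>q. delta H p g q \<otimes>\<^bsub>H\<^esub> d) = delta H p (g \<otimes>\<^bsub>H\<^esub> d)" using delta by (auto simp: delta_def)
  then show ?case using delta u unfolding p
    by (simp add: ev_delta \<iota>_hom A.smult_mult_left A.A.m_assoc)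
next
  case (add f g)
  have "(\<lambda>p. (f p \<oplus>\<^bsub>H\<^esub> g p) \<otimes>\<^bsub>H\<^esub> d) = (\<lambda>p. f p \<otimes>\<^bsub>H\<^esub> d \<oplus>\<^bsub>H\<^esub> g p \<otimes>\<^bsub>H\<^esub> d)"
    using add FS_ok by (simp add: H.l_distr)
  then show ?case using add by (simp add: ev_add FS_mult A.A.l_distr)
qed

text \<open>In the square, the mixed relation turns the cross terms c (s D + D s) into c (s - 1),
  and idempotence leaves c^2 D. Together with s^2 = 1 this regroups to 1 - c + c T.\<close>

lemma T_quadratic:
  assumes x: "x \<in> I"
  shows "T x \<otimes>\<^bsub>A\<^esub> T x = (\<one>\<^bsub>A\<^esub> \<ominus>\<^bsub>A\<^esub> \<gamma> (cl x) \<odot>\<^bsub>A\<^esub> \<one>\<^bsub>A\<^esub>) \<oplus>\<^bsub>A\<^esub> \<gamma> (cl x) \<odot>\<^bsub>A\<^esub> T x"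
proof -
  let ?c = "\<gamma> (cl x)" and ?s = "\<iota> (s x)" and ?d = "\<iota> (D x)"
  have c: "?s \<in> carrier A" "?d \<in> carrier A" using x by simp_all
  have ss: "?s \<otimes>\<^bsub>A\<^esub> ?s = \<one>\<^bsub>A\<^esub>" using x s_sq[OF x] \<iota>_hom(1) \<iota>_hom(2)[of "s x" "s x"] by simp
  have dd: "?d \<otimes>\<^bsub>A\<^esub> ?d = ?d" using x D_sq[OF x] \<iota>_hom(2)[of "D x" "D x"] by simp
  have sd: "?s \<otimes>\<^bsub>A\<^esub> ?d \<oplus>\<^bsub>A\<^esub> ?d \<otimes>\<^bsub>A\<^esub> ?s = ?s \<ominus>\<^bsub>A\<^esub> \<one>\<^bsub>A\<^esub>"
    using x s_D[OF x] \<iota>_hom(1) by (simp add: \<iota>_hom(2,3)[symmetric] \<iota>_diff[symmetric] flip: \<iota>_hom(1))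
  have "T x \<otimes>\<^bsub>A\<^esub> T x = (\<one>\<^bsub>A\<^esub> \<oplus>\<^bsub>A\<^esub> ?c \<odot>\<^bsub>A\<^esub> (?d \<otimes>\<^bsub>A\<^esub> ?s)) \<oplus>\<^bsub>A\<^esub> (?c \<odot>\<^bsub>A\<^esub> (?s \<otimes>\<^bsub>A\<^esub> ?d) \<oplus>\<^bsub>A\<^esub> ?c \<odot>\<^bsub>A\<^esub> (?c \<odot>\<^bsub>A\<^esub> ?d))"
    using c by (simp add: T_def A.A.l_distr A.A.r_distr A.smult_mult_left A.smult_mult_right A.smult_r_distr ss dd)
  also have "\<dots> = \<one>\<^bsub>A\<^esub> \<oplus>\<^bsub>A\<^esub> (?c \<odot>\<^bsub>A\<^esub> (?s \<otimes>\<^bsub>A\<^esub> ?d \<oplus>\<^bsub>A\<^esub> ?d \<otimes>\<^bsub>A\<^esub> ?s) \<oplus>\<^bsub>A\<^esub> ?c \<odot>\<^bsub>A\<^esub> (?c \<odot>\<^bsub>A\<^esub> ?d))"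
    using c by (simp add: A.smult_r_distr A.A.a_ac)
  also have "\<dots> = \<one>\<^bsub>A\<^esub> \<oplus>\<^bsub>A\<^esub> ((?c \<odot>\<^bsub>A\<^esub> ?s \<ominus>\<^bsub>A\<^esub> ?c \<odot>\<^bsub>A\<^esub> \<one>\<^bsub>A\<^esub>) \<oplus>\<^bsub>A\<^esub> ?c \<odot>\<^bsub>A\<^esub> (?c \<odot>\<^bsub>A\<^esub> ?d))"
    unfolding sd using c by (simp add: a_minus_def A.smult_r_distr A.smult_r_minus)
  also have "\<dots> = (\<one>\<^bsub>A\<^esub> \<ominus>\<^bsub>A\<^esub> ?c \<odot>\<^bsub>A\<^esub> \<one>\<^bsub>A\<^esub>) \<oplus>\<^bsub>A\<^esub> (?c \<odot>\<^bsub>A\<^esub> ?s \<oplus>\<^bsub>A\<^esub> ?c \<odot>\<^bsub>A\<^esub> (?c \<odot>\<^bsub>A\<^esub> ?d))"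
    using c by (simp add: a_minus_def A.A.a_ac)
  finally show ?thesis using c by (simp add: T_def A.smult_r_distr)
qed

text \<open>By additivity only basis elements matter. Where the word starts with \<open>x\<close>,
  the formal rule behind \<open>TT\<close> matches the quadratic relation of
  \<open>T x\<close>.\<close>

lemma ev_TT: "f \<in> FS \<Longrightarrow> x \<in> I \<Longrightarrow> ev (TT x f) = T x \<otimes>\<^bsub>A\<^esub> ev f"
proof (induction rule: H.fsupp_induct)
  case zero
  have "TT x (\<lambda>_. \<zero>\<^bsub>H\<^esub>) = (\<lambda>_. \<zero>\<^bsub>H\<^esub>)" by (auto simp: TT_def CC_def a_minus_def)
  then show ?case using zero by (simp add: ev_zero)
next
  case (delta p g)
  obtain u e where p: "p = (u, e)" by (cases p)
  have u: "u \<in> lists I" using delta p IX_lists by blast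
  show ?case
  proof (cases "u \<noteq> [] \<and> hd u = x")
    case True
    then obtain u' where u': "u = x # u'" by (cases u) auto
    have i: "(u', e) \<in> IX" "(x # u', e) \<in> IX" using delta IX_Cons_iff unfolding p u' by blast+
    have ul: "u' \<in> lists I" using u u' by simp
    let ?w = "wprod A T u' \<otimes>\<^bsub>A\<^esub> \<iota> g"
    have wc: "?w \<in> carrier A" using ul delta by simp
    have ev1: "ev (delta H (u', e) g) = cm e \<odot>\<^bsub>A\<^esub> ?w" using i delta by (simp add: ev_delta)
    have ev2: "ev (delta H (x # u', e) g) = cm e \<odot>\<^bsub>A\<^esub> (T x \<otimes>\<^bsub>A\<^esub> ?w)"
      using i delta ul by (simp add: ev_delta wprod_Cons A.A.m_assoc)
    have f1: "delta H (u', e) g \<in> FS" "delta H (x # u', e) g \<in> FS" using i delta by (auto intro: H.fsupp_delta)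
    have "ev (TT x (delta H p g)) = ev (delta H (u', e) g) \<ominus>\<^bsub>A\<^esub> \<gamma> (cl x) \<odot>\<^bsub>A\<^esub> ev (delta H (u', e) g)
        \<oplus>\<^bsub>A\<^esub> \<gamma> (cl x) \<odot>\<^bsub>A\<^esub> ev (delta H (x # u', e) g)"
      unfolding p u' TT_delta_down[OF i(2) delta(2)]
      using f1 by (simp add: ev_add ev_diff FS_diff FS_CC ev_CC)
    also have "\<dots> = cm e \<odot>\<^bsub>A\<^esub> ((\<one>\<^bsub>A\<^esub> \<ominus>\<^bsub>A\<^esub> \<gamma> (cl x) \<odot>\<^bsub>A\<^esub> \<one>\<^bsub>A\<^esub>) \<otimes>\<^bsub>A\<^esub> ?w \<oplus>\<^bsub>A\<^esub> \<gamma> (cl x) \<odot>\<^bsub>A\<^esub> (T x \<otimes>\<^bsub>A\<^esub> ?w))"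
    proof -
      have sw: "a \<odot>\<^bsub>A\<^esub> (b \<odot>\<^bsub>A\<^esub> z) = b \<odot>\<^bsub>A\<^esub> (a \<odot>\<^bsub>A\<^esub> z)" if "a \<in> carrier K" "b \<in> carrier K" "z \<in> carrier A" for a b z
        using that by (simp add: A.smult_assoc1[symmetric] A.R.m_comm)
      show ?thesis unfolding ev1 ev2 using wc delta
        by (simp add: a_minus_def A.A.l_distr A.A.l_minus A.smult_mult_left A.smult_r_distr A.smult_r_minus sw[of "cm e"])
    qed
    also have "\<dots> = cm e \<odot>\<^bsub>A\<^esub> ((T x \<otimes>\<^bsub>A\<^esub> T x) \<otimes>\<^bsub>A\<^esub> ?w)"
      unfolding T_quadratic[OF delta(3)] using wc delta by (simp add: A.A.l_distr A.smult_mult_left)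
    also have "\<dots> = T x \<otimes>\<^bsub>A\<^esub> ev (delta H p g)"
      unfolding p u' ev2 using wc delta by (simp add: A.smult_mult_right A.A.m_assoc)
    finally show ?thesis .
  next
    case False
    then have "(x # u, e) \<in> IX" using delta IX_Cons_iff unfolding p by blast
    then show ?thesis using delta False u unfolding p
      by (simp add: TT_delta_up ev_delta wprod_Cons A.smult_mult_right A.A.m_assoc)
  qed
next
  case (add f g)
  then show ?case using FS_ok by (simp add: TT_add ev_add FS_TT A.A.r_distr)
qed

lemma FS_step: "f \<in> FS \<Longrightarrow> v \<in> lists I \<Longrightarrow> x \<in> I \<Longrightarrow> step v x f \<in> FS"
  unfolding step_def by (intro FS_diff FS_TT FS_CC FS_mult) auto

lemma FS_walk: "f \<in> FS \<Longrightarrow> v \<in> lists I \<Longrightarrow> u \<in> lists I \<Longrightarrow> walk v u f \<in> FS"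
  by (induction u arbitrary: v f) (auto simp: FS_step)

lemma FS_one: "one_f \<in> FS"
  unfolding one_f_def by (rule H.fsupp_delta) (auto simp: IX_def)

text \<open>Along positive roots \<open>Dr w x\<close> is the true conjugate of \<open>D x\<close>,
  so carrying it back to the left of \<open>h (rev w)\<close> gives \<open>D x\<close>. A step then
  evaluates to multiplication by T_x - c D_x = s_x.\<close>

lemma ev_walk:
  "w \<in> lists I \<Longrightarrow> (\<And>q. q < length w \<Longrightarrow> pos (take q w) (w ! q)) \<Longrightarrow>
    ev (walk [] w one_f) = \<iota> (h (rev w))"
proof (induction w rule: rev_induct)
  case Nil
  have "([], \<lambda>_. 0) \<in> IX" by (simp add: IX_def)
  then show ?case by (simp add: one_f_def ev_delta cm_zero \<iota>_hom)
next
  case (snoc x w)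
  have x: "x \<in> I" "w \<in> lists I" using snoc.prems by auto
  have IH: "ev (walk [] w one_f) = \<iota> (h (rev w))"
    using snoc.IH x snoc.prems(2) by (metis append_eq_conv_conj butlast_snoc length_append_singleton less_Suc_eq nth_append take_append take_all less_imp_le diff_is_0_eq take_0 append_Nil2)
  have p: "pos w x" using snoc.prems(2)[of "length w"] by simp
  let ?f = "walk [] w one_f"
  have f: "?f \<in> FS" using FS_walk FS_one x by simp
  have Dr: "h (rev w) \<otimes>\<^bsub>H\<^esub> Dr w x = D x \<otimes>\<^bsub>H\<^esub> h (rev w)"
  proof -
    have "h (rev w) \<otimes>\<^bsub>H\<^esub> Dr w x = (h (rev w) \<otimes>\<^bsub>H\<^esub> h w) \<otimes>\<^bsub>H\<^esub> D x \<otimes>\<^bsub>H\<^esub> h (rev w)"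
      using p x by (simp add: Dr_def H.m_assoc)
    then show ?thesis using x by (simp add: h_rev)
  qed
  have "ev (walk [] (w @ [x]) one_f) = T x \<otimes>\<^bsub>A\<^esub> ev ?f \<ominus>\<^bsub>A\<^esub> \<gamma> (cl x) \<odot>\<^bsub>A\<^esub> (ev ?f \<otimes>\<^bsub>A\<^esub> \<iota> (Dr w x))"
    unfolding walk_append using f x
    by (simp add: step_def ev_diff FS_TT FS_CC FS_mult ev_TT ev_CC ev_mult)
  also have "ev ?f \<otimes>\<^bsub>A\<^esub> \<iota> (Dr w x) = \<iota> (D x) \<otimes>\<^bsub>A\<^esub> \<iota> (h (rev w))"
    unfolding IH using x by (simp add: \<iota>_hom(2)[symmetric] Dr)
  also have "T x \<otimes>\<^bsub>A\<^esub> ev ?f = \<iota> (s x) \<otimes>\<^bsub>A\<^esub> \<iota> (h (rev w)) \<oplus>\<^bsub>A\<^esub> \<gamma> (cl x) \<odot>\<^bsub>A\<^esub> (\<iota> (D x) \<otimes>\<^bsub>A\<^esub> \<iota> (h (rev w)))"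
    unfolding IH using x by (simp add: T_def A.A.l_distr A.smult_mult_left)
  also have "\<dots> \<ominus>\<^bsub>A\<^esub> \<gamma> (cl x) \<odot>\<^bsub>A\<^esub> (\<iota> (D x) \<otimes>\<^bsub>A\<^esub> \<iota> (h (rev w))) = \<iota> (s x) \<otimes>\<^bsub>A\<^esub> \<iota> (h (rev w))"
    using x by (simp add: a_minus_def A.A.a_assoc A.A.r_neg)
  finally show ?case using x by (simp add: h_Cons \<iota>_hom)
qed

lemma pos_alt_word_prefix:
  assumes "x \<in> I" "y \<in> I" "x \<noteq> y" "q < length (alt_word (m x y) x y)"
  shows "pos (take q (alt_word (m x y) x y)) (alt_word (m x y) x y ! q)"
  using assms pos_alt_word[of x y q] by (simp add: take_alt_word nth_alt_word)

theorem braid_relation: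
  assumes xy: "x \<in> I" "y \<in> I" "x \<noteq> y" and cl: "odd (m x y) \<Longrightarrow> cl x = cl y"
    and defect: "\<And>u e. length u < m x y \<Longrightarrow> \<iota> (braid_defect [] x y (u, e)) = \<zero>\<^bsub>A\<^esub>"
  shows "wprod A T (alt_word (m x y) x y) = wprod A T (alt_word (m x y) y x)"
proof -
  define n w1 w2 where "n = m x y" and "w1 = alt_word n x y" and "w2 = alt_word n y x"
  have myx: "m y x = n" using xy m_sym by (simp add: n_def)
  have wl: "w1 \<in> lists I" "w2 \<in> lists I" "length w1 = n" "length w2 = n" using xy by (simp_all add: w1_def w2_def)
  have da: "distinct_adj w1" "distinct_adj w2" using xy distinct_adj_alt_word unfolding w1_def w2_def by metis+
  have p1: "pos (take q w1) (w1 ! q)" if "q < length w1" for q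
    using pos_alt_word_prefix[OF xy] that unfolding w1_def n_def by simp
  have p2: "pos (take q w2) (w2 ! q)" if "q < length w2" for q
    using pos_alt_word_prefix[OF xy(2,1) xy(3)[symmetric]] that unfolding w2_def myx by simp
  have f: "walk [] w1 one_f \<in> FS" "walk [] w2 one_f \<in> FS" using FS_walk FS_one wl by simp_all
  define \<Gamma> where "\<Gamma> = braid_defect [] x y"
  have \<Gamma>: "\<Gamma> = (\<lambda>p. walk [] w1 one_f p \<ominus>\<^bsub>H\<^esub> walk [] w2 one_f p)"
    by (simp add: \<Gamma>_def braid_defect_def w1_def w2_def n_def)
  have \<Gamma>FS: "\<Gamma> \<in> FS" unfolding \<Gamma> using f by (rule FS_diff)
  have "rev w1 \<asymp> rev w2" using ceq_rev[OF alt_word_braid[OF xy(1,2)]] by (simp add: w1_def w2_def n_def)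
  then have hh: "h (rev w1) = h (rev w2)" by (rule h_ceq)
  have "ev (walk [] w1 one_f) = \<iota> (h (rev w1))" "ev (walk [] w2 one_f) = \<iota> (h (rev w2))"
    using ev_walk wl p1 p2 by blast+
  then have ev0: "ev \<Gamma> = \<zero>\<^bsub>A\<^esub>"
    unfolding \<Gamma> ev_diff[OF f] hh using wl by (simp add: a_minus_def A.A.r_neg)
  \<comment> \<open>The part of the defect on words shorter than the leading ones; the hypothesis
    kills it coefficient by coefficient.\<close>
  define R where "R = (\<lambda>p. if length (fst p) < n then \<Gamma> p else \<zero>\<^bsub>H\<^esub>)"
  have RFS: "R \<in> FS"
  proof -
    have "{p. R p \<noteq> \<zero>\<^bsub>H\<^esub>} \<subseteq> {p. \<Gamma> p \<noteq> \<zero>\<^bsub>H\<^esub>}" by (auto simp: R_def)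
    then show ?thesis using \<Gamma>FS unfolding fsupp_def R_def by (auto intro: finite_subset)
  qed
  have \<iota>R: "\<iota> (R p) = \<zero>\<^bsub>A\<^esub>" for p
    using defect[of "fst p" "snd p"] \<iota>_zero by (auto simp: R_def \<Gamma>_def n_def)
  have evR: "ev R = \<zero>\<^bsub>A\<^esub>"
    unfolding ev_def lin_def
  proof (rule A.A.add.finprod_one_eqI)
    fix p assume "p \<in> {p. R p \<noteq> \<zero>\<^bsub>H\<^esub>}"
    then have "p \<in> IX" using supp_ok_zero[OF FS_ok[OF RFS]] by (cases p) blast
    then show "act p (R p) = \<zero>\<^bsub>A\<^esub>" using \<iota>R[of p] IX_lists by (cases p) (auto simp: act_def)
  qed
  let ?d1 = "delta H (rev w1, \<lambda>_. 0) \<one>\<^bsub>H\<^esub>" and ?d2 = "delta H (rev w2, \<lambda>_. 0) \<one>\<^bsub>H\<^esub>"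
  have i: "(rev w1, \<lambda>_. 0) \<in> IX" "(rev w2, \<lambda>_. 0) \<in> IX" using wl da by (simp_all add: IX_def)
  have dFS: "?d1 \<in> FS" "?d2 \<in> FS" using i by (auto intro: H.fsupp_delta)
  have lead1: "walk [] w1 one_f (u, e) = ?d1 (u, e)" if "n \<le> length u" for u e
    using walk_leading[OF H.oneideal D_closed wl(1) da(1) p1] that wl by (simp add: delta_def)
  have lead2: "walk [] w2 one_f (u, e) = ?d2 (u, e)" if "n \<le> length u" for u e
    using walk_leading[OF H.oneideal D_closed wl(2) da(2) p2] that wl by (simp add: delta_def)
  have dec: "\<Gamma> = (\<lambda>p. (?d1 p \<ominus>\<^bsub>H\<^esub> ?d2 p) \<oplus>\<^bsub>H\<^esub> R p)"
  proof (intro ext, clarify)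
    fix u e
    show "\<Gamma> (u, e) = (?d1 (u, e) \<ominus>\<^bsub>H\<^esub> ?d2 (u, e)) \<oplus>\<^bsub>H\<^esub> R (u, e)"
    proof (cases "length u < n")
      case True
      then have "u \<noteq> rev w1" "u \<noteq> rev w2" using wl by auto
      moreover have "\<Gamma> (u, e) \<in> carrier H" using FS_ok[OF \<Gamma>FS] by simp
      ultimately show ?thesis using True by (simp add: R_def delta_def a_minus_def)
    next
      case False
      then have "\<Gamma> (u, e) = ?d1 (u, e) \<ominus>\<^bsub>H\<^esub> ?d2 (u, e)" unfolding \<Gamma> by (simp add: lead1 lead2)
      moreover have "?d1 (u, e) \<ominus>\<^bsub>H\<^esub> ?d2 (u, e) \<in> carrier H" by (simp add: delta_def)
      ultimately show ?thesis using False by (simp add: R_def)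
    qed
  qed
  have "ev \<Gamma> = (ev ?d1 \<ominus>\<^bsub>A\<^esub> ev ?d2) \<oplus>\<^bsub>A\<^esub> ev R"
    unfolding dec using dFS RFS by (simp add: ev_add ev_diff FS_diff)
  moreover have "ev ?d1 = wprod A T (rev w1)" "ev ?d2 = wprod A T (rev w2)"
    using ev_delta[OF i(1)] ev_delta[OF i(2)] wl by (simp_all add: cm_zero \<iota>_hom)
  ultimately have "wprod A T (rev w1) \<ominus>\<^bsub>A\<^esub> wprod A T (rev w2) = \<zero>\<^bsub>A\<^esub>"
    using ev0 evR wl by simp
  then have "wprod A T (rev w1) = wprod A T (rev w2)" using wl by (simp add: A.A.r_right_minus_eq)
  \<comment> \<open>A walk multiplies on the left, so the leading words come out reversed: unchanged
    for odd length, exchanged for even length.\<close>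
  then show ?thesis unfolding w1_def w2_def rev_alt_word n_def by (auto split: if_splits)
qed

end

section \<open>The regular representation\<close>

subsection \<open>Linear operators on a module of functions\<close>

text \<open>Operators act from the right: the product \<open>A B\<close> is \<open>A\<close> followed by \<open>B\<close>.\<close>

definition operators :: "('k, 'c) ring_scheme \<Rightarrow> ('x \<Rightarrow> 'k) set \<Rightarrow> ('k, ('x \<Rightarrow> 'k) \<Rightarrow> 'x \<Rightarrow> 'k) module"
  where "operators K V =
    \<lparr>carrier = {T \<in> extensional V. (\<forall>f\<in>V. T f \<in> V) \<and>
        (\<forall>f\<in>V. \<forall>g\<in>V. T (\<lambda>x. f x \<oplus>\<^bsub>K\<^esub> g x) = (\<lambda>x. T f x \<oplus>\<^bsub>K\<^esub> T g x)) \<and>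
        (\<forall>c\<in>carrier K. \<forall>f\<in>V. T (\<lambda>x. c \<otimes>\<^bsub>K\<^esub> f x) = (\<lambda>x. c \<otimes>\<^bsub>K\<^esub> T f x))},
     mult = (\<lambda>A B. restrict (\<lambda>f. B (A f)) V),
     one = restrict (\<lambda>f. f) V,
     zero = restrict (\<lambda>f x. \<zero>\<^bsub>K\<^esub>) V,
     add = (\<lambda>A B. restrict (\<lambda>f x. A f x \<oplus>\<^bsub>K\<^esub> B f x) V),
     smult = (\<lambda>c A. restrict (\<lambda>f x. c \<otimes>\<^bsub>K\<^esub> A f x) V)\<rparr>"

locale fun_module = cring K for K :: "('k, 'c) ring_scheme" (structure) +
  fixes V :: "('x \<Rightarrow> 'k) set"
  assumes V_carrier: "f \<in> V \<Longrightarrow> f x \<in> carrier K"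
    and V_zero: "(\<lambda>_. \<zero>) \<in> V"
    and V_add: "f \<in> V \<Longrightarrow> g \<in> V \<Longrightarrow> (\<lambda>x. f x \<oplus> g x) \<in> V"
    and V_smult: "c \<in> carrier K \<Longrightarrow> f \<in> V \<Longrightarrow> (\<lambda>x. c \<otimes> f x) \<in> V"
begin

abbreviation "E \<equiv> operators K V"

lemma operatorsI:
  assumes "T \<in> extensional V" "\<And>f. f \<in> V \<Longrightarrow> T f \<in> V"
    "\<And>f g. f \<in> V \<Longrightarrow> g \<in> V \<Longrightarrow> T (\<lambda>x. f x \<oplus> g x) = (\<lambda>x. T f x \<oplus> T g x)"
    "\<And>c f. c \<in> carrier K \<Longrightarrow> f \<in> V \<Longrightarrow> T (\<lambda>x. c \<otimes> f x) = (\<lambda>x. c \<otimes> T f x)"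
  shows "T \<in> carrier E"
  using assms by (simp add: operators_def)

lemma operatorsD:
  assumes "T \<in> carrier E"
  shows "T \<in> extensional V" "\<And>f. f \<in> V \<Longrightarrow> T f \<in> V"
    "\<And>f g. f \<in> V \<Longrightarrow> g \<in> V \<Longrightarrow> T (\<lambda>x. f x \<oplus> g x) = (\<lambda>x. T f x \<oplus> T g x)"
    "\<And>c f. c \<in> carrier K \<Longrightarrow> f \<in> V \<Longrightarrow> T (\<lambda>x. c \<otimes> f x) = (\<lambda>x. c \<otimes> T f x)"
  using assms by (simp_all add: operators_def)

lemma operators_eqI:
  "T \<in> carrier E \<Longrightarrow> T' \<in> carrier E \<Longrightarrow> (\<And>f. f \<in> V \<Longrightarrow> T f = T' f) \<Longrightarrow> T = T'"
  by (rule extensionalityI[of _ V]) (auto dest: operatorsD)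

lemma operators_ops:
  "f \<in> V \<Longrightarrow> (A \<otimes>\<^bsub>E\<^esub> B) f = B (A f)"
  "f \<in> V \<Longrightarrow> \<one>\<^bsub>E\<^esub> f = f"
  "f \<in> V \<Longrightarrow> \<zero>\<^bsub>E\<^esub> f = (\<lambda>x. \<zero>)"
  "f \<in> V \<Longrightarrow> (A \<oplus>\<^bsub>E\<^esub> B) f = (\<lambda>x. A f x \<oplus> B f x)"
  "f \<in> V \<Longrightarrow> (c \<odot>\<^bsub>E\<^esub> A) f = (\<lambda>x. c \<otimes> A f x)"
  by (simp_all add: operators_def)

lemma operators_ext:
  "A \<otimes>\<^bsub>E\<^esub> B \<in> extensional V" "\<one>\<^bsub>E\<^esub> \<in> extensional V" "\<zero>\<^bsub>E\<^esub> \<in> extensional V"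
  "A \<oplus>\<^bsub>E\<^esub> B \<in> extensional V" "c \<odot>\<^bsub>E\<^esub> A \<in> extensional V"
  by (simp_all add: operators_def)

lemma operators_closed:
  shows "A \<in> carrier E \<Longrightarrow> B \<in> carrier E \<Longrightarrow> A \<otimes>\<^bsub>E\<^esub> B \<in> carrier E"
    and "\<one>\<^bsub>E\<^esub> \<in> carrier E" and "\<zero>\<^bsub>E\<^esub> \<in> carrier E"
    and "A \<in> carrier E \<Longrightarrow> B \<in> carrier E \<Longrightarrow> A \<oplus>\<^bsub>E\<^esub> B \<in> carrier E"
    and "c \<in> carrier K \<Longrightarrow> A \<in> carrier E \<Longrightarrow> c \<odot>\<^bsub>E\<^esub> A \<in> carrier E"
proof -
  note c = V_carrier
  show "A \<otimes>\<^bsub>E\<^esub> B \<in> carrier E" if "A \<in> carrier E" "B \<in> carrier E"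
    using that[THEN operatorsD(2)] that[THEN operatorsD(3)] that[THEN operatorsD(4)]
    by (intro operatorsI operators_ext) (simp_all add: operators_ops V_add V_smult)
  show "\<one>\<^bsub>E\<^esub> \<in> carrier E" "\<zero>\<^bsub>E\<^esub> \<in> carrier E"
    by (intro operatorsI operators_ext; simp add: operators_ops V_add V_smult V_zero)+
  show "A \<oplus>\<^bsub>E\<^esub> B \<in> carrier E" if "A \<in> carrier E" "B \<in> carrier E"
    using that[THEN operatorsD(2)] that[THEN operatorsD(3)] that[THEN operatorsD(4)]
    by (intro operatorsI operators_ext)
      (simp_all add: operators_ops V_add V_smult c a_ac r_distr)
  show "c \<odot>\<^bsub>E\<^esub> A \<in> carrier E" if "c \<in> carrier K" "A \<in> carrier E"
    using that(1) operatorsD(2-4)[OF that(2)]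
    by (intro operatorsI operators_ext)
      (simp_all add: operators_ops V_add V_smult c r_distr m_lcomm)
qed

lemma nc_alg_operators: "nc_alg K E"
proof -
  note c = V_carrier and cl = operators_closed and d = operatorsD(2)
  have grp: "abelian_group E"
  proof (rule abelian_groupI)
    fix A assume A: "A \<in> carrier E"
    have "(\<ominus> \<one>) \<odot>\<^bsub>E\<^esub> A \<oplus>\<^bsub>E\<^esub> A = \<zero>\<^bsub>E\<^esub>"
      using A cl d[OF A] c by (intro operators_eqI) (auto simp: operators_ops l_minus l_neg)
    then show "\<exists>B\<in>carrier E. B \<oplus>\<^bsub>E\<^esub> A = \<zero>\<^bsub>E\<^esub>" using A cl(5) by blast
  next
    fix A B C assume a: "A \<in> carrier E" "B \<in> carrier E" "C \<in> carrier E"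
    show "A \<oplus>\<^bsub>E\<^esub> B \<oplus>\<^bsub>E\<^esub> C = A \<oplus>\<^bsub>E\<^esub> (B \<oplus>\<^bsub>E\<^esub> C)"
      using a cl a[THEN d] c by (intro operators_eqI) (auto simp: operators_ops a_assoc)
  next
    fix A B assume a: "A \<in> carrier E" "B \<in> carrier E"
    show "A \<oplus>\<^bsub>E\<^esub> B = B \<oplus>\<^bsub>E\<^esub> A"
      using a cl a[THEN d] c by (intro operators_eqI) (auto simp: operators_ops a_comm)
  next
    fix A assume a: "A \<in> carrier E"
    show "\<zero>\<^bsub>E\<^esub> \<oplus>\<^bsub>E\<^esub> A = A"
      using a cl a[THEN d] c by (intro operators_eqI) (auto simp: operators_ops)
  qed (simp_all add: cl)
  have mon: "Group.monoid E"
  proof (rule monoidI)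
    fix A B C assume a: "A \<in> carrier E" "B \<in> carrier E" "C \<in> carrier E"
    show "A \<otimes>\<^bsub>E\<^esub> B \<otimes>\<^bsub>E\<^esub> C = A \<otimes>\<^bsub>E\<^esub> (B \<otimes>\<^bsub>E\<^esub> C)"
      using a cl a[THEN d] by (intro operators_eqI) (auto simp: operators_ops)
  next
    fix A assume a: "A \<in> carrier E"
    show "\<one>\<^bsub>E\<^esub> \<otimes>\<^bsub>E\<^esub> A = A" "A \<otimes>\<^bsub>E\<^esub> \<one>\<^bsub>E\<^esub> = A"
      using a cl d[OF a] by (auto intro!: operators_eqI simp: operators_ops)
  qed (simp_all add: cl)
  have ring: "ring E"
  proof (rule ringI[OF grp mon])
    fix A B C assume a: "A \<in> carrier E" "B \<in> carrier E" "C \<in> carrier E"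
    show "(A \<oplus>\<^bsub>E\<^esub> B) \<otimes>\<^bsub>E\<^esub> C = A \<otimes>\<^bsub>E\<^esub> C \<oplus>\<^bsub>E\<^esub> B \<otimes>\<^bsub>E\<^esub> C"
      using a cl a[THEN d] operatorsD(3)[OF a(3)] by (intro operators_eqI) (auto simp: operators_ops)
    show "C \<otimes>\<^bsub>E\<^esub> (A \<oplus>\<^bsub>E\<^esub> B) = C \<otimes>\<^bsub>E\<^esub> A \<oplus>\<^bsub>E\<^esub> C \<otimes>\<^bsub>E\<^esub> B"
      using a cl a[THEN d] by (intro operators_eqI) (auto simp: operators_ops)
  qed
  show ?thesis
  proof (rule nc_algI[OF is_cring ring])
    fix r A B assume a: "r \<in> carrier K" "A \<in> carrier E" "B \<in> carrier E"
    note aa = a(2,3)[THEN d]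
    show "r \<odot>\<^bsub>E\<^esub> (A \<oplus>\<^bsub>E\<^esub> B) = r \<odot>\<^bsub>E\<^esub> A \<oplus>\<^bsub>E\<^esub> r \<odot>\<^bsub>E\<^esub> B"
      using a cl aa c by (intro operators_eqI) (auto simp: operators_ops r_distr)
    show "r \<odot>\<^bsub>E\<^esub> A \<otimes>\<^bsub>E\<^esub> B = r \<odot>\<^bsub>E\<^esub> (A \<otimes>\<^bsub>E\<^esub> B)"
      using a cl aa operatorsD(4)[OF a(3)] by (intro operators_eqI) (auto simp: operators_ops)
    show "A \<otimes>\<^bsub>E\<^esub> (r \<odot>\<^bsub>E\<^esub> B) = r \<odot>\<^bsub>E\<^esub> (A \<otimes>\<^bsub>E\<^esub> B)"
      using a cl aa by (intro operators_eqI) (auto simp: operators_ops)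
  next
    fix r s A assume a: "r \<in> carrier K" "s \<in> carrier K" "A \<in> carrier E"
    note aa = d[OF a(3)]
    show "(r \<oplus> s) \<odot>\<^bsub>E\<^esub> A = r \<odot>\<^bsub>E\<^esub> A \<oplus>\<^bsub>E\<^esub> s \<odot>\<^bsub>E\<^esub> A"
      using a cl aa c by (intro operators_eqI) (auto simp: operators_ops l_distr)
    show "(r \<otimes> s) \<odot>\<^bsub>E\<^esub> A = r \<odot>\<^bsub>E\<^esub> (s \<odot>\<^bsub>E\<^esub> A)"
      using a cl aa c by (intro operators_eqI) (auto simp: operators_ops m_assoc)
  next
    fix A assume a: "A \<in> carrier E"
    show "\<one> \<odot>\<^bsub>E\<^esub> A = A"
      using a cl d[OF a] c by (intro operators_eqI) (auto simp: operators_ops)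
  qed (simp_all add: cl)
qed

lemma operators_minus:
  assumes "A \<in> carrier E" "B \<in> carrier E" "f \<in> V"
  shows "(A \<ominus>\<^bsub>E\<^esub> B) f = (\<lambda>x. A f x \<ominus> B f x)"
proof -
  interpret E: nc_alg K E by (rule nc_alg_operators)
  have "\<ominus>\<^bsub>E\<^esub> B = (\<ominus> \<one>) \<odot>\<^bsub>E\<^esub> B" using assms E.smult_l_minus[of \<one> B] by simp
  then show ?thesis
    using assms V_carrier[OF operatorsD(2)[OF assms(2,3)]]
    by (simp add: a_minus_def[of E] operators_ops l_minus) (simp add: a_minus_def)
qed

end

subsection \<open>Functions on the Coxeter group\<close>

locale coxeter_functions = coxeter I m + K: cring K for I :: "'i set" and m and K :: "('k, 'c) ring_scheme"
begin

text \<open>Functions on the Coxeter group, lifted to words. The value zero outside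
  \<open>lists I\<close> makes equality of two such functions the same as equality on the
  group.\<close>

definition V :: "('i list \<Rightarrow> 'k) set"
  where "V = {F. (\<forall>v. F v \<in> carrier K) \<and> (\<forall>u v. u \<asymp> v \<longrightarrow> F u = F v) \<and> (\<forall>v. v \<notin> lists I \<longrightarrow> F v = \<zero>\<^bsub>K\<^esub>)}"

lemma V_simps:
  "F \<in> V \<Longrightarrow> F v \<in> carrier K" "F \<in> V \<Longrightarrow> u \<asymp> v \<Longrightarrow> F u = F v" "F \<in> V \<Longrightarrow> v \<notin> lists I \<Longrightarrow> F v = \<zero>\<^bsub>K\<^esub>"
  unfolding V_def by blast+

sublocale fun_module K V
proof unfold_locales
  fix f g :: "'i list \<Rightarrow> 'k" assume f: "f \<in> V" and g: "g \<in> V"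
  show "(\<lambda>x. f x \<oplus>\<^bsub>K\<^esub> g x) \<in> V" using f g unfolding V_def by fastforce
next
  fix c and f :: "'i list \<Rightarrow> 'k" assume c: "c \<in> carrier K" and f: "f \<in> V"
  show "(\<lambda>x. c \<otimes>\<^bsub>K\<^esub> f x) \<in> V" using c f unfolding V_def by fastforce
qed (auto simp: V_def)

sublocale E: nc_alg K E by (rule nc_alg_operators)

definition sop :: "'i \<Rightarrow> ('i list \<Rightarrow> 'k) \<Rightarrow> 'i list \<Rightarrow> 'k"
  where "sop i = restrict (\<lambda>F v. F (v @ [i])) V"

text \<open>D_i acts as 1 - s_i at the elements \<open>v\<close> that \<open>i\<close> shortens from
  the right, and as 0 at the others. With this cut-off every D_i, and likewise every D_s, gives 0
  when evaluated at the identity.\<close>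

definition dop :: "'i \<Rightarrow> ('i list \<Rightarrow> 'k) \<Rightarrow> 'i list \<Rightarrow> 'k"
  where "dop i = restrict (\<lambda>F v. if pos v i then \<zero>\<^bsub>K\<^esub> else F v \<ominus>\<^bsub>K\<^esub> F (v @ [i])) V"

lemma sop_closed [simp]: "i \<in> I \<Longrightarrow> sop i \<in> carrier E"
proof (rule operatorsI)
  assume i: "i \<in> I"
  fix F assume F: "F \<in> V"
  have "F (u @ [i]) = F (v @ [i])" if "u \<asymp> v" for u v
    using V_simps(2)[OF F ceq_append_right[OF that, of "[i]"]] i by simp
  then show "sop i F \<in> V" using F i by (auto simp: sop_def V_def)
qed (auto simp: sop_def V_add V_smult)

lemma dop_closed [simp]: "i \<in> I \<Longrightarrow> dop i \<in> carrier E"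
proof (rule operatorsI)
  assume i: "i \<in> I"
  fix F assume F: "F \<in> V"
  have "F (u @ [i]) = F (v @ [i])" if "u \<asymp> v" for u v
    using V_simps(2)[OF F ceq_append_right[OF that, of "[i]"]] i by simp
  then have 1: "dop i F u = dop i F v" if "u \<asymp> v" for u v
    using that pos_ceq[OF that i] F V_simps(2)[OF F that] by (simp add: dop_def)
  have 2: "dop i F v \<in> carrier K" for v using F V_simps(1)[OF F] by (simp add: dop_def)
  have 3: "dop i F v = \<zero>\<^bsub>K\<^esub>" if "v \<notin> lists I" for v
    using that F V_simps(3)[OF F, of v] V_simps(3)[OF F, of "v @ [i]"] by (simp add: dop_def a_minus_def)
  show "dop i F \<in> V" unfolding V_def using 1 2 3 by blast
next
  fix f g assume f: "f \<in> V" "g \<in> V"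
  have "f v \<oplus>\<^bsub>K\<^esub> g v \<ominus>\<^bsub>K\<^esub> (f w \<oplus>\<^bsub>K\<^esub> g w) = (f v \<ominus>\<^bsub>K\<^esub> f w) \<oplus>\<^bsub>K\<^esub> (g v \<ominus>\<^bsub>K\<^esub> g w)" for v w
    using f V_simps(1) by (intro K.diff_rearrange) auto
  then show "dop i (\<lambda>x. f x \<oplus>\<^bsub>K\<^esub> g x) = (\<lambda>x. dop i f x \<oplus>\<^bsub>K\<^esub> dop i g x)"
    using f by (auto simp: dop_def V_add)
next
  fix c f assume c: "c \<in> carrier K" and f: "f \<in> V"
  have "c \<otimes>\<^bsub>K\<^esub> f v \<ominus>\<^bsub>K\<^esub> c \<otimes>\<^bsub>K\<^esub> f w = c \<otimes>\<^bsub>K\<^esub> (f v \<ominus>\<^bsub>K\<^esub> f w)" for v w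
    using c V_simps(1)[OF f] by (simp add: a_minus_def K.r_distr K.r_minus)
  then show "dop i (\<lambda>x. c \<otimes>\<^bsub>K\<^esub> f x) = (\<lambda>x. c \<otimes>\<^bsub>K\<^esub> dop i f x)"
    using c f by (auto simp: dop_def V_smult)
qed (auto simp: dop_def)

lemma sop_apply: "F \<in> V \<Longrightarrow> sop i F v = F (v @ [i])"
  and dop_apply: "F \<in> V \<Longrightarrow> dop i F v = (if pos v i then \<zero>\<^bsub>K\<^esub> else F v \<ominus>\<^bsub>K\<^esub> F (v @ [i]))"
  by (simp_all add: sop_def dop_def)

lemma sop_V: "i \<in> I \<Longrightarrow> F \<in> V \<Longrightarrow> sop i F \<in> V"
  and dop_V: "i \<in> I \<Longrightarrow> F \<in> V \<Longrightarrow> dop i F \<in> V"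
  using operatorsD(2) sop_closed dop_closed by blast+

lemma wprod_sop_closed [simp]: "u \<in> lists I \<Longrightarrow> wprod E sop u \<in> carrier E"
  by (rule E.A.wprod_closed[of sop I]) auto

lemma wprod_sop: "u \<in> lists I \<Longrightarrow> F \<in> V \<Longrightarrow> wprod E sop u F v = F (v @ rev u)"
proof (induction u arbitrary: F)
  case (Cons i u)
  then have i: "i \<in> I" "u \<in> lists I" by auto
  have "wprod E sop (i # u) F v = wprod E sop u (sop i F) v"
    using Cons.prems by (simp add: wprod_Cons operators_ops)
  then show ?case using Cons.IH[OF i(2) sop_V[OF i(1) Cons.prems(2)]] Cons.prems by (simp add: sop_apply)
qed (simp add: operators_ops)

lemma V_out: "F \<in> V \<Longrightarrow> v \<notin> lists I \<Longrightarrow> F (v @ w) = \<zero>\<^bsub>K\<^esub>"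
  using V_simps(3)[of F "v @ w"] by simp

lemma sop_dop_relations:
  assumes i: "i \<in> I"
  shows "sop i \<otimes>\<^bsub>E\<^esub> sop i = \<one>\<^bsub>E\<^esub>"
    and "dop i \<otimes>\<^bsub>E\<^esub> dop i = dop i"
    and "sop i \<otimes>\<^bsub>E\<^esub> dop i \<oplus>\<^bsub>E\<^esub> dop i \<otimes>\<^bsub>E\<^esub> sop i = sop i \<ominus>\<^bsub>E\<^esub> \<one>\<^bsub>E\<^esub>"
proof -
  have dbl: "F (v @ [i, i]) = F v" if F: "F \<in> V" for F v
  proof (cases "v \<in> lists I")
    case True
    then show ?thesis using V_simps(2)[OF F ceq_double[of i v "[]"]] i by simp
  next
    case False
    then show ?thesis using V_out[OF F] V_simps(3)[OF F] by metis
  qed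
  note s = sop_closed[OF i] and d = dop_closed[OF i]
  show "sop i \<otimes>\<^bsub>E\<^esub> sop i = \<one>\<^bsub>E\<^esub>"
  proof (rule operators_eqI)
    fix F assume F: "F \<in> V"
    show "(sop i \<otimes>\<^bsub>E\<^esub> sop i) F = \<one>\<^bsub>E\<^esub> F"
      using F sop_V[OF i F] dbl[OF F] by (auto simp: operators_ops sop_apply)
  qed (use s in auto)
  show "dop i \<otimes>\<^bsub>E\<^esub> dop i = dop i"
  proof (rule operators_eqI)
    fix F assume F: "F \<in> V"
    \<comment> \<open>At \<open>v @ [i]\<close> the sign is the opposite one, so the second
      application subtracts zero.\<close>
    have "dop i (dop i F) v = dop i F v" for v
    proof (cases "v \<in> lists I \<and> \<not> pos v i")
      case True
      then have "pos (v @ [i]) i" using pos_snoc_same i by blast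
      then show ?thesis using True F dop_V[OF i F] V_simps(1)[OF F] by (simp add: dop_apply a_minus_def)
    next
      case False
      then have "pos v i \<or> (F v = \<zero>\<^bsub>K\<^esub> \<and> F (v @ [i]) = \<zero>\<^bsub>K\<^esub> \<and> F ((v @ [i]) @ [i]) = \<zero>\<^bsub>K\<^esub>)"
        using V_simps(3)[OF F] V_out[OF F] by (metis append_assoc)
      then show ?thesis using F dop_V[OF i F] by (auto simp: dop_apply a_minus_def)
    qed
    then show "(dop i \<otimes>\<^bsub>E\<^esub> dop i) F = dop i F" using F by (auto simp: operators_ops)
  qed (use d in auto)
  show "sop i \<otimes>\<^bsub>E\<^esub> dop i \<oplus>\<^bsub>E\<^esub> dop i \<otimes>\<^bsub>E\<^esub> sop i = sop i \<ominus>\<^bsub>E\<^esub> \<one>\<^bsub>E\<^esub>"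
  proof (rule operators_eqI)
    fix F assume F: "F \<in> V"
    have "dop i (sop i F) v \<oplus>\<^bsub>K\<^esub> sop i (dop i F) v = F (v @ [i]) \<ominus>\<^bsub>K\<^esub> F v" for v
    proof (cases "v \<in> lists I")
      case True
      then have "pos (v @ [i]) i = (\<not> pos v i)" using pos_snoc_same i by blast
      then show ?thesis using F sop_V[OF i F] dop_V[OF i F] V_simps(1)[OF F] dbl[OF F]
        by (auto simp: dop_apply sop_apply)
    next
      case False
      have "F v = \<zero>\<^bsub>K\<^esub>" "F (v @ [i]) = \<zero>\<^bsub>K\<^esub>" "F (v @ [i, i]) = \<zero>\<^bsub>K\<^esub>"
        using False V_simps(3)[OF F] V_out[OF F] by auto
      then show ?thesis using F sop_V[OF i F] dop_V[OF i F] by (auto simp: dop_apply sop_apply a_minus_def)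
    qed
    then show "(sop i \<otimes>\<^bsub>E\<^esub> dop i \<oplus>\<^bsub>E\<^esub> dop i \<otimes>\<^bsub>E\<^esub> sop i) F = (sop i \<ominus>\<^bsub>E\<^esub> \<one>\<^bsub>E\<^esub>) F"
      using F s operators_closed(2) by (simp add: operators_ops operators_minus sop_apply)
  qed (use s d in auto)
qed

lemma sop_coxeter_relation:
  assumes "i \<in> I" "j \<in> I"
  shows "wprod E sop (concat (replicate (m i j) [i, j])) = \<one>\<^bsub>E\<^esub>"
proof -
  let ?w = "alt_word (2 * m i j) i j"
  have w: "?w \<in> lists I" "rev ?w \<in> lists I" using assms by simp_all
  have rw: "rev ?w \<asymp> []" using ceq_rev[OF alt_word_relation[OF assms]] by simp
  show ?thesis unfolding concat_replicate_alt_word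
  proof (rule operators_eqI)
    fix F assume F: "F \<in> V"
    have "F (v @ rev ?w) = F v" for v
    proof (cases "v \<in> lists I")
      case True
      then show ?thesis using V_simps(2)[OF F ceq_append_left[OF rw True]] by simp
    next
      case False
      then show ?thesis using V_out[OF F] V_simps(3)[OF F] by metis
    qed
    then show "wprod E sop ?w F = \<one>\<^bsub>E\<^esub> F"
      by (intro ext) (simp only: wprod_sop[OF w(1) F] operators_ops(2)[OF F])
  qed (use w in auto)
qed

text \<open>\<open>rev u\<close> carries the simple root of \<open>i\<close> to that of the final
  index of the relation and keeps it positive. Translation by this word therefore turns the cut-off
  in one operator into the cut-off in the other.\<close>

lemma sop_dop_braid:
  assumes ij: "i \<in> I" "j \<in> I" "i \<noteq> j" "m i j \<noteq> 0"
  shows "dop i \<otimes>\<^bsub>E\<^esub> wprod E sop (alt_word (m i j - 1) j i) =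
    wprod E sop (alt_word (m i j - 1) j i) \<otimes>\<^bsub>E\<^esub> dop (if even (m i j) then i else j)"
proof -
  obtain n where n: "m i j = Suc n" using ij by (cases "m i j") auto
  define u where "u = alt_word n j i"
  define i' where "i' = (if even (m i j) then i else j)"
  have ul: "u \<in> lists I" "rev u \<in> lists I" "i' \<in> I" using ij by (simp_all add: u_def i'_def)
  have ru: "rev u = (if odd n then alt_word n j i else alt_word n i j)" by (simp add: u_def rev_alt_word)
  have mji: "m j i = Suc n" using ij n m_sym by simp
  have 1: "rev u @ [i] \<asymp> i' # rev u"
  proof -
    have "rev (i # u) \<asymp> rev (u @ [i'])"
    proof (rule ceq_rev)
      have "i # u = alt_word (m i j) i j" unfolding n u_def by simp
      moreover have "u @ [i'] = alt_word (m i j) j i"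
        unfolding n u_def i'_def alt_word_last2[symmetric] by simp
      ultimately show "i # u \<asymp> u @ [i']" using alt_word_braid[OF ij(1,2)] by simp
    qed
    then show ?thesis by simp
  qed
  have pu: "pos (rev u) i"
    using pos_alt_word[of j i n] pos_alt_word[of i j n] ij n mji unfolding ru by (cases "even n") auto
  have mn: "m i j - 1 = n" using n by simp
  show ?thesis unfolding mn u_def[symmetric] i'_def[symmetric]
  proof (rule operators_eqI)
    fix F assume F: "F \<in> V"
    have dF: "dop i F \<in> V" using dop_V ij F by blast
    have wF: "wprod E sop u F \<in> V" using operatorsD(2) wprod_sop_closed ul F by blast
    have "dop i F (v @ rev u) = dop i' (wprod E sop u F) v" for v
    proof (cases "v \<in> lists I")
      case True
      have p: "pos (v @ rev u) i = pos v i'"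
        using pos_append_simple[OF 1 True ul(2,3) ij(1)] pu by simp
      have "F (v @ rev u @ [i]) = F (v @ i' # rev u)"
        using V_simps(2)[OF F ceq_append_left[OF 1 True]] by simp
      then show ?thesis using F wF ul p by (simp add: dop_apply wprod_sop)
    next
      case False
      have z: "F (v @ w) = \<zero>\<^bsub>K\<^esub>" for w using V_out[OF F False] .
      have "dop i F (v @ rev u) = \<zero>\<^bsub>K\<^esub>" using V_out[OF dF False] .
      moreover have "dop i' (wprod E sop u F) v = \<zero>\<^bsub>K\<^esub>"
        using V_simps(3)[OF dop_V[OF ul(3) wF] False] .
      ultimately show ?thesis by simp
    qed
    then show "(dop i \<otimes>\<^bsub>E\<^esub> wprod E sop u) F = (wprod E sop u \<otimes>\<^bsub>E\<^esub> dop i') F"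
      using F dF ul by (auto simp: operators_ops wprod_sop)
  qed (use ul ij in auto)
qed

end

section \<open>The algebra extending the group ring\<close>

subsection \<open>The Coxeter group as a group of classes\<close>

context coxeter
begin

abbreviation "W \<equiv> coxeter_group I m"

definition cc :: "'i list \<Rightarrow> 'i list set"
  where "cc u = {w. u \<asymp> w}"

lemma cc_eq: "v \<in> lists I \<Longrightarrow> cc u = cc v \<longleftrightarrow> u \<asymp> v"
proof
  assume v: "v \<in> lists I" and e: "cc u = cc v"
  have "v \<in> cc v" using v by (simp add: cc_def coxeter_eq.refl)
  then have "v \<in> cc u" unfolding e .
  then show "u \<asymp> v" by (simp add: cc_def)
next
  assume e: "u \<asymp> v"
  have "u \<asymp> w \<longleftrightarrow> v \<asymp> w" for w
    using coxeter_eq.trans[OF coxeter_eq.sym[OF e], of w] coxeter_eq.trans[OF e, of w] by blast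
  then show "cc u = cc v" by (simp add: cc_def)
qed

lemma carrier_W: "carrier W = cc ` lists I"
  by (auto simp: coxeter_group_def quotient_def cc_def)

lemma cc_mult: "u \<in> lists I \<Longrightarrow> v \<in> lists I \<Longrightarrow> cc u \<otimes>\<^bsub>W\<^esub> cc v = cc (u @ v)"
proof -
  assume a: "u \<in> lists I" "v \<in> lists I"
  have "(\<exists>x. u \<asymp> x \<and> (\<exists>y. v \<asymp> y \<and> x @ y \<asymp> w)) \<longleftrightarrow> u @ v \<asymp> w" for w
  proof
    assume "u @ v \<asymp> w"
    then show "\<exists>x. u \<asymp> x \<and> (\<exists>y. v \<asymp> y \<and> x @ y \<asymp> w)"
      using coxeter_eq.refl[OF a(1)] coxeter_eq.refl[OF a(2)] by blast
  next
    assume "\<exists>x. u \<asymp> x \<and> (\<exists>y. v \<asymp> y \<and> x @ y \<asymp> w)"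
    then obtain x y where xy: "u \<asymp> x" "v \<asymp> y" "x @ y \<asymp> w" by blast
    show "u @ v \<asymp> w" using coxeter_eq.trans[OF ceq_append[OF xy(1,2)] xy(3)] .
  qed
  then show ?thesis by (simp add: coxeter_group_def cc_def)
qed

lemma cc_one: "\<one>\<^bsub>W\<^esub> = cc []"
  by (simp add: coxeter_group_def cc_def)

lemma cc_closed [simp]: "u \<in> lists I \<Longrightarrow> cc u \<in> carrier W"
  by (simp add: carrier_W)

lemma cc_rev: "u \<in> lists I \<Longrightarrow> cc (rev u) \<otimes>\<^bsub>W\<^esub> cc u = \<one>\<^bsub>W\<^esub>"
  unfolding cc_one using ceq_rev_append[of u] cc_eq[of "[]" "rev u @ u"] cc_mult[of "rev u" u] by simp

lemma W_cases: "x \<in> carrier W \<Longrightarrow> (\<And>u. x = cc u \<Longrightarrow> u \<in> lists I \<Longrightarrow> thesis) \<Longrightarrow> thesis"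
  unfolding carrier_W by (rule imageE)

lemma group_W: "group W"
proof (rule groupI)
  fix x y z assume "x \<in> carrier W" "y \<in> carrier W" "z \<in> carrier W"
  then show "x \<otimes>\<^bsub>W\<^esub> y \<otimes>\<^bsub>W\<^esub> z = x \<otimes>\<^bsub>W\<^esub> (y \<otimes>\<^bsub>W\<^esub> z)"
    by (elim W_cases) (simp only: cc_mult append_in_lists_conv append_assoc)
next
  fix x y assume "x \<in> carrier W" "y \<in> carrier W"
  then show "x \<otimes>\<^bsub>W\<^esub> y \<in> carrier W" by (elim W_cases) (simp only: cc_mult cc_closed append_in_lists_conv)
next
  fix x assume x: "x \<in> carrier W"
  then obtain u where u: "x = cc u" "u \<in> lists I" by (rule W_cases)
  show "\<one>\<^bsub>W\<^esub> \<otimes>\<^bsub>W\<^esub> x = x" unfolding cc_one u(1) using cc_mult[of "[]" u] u(2) by simp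
  show "\<exists>y\<in>carrier W. y \<otimes>\<^bsub>W\<^esub> x = \<one>\<^bsub>W\<^esub>"
    using cc_rev[OF u(2)] cc_closed[of "rev u"] u by (intro bexI[of _ "cc (rev u)"]) simp_all
next
  show "\<one>\<^bsub>W\<^esub> \<in> carrier W" unfolding cc_one by (rule cc_closed) simp
qed

lemma cc_inv: "u \<in> lists I \<Longrightarrow> inv\<^bsub>W\<^esub> (cc u) = cc (rev u)"
  by (rule group.inv_equality[OF group_W cc_rev]) simp_all

lemma cox_s_cc: "cox_s I m i = cc [i]"
  by (simp add: cox_s_def cc_def)

lemma reflections_cc: "reflections I m = {cc (v @ x # rev v) | v x. v \<in> lists I \<and> x \<in> I}" (is "_ = ?R")
proof
  have e: "cc v \<otimes>\<^bsub>W\<^esub> cox_s I m x \<otimes>\<^bsub>W\<^esub> inv\<^bsub>W\<^esub> (cc v) = cc (v @ x # rev v)" if "v \<in> lists I" "x \<in> I" for v x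
    using that by (simp add: cox_s_cc cc_inv cc_mult)
  show "reflections I m \<subseteq> ?R"
    unfolding reflections_def Let_def carrier_W using e by blast
  show "?R \<subseteq> reflections I m"
    unfolding reflections_def Let_def carrier_W using e by (smt (verit) Collect_mono image_eqI mem_Collect_eq subsetI)
qed

end

subsection \<open>The universal property\<close>

locale hecke_hopf = coxeter I m for I :: "'i set" and m
begin

lemma Gs_closed [simp]: "i \<in> I \<Longrightarrow> Gs i \<in> hh_gens I" and Gd_closed [simp]: "i \<in> I \<Longrightarrow> Gd i \<in> hh_gens I"
  by (simp_all add: hh_gens_def)

lemma map_Gs_lists [simp]: "u \<in> lists I \<Longrightarrow> map Gs u \<in> lists (hh_gens I)"
  by auto

lemma concat_Gs: "concat (replicate n [Gs i, Gs j]) = map Gs (concat (replicate n [i, j]))"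
  by (induction n) auto

lemma hh_rels_cases:
  assumes "(l, r) \<in> hh_rels I m"
  obtains
    (sq) i where "i \<in> I" "l = single \<Z> [Gs i, Gs i]" "r = single \<Z> []"
  | (idem) i where "i \<in> I" "l = single \<Z> [Gd i, Gd i]" "r = single \<Z> [Gd i]"
  | (mixed) i where "i \<in> I" "l = single \<Z> [Gs i, Gd i] \<oplus>\<^bsub>free_algebra \<Z> (hh_gens I)\<^esub> single \<Z> [Gd i, Gs i]"
      "r = single \<Z> [Gs i] \<ominus>\<^bsub>free_algebra \<Z> (hh_gens I)\<^esub> single \<Z> []"
  | (cox) i j where "i \<in> I" "j \<in> I" "l = single \<Z> (map Gs (alt_word (2 * m i j) i j))" "r = single \<Z> []"
  | (braid) i j where "i \<in> I" "j \<in> I" "i \<noteq> j" "m i j \<noteq> 0"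
      "l = single \<Z> (Gd i # map Gs (alt_word (m i j - 1) j i))"
      "r = single \<Z> (map Gs (alt_word (m i j - 1) j i) @ [Gd (if even (m i j) then i else j)])"
  using assms unfolding hh_rels_def Let_def concat_Gs unfolding concat_replicate_alt_word
  by (elim UnE CollectE exE conjE Pair_inject) (rule sq idem mixed cox braid; assumption)+

sublocale HH: presentation \<Z> "hh_gens I" "hh_rels I m"
proof
  interpret P: presentation \<Z> "hh_gens I" "{}"
    by unfold_locales (simp_all add: int_is_cring)
  interpret F: ring "free_algebra \<Z> (hh_gens I)" by (rule P.F.ring_F)
  note c = P.F.single_closed
  fix l r assume "(l, r) \<in> hh_rels I m"
  then show "l \<in> carrier (free_algebra \<Z> (hh_gens I)) \<and> r \<in> carrier (free_algebra \<Z> (hh_gens I))"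
  proof (cases rule: hh_rels_cases)
    case (cox i j)
    then show ?thesis using c[of "map Gs (alt_word (2 * m i j) i j)"] c[of "[]"]
      by (simp only: map_Gs_lists alt_word_in_lists lists.Nil)
  next
    case (braid i j)
    let ?u = "alt_word (m i j - 1) j i"
    have u: "map Gs ?u \<in> lists (hh_gens I)" using braid by simp
    show ?thesis using c[of "Gd i # map Gs ?u"] c[of "map Gs ?u @ [Gd (if even (m i j) then i else j)]"] u braid
      by simp
  next
    case (mixed i)
    have "single \<Z> [Gs i, Gd i] \<in> carrier (free_algebra \<Z> (hh_gens I))" "single \<Z> [Gd i, Gs i] \<in> carrier (free_algebra \<Z> (hh_gens I))"
      "single \<Z> [Gs i] \<in> carrier (free_algebra \<Z> (hh_gens I))" "single \<Z> [] \<in> carrier (free_algebra \<Z> (hh_gens I))"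
      using mixed(1) by (auto intro!: c)
    then show ?thesis unfolding mixed(2,3) by simp
  qed (auto intro!: c)
qed

abbreviation "H \<equiv> hat_H I m"
abbreviation "hs \<equiv> hat_s I m"
abbreviation "hD \<equiv> hat_D I m"

sublocale H: nc_alg \<Z> H
  using HH.nc_alg_presented unfolding hat_H_def .

lemma hs_closed [simp]: "i \<in> I \<Longrightarrow> hs i \<in> carrier H" and hD_closed [simp]: "i \<in> I \<Longrightarrow> hD i \<in> carrier H"
  using HH.gen_closed by (simp_all add: hat_H_def hat_s_def hat_D_def)

lemma hat_universal:
  fixes S :: "('b, 'z) ring_scheme"
  assumes "ring S" and cl: "\<And>i. i \<in> I \<Longrightarrow> s i \<in> carrier S" "\<And>i. i \<in> I \<Longrightarrow> D i \<in> carrier S"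
    and sq: "\<And>i. i \<in> I \<Longrightarrow> s i \<otimes>\<^bsub>S\<^esub> s i = \<one>\<^bsub>S\<^esub>"
    and idem: "\<And>i. i \<in> I \<Longrightarrow> D i \<otimes>\<^bsub>S\<^esub> D i = D i"
    and mixed: "\<And>i. i \<in> I \<Longrightarrow> s i \<otimes>\<^bsub>S\<^esub> D i \<oplus>\<^bsub>S\<^esub> D i \<otimes>\<^bsub>S\<^esub> s i = s i \<ominus>\<^bsub>S\<^esub> \<one>\<^bsub>S\<^esub>"
    and cox: "\<And>i j. i \<in> I \<Longrightarrow> j \<in> I \<Longrightarrow> wprod S s (alt_word (2 * m i j) i j) = \<one>\<^bsub>S\<^esub>"
    and braid: "\<And>i j. i \<in> I \<Longrightarrow> j \<in> I \<Longrightarrow> i \<noteq> j \<Longrightarrow> m i j \<noteq> 0 \<Longrightarrow>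
      D i \<otimes>\<^bsub>S\<^esub> wprod S s (alt_word (m i j - 1) j i) =
      wprod S s (alt_word (m i j - 1) j i) \<otimes>\<^bsub>S\<^esub> D (if even (m i j) then i else j)"
  shows "\<exists>\<phi>\<in>ring_hom H S. \<forall>i\<in>I. \<phi> (hs i) = s i \<and> \<phi> (hD i) = D i"
proof -
  interpret S: ring S by fact
  define g where "g = case_hh_gen s D"
  have gc: "g \<in> hh_gens I \<rightarrow> carrier S" using cl by (auto simp: g_def hh_gens_def)
  have gs: "wprod S g (map Gs u) = wprod S s u" for u by (simp add: wprod_map g_def comp_def)
  have "\<exists>\<phi>\<in>alg_hom \<Z> HH.PA (int_algebra S). \<forall>x\<in>hh_gens I. \<phi> (HH.gen x) = g x"
  proof (rule HH.presented_universal[OF nc_alg_int_algebra[OF assms(1)]])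
    show "g \<in> hh_gens I \<rightarrow> carrier (int_algebra S)" using gc by simp
    fix h l r
    assume h: "h \<in> alg_hom \<Z> HH.F (int_algebra S)"
      and hw: "\<And>u. u \<in> lists (hh_gens I) \<Longrightarrow> h (single \<Z> u) = wprod (int_algebra S) g u"
      and lr: "(l, r) \<in> hh_rels I m"
    have hw: "h (single \<Z> u) = wprod S g u" if "u \<in> lists (hh_gens I)" for u using hw[OF that] by simp
    have hr: "h \<in> ring_hom HH.F S" using alg_homD(1)[OF h] by (simp add: ring_hom_int_algebra)
    note c = HH.F.single_closed
    from lr show "h l = h r"
    proof (cases rule: hh_rels_cases)
      case (sq i)
      show ?thesis unfolding sq(2,3) using sq(1) assms(4)[OF sq(1)] cl
        by (simp add: hw wprod_Cons g_def)
    next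
      case (idem i)
      show ?thesis unfolding idem(2,3) using idem(1) assms(5)[OF idem(1)] cl
        by (simp add: hw wprod_Cons g_def)
    next
      case (mixed i)
      have l: "[Gs i, Gd i] \<in> lists (hh_gens I)" "[Gd i, Gs i] \<in> lists (hh_gens I)" "[Gs i] \<in> lists (hh_gens I)"
        "[] \<in> lists (hh_gens I)" using mixed(1) by auto
      show ?thesis unfolding mixed(2,3) ring_hom_add[OF hr c[OF l(1)] c[OF l(2)]]
          ring_hom_diff[OF hr HH.F.ring_F assms(1) c[OF l(3)] c[OF l(4)]] hw[OF l(1)] hw[OF l(2)] hw[OF l(3)] hw[OF l(4)]
        using mixed(1) assms(6)[OF mixed(1)] cl by (simp add: wprod_Cons g_def)
    next
      case (cox i j)
      have u: "map Gs (alt_word (2 * m i j) i j) \<in> lists (hh_gens I)" using cox(1,2) by (intro map_Gs_lists) simp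
      show ?thesis unfolding cox(3,4) hw[OF u] gs using assms(7)[OF cox(1,2)] hw[of "[]"] by simp
    next
      case (braid i j)
      let ?u = "alt_word (m i j - 1) j i"
      define k where "k = (if even (m i j) then i else j)"
      have u: "map Gs ?u \<in> lists (hh_gens I)" using braid by (intro map_Gs_lists) simp
      have k: "k \<in> I" using braid by (simp add: k_def)
      have gk: "wprod S g [Gd k] = D k" using cl(2)[OF k] by (simp add: wprod_Cons g_def)
      have "h l = D i \<otimes>\<^bsub>S\<^esub> wprod S s ?u"
        unfolding braid(5) using hw[of "Gd i # map Gs ?u"] u braid(1) by (simp add: wprod_Cons gs) (simp add: g_def)
      moreover have "h r = wprod S s ?u \<otimes>\<^bsub>S\<^esub> D k"
        unfolding braid(6) k_def[symmetric]
        using hw[of "map Gs ?u @ [Gd k]"] u k S.wprod_append[OF gc u, of "[Gd k]"]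
        by (simp add: gs gk)
      ultimately show ?thesis using assms(8)[OF braid(1-4)] by (simp add: k_def)
    qed
  qed
  then obtain \<phi> where \<phi>: "\<phi> \<in> alg_hom \<Z> HH.PA (int_algebra S)" "\<And>x. x \<in> hh_gens I \<Longrightarrow> \<phi> (HH.gen x) = g x"
    by blast
  have "\<phi> \<in> ring_hom H S" using alg_homD(1)[OF \<phi>(1)] by (simp add: ring_hom_int_algebra hat_H_def)
  moreover have "\<phi> (hs i) = s i \<and> \<phi> (hD i) = D i" if "i \<in> I" for i
    using \<phi>(2)[of "Gs i"] \<phi>(2)[of "Gd i"] that by (simp add: hat_s_def hat_D_def g_def)
  ultimately show ?thesis by blast
qed

lemma hat_hom_eq:
  assumes "ring S" "\<phi> \<in> ring_hom H S" "\<psi> \<in> ring_hom H S"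
    and "\<And>i. i \<in> I \<Longrightarrow> \<phi> (hs i) = \<psi> (hs i) \<and> \<phi> (hD i) = \<psi> (hD i)" and x: "x \<in> carrier H"
  shows "\<phi> x = \<psi> x"
proof -
  have h: "alg_hom \<Z> HH.PA (int_algebra S) = alg_hom \<Z> H (int_algebra S)" by (simp add: hat_H_def)
  note p = alg_homD[OF ring_hom_alg_hom_int[OF H.nc_alg_axioms assms(1,2)]]
    and q = alg_homD[OF ring_hom_alg_hom_int[OF H.nc_alg_axioms assms(1,3)]]
  have gen: "\<phi> (HH.gen g) = \<psi> (HH.gen g)" if "g \<in> hh_gens I" for g
    using that assms(4) by (auto simp: hh_gens_def hat_s_def hat_D_def)
  have x': "x \<in> carrier HH.PA" using x by (simp add: hat_H_def)
  have gc: "HH.gen \<in> hh_gens I \<rightarrow> carrier H" by (simp add: hat_H_def)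
  have w: "\<phi> (wprod H HH.gen u) = \<psi> (wprod H HH.gen u)" if u: "u \<in> lists (hh_gens I)" for u
  proof -
    have "wprod S (\<phi> \<circ> HH.gen) u = wprod S (\<psi> \<circ> HH.gen) u"
      using u gen by (intro wprod_cong) auto
    then show ?thesis
      using ring_hom_wprod[OF assms(2) H.A.monoid_axioms gc u] ring_hom_wprod[OF assms(3) H.A.monoid_axioms gc u] by simp
  qed
  show ?thesis using x'
  proof (induction rule: HH.presented_induct)
    case (word u r)
    have "wprod H HH.gen u \<in> carrier H" using H.A.wprod_closed[OF gc word(1)] .
    then show ?case using p(6) q(6) w[OF word(1)] word(2) unfolding hat_H_def by simp
  next
    case (add x y)
    then show ?case using p(4) q(4) unfolding hat_H_def by simp
  qed
qed

lemma hat_relation: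
  "(l, r) \<in> hh_rels I m \<Longrightarrow> HH.proj l = HH.proj r"
  by (rule HH.presented_relation)

lemma cox_hopf_hat: "cox_hopf I m H hs hD"
proof -
  have w: "HH.proj (single \<Z> u) = wprod H (case_hh_gen hs hD) u" if "u \<in> lists (hh_gens I)" for u
  proof -
    have "wprod H HH.gen u = wprod H (case_hh_gen hs hD) u"
      using that by (intro wprod_cong) (auto simp: hh_gens_def hat_s_def hat_D_def)
    then show ?thesis using HH.proj_single[OF that] by (simp add: hat_H_def)
  qed
  have ph: "HH.proj \<in> ring_hom HH.F H" using alg_homD(1)[OF HH.proj_hom] by (simp add: hat_H_def)
  note c = HH.F.single_closed
  show ?thesis
  proof unfold_locales
    fix i assume i: "i \<in> I"
    have "(single \<Z> [Gs i, Gs i], single \<Z> []) \<in> hh_rels I m" using i unfolding hh_rels_def Let_def by blast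
    from hat_relation[OF this] show "hs i \<otimes>\<^bsub>H\<^esub> hs i = \<one>\<^bsub>H\<^esub>" using i by (simp add: w wprod_Cons)
    have "(single \<Z> [Gd i, Gd i], single \<Z> [Gd i]) \<in> hh_rels I m" using i unfolding hh_rels_def Let_def by blast
    from hat_relation[OF this] show "hD i \<otimes>\<^bsub>H\<^esub> hD i = hD i" using i by (simp add: w wprod_Cons)
    have l: "[Gs i, Gd i] \<in> lists (hh_gens I)" "[Gd i, Gs i] \<in> lists (hh_gens I)" "[Gs i] \<in> lists (hh_gens I)"
      "[] \<in> lists (hh_gens I)" using i by auto
    have "(single \<Z> [Gs i, Gd i] \<oplus>\<^bsub>HH.F\<^esub> single \<Z> [Gd i, Gs i], single \<Z> [Gs i] \<ominus>\<^bsub>HH.F\<^esub> single \<Z> []) \<in> hh_rels I m"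
      using i unfolding hh_rels_def Let_def by blast
    from hat_relation[OF this] show "hs i \<otimes>\<^bsub>H\<^esub> hD i \<oplus>\<^bsub>H\<^esub> hD i \<otimes>\<^bsub>H\<^esub> hs i = hs i \<ominus>\<^bsub>H\<^esub> \<one>\<^bsub>H\<^esub>"
      unfolding ring_hom_add[OF ph c[OF l(1)] c[OF l(2)]] w[OF l(1)] w[OF l(2)] w[OF l(3)] w[OF l(4)]
        ring_hom_diff[OF ph HH.F.ring_F H.A.ring_axioms c[OF l(3)] c[OF l(4)]]
      using i by (simp add: wprod_Cons)
  next
    fix i j assume ij: "i \<in> I" "j \<in> I"
    have "(single \<Z> (concat (replicate (m i j) [Gs i, Gs j])), single \<Z> []) \<in> hh_rels I m"
      using ij unfolding hh_rels_def Let_def by blast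
    note r = hat_relation[OF this, unfolded concat_Gs]
    have u: "map Gs (concat (replicate (m i j) [i, j])) \<in> lists (hh_gens I)"
      using ij by (intro map_Gs_lists) (simp add: concat_replicate_alt_word)
    show "wprod H hs (concat (replicate (m i j) [i, j])) = \<one>\<^bsub>H\<^esub>"
      using r w[OF u] w[of "[]"] by (simp add: wprod_map comp_def)
  qed simp_all
qed

end

subsection \<open>The counit\<close>

lemma wprod_int_one: "wprod \<Z> (\<lambda>_. 1) u = 1"
  by (induction u) (simp_all add: wprod_Cons)

context hecke_hopf
begin

abbreviation "\<epsilon> \<equiv> hat_counit I m"

text \<open>\<open>hat_counit\<close> is a definite description. The universal property gives
  existence, agreement on the generators gives uniqueness on the carrier, and extensionality fixes
  the values elsewhere.\<close>

lemma counit: "\<epsilon> \<in> ring_hom H \<Z>" "i \<in> I \<Longrightarrow> \<epsilon> (hs i) = 1" "i \<in> I \<Longrightarrow> \<epsilon> (hD i) = 0"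
proof -
  have Z: "ring \<Z>" using int_is_cring cring_def by blast
  obtain \<phi> where \<phi>: "\<phi> \<in> ring_hom H \<Z>" "\<And>i. i \<in> I \<Longrightarrow> \<phi> (hs i) = 1 \<and> \<phi> (hD i) = 0"
    using hat_universal[OF Z, of "\<lambda>_. 1" "\<lambda>_. 0"] by (auto simp: wprod_int_one a_minus_def int_a_inv_eq)
  let ?P = "\<lambda>h. h \<in> extensional (carrier H) \<and> h \<in> ring_hom H \<Z> \<and> (\<forall>i\<in>I. h (hs i) = 1 \<and> h (hD i) = 0)"
  have P: "?P (restrict \<phi> (carrier H))" using \<phi> by (simp add: ring_hom_def)
  have "?P \<epsilon>" unfolding hat_counit_def
  proof (rule theI[of ?P, OF P])
    fix h assume h: "?P h"
    show "h = restrict \<phi> (carrier H)"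
    proof (rule extensionalityI[of _ "carrier H"])
      fix x assume x: "x \<in> carrier H"
      have "h x = \<phi> x" using h \<phi> by (intro hat_hom_eq[OF Z _ _ _ x]) simp_all
      then show "h x = restrict \<phi> (carrier H) x" using x by simp
    qed (use h in simp_all)
  qed
  then show "\<epsilon> \<in> ring_hom H \<Z>" "i \<in> I \<Longrightarrow> \<epsilon> (hs i) = 1" "i \<in> I \<Longrightarrow> \<epsilon> (hD i) = 0" by simp_all
qed

sublocale Hat: cox_hopf I m H hs hD
  by (rule cox_hopf_hat)

lemma counit_ops:
  "x \<in> carrier H \<Longrightarrow> y \<in> carrier H \<Longrightarrow> \<epsilon> (x \<otimes>\<^bsub>H\<^esub> y) = \<epsilon> x * \<epsilon> y"
  "x \<in> carrier H \<Longrightarrow> y \<in> carrier H \<Longrightarrow> \<epsilon> (x \<oplus>\<^bsub>H\<^esub> y) = \<epsilon> x + \<epsilon> y"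
  "x \<in> carrier H \<Longrightarrow> \<epsilon> (\<ominus>\<^bsub>H\<^esub> x) = - \<epsilon> x"
  "\<epsilon> \<one>\<^bsub>H\<^esub> = 1"
proof -
  have Z: "ring \<Z>" using int_is_cring cring_def by blast
  interpret e: ring_hom_ring H \<Z> \<epsilon> using counit(1) H.A.ring_axioms Z by (intro ring_hom_ringI2)
  show "x \<in> carrier H \<Longrightarrow> y \<in> carrier H \<Longrightarrow> \<epsilon> (x \<otimes>\<^bsub>H\<^esub> y) = \<epsilon> x * \<epsilon> y"
    "x \<in> carrier H \<Longrightarrow> y \<in> carrier H \<Longrightarrow> \<epsilon> (x \<oplus>\<^bsub>H\<^esub> y) = \<epsilon> x + \<epsilon> y"
    "x \<in> carrier H \<Longrightarrow> \<epsilon> (\<ominus>\<^bsub>H\<^esub> x) = - \<epsilon> x" "\<epsilon> \<one>\<^bsub>H\<^esub> = 1"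
    using e.hom_mult e.hom_add e.hom_a_inv e.hom_one by (simp_all add: int_a_inv_eq)
qed

lemma counit_word: "u \<in> lists I \<Longrightarrow> \<epsilon> (Hat.h u) = 1"
proof (induction u)
  case (Cons i u)
  then show ?case by (simp add: Hat.h_Cons counit_ops counit)
qed (simp add: counit_ops)

lemma kernel_ideal: "ideal (a_kernel H \<Z> \<epsilon>) H"
  using ring_hom_ring.kernel_is_ideal[OF ring_hom_ringI2[OF H.A.ring_axioms _ counit(1)]] int_is_cring cring_def
  by blast

lemma kernel_iff: "x \<in> a_kernel H \<Z> \<epsilon> \<longleftrightarrow> x \<in> carrier H \<and> \<epsilon> x = 0"
  by (simp add: a_kernel_def kernel_def)

subsection \<open>The elements attached to reflections\<close>

text \<open>All words in a class have the same product, so the image in the definition of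
  \<open>hat_W\<close> is a singleton and \<open>the_elem\<close> returns this product.\<close>

lemma hat_W_cc: "u \<in> lists I \<Longrightarrow> hat_W I m (cc u) = Hat.h u"
proof -
  assume u: "u \<in> lists I"
  have c: "Hat.h w = Hat.h u" if "w \<in> cc u" for w
    using that Hat.h_ceq[of u w] unfolding cc_def by simp
  have "u \<in> cc u" using u by (simp add: cc_def coxeter_eq.refl)
  then have i: "Hat.h ` cc u = {Hat.h u}" using c by (metis image_constant image_cong)
  have "hat_W I m (cc u) = the_elem (Hat.h ` cc u)"
    unfolding hat_W_def wprod_def ..
  then show ?thesis unfolding i by simp
qed

lemma reflection_ceq: "v \<asymp> w \<Longrightarrow> x \<in> I \<Longrightarrow> cc (v @ x # rev v) = cc (w @ x # rev w)"
proof -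
  assume a: "v \<asymp> w" "x \<in> I"
  have "v @ [x] @ rev v \<asymp> w @ [x] @ rev w"
    using a by (intro ceq_append ceq_rev) (simp_all add: coxeter_eq.refl)
  moreover have "w \<in> lists I" using ceq_lists[OF a(1)] by blast
  ultimately show ?thesis using cc_eq[of "w @ x # rev w" "v @ x # rev v"] a(2) by simp
qed

text \<open>The wall condition of \<open>pos\<close> is exactly the case excluded by the conjugation
  rule of \<open>refl_D\<close>.\<close>

lemma reflection_simple_iff:
  assumes "v \<in> lists I" "x \<in> I" "k \<in> I"
  shows "cc (v @ x # rev v) = cc [k] \<longleftrightarrow> v @ [x] \<asymp> k # v"
proof -
  have "cc (v @ x # rev v) = cc [k] \<longleftrightarrow> (v @ [x]) @ rev v \<asymp> [k]" using cc_eq[of "[k]"] assms by simp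
  also have "\<dots> \<longleftrightarrow> v @ [x] \<asymp> [k] @ rev (rev v)" using assms by (intro ceq_move_right) simp_all
  finally show ?thesis by simp
qed

lemma reflection_conj:
  assumes "v \<in> lists I" "x \<in> I" "k \<in> I"
  shows "cox_s I m k \<otimes>\<^bsub>W\<^esub> cc (v @ x # rev v) \<otimes>\<^bsub>W\<^esub> cox_s I m k = cc ((k # v) @ x # rev (k # v))"
proof -
  have l: "[k] \<in> lists I" "v @ x # rev v \<in> lists I" "[k] @ v @ x # rev v \<in> lists I" using assms by simp_all
  show ?thesis unfolding cox_s_cc cc_mult[OF l(1,2)] cc_mult[OF l(3,1)] by simp
qed

text \<open>The induction is on the length because the root may be negative at intermediate points.
  If prepending \<open>k\<close> to \<open>v'\<close> crosses its wall, the root is negative at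
  \<open>v'\<close>, and exchange supplies a shorter word for the same element as
  \<open>v\<close>.\<close>

lemma refl_D_pos:
  "v \<in> lists I \<Longrightarrow> x \<in> I \<Longrightarrow> pos v x \<Longrightarrow>
    (cc (v @ x # rev v), Hat.h v \<otimes>\<^bsub>H\<^esub> hD x \<otimes>\<^bsub>H\<^esub> Hat.h (rev v)) \<in> refl_D I m"
proof (induction "length v" arbitrary: v rule: less_induct)
  case less
  show ?case
  proof (cases v)
    case Nil
    then show ?thesis using refl_D.base[OF less.prems(2), of m] less.prems(2) by (simp add: cox_s_cc)
  next
    case (Cons k v')
    have k: "k \<in> I" "v' \<in> lists I" using less.prems Cons by auto
    show ?thesis
    proof (cases "v' @ [x] \<asymp> k # v'")
      case False
      then have "pos v' x" using less.prems(3) Cons by simp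
      then have IH: "(cc (v' @ x # rev v'), Hat.h v' \<otimes>\<^bsub>H\<^esub> hD x \<otimes>\<^bsub>H\<^esub> Hat.h (rev v')) \<in> refl_D I m"
        using less.hyps[of v'] k less.prems(2) Cons by simp
      have "cc (v' @ x # rev v') \<in> reflections I m" using k less.prems(2) unfolding reflections_cc by blast
      moreover have "cc (v' @ x # rev v') \<noteq> cox_s I m k"
        using False reflection_simple_iff[OF k(2) less.prems(2) k(1)] by (simp add: cox_s_cc)
      ultimately have "(cc (v @ x # rev v), hs k \<otimes>\<^bsub>H\<^esub> (Hat.h v' \<otimes>\<^bsub>H\<^esub> hD x \<otimes>\<^bsub>H\<^esub> Hat.h (rev v')) \<otimes>\<^bsub>H\<^esub> hs k) \<in> refl_D I m"
        using refl_D.conj[OF IH k(1)] reflection_conj[OF k(2) less.prems(2) k(1)] Cons by simp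
      then show ?thesis unfolding Cons
        using k less.prems(2) by (simp add: Hat.h_Cons Hat.h_append H.A.m_assoc)
    next
      case True
      then have "\<not> pos v' x" using less.prems(3) Cons by simp
      then obtain p where p: "p < length v'" "v' @ [x] \<asymp> take p v' @ drop (Suc p) v'"
        using exchange k less.prems(2) by blast
      define b where "b = take p v' @ drop (Suc p) v'"
      have vb: "v \<asymp> b" using coxeter_eq.trans[OF coxeter_eq.sym[OF True] p(2)] Cons by (simp add: b_def)
      have bl: "b \<in> lists I" "length b < length v" using ceq_lists[OF vb] p(1) Cons by (auto simp: b_def)
      have "pos b x" using pos_ceq[OF vb less.prems(2)] less.prems(3) by simp
      from less.hyps[OF bl(2,1) less.prems(2) this]
      show ?thesis
        using Hat.h_ceq[OF vb] Hat.h_ceq[OF ceq_rev[OF vb]] reflection_ceq[OF vb less.prems(2)] by simp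
    qed
  qed
qed

text \<open>The conjugation rule excludes the one reflection at which the sign would change, so
  positivity persists along every derivation.\<close>

lemma refl_D_form:
  "(s, d) \<in> refl_D I m \<Longrightarrow> \<exists>v x. v \<in> lists I \<and> x \<in> I \<and> pos v x \<and> s = cc (v @ x # rev v) \<and>
    d = Hat.h v \<otimes>\<^bsub>H\<^esub> hD x \<otimes>\<^bsub>H\<^esub> Hat.h (rev v)"
proof (induction rule: refl_D.induct)
  case (base i)
  then show ?case by (intro exI[of _ "[]"] exI[of _ i]) (simp add: cox_s_cc)
next
  case (conj s d i)
  then obtain v x where v: "v \<in> lists I" "x \<in> I" "pos v x" "s = cc (v @ x # rev v)"
    "d = Hat.h v \<otimes>\<^bsub>H\<^esub> hD x \<otimes>\<^bsub>H\<^esub> Hat.h (rev v)" by blast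
  have "\<not> v @ [x] \<asymp> i # v"
    using conj reflection_simple_iff[OF v(1,2) conj(2)] v(4) by (simp add: cox_s_cc)
  then have "pos (i # v) x" using v(3) by simp
  moreover have "hs i \<otimes>\<^bsub>H\<^esub> d \<otimes>\<^bsub>H\<^esub> hs i = Hat.h (i # v) \<otimes>\<^bsub>H\<^esub> hD x \<otimes>\<^bsub>H\<^esub> Hat.h (rev (i # v))"
    unfolding v(5) using v(1,2) conj(2) by (simp add: Hat.h_Cons Hat.h_append H.A.m_assoc)
  moreover have "cox_s I m i \<otimes>\<^bsub>W\<^esub> s \<otimes>\<^bsub>W\<^esub> cox_s I m i = cc ((i # v) @ x # rev (i # v))"
    unfolding v(4) by (rule reflection_conj[OF v(1,2) conj(2)])
  ultimately show ?case using v(1,2) conj(2) by (intro exI[of _ "i # v"] exI[of _ x]) simp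
qed

lemma hat_DW_gens:
  "{d. \<exists>s\<in>reflections I m. (s, d) \<in> refl_D I m} =
    {Hat.h v \<otimes>\<^bsub>H\<^esub> hD x \<otimes>\<^bsub>H\<^esub> Hat.h (rev v) | v x. v \<in> lists I \<and> x \<in> I \<and> pos v x}" (is "?L = ?R")
proof
  show "?L \<subseteq> ?R" using refl_D_form by blast
  show "?R \<subseteq> ?L"
  proof
    fix d assume "d \<in> ?R"
    then obtain v x where v: "v \<in> lists I" "x \<in> I" "pos v x" "d = Hat.h v \<otimes>\<^bsub>H\<^esub> hD x \<otimes>\<^bsub>H\<^esub> Hat.h (rev v)" by blast
    have "cc (v @ x # rev v) \<in> reflections I m" using v unfolding reflections_cc by blast
    then show "d \<in> ?L" using refl_D_pos[OF v(1-3)] v(4) by blast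
  qed
qed

lemma hat_DW_gens_closed: "{d. \<exists>s\<in>reflections I m. (s, d) \<in> refl_D I m} \<subseteq> carrier H"
  unfolding hat_DW_gens by (safe, intro H.A.m_closed Hat.h_closed hD_closed) auto

lemma subring_hat_DW: "subring (hat_DW I m) H"
  unfolding hat_DW_def by (rule H.A.generate_ring_is_subring[OF hat_DW_gens_closed])

text \<open>For a negative root, \<open>Dr\<close> is 1 minus the generator of the opposite root, so
  the subring contains the root elements of both signs.\<close>

lemma Dr_hat_DW:
  assumes "v \<in> lists I" "x \<in> I"
  shows "Hat.Dr v x \<in> hat_DW I m"
proof -
  note B = subringE[OF subring_hat_DW]
  have gen: "Hat.h v \<otimes>\<^bsub>H\<^esub> hD x \<otimes>\<^bsub>H\<^esub> Hat.h (rev v) \<in> hat_DW I m" if "v \<in> lists I" "pos v x" for v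
    unfolding hat_DW_def hat_DW_gens using that assms(2) by (intro generate_ring.incl) blast
  show ?thesis
  proof (cases "pos v x")
    case True
    then show ?thesis unfolding Hat.Dr_def using gen[OF assms(1)] by simp
  next
    case False
    have "Hat.h (v @ [x]) \<otimes>\<^bsub>H\<^esub> hD x \<otimes>\<^bsub>H\<^esub> Hat.h (rev (v @ [x])) \<in> hat_DW I m"
      using False assms pos_snoc_same[OF assms] by (intro gen) auto
    then show ?thesis unfolding Hat.Dr_def a_minus_def using False B(3,5,7) by simp
  qed
qed

subsection \<open>The ideal defining the lower algebra\<close>

lemma K_W_iff: "x \<in> K_W I m \<longleftrightarrow>
    (\<forall>u\<in>lists I. \<exists>y\<in>hat_DW I m. x = Hat.h u \<otimes>\<^bsub>H\<^esub> y \<otimes>\<^bsub>H\<^esub> Hat.h (rev u))"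
proof -
  have e: "{hat_W I m (cc u) \<otimes>\<^bsub>H\<^esub> x \<otimes>\<^bsub>H\<^esub> hat_W I m (inv\<^bsub>W\<^esub> (cc u)) | x. x \<in> hat_DW I m} =
      {Hat.h u \<otimes>\<^bsub>H\<^esub> x \<otimes>\<^bsub>H\<^esub> Hat.h (rev u) | x. x \<in> hat_DW I m}" if "u \<in> lists I" for u
    using that by (simp add: cc_inv hat_W_cc)
  have "x \<in> K_W I m \<longleftrightarrow> (\<forall>u\<in>lists I.
      x \<in> {hat_W I m (cc u) \<otimes>\<^bsub>H\<^esub> x \<otimes>\<^bsub>H\<^esub> hat_W I m (inv\<^bsub>W\<^esub> (cc u)) | x. x \<in> hat_DW I m})"
    unfolding K_W_def carrier_W by (simp only: INT_iff ball_simps)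
  also have "\<dots> \<longleftrightarrow> (\<forall>u\<in>lists I. x \<in> {Hat.h u \<otimes>\<^bsub>H\<^esub> y \<otimes>\<^bsub>H\<^esub> Hat.h (rev u) | y. y \<in> hat_DW I m})"
    by (rule ball_cong[OF HOL.refl]) (simp only: e)
  also have "\<dots> \<longleftrightarrow> (\<forall>u\<in>lists I. \<exists>y\<in>hat_DW I m. x = Hat.h u \<otimes>\<^bsub>H\<^esub> y \<otimes>\<^bsub>H\<^esub> Hat.h (rev u))"
    by (simp only: mem_Collect_eq Bex_def conj_commute)
  finally show ?thesis .
qed

lemma K_W_hat_DW: "x \<in> K_W I m \<Longrightarrow> x \<in> hat_DW I m"
proof -
  assume x: "x \<in> K_W I m"
  obtain y where y: "y \<in> hat_DW I m" "x = Hat.h [] \<otimes>\<^bsub>H\<^esub> y \<otimes>\<^bsub>H\<^esub> Hat.h (rev [])"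
    using bspec[OF K_W_iff[THEN iffD1, OF x] lists.Nil] by (rule bexE)
  have "y \<in> carrier H" using y(1) subringE(1)[OF subring_hat_DW] by (rule rev_subsetD)
  then have "x = y" unfolding y(2) by simp
  then show ?thesis using y(1) by simp
qed

lemma K_W_closed: "K_W I m \<subseteq> carrier H"
  using K_W_hat_DW subringE(1)[OF subring_hat_DW] by blast

lemma ideal_J_W: "ideal (J_W I m) H"
  unfolding J_W_def using K_W_closed by (intro H.A.genideal_ideal) blast

sublocale J: alg_ideal \<Z> H "J_W I m"
  rewrites "alg_quot H (J_W I m) = lower_H I m"
  using H.nc_alg_axioms ideal_J_W by (auto intro: alg_ideal.intro simp: lower_H_def)

lemma J_W_incl: "x \<in> K_W I m \<Longrightarrow> \<epsilon> x = 0 \<Longrightarrow> x \<in> J_W I m"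
proof -
  assume x: "x \<in> K_W I m" "\<epsilon> x = 0"
  have "K_W I m \<inter> a_kernel H \<Z> \<epsilon> \<subseteq> carrier H" using K_W_closed by blast
  moreover have "x \<in> K_W I m \<inter> a_kernel H \<Z> \<epsilon>"
    using x subsetD[OF K_W_closed x(1)] unfolding Int_iff kernel_iff by blast
  ultimately show ?thesis unfolding J_W_def using H.A.genideal_self by blast
qed

lemma braid_defect_J_W:
  assumes xy: "x \<in> I" "y \<in> I" "x \<noteq> y" and cl: "odd (m x y) \<Longrightarrow> cl x = cl y" and "length u < m x y"
  shows "hecke_walk.braid_defect I m H hs hD cl [] x y (u, e) \<in> J_W I m"
proof -
  interpret B: hecke_walk I m H hs hD cl ..
  let ?d = "B.braid_defect [] x y (u, e)"
  have "?d \<in> K_W I m" unfolding K_W_iff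
  proof
    fix w assume w: "w \<in> lists I"
    \<comment> \<open>Starting the two walks at \<open>rev w\<close> and conjugating by
      \<open>w\<close> moves the starting point to the identity. So the defect is, for every
      \<open>w\<close>, a conjugate of an element with coefficients in the D_s.\<close>
    have "?d = Hat.h w \<otimes>\<^bsub>H\<^esub> B.braid_defect (rev w) x y (u, e) \<otimes>\<^bsub>H\<^esub> Hat.h (rev w)"
      using B.conj_braid_defect_word[OF w _ xy cl, of "rev w"] B.braid_defect_ceq[OF ceq_append_rev[OF w] xy(1,2)] w
      by simp
    moreover have "B.braid_defect (rev w) x y (u, e) \<in> hat_DW I m"
      using B.braid_defect_subring[OF subring_hat_DW Dr_hat_DW] w xy by simp
    ultimately show "\<exists>z\<in>hat_DW I m. ?d = Hat.h w \<otimes>\<^bsub>H\<^esub> z \<otimes>\<^bsub>H\<^esub> Hat.h (rev w)" by blast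
  qed
  moreover have "?d \<in> a_kernel H \<Z> \<epsilon>"
  proof -
    interpret N: ideal "a_kernel H \<Z> \<epsilon>" H by (rule kernel_ideal)
    have D: "hD i \<in> a_kernel H \<Z> \<epsilon>" if "i \<in> I" for i using that by (simp add: kernel_iff counit)
    have lead: "B.walk [] (alt_word (m x y) a b) B.one_f (u, e) \<in> a_kernel H \<Z> \<epsilon>"
      if ab: "a \<in> I" "b \<in> I" "a \<noteq> b" "m a b = m x y" for a b
    proof -
      let ?w = "alt_word (m x y) a b"
      have "pos (take q ?w) (?w ! q)" if "q < length ?w" for q
        using that pos_alt_word[of a b q] ab by (simp add: take_alt_word nth_alt_word)
      moreover have "?w \<in> lists I" using ab by simp
      \<comment> \<open>A word below the leading length is not the leading word, and all other terms
        of the walk lie in the kernel of the counit.\<close>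
      moreover have "u \<noteq> rev ?w" using assms(5) by auto
      ultimately show ?thesis
        using B.walk_leading[OF kernel_ideal D, of ?w] distinct_adj_alt_word[OF ab(3)] by blast
    qed
    show ?thesis unfolding B.braid_defect_def a_minus_def
      using lead[OF xy] lead[OF xy(2,1)] xy m_sym[OF xy(1,2)] by (intro N.a_closed N.a_inv_closed) auto
  qed
  ultimately show ?thesis using J_W_incl by (simp add: kernel_iff)
qed

end

section \<open>The embedding of the Hecke algebra\<close>

text \<open>Serves the coideal property: that a multiplication or a scalar preserves H \<otimes> A
  then has to be checked on pure tensors only.\<close>

lemma (in abelian_group) generate_additive:
  assumes X: "X \<subseteq> carrier G"
    and f: "\<And>x y. x \<in> carrier G \<Longrightarrow> y \<in> carrier G \<Longrightarrow> f (x \<oplus> y) = f x \<oplus> f y"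
      "\<And>x. x \<in> carrier G \<Longrightarrow> f x \<in> carrier G"
    and gen: "\<And>x. x \<in> X \<Longrightarrow> f x \<in> generate (add_monoid G) X"
    and x: "x \<in> generate (add_monoid G) X"
  shows "f x \<in> generate (add_monoid G) X"
proof -
  have sub: "subgroup (generate (add_monoid G) X) (add_monoid G)"
    using X by (intro group.generate_is_subgroup[OF a_group]) simp
  have zero: "f \<zero> = \<zero>"
    using f(1)[of \<zero> \<zero>] f(2)[of \<zero>] add.r_cancel_one[of "f \<zero>" "f \<zero>"] by simp
  have neg: "f (\<ominus> y) = \<ominus> f y" if y: "y \<in> carrier G" for y
    using f(1)[of "\<ominus> y" y] f(2) y zero by (intro minus_equality[symmetric]) (simp_all add: l_neg)
  from x show ?thesis
  proof (induction rule: generate.induct)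
    case one
    then show ?case using generate.one[of "add_monoid G" X] zero by simp
  next
    case (incl h)
    then show ?case by (rule gen)
  next
    case (inv h)
    then have "h \<in> carrier G" using X by blast
    then have "f (inv\<^bsub>add_monoid G\<^esub> h) = inv\<^bsub>add_monoid G\<^esub> (f h)" using neg by (simp add: a_inv_def)
    then show ?case using subgroup.m_inv_closed[OF sub gen[OF inv]] by simp
  next
    case (eng h1 h2)
    have c: "h1 \<in> carrier G" "h2 \<in> carrier G" using eng(1,2) subgroup.subset[OF sub] by auto
    show ?case using f(1)[OF c] generate.eng[OF eng(3,4)] by simp
  qed
qed

locale hecke_lower = hecke_hopf I m + Fn: coxeter_functions I m K
  for I :: "'i set" and m and K :: "('k, 'c) ring_scheme" +
  fixes q :: "'i \<Rightarrow> 'k"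
  assumes q_closed [simp]: "i \<in> I \<Longrightarrow> q i \<in> carrier K"
    and q_odd: "i \<in> I \<Longrightarrow> j \<in> I \<Longrightarrow> odd (m i j) \<Longrightarrow> q i = q j"
begin

abbreviation "V \<equiv> Fn.V"
abbreviation "E \<equiv> operators K V"
abbreviation "sop \<equiv> Fn.sop"
abbreviation "dop \<equiv> Fn.dop"

subsection \<open>The action on functions\<close>

context
  fixes \<rho>
  assumes \<rho>: "\<rho> \<in> ring_hom H E" and \<rho>s: "\<And>i. i \<in> I \<Longrightarrow> \<rho> (hs i) = sop i"
    and \<rho>D: "\<And>i. i \<in> I \<Longrightarrow> \<rho> (hD i) = dop i"
begin

lemma \<rho>_word: "u \<in> lists I \<Longrightarrow> \<rho> (Hat.h u) = wprod E sop u"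
proof -
  assume u: "u \<in> lists I"
  have "\<rho> (Hat.h u) = wprod E (\<rho> \<circ> hs) u"
    by (rule ring_hom_wprod[OF \<rho> H.A.monoid_axioms _ u]) simp
  also have "\<dots> = wprod E sop u" using u \<rho>s by (intro wprod_cong) auto
  finally show ?thesis .
qed

lemma \<rho>_V: "x \<in> carrier H \<Longrightarrow> F \<in> V \<Longrightarrow> \<rho> x F \<in> V"
  using Fn.operatorsD(2) ring_hom_closed[OF \<rho>] by blast

lemma \<rho>_mult: "x \<in> carrier H \<Longrightarrow> y \<in> carrier H \<Longrightarrow> F \<in> V \<Longrightarrow> \<rho> (x \<otimes>\<^bsub>H\<^esub> y) F = \<rho> y (\<rho> x F)"
  by (simp add: ring_hom_mult[OF \<rho>] Fn.operators_ops)

text \<open>Operators compose from left to right and \<open>sop\<close> shifts the argument, so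
  conjugation by \<open>u\<close> moves the point of evaluation from \<open>v\<close> to
  \<open>v @ u\<close>.\<close>

lemma \<rho>_conj:
  assumes "u \<in> lists I" "z \<in> carrier H" "F \<in> V"
  shows "\<rho> (Hat.h u \<otimes>\<^bsub>H\<^esub> z \<otimes>\<^bsub>H\<^esub> Hat.h (rev u)) F v = \<rho> z (wprod E sop u F) (v @ u)"
proof -
  have w: "wprod E sop u F \<in> V" using \<rho>_V[of "Hat.h u" F] assms \<rho>_word by simp
  show ?thesis
    using assms w by (simp add: \<rho>_mult \<rho>_V \<rho>_word Fn.wprod_sop)
qed

text \<open>A generator evaluated at the identity is \<open>dop x\<close> evaluated at some
  \<open>v\<close> where the root of \<open>x\<close> is positive, hence 0. For products the second
  factor is applied to the function produced by the first, which is why the induction keeps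
  \<open>F\<close> arbitrary.\<close>

lemma hat_DW_action:
  "y \<in> hat_DW I m \<Longrightarrow> F \<in> V \<Longrightarrow> \<rho> y F [] = \<epsilon> y \<odot>\<^bsub>int_algebra K\<^esub> F []"
  unfolding hat_DW_def
proof (induction arbitrary: F rule: generate_ring.induct)
  interpret Z: nc_alg \<Z> "int_algebra K" by (rule nc_alg_int_algebra[OF Fn.K.ring_axioms])
  have closed: "y \<in> carrier H" if "y \<in> generate_ring H {d. \<exists>s\<in>reflections I m. (s, d) \<in> refl_D I m}" for y
    using H.A.generate_ring_in_carrier[OF hat_DW_gens_closed that] .
  {
    case one
    then show ?case using Z.smult_one[of "F []"] Fn.V_simps(1)
      by (simp add: ring_hom_one[OF \<rho>] Fn.operators_ops counit_ops)
  next
    case (incl d)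
    then obtain v x where v: "v \<in> lists I" "x \<in> I" "pos v x" "d = Hat.h v \<otimes>\<^bsub>H\<^esub> hD x \<otimes>\<^bsub>H\<^esub> Hat.h (rev v)"
      unfolding hat_DW_gens by blast
    have w: "wprod E sop v F \<in> V" using \<rho>_V[of "Hat.h v" F] v(1) incl(2) \<rho>_word by simp
    have "\<rho> d F [] = dop x (wprod E sop v F) v"
      unfolding v(4) using \<rho>_conj[of v "hD x" F "[]"] v incl(2) \<rho>D by simp
    then have "\<rho> d F [] = \<zero>\<^bsub>K\<^esub>" using w v(3) by (simp add: Fn.dop_apply)
    moreover have "\<epsilon> d = 0" unfolding v(4) using v(1,2) by (simp add: counit_ops counit)
    ultimately show ?case using Z.smult_l_null[of "F []"] Fn.V_simps(1)[OF incl(2)] by simp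
  next
    case (a_inv d)
    interpret r: ring_hom_ring H E \<rho> using \<rho> H.A.ring_axioms Fn.E.A.ring_axioms by (intro ring_hom_ringI2)
    have d: "d \<in> carrier H" using closed a_inv(1) .
    have "\<rho> (\<ominus>\<^bsub>H\<^esub> d) = \<zero>\<^bsub>E\<^esub> \<ominus>\<^bsub>E\<^esub> \<rho> d" using d by (simp add: a_minus_def)
    then have "\<rho> (\<ominus>\<^bsub>H\<^esub> d) F [] = \<zero>\<^bsub>K\<^esub> \<ominus>\<^bsub>K\<^esub> \<rho> d F []"
      using Fn.operators_minus[OF Fn.operators_closed(3) ring_hom_closed[OF \<rho> d] a_inv(3)]
      by (simp only: Fn.operators_ops(3)[OF a_inv(3)])
    then have "\<rho> (\<ominus>\<^bsub>H\<^esub> d) F [] = \<ominus>\<^bsub>K\<^esub> \<rho> d F []"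
      using Fn.V_simps(1)[OF \<rho>_V[OF d a_inv(3)]] by (simp add: a_minus_def)
    moreover have "(- \<epsilon> d) \<odot>\<^bsub>int_algebra K\<^esub> F [] = \<ominus>\<^bsub>int_algebra K\<^esub> (\<epsilon> d \<odot>\<^bsub>int_algebra K\<^esub> F [])"
      using Z.smult_l_minus[of "\<epsilon> d" "F []"] Fn.V_simps(1)[OF a_inv(3)] by (simp add: int_a_inv_eq)
    moreover have "\<ominus>\<^bsub>int_algebra K\<^esub> z = \<ominus>\<^bsub>K\<^esub> z" for z by (simp add: a_inv_def m_inv_def)
    ultimately show ?case using a_inv(2)[OF a_inv(3)] d by (simp add: counit_ops)
  next
    case (eng_add d e)
    then show ?case
      using closed[OF eng_add(1)] closed[OF eng_add(2)] Z.smult_l_distr[of "\<epsilon> d" "\<epsilon> e" "F []"] Fn.V_simps(1)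
      by (simp add: ring_hom_add[OF \<rho>] Fn.operators_ops counit_ops)
  next
    case (eng_mult d e)
    then show ?case
      using closed[OF eng_mult(1)] closed[OF eng_mult(2)] Z.smult_assoc1[of "\<epsilon> e" "\<epsilon> d" "F []"] Fn.V_simps(1)
      by (simp add: \<rho>_mult \<rho>_V counit_ops mult.commute)
  }
qed

text \<open>To evaluate at \<open>v\<close>, the element is written as the conjugate by
  \<open>rev v\<close> of some \<open>z\<close> in the subalgebra generated by the D_s. This moves
  the point of evaluation to the identity, where \<open>z\<close> acts by its counit, and
  conjugation does not change the counit.\<close>

lemma K_W_action:
  assumes y: "y \<in> K_W I m" "\<epsilon> y = 0"
  shows "\<rho> y = \<zero>\<^bsub>E\<^esub>"
proof (rule Fn.operators_eqI)
  interpret Z: nc_alg \<Z> "int_algebra K" by (rule nc_alg_int_algebra[OF Fn.K.ring_axioms])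
  have yc: "y \<in> carrier H" using y(1) K_W_closed by blast
  show "\<rho> y \<in> carrier E" using ring_hom_closed[OF \<rho> yc] .
  fix F assume F: "F \<in> V"
  have "\<rho> y F v = \<zero>\<^bsub>K\<^esub>" for v
  proof (cases "v \<in> lists I")
    case True
    then have rv: "rev v \<in> lists I" by simp
    obtain z where z: "z \<in> hat_DW I m" "y = Hat.h (rev v) \<otimes>\<^bsub>H\<^esub> z \<otimes>\<^bsub>H\<^esub> Hat.h (rev (rev v))"
      using bspec[OF K_W_iff[THEN iffD1, OF y(1)] rv] by (rule bexE)
    have zc: "z \<in> carrier H" using z(1) subringE(1)[OF subring_hat_DW] by blast
    have w: "wprod E sop (rev v) F \<in> V" using \<rho>_V[of "Hat.h (rev v)" F] rv F \<rho>_word by simp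
    have "\<epsilon> y = \<epsilon> z" unfolding z(2) using zc rv True by (simp add: counit_ops counit_word)
    then have e: "\<epsilon> z = 0" using y(2) by simp
    have "\<rho> y F v = \<rho> z (wprod E sop (rev v) F) (v @ rev v)"
      unfolding z(2) by (rule \<rho>_conj[OF rv zc F])
    also have "\<dots> = \<rho> z (wprod E sop (rev v) F) []"
      using Fn.V_simps(2)[OF \<rho>_V[OF zc w] ceq_append_rev[OF True]] .
    finally show ?thesis
      using hat_DW_action[OF z(1) w] e Z.smult_l_null[of "wprod E sop (rev v) F []"] Fn.V_simps(1)[OF w] by simp
  next
    case False
    then show ?thesis using Fn.V_simps(3)[OF \<rho>_V[OF yc F]] by simp
  qed
  then show "\<rho> y F = \<zero>\<^bsub>E\<^esub> F" using F by (simp add: Fn.operators_ops fun_eq_iff)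
qed (rule Fn.operators_closed)

lemma J_W_action: "x \<in> J_W I m \<Longrightarrow> \<rho> x = \<zero>\<^bsub>E\<^esub>"
  unfolding J_W_def
proof (rule ring_hom_genideal_zero[OF H.A.ring_axioms Fn.E.A.ring_axioms \<rho>])
  show "K_W I m \<inter> a_kernel H \<Z> \<epsilon> \<subseteq> carrier H" using K_W_closed by blast
  show "\<rho> x = \<zero>\<^bsub>E\<^esub>" if "x \<in> K_W I m \<inter> a_kernel H \<Z> \<epsilon>" for x
    using that K_W_action by (simp add: kernel_iff)
qed

end

section \<open>The lower algebra over the base ring\<close>

sublocale L: base_extension K "lower_H I m"
  rewrites "base_change K (lower_H I m) = lower_HK K I m"
  using J.nc_alg_Q Fn.K.cring_axioms by (auto intro: base_extension.intro simp: lower_HK_def)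

abbreviation "LK \<equiv> lower_HK K I m"
abbreviation "\<iota> x \<equiv> L.bc (J_W I m +>\<^bsub>H\<^esub> x)"

lemma \<iota>_hom: "\<iota> \<in> ring_hom H LK"
  using ring_hom_trans[OF J.cls_hom L.bc_hom] by (simp add: comp_def)

lemma lowerK_\<iota>: "lowerK_s K I m i = \<iota> (hs i)" "lowerK_D K I m i = \<iota> (hD i)"
  by (simp_all add: lowerK_s_def lowerK_D_def)

lemma lowerK_closed [simp]:
  "i \<in> I \<Longrightarrow> lowerK_s K I m i \<in> carrier LK" "i \<in> I \<Longrightarrow> lowerK_D K I m i \<in> carrier LK"
  using ring_hom_closed[OF \<iota>_hom] by (simp_all add: lowerK_\<iota>)

text \<open>The ideal acts by zero, so the action on functions factors through the lower algebra.
  The operators form a \<open>K\<close>-algebra, so it extends to the base change.\<close>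

lemma lower_action:
  "\<exists>\<tau>\<in>alg_hom K LK E. \<forall>i\<in>I. \<tau> (lowerK_s K I m i) = sop i \<and> \<tau> (lowerK_D K I m i) = dop i"
proof -
  have "\<exists>\<rho>\<in>ring_hom H E. \<forall>i\<in>I. \<rho> (hs i) = sop i \<and> \<rho> (hD i) = dop i"
    using Fn.sop_dop_relations Fn.sop_coxeter_relation[unfolded concat_replicate_alt_word] Fn.sop_dop_braid
    by (intro hat_universal Fn.E.A.ring_axioms) simp_all
  then obtain \<rho> where \<rho>: "\<rho> \<in> ring_hom H E" "\<And>i. i \<in> I \<Longrightarrow> \<rho> (hs i) = sop i" "\<And>i. i \<in> I \<Longrightarrow> \<rho> (hD i) = dop i"
    by blast
  have "\<rho> \<in> alg_hom \<Z> H (int_algebra E)"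
    by (rule ring_hom_alg_hom_int[OF H.nc_alg_axioms Fn.E.A.ring_axioms \<rho>(1)])
  then obtain \<sigma> where \<sigma>: "\<sigma> \<in> alg_hom \<Z> (lower_H I m) (int_algebra E)"
    "\<And>x. x \<in> carrier H \<Longrightarrow> \<sigma> (J_W I m +>\<^bsub>H\<^esub> x) = \<rho> x"
    using J.quot_universal[OF nc_alg_int_algebra[OF Fn.E.A.ring_axioms], of \<rho>] J_W_action[OF \<rho>] by auto
  have "\<sigma> \<in> ring_hom (lower_H I m) E" using alg_homD(1)[OF \<sigma>(1)] by (simp add: ring_hom_int_algebra)
  then obtain \<tau> where \<tau>: "\<tau> \<in> alg_hom K LK E" "\<And>a. a \<in> carrier (lower_H I m) \<Longrightarrow> \<tau> (L.bc a) = \<sigma> a"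
    using L.base_change_universal[OF Fn.nc_alg_operators] by blast
  have "\<tau> (\<iota> x) = \<rho> x" if x: "x \<in> carrier H" for x
    using \<tau>(2)[OF ring_hom_closed[OF J.cls_hom x]] \<sigma>(2)[OF x] by simp
  then have "\<forall>i\<in>I. \<tau> (lowerK_s K I m i) = sop i \<and> \<tau> (lowerK_D K I m i) = dop i"
    using \<rho>(2,3) by (simp add: lowerK_\<iota>)
  then show ?thesis using \<tau>(1) by blast
qed

subsection \<open>The homomorphism\<close>

abbreviation "Hk \<equiv> hecke_algebra K I m q"
abbreviation "t \<equiv> hecke_T K I m q"

lemma hecke_rels_cases:
  assumes "(l, r) \<in> hecke_rels K I m q"
  obtains
    (quadratic) i where "i \<in> I" "l = single K [i, i]"
      "r = ((\<one>\<^bsub>K\<^esub> \<ominus>\<^bsub>K\<^esub> q i) \<odot>\<^bsub>free_algebra K I\<^esub> single K [i]) \<oplus>\<^bsub>free_algebra K I\<^esub> (q i \<odot>\<^bsub>free_algebra K I\<^esub> single K [])"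
  | (braid) i j where "i \<in> I" "j \<in> I" "i \<noteq> j"
      "l = single K (alt_word (m i j) i j)" "r = single K (alt_word (m i j) j i)"
  using assms unfolding hecke_rels_def Let_def
  by (elim UnE CollectE exE conjE Pair_inject) (rule quadratic braid; assumption)+

sublocale HP: presentation K I "hecke_rels K I m q"
  rewrites "presented_algebra K I (hecke_rels K I m q) = Hk"
    and "presented_gen K I (hecke_rels K I m q) = t"
proof -
  interpret P: presentation K I "{}"
    by unfold_locales (simp_all add: Fn.K.is_cring)
  interpret F: nc_alg K "free_algebra K I" by (rule P.F.nc_alg_F)
  note c = P.F.single_closed
  show "presentation K I (hecke_rels K I m q)"
  proof (rule presentation.intro[OF Fn.K.is_cring])
    fix l r assume "(l, r) \<in> hecke_rels K I m q"
    then show "l \<in> carrier (free_algebra K I) \<and> r \<in> carrier (free_algebra K I)"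
    proof (cases rule: hecke_rels_cases)
      case (quadratic i)
      have "single K [i, i] \<in> carrier (free_algebra K I)" "single K [i] \<in> carrier (free_algebra K I)"
        "single K [] \<in> carrier (free_algebra K I)" using quadratic(1) by (auto intro!: c)
      then show ?thesis unfolding quadratic(2,3) using quadratic(1) by simp
    next
      case (braid i j)
      then show ?thesis using c[of "alt_word (m i j) i j"] c[of "alt_word (m i j) j i"] by simp
    qed
  qed
qed (simp_all add: hecke_algebra_def hecke_T_def fun_eq_iff)

sublocale Hk: nc_alg K Hk
  by (rule HP.nc_alg_presented)

definition Tl :: "'i \<Rightarrow> _"
  where "Tl i = lowerK_s K I m i \<oplus>\<^bsub>LK\<^esub> (\<one>\<^bsub>K\<^esub> \<ominus>\<^bsub>K\<^esub> q i) \<odot>\<^bsub>LK\<^esub> lowerK_D K I m i"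

lemma Tl_closed [simp]: "i \<in> I \<Longrightarrow> Tl i \<in> carrier LK"
  by (simp add: Tl_def)

lemma hecke_eval_LK: "hecke_eval I m H hs hD K LK (\<lambda>x. \<iota> x) \<gamma>" if "\<And>b. \<gamma> b \<in> carrier K"
  using that \<iota>_hom by unfold_locales simp_all

lemma Tl_braid:
  assumes xy: "x \<in> I" "y \<in> I" "x \<noteq> y"
  shows "wprod LK Tl (alt_word (m x y) x y) = wprod LK Tl (alt_word (m x y) y x)"
proof -
  \<comment> \<open>For odd order both letters carry the same parameter, as the cancellation of the
    corrections demands; otherwise each letter has its own.\<close>
  define cl where "cl = (\<lambda>z. odd (m x y) \<or> z = x)"
  define \<gamma> where "\<gamma> = (\<lambda>b. \<one>\<^bsub>K\<^esub> \<ominus>\<^bsub>K\<^esub> (if b then q x else q y))"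
  interpret X: hecke_eval I m H hs hD cl K LK "\<lambda>x. \<iota> x" \<gamma>
    by (rule hecke_eval_LK) (simp add: \<gamma>_def xy)
  have T: "X.T z = Tl z" if "z \<in> {x, y}" for z
    using that q_odd[OF xy(1,2)] xy(3) unfolding X.T_def Tl_def lowerK_\<iota> by (auto simp: \<gamma>_def cl_def)
  have w: "wprod LK X.T (alt_word n a b) = wprod LK Tl (alt_word n a b)" if "{a, b} = {x, y}" for n a b
    using that T set_alt_word[of n a b] by (intro wprod_cong) blast
  have cl: "odd (m x y) \<Longrightarrow> cl x = cl y" by (simp add: cl_def)
  have "wprod LK X.T (alt_word (m x y) x y) = wprod LK X.T (alt_word (m x y) y x)"
  proof (rule X.braid_relation[OF xy cl])
    fix u :: "'i list" and e assume "length u < m x y"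
    from braid_defect_J_W[OF xy cl this]
    have j: "X.braid_defect [] x y (u, e) \<in> J_W I m" .
    have "J_W I m +>\<^bsub>H\<^esub> X.braid_defect [] x y (u, e) = \<zero>\<^bsub>lower_H I m\<^esub>"
      using J.a_rcos_const[OF j] by (simp add: lower_H_def alg_quot_def FactRing_def)
    then show "\<iota> (X.braid_defect [] x y (u, e)) = \<zero>\<^bsub>LK\<^esub>"
      using ring_hom_zero[OF L.bc_hom J.Q_ring L.AK.A.ring_axioms] by simp
  qed
  then show ?thesis using w[of x y] w[of y x] by (simp add: insert_commute)
qed

lemma Tl_quadratic:
  assumes i: "i \<in> I"
  shows "Tl i \<otimes>\<^bsub>LK\<^esub> Tl i = (\<one>\<^bsub>K\<^esub> \<ominus>\<^bsub>K\<^esub> q i) \<odot>\<^bsub>LK\<^esub> Tl i \<oplus>\<^bsub>LK\<^esub> q i \<odot>\<^bsub>LK\<^esub> \<one>\<^bsub>LK\<^esub>"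
proof -
  interpret X: hecke_eval I m H hs hD "\<lambda>_. True" K LK "\<lambda>x. \<iota> x" "\<lambda>_. \<one>\<^bsub>K\<^esub> \<ominus>\<^bsub>K\<^esub> q i"
    by (rule hecke_eval_LK) (simp add: i)
  have T: "X.T i = Tl i" by (simp add: X.T_def Tl_def lowerK_\<iota>)
  have "\<one>\<^bsub>LK\<^esub> \<ominus>\<^bsub>LK\<^esub> (\<one>\<^bsub>K\<^esub> \<ominus>\<^bsub>K\<^esub> q i) \<odot>\<^bsub>LK\<^esub> \<one>\<^bsub>LK\<^esub> = q i \<odot>\<^bsub>LK\<^esub> \<one>\<^bsub>LK\<^esub>"
    using i by (simp add: a_minus_def L.AK.smult_l_distr L.AK.smult_l_minus L.AK.A.minus_add
        L.AK.A.a_assoc[symmetric] L.AK.A.r_neg)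
  then show ?thesis using X.T_quadratic[OF i] i unfolding T
    by (simp add: L.AK.A.a_comm)
qed

lemma hecke_hom: "\<exists>\<phi>\<in>alg_hom K Hk LK. \<forall>i\<in>I. \<phi> (t i) = Tl i"
proof (rule HP.presented_universal[OF L.AK.nc_alg_axioms])
  show g: "Tl \<in> I \<rightarrow> carrier LK" by simp
  fix h l r
  assume h: "h \<in> alg_hom K HP.F LK" and hw: "\<And>u. u \<in> lists I \<Longrightarrow> h (single K u) = wprod LK Tl u"
    and "(l, r) \<in> hecke_rels K I m q"
  from this(3) show "h l = h r"
  proof (cases rule: hecke_rels_cases)
    case (quadratic i)
    have l: "[i, i] \<in> lists I" "[i] \<in> lists I" "[] \<in> lists I" using quadratic(1) by auto
    note c = HP.F.single_closed[OF l(2)] HP.F.single_closed[OF l(3)]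
    interpret F: nc_alg K HP.F by (rule HP.F.nc_alg_F)
    show ?thesis unfolding quadratic(2,3)
      using c quadratic(1) Tl_quadratic[OF quadratic(1)] hw[OF l(1)] hw[OF l(2)] hw[OF l(3)]
      by (simp add: alg_homD(4,6)[OF h] wprod_Cons)
  next
    case (braid i j)
    then show ?thesis using Tl_braid[OF braid(1-3)] by (simp add: hw)
  qed
qed

subsection \<open>Linear independence of the standard basis\<close>

lemma t_closed [simp]: "i \<in> I \<Longrightarrow> t i \<in> carrier Hk"
  by (rule HP.gen_closed)

lemma wt_closed [simp]: "u \<in> lists I \<Longrightarrow> wprod Hk t u \<in> carrier Hk"
  by (rule Hk.A.wprod_closed[of t I]) auto

lemma t_braid:
  assumes "x \<in> I" "y \<in> I" "x \<noteq> y"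
  shows "wprod Hk t (alt_word (m x y) x y) = wprod Hk t (alt_word (m x y) y x)"
proof -
  have "(single K (alt_word (m x y) x y), single K (alt_word (m x y) y x)) \<in> hecke_rels K I m q"
    using assms unfolding hecke_rels_def Let_def by blast
  from HP.presented_relation[OF this] show ?thesis using assms by (simp add: HP.proj_single)
qed

lemma t_quadratic:
  assumes i: "i \<in> I"
  shows "t i \<otimes>\<^bsub>Hk\<^esub> t i = (\<one>\<^bsub>K\<^esub> \<ominus>\<^bsub>K\<^esub> q i) \<odot>\<^bsub>Hk\<^esub> t i \<oplus>\<^bsub>Hk\<^esub> q i \<odot>\<^bsub>Hk\<^esub> \<one>\<^bsub>Hk\<^esub>"
proof -
  have l: "[i, i] \<in> lists I" "[i] \<in> lists I" "[] \<in> lists I" using i by auto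
  note c = HP.F.single_closed[OF l(2)] HP.F.single_closed[OF l(3)]
  interpret F: nc_alg K HP.F by (rule HP.F.nc_alg_F)
  have "(single K [i, i], ((\<one>\<^bsub>K\<^esub> \<ominus>\<^bsub>K\<^esub> q i) \<odot>\<^bsub>HP.F\<^esub> single K [i]) \<oplus>\<^bsub>HP.F\<^esub> (q i \<odot>\<^bsub>HP.F\<^esub> single K [])) \<in> hecke_rels K I m q"
    using i unfolding hecke_rels_def Let_def by blast
  from HP.presented_relation[OF this] show ?thesis
    using c i HP.proj_single[OF l(1)] HP.proj_single[OF l(2)] HP.proj_single[OF l(3)]
    by (simp add: alg_homD(4,6)[OF HP.proj_hom] wprod_Cons)
qed

lemma t_reduced: "reduced u \<Longrightarrow> reduced v \<Longrightarrow> u \<asymp> v \<Longrightarrow> wprod Hk t u = wprod Hk t v"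
  using matsumoto_wprod[OF Hk.A.monoid_axioms _ t_braid] by auto

definition nf :: "'i list \<Rightarrow> 'i list"
  where "nf u = (SOME v. reduced v \<and> u \<asymp> v)"

lemma nf: "u \<in> lists I \<Longrightarrow> reduced (nf u)" "u \<in> lists I \<Longrightarrow> u \<asymp> nf u"
  unfolding nf_def using someI_ex[OF reduced_exists[of u]] by blast+

lemma nf_ceq: "u \<asymp> v \<Longrightarrow> nf u = nf v"
proof -
  assume e: "u \<asymp> v"
  have "u \<asymp> w \<longleftrightarrow> v \<asymp> w" for w
    using coxeter_eq.trans[OF coxeter_eq.sym[OF e], of w] coxeter_eq.trans[OF e, of w] by blast
  then show ?thesis by (simp add: nf_def)
qed

text \<open>One reduced word for each group element: the index set of the standard basis.\<close>

definition C :: "'i list set"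
  where "C = nf ` lists I"

lemma C_reduced: "u \<in> C \<Longrightarrow> reduced u" and C_lists: "u \<in> C \<Longrightarrow> u \<in> lists I"
  using nf reduced_lists unfolding C_def by blast+

lemma C_unique: "u \<in> C \<Longrightarrow> v \<in> C \<Longrightarrow> u \<asymp> v \<Longrightarrow> u = v"
proof -
  assume a: "u \<in> C" "v \<in> C" "u \<asymp> v"
  have "nf w = w" if w: "w \<in> C" for w
  proof -
    obtain x where x: "x \<in> lists I" "w = nf x" using w unfolding C_def by blast
    show ?thesis using nf_ceq[OF nf(2)[OF x(1)]] x(2) by simp
  qed
  then show ?thesis using a nf_ceq[OF a(3)] by simp
qed

sublocale BC: linear_extension K Hk C "\<lambda>u a. a \<odot>\<^bsub>Hk\<^esub> wprod Hk t u"
  by unfold_locales (simp_all add: C_lists Hk.smult_l_distr)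

definition basis_comb :: "('i list \<Rightarrow> 'k) \<Rightarrow> _"
  where "basis_comb f = lin Hk K (\<lambda>u a. a \<odot>\<^bsub>Hk\<^esub> wprod Hk t u) f"

section \<open>Products along reduced words span the Hecke algebra\<close>

abbreviation "FC \<equiv> fsupp K C"
abbreviation "Span \<equiv> basis_comb ` FC"

lemma basis_comb_closed [simp]: "f \<in> FC \<Longrightarrow> basis_comb f \<in> carrier Hk"
  by (simp add: basis_comb_def)

lemma basis_comb_simps:
  "basis_comb (\<lambda>_. \<zero>\<^bsub>K\<^esub>) = \<zero>\<^bsub>Hk\<^esub>"
  "u \<in> C \<Longrightarrow> a \<in> carrier K \<Longrightarrow> basis_comb (delta K u a) = a \<odot>\<^bsub>Hk\<^esub> wprod Hk t u"
  "f \<in> FC \<Longrightarrow> g \<in> FC \<Longrightarrow> basis_comb (\<lambda>z. f z \<oplus>\<^bsub>K\<^esub> g z) = basis_comb f \<oplus>\<^bsub>Hk\<^esub> basis_comb g"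
  by (simp_all add: basis_comb_def BC.lin_add)

lemma Span_add: "x \<in> Span \<Longrightarrow> y \<in> Span \<Longrightarrow> x \<oplus>\<^bsub>Hk\<^esub> y \<in> Span"
proof -
  assume "x \<in> Span" "y \<in> Span"
  then obtain f g where f: "f \<in> FC" "g \<in> FC" "x = basis_comb f" "y = basis_comb g" by blast
  have "x \<oplus>\<^bsub>Hk\<^esub> y = basis_comb (\<lambda>z. f z \<oplus>\<^bsub>K\<^esub> g z)" using f basis_comb_simps(3) by simp
  then show ?thesis using Fn.K.fsupp_add[OF f(1,2)] by blast
qed

lemma Span_word: "reduced u \<Longrightarrow> a \<in> carrier K \<Longrightarrow> a \<odot>\<^bsub>Hk\<^esub> wprod Hk t u \<in> Span"
proof -
  assume u: "reduced u" and a: "a \<in> carrier K"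
  have l: "u \<in> lists I" using reduced_lists[OF u] .
  have n: "nf u \<in> C" using l by (simp add: C_def)
  have "wprod Hk t u = wprod Hk t (nf u)" using t_reduced[OF u nf(1)[OF l] nf(2)[OF l]] .
  then have "a \<odot>\<^bsub>Hk\<^esub> wprod Hk t u = basis_comb (delta K (nf u) a)" using basis_comb_simps(2)[OF n a] by simp
  then show ?thesis using Fn.K.fsupp_delta[OF n a] by blast
qed

lemma Span_additive:
  assumes "g \<zero>\<^bsub>Hk\<^esub> = \<zero>\<^bsub>Hk\<^esub>"
    and "\<And>x y. x \<in> carrier Hk \<Longrightarrow> y \<in> carrier Hk \<Longrightarrow> g (x \<oplus>\<^bsub>Hk\<^esub> y) = g x \<oplus>\<^bsub>Hk\<^esub> g y"
    and "\<And>u a. reduced u \<Longrightarrow> a \<in> carrier K \<Longrightarrow> g (a \<odot>\<^bsub>Hk\<^esub> wprod Hk t u) \<in> Span"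
    and x: "x \<in> Span"
  shows "g x \<in> Span"
proof -
  obtain f where f: "f \<in> FC" "x = basis_comb f" using x by blast
  have "g (basis_comb f) \<in> Span" using f(1)
  proof (induction rule: Fn.K.fsupp_induct)
    case zero
    have "\<zero>\<^bsub>Hk\<^esub> \<in> Span" using basis_comb_simps(1) Fn.K.fsupp_zero[of C] by (metis image_eqI)
    then show ?case using assms(1) by (simp add: basis_comb_simps(1))
  next
    case (delta u a)
    then show ?case using assms(3) C_reduced by (simp add: basis_comb_simps(2))
  next
    case (add f f')
    then show ?case using assms(2) Span_add by (simp add: basis_comb_simps(3))
  qed
  then show ?thesis unfolding f(2) .
qed

text \<open>If \<open>i\<close> lengthens \<open>u\<close>, the product is again one along a reduced
  word. Otherwise \<open>u\<close> has a reduced spelling with last letter \<open>i\<close>, by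
  Matsumoto's theorem with the same product, and the quadratic relation applies.\<close>

lemma Span_mult_t:
  assumes i: "i \<in> I" and x: "x \<in> Span"
  shows "x \<otimes>\<^bsub>Hk\<^esub> t i \<in> Span"
proof (rule Span_additive[where g = "\<lambda>x. x \<otimes>\<^bsub>Hk\<^esub> t i", OF _ _ _ x])
  fix u a assume u: "reduced u" and a: "a \<in> carrier K"
  have ul: "u \<in> lists I" using reduced_lists[OF u] .
  have snoc: "wprod Hk t (v @ [i]) = wprod Hk t v \<otimes>\<^bsub>Hk\<^esub> t i" if "v \<in> lists I" for v
    using Hk.A.wprod_append[of t I v "[i]"] that i by (auto simp: wprod_Cons)
  show "a \<odot>\<^bsub>Hk\<^esub> wprod Hk t u \<otimes>\<^bsub>Hk\<^esub> t i \<in> Span"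
  proof (cases "pos u i")
    case True
    have "a \<odot>\<^bsub>Hk\<^esub> wprod Hk t u \<otimes>\<^bsub>Hk\<^esub> t i = a \<odot>\<^bsub>Hk\<^esub> wprod Hk t (u @ [i])"
      using snoc[OF ul] a i ul by (simp add: Hk.smult_mult_left)
    then show ?thesis using Span_word[OF reduced_snocI[OF u True i] a] by simp
  next
    case False
    obtain b where b: "reduced (b @ [i])" "u \<asymp> b @ [i]" using reduced_neg[OF u False i] by blast
    have rb: "reduced b" using reduced_append(1)[OF b(1)] .
    have bl: "b \<in> lists I" using reduced_lists[OF rb] .
    have tu: "wprod Hk t u = wprod Hk t b \<otimes>\<^bsub>Hk\<^esub> t i"
      using t_reduced[OF u b] snoc[OF bl] by simp
    have "wprod Hk t u \<otimes>\<^bsub>Hk\<^esub> t i = wprod Hk t b \<otimes>\<^bsub>Hk\<^esub> (t i \<otimes>\<^bsub>Hk\<^esub> t i)"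
      unfolding tu using bl i by (simp add: Hk.A.m_assoc)
    also have "\<dots> = (\<one>\<^bsub>K\<^esub> \<ominus>\<^bsub>K\<^esub> q i) \<odot>\<^bsub>Hk\<^esub> wprod Hk t u \<oplus>\<^bsub>Hk\<^esub> q i \<odot>\<^bsub>Hk\<^esub> wprod Hk t b"
      unfolding t_quadratic[OF i] tu using bl i by (simp add: Hk.A.r_distr Hk.smult_mult_right)
    finally have "a \<odot>\<^bsub>Hk\<^esub> wprod Hk t u \<otimes>\<^bsub>Hk\<^esub> t i =
        (a \<otimes>\<^bsub>K\<^esub> (\<one>\<^bsub>K\<^esub> \<ominus>\<^bsub>K\<^esub> q i)) \<odot>\<^bsub>Hk\<^esub> wprod Hk t u \<oplus>\<^bsub>Hk\<^esub> (a \<otimes>\<^bsub>K\<^esub> q i) \<odot>\<^bsub>Hk\<^esub> wprod Hk t b"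
      using a ul bl i by (simp add: Hk.smult_mult_left Hk.smult_r_distr Hk.smult_assoc1)
    then show ?thesis using Span_add Span_word[OF u] Span_word[OF rb] a i by simp
  qed
qed (use i in \<open>simp_all add: Hk.A.l_distr\<close>)

lemma Span_carrier: "x \<in> carrier Hk \<Longrightarrow> x \<in> Span"
proof (induction rule: HP.presented_induct)
  case (word u r)
  have "wprod Hk t u \<in> Span" using word(1)
  proof (induction u rule: rev_induct)
    case Nil
    then show ?case using Span_word[of "[]" "\<one>\<^bsub>K\<^esub>"] by simp
  next
    case (snoc i u)
    then have "wprod Hk t (u @ [i]) = wprod Hk t u \<otimes>\<^bsub>Hk\<^esub> t i"
      using Hk.A.wprod_append[of t I u "[i]"] by (auto simp: wprod_Cons)
    then show ?case using snoc Span_mult_t by simp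
  qed
  then show ?case
  proof (rule Span_additive[where g = "\<lambda>x. r \<odot>\<^bsub>Hk\<^esub> x", rotated 3])
    fix u a assume u: "reduced u" and a: "a \<in> carrier K"
    have "r \<odot>\<^bsub>Hk\<^esub> (a \<odot>\<^bsub>Hk\<^esub> wprod Hk t u) = (r \<otimes>\<^bsub>K\<^esub> a) \<odot>\<^bsub>Hk\<^esub> wprod Hk t u"
      using u a word(2) reduced_lists by (simp add: Hk.smult_assoc1)
    then show "r \<odot>\<^bsub>Hk\<^esub> (a \<odot>\<^bsub>Hk\<^esub> wprod Hk t u) \<in> Span" using Span_word[OF u] a word(2) by simp
  qed (use word(2) in \<open>simp_all add: Hk.smult_r_distr\<close>)
next
  case (add x y)
  then show ?case using Span_add by blast
qed

text \<open>In a reduced word every letter acts at a point where its root is positive. There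
  \<open>dop\<close> vanishes and T_i acts as the shift alone, for any parameter.\<close>

lemma hecke_action_word:
  assumes \<theta>: "\<theta> \<in> alg_hom K Hk E"
    and \<theta>t: "\<And>i. i \<in> I \<Longrightarrow> \<theta> (t i) = sop i \<oplus>\<^bsub>E\<^esub> (\<one>\<^bsub>K\<^esub> \<ominus>\<^bsub>K\<^esub> q i) \<odot>\<^bsub>E\<^esub> dop i"
  shows "reduced u \<Longrightarrow> F \<in> V \<Longrightarrow> \<theta> (wprod Hk t u) F [] = F (rev u)"
proof (induction u arbitrary: F)
  case Nil
  then show ?case by (simp add: alg_homD(5)[OF \<theta>] Fn.operators_ops)
next
  case (Cons i u)
  have l: "i \<in> I" "u \<in> lists I" using reduced_lists[OF Cons.prems(1)] by auto
  have u: "reduced u" using Cons.prems(1) reduced_append(2)[of "[i]" u] by simp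
  have p: "pos (rev u) i" using reduced_snoc_pos[of "rev u" i] reduced_rev[OF Cons.prems(1)] by simp
  have tF: "\<theta> (t i) F \<in> V" using Fn.operatorsD(2)[OF alg_homD(2)[OF \<theta>] Cons.prems(2)] l(1) by simp
  have "\<theta> (wprod Hk t (i # u)) F [] = \<theta> (wprod Hk t u) (\<theta> (t i) F) []"
    using l Cons.prems(2) by (simp add: wprod_Cons alg_homD(3)[OF \<theta>] Fn.operators_ops)
  also have "\<dots> = \<theta> (t i) F (rev u)" by (rule Cons.IH[OF u tF])
  also have "\<dots> = F (rev u @ [i])"
    using Cons.prems(2) p l Fn.V_simps(1)[OF Cons.prems(2)]
    by (simp add: \<theta>t Fn.operators_ops Fn.sop_apply Fn.dop_apply)
  finally show ?case by simp
qed

lemma indicator_V: "(\<lambda>v. if v \<asymp> w then \<one>\<^bsub>K\<^esub> else \<zero>\<^bsub>K\<^esub>) \<in> V"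
proof -
  have "u \<asymp> w \<longleftrightarrow> v \<asymp> w" if "u \<asymp> v" for u v
    using coxeter_eq.trans[OF coxeter_eq.sym[OF that], of w] coxeter_eq.trans[OF that, of w] by blast
  then show ?thesis using ceq_lists[of _ w] by (auto simp: Fn.V_def)
qed

text \<open>By \<open>hecke_action_word\<close> the basis element of \<open>u\<close> evaluates a
  function at the inverse of \<open>u\<close>. The indicator of the inverse of \<open>w\<close>
  therefore isolates the coefficient at \<open>w\<close>.\<close>

lemma hecke_action_coeff:
  assumes \<theta>: "\<theta> \<in> alg_hom K Hk E"
    and \<theta>t: "\<And>i. i \<in> I \<Longrightarrow> \<theta> (t i) = sop i \<oplus>\<^bsub>E\<^esub> (\<one>\<^bsub>K\<^esub> \<ominus>\<^bsub>K\<^esub> q i) \<odot>\<^bsub>E\<^esub> dop i"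
    and w: "w \<in> C" and f: "f \<in> FC"
  shows "\<theta> (basis_comb f) (\<lambda>v. if v \<asymp> rev w then \<one>\<^bsub>K\<^esub> else \<zero>\<^bsub>K\<^esub>) [] = f w"
proof -
  let ?F = "\<lambda>v. if v \<asymp> rev w then \<one>\<^bsub>K\<^esub> else \<zero>\<^bsub>K\<^esub>"
  have F: "?F \<in> V" by (rule indicator_V)
  from f show ?thesis
  proof (induction rule: Fn.K.fsupp_induct)
    case zero
    have "\<theta> \<zero>\<^bsub>Hk\<^esub> = \<zero>\<^bsub>E\<^esub>"
      using ring_hom_zero[OF alg_homD(1)[OF \<theta>] Hk.A.ring_axioms Fn.E.A.ring_axioms] .
    then show ?case using F by (simp add: basis_comb_simps Fn.operators_ops)
  next
    case (delta u a)
    have "rev u \<asymp> rev w \<longleftrightarrow> u = w"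
      using C_unique[OF delta(1) w] ceq_rev[of "rev u" "rev w"] coxeter_eq.refl[of "rev w" I m] C_lists[OF w] by auto
    then have "?F (rev u) = (if u = w then \<one>\<^bsub>K\<^esub> else \<zero>\<^bsub>K\<^esub>)" by simp
    moreover have "\<theta> (wprod Hk t u) ?F [] = ?F (rev u)"
      by (rule hecke_action_word[OF \<theta> _ C_reduced[OF delta(1)] F]) (rule \<theta>t)
    then have "\<theta> (basis_comb (delta K u a)) ?F [] = a \<otimes>\<^bsub>K\<^esub> ?F (rev u)"
      unfolding basis_comb_simps(2)[OF delta] alg_homD(6)[OF \<theta> delta(2) wt_closed[OF C_lists[OF delta(1)]]]
        Fn.operators_ops(5)[OF F] by (rule arg_cong)
    ultimately show ?case using delta(2) by (simp add: delta_def)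
  next
    case (add f g)
    then show ?case
      using alg_homD(4)[OF \<theta>, of "basis_comb f" "basis_comb g"] Fn.operators_ops(4)[OF F]
      by (simp add: basis_comb_simps(3))
  qed
qed

text \<open>After composing with the action on functions, the coefficients of an element along
  reduced words can be recovered from its image.\<close>

lemma hecke_hom_inj:
  assumes \<phi>: "\<phi> \<in> alg_hom K Hk LK" "\<And>i. i \<in> I \<Longrightarrow> \<phi> (t i) = Tl i"
  shows "inj_on \<phi> (carrier Hk)"
proof (rule inj_onI)
  obtain \<tau> where \<tau>: "\<tau> \<in> alg_hom K LK E" "\<And>i. i \<in> I \<Longrightarrow> \<tau> (lowerK_s K I m i) = sop i"
    "\<And>i. i \<in> I \<Longrightarrow> \<tau> (lowerK_D K I m i) = dop i"
    using lower_action by blast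
  define \<theta> where "\<theta> = (\<lambda>x. \<tau> (\<phi> x))"
  note p = alg_homD[OF \<phi>(1)] and r = alg_homD[OF \<tau>(1)]
  have \<theta>: "\<theta> \<in> alg_hom K Hk E" unfolding \<theta>_def
    by (rule alg_homI) (simp_all add: p(2-6) r(2-6))
  have \<theta>t: "\<theta> (t i) = sop i \<oplus>\<^bsub>E\<^esub> (\<one>\<^bsub>K\<^esub> \<ominus>\<^bsub>K\<^esub> q i) \<odot>\<^bsub>E\<^esub> dop i" if "i \<in> I" for i
    using that \<phi>(2) \<tau>(2,3) by (simp add: \<theta>_def Tl_def r(4,6))
  fix x y assume xy: "x \<in> carrier Hk" "y \<in> carrier Hk" "\<phi> x = \<phi> y"
  obtain f g where f: "f \<in> FC" "x = basis_comb f" and g: "g \<in> FC" "y = basis_comb g"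
    using Span_carrier[OF xy(1)] Span_carrier[OF xy(2)] by blast
  have e: "\<theta> (basis_comb f) = \<theta> (basis_comb g)" using xy(3) unfolding \<theta>_def f(2) g(2) by simp
  have "f w = g w" for w
  proof (cases "w \<in> C")
    case True
    show ?thesis
      using hecke_action_coeff[OF \<theta> \<theta>t True f(1)] hecke_action_coeff[OF \<theta> \<theta>t True g(1)] e by simp
  next
    case False
    then show ?thesis using f(1) g(1) by (simp add: fsupp_def)
  qed
  then have "f = g" by (rule ext)
  then show "x = y" using f g by simp
qed

subsection \<open>The coideal property\<close>

lemma hecke_image_coideal:
  assumes \<phi>: "\<phi> \<in> alg_hom K Hk LK" "\<And>i. i \<in> I \<Longrightarrow> \<phi> (t i) = Tl i"
    and \<Delta>: "is_lowerK_coproduct K I m \<Delta>"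
  shows "left_coideal_subalgebra K LK \<Delta> (\<phi> ` carrier Hk)"
proof -
  interpret TN: tensor K LK LK by (intro tensor.intro L.AK.nc_alg_axioms)
  note p = alg_homD[OF \<phi>(1)]
  have d: "\<Delta> \<in> alg_hom K LK TN.T"
    and ds: "\<And>i. i \<in> I \<Longrightarrow> \<Delta> (lowerK_s K I m i) = TN.pt (lowerK_s K I m i) (lowerK_s K I m i)"
    and dD: "\<And>i. i \<in> I \<Longrightarrow> \<Delta> (lowerK_D K I m i) =
      TN.pt (lowerK_D K I m i) \<one>\<^bsub>LK\<^esub> \<oplus>\<^bsub>TN.T\<^esub> TN.pt (lowerK_s K I m i) (lowerK_D K I m i)"
    using \<Delta> unfolding is_lowerK_coproduct_def Let_def by blast+
  note dd = alg_homD[OF d]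
  define A where "A = \<phi> ` carrier Hk"
  interpret r: ring_hom_ring Hk LK \<phi>
    using p(1) Hk.A.ring_axioms L.AK.A.ring_axioms by (intro ring_hom_ringI2)
  have Ac: "A \<subseteq> carrier LK" using p(2) by (auto simp: A_def)
  have sr: "subring A LK" unfolding A_def by (rule r.img_is_subring[OF Hk.A.carrier_is_subring])
  note srE = subringE[OF sr]
  have As: "c \<odot>\<^bsub>LK\<^esub> a \<in> A" if "c \<in> carrier K" "a \<in> A" for c a
  proof -
    obtain x where x: "x \<in> carrier Hk" "a = \<phi> x" using \<open>a \<in> A\<close> by (auto simp: A_def)
    show ?thesis using p(6)[OF \<open>c \<in> carrier K\<close> x(1)] x \<open>c \<in> carrier K\<close> unfolding A_def by (metis Hk.smult_closed imageI)
  qed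
  have sm: "submodule A K LK"
    using srE As by (intro L.AK.submoduleI) auto
  define X where "X = {TN.pt h a | h a. h \<in> carrier LK \<and> a \<in> A}"
  define P where "P = generate (add_monoid TN.T) X"
  have Xc: "X \<subseteq> carrier TN.T" using Ac by (auto simp: X_def)
  have XP: "TN.pt h a \<in> P" if "h \<in> carrier LK" "a \<in> A" for h a
    unfolding P_def X_def using that by (intro generate.incl) blast
  have Padd: "x \<oplus>\<^bsub>TN.T\<^esub> y \<in> P" if "x \<in> P" "y \<in> P" for x y
    using generate.eng[of x "add_monoid TN.T" X y] that by (simp add: P_def)
  have TlA: "Tl i \<in> A" if "i \<in> I" for i using that \<phi>(2) t_closed unfolding A_def by (metis imageI)
  have dT: "\<Delta> (Tl i) = TN.pt ((\<one>\<^bsub>K\<^esub> \<ominus>\<^bsub>K\<^esub> q i) \<odot>\<^bsub>LK\<^esub> lowerK_D K I m i) \<one>\<^bsub>LK\<^esub> \<oplus>\<^bsub>TN.T\<^esub> TN.pt (lowerK_s K I m i) (Tl i)"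
    if i: "i \<in> I" for i
  proof -
    let ?c = "\<one>\<^bsub>K\<^esub> \<ominus>\<^bsub>K\<^esub> q i"
    have "\<Delta> (Tl i) = TN.pt (lowerK_s K I m i) (lowerK_s K I m i) \<oplus>\<^bsub>TN.T\<^esub>
        (?c \<odot>\<^bsub>TN.T\<^esub> TN.pt (lowerK_D K I m i) \<one>\<^bsub>LK\<^esub> \<oplus>\<^bsub>TN.T\<^esub> ?c \<odot>\<^bsub>TN.T\<^esub> TN.pt (lowerK_s K I m i) (lowerK_D K I m i))"
      unfolding Tl_def using i by (simp add: dd(4,6) ds dD TN.T.smult_r_distr)
    also have "\<dots> = ?c \<odot>\<^bsub>TN.T\<^esub> TN.pt (lowerK_D K I m i) \<one>\<^bsub>LK\<^esub> \<oplus>\<^bsub>TN.T\<^esub>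
        (TN.pt (lowerK_s K I m i) (lowerK_s K I m i) \<oplus>\<^bsub>TN.T\<^esub> ?c \<odot>\<^bsub>TN.T\<^esub> TN.pt (lowerK_s K I m i) (lowerK_D K I m i))"
      using i by (intro TN.T.A.a_lcomm) simp_all
    \<comment> \<open>The terms s \<otimes> s and c s \<otimes> D combine to s \<otimes> T.\<close>
    also have "\<dots> = TN.pt (?c \<odot>\<^bsub>LK\<^esub> lowerK_D K I m i) \<one>\<^bsub>LK\<^esub> \<oplus>\<^bsub>TN.T\<^esub> TN.pt (lowerK_s K I m i) (Tl i)"
      unfolding Tl_def using i by (simp add: TN.pt_smult_left TN.pt_smult_right TN.pt_add_right)
    finally show ?thesis .
  qed
  have mult_closed: "\<Delta> (Tl i) \<otimes>\<^bsub>TN.T\<^esub> z \<in> P" if i: "i \<in> I" and z: "z \<in> P" for i z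
    unfolding P_def
  proof (rule TN.T.A.generate_additive[where f = "\<lambda>z. \<Delta> (Tl i) \<otimes>\<^bsub>TN.T\<^esub> z", OF Xc])
    have c: "\<Delta> (Tl i) \<in> carrier TN.T" using dd(2) i by simp
    show "\<Delta> (Tl i) \<otimes>\<^bsub>TN.T\<^esub> (x \<oplus>\<^bsub>TN.T\<^esub> y) = \<Delta> (Tl i) \<otimes>\<^bsub>TN.T\<^esub> x \<oplus>\<^bsub>TN.T\<^esub> \<Delta> (Tl i) \<otimes>\<^bsub>TN.T\<^esub> y"
      if "x \<in> carrier TN.T" "y \<in> carrier TN.T" for x y using that c by (simp add: TN.T.A.r_distr)
    show "\<Delta> (Tl i) \<otimes>\<^bsub>TN.T\<^esub> x \<in> carrier TN.T" if "x \<in> carrier TN.T" for x using that c by simp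
    show "z \<in> generate (add_monoid TN.T) X" using z by (simp add: P_def)
    fix x assume "x \<in> X"
    then obtain h a where x: "x = TN.pt h a" "h \<in> carrier LK" "a \<in> A" by (auto simp: X_def)
    have ac: "a \<in> carrier LK" using x(3) Ac by blast
    \<comment> \<open>The product of c D \<otimes> 1 + s \<otimes> T with h \<otimes> a is c D h
      \<otimes> a + s h \<otimes> T a, and both right-hand factors lie in the image.\<close>
    have "\<Delta> (Tl i) \<otimes>\<^bsub>TN.T\<^esub> x = TN.pt ((\<one>\<^bsub>K\<^esub> \<ominus>\<^bsub>K\<^esub> q i) \<odot>\<^bsub>LK\<^esub> lowerK_D K I m i \<otimes>\<^bsub>LK\<^esub> h) a \<oplus>\<^bsub>TN.T\<^esub>
        TN.pt (lowerK_s K I m i \<otimes>\<^bsub>LK\<^esub> h) (Tl i \<otimes>\<^bsub>LK\<^esub> a)"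
      unfolding dT[OF i] x(1) using i x(2) ac by (simp add: TN.T.A.l_distr TN.pt_mult)
    moreover have "TN.pt ((\<one>\<^bsub>K\<^esub> \<ominus>\<^bsub>K\<^esub> q i) \<odot>\<^bsub>LK\<^esub> lowerK_D K I m i \<otimes>\<^bsub>LK\<^esub> h) a \<in> P"
      using i x by (intro XP) simp_all
    moreover have "TN.pt (lowerK_s K I m i \<otimes>\<^bsub>LK\<^esub> h) (Tl i \<otimes>\<^bsub>LK\<^esub> a) \<in> P"
      using i x srE(6) TlA by (intro XP) simp_all
    ultimately show "\<Delta> (Tl i) \<otimes>\<^bsub>TN.T\<^esub> x \<in> generate (add_monoid TN.T) X"
      using Padd unfolding P_def[symmetric] by simp
  qed
  have smult_closed: "c \<odot>\<^bsub>TN.T\<^esub> z \<in> P" if c: "c \<in> carrier K" and z: "z \<in> P" for c z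
    unfolding P_def
  proof (rule TN.T.A.generate_additive[where f = "\<lambda>z. c \<odot>\<^bsub>TN.T\<^esub> z", OF Xc])
    show "z \<in> generate (add_monoid TN.T) X" using z by (simp add: P_def)
    fix x assume "x \<in> X"
    then obtain h a where x: "x = TN.pt h a" "h \<in> carrier LK" "a \<in> A" by (auto simp: X_def)
    have "c \<odot>\<^bsub>TN.T\<^esub> x = TN.pt (c \<odot>\<^bsub>LK\<^esub> h) a" using TN.pt_smult_left[OF c x(2)] x Ac by auto
    then show "c \<odot>\<^bsub>TN.T\<^esub> x \<in> generate (add_monoid TN.T) X"
      using XP[of "c \<odot>\<^bsub>LK\<^esub> h" a] x c unfolding P_def by simp
  qed (use c in \<open>simp_all add: TN.T.smult_r_distr\<close>)
  have dword: "\<Delta> (\<phi> (wprod Hk t u)) \<in> P" if "u \<in> lists I" for u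
    using that
  proof (induction u)
    case Nil
    have "\<Delta> (\<phi> \<one>\<^bsub>Hk\<^esub>) = TN.pt \<one>\<^bsub>LK\<^esub> \<one>\<^bsub>LK\<^esub>" by (simp only: p(5) dd(5) TN.pt_one)
    then show ?case using XP[of "\<one>\<^bsub>LK\<^esub>" "\<one>\<^bsub>LK\<^esub>"] srE(3) by simp
  next
    case (Cons i u)
    then have i: "i \<in> I" "u \<in> lists I" by auto
    have "\<Delta> (\<phi> (wprod Hk t (i # u))) = \<Delta> (Tl i) \<otimes>\<^bsub>TN.T\<^esub> \<Delta> (\<phi> (wprod Hk t u))"
      using i by (simp only: wprod_Cons p(2,3) dd(3) \<phi>(2) t_closed wt_closed Tl_closed)
    then show ?case using mult_closed[OF i(1) Cons.IH] by simp
  qed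
  have "\<Delta> (\<phi> x) \<in> P" if "x \<in> carrier Hk" for x
    using that
  proof (induction rule: HP.presented_induct)
    case (word u r)
    then show ?case using dword[OF word(1)] smult_closed
      by (simp only: p(2,6) dd(6) wt_closed)
  next
    case (add x y)
    then show ?case using Padd by (simp only: p(2,4) dd(4))
  qed
  then have "\<Delta> ` A \<subseteq> P" unfolding A_def by blast
  then show ?thesis
    using sr sm unfolding left_coideal_subalgebra_def P_def X_def A_def[symmetric] by blast
qed

end

theorem theorem1p20:
  fixes I :: "'i set" and m :: "'i \<Rightarrow> 'i \<Rightarrow> nat"
    and K :: "('k, 'c) ring_scheme" and q :: "'i \<Rightarrow> 'k"
  assumes "coxeter_matrix I m"
    and "cring K"
    and "\<And>i. i \<in> I \<Longrightarrow> q i \<in> carrier K"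
    and "\<And>i j. i \<in> I \<Longrightarrow> j \<in> I \<Longrightarrow> odd (m i j) \<Longrightarrow> q i = q j"
  shows "\<exists>\<phi>. \<phi> \<in> alg_hom K (hecke_algebra K I m q) (lower_HK K I m)
      \<and> (\<forall>i\<in>I. \<phi> (hecke_T K I m q i) =
            lowerK_s K I m i \<oplus>\<^bsub>lower_HK K I m\<^esub>
              ((\<one>\<^bsub>K\<^esub> \<ominus>\<^bsub>K\<^esub> q i) \<odot>\<^bsub>lower_HK K I m\<^esub> lowerK_D K I m i))
      \<and> inj_on \<phi> (carrier (hecke_algebra K I m q))
      \<and> (\<forall>\<Delta>. is_lowerK_coproduct K I m \<Delta> \<longrightarrow>
            left_coideal_subalgebra K (lower_HK K I m) \<Delta>
              (\<phi> ` carrier (hecke_algebra K I m q)))"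
proof -
  interpret hecke_lower I m K q
    using assms by (intro hecke_lower.intro hecke_hopf.intro coxeter_functions.intro coxeter.intro hecke_lower_axioms.intro)
  obtain \<phi> where \<phi>: "\<phi> \<in> alg_hom K Hk LK" "\<And>i. i \<in> I \<Longrightarrow> \<phi> (t i) = Tl i"
    using hecke_hom by blast
  show ?thesis
    using \<phi> hecke_hom_inj[OF \<phi>] hecke_image_coideal[OF \<phi>] unfolding Tl_def by blast
qed

end
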